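(* There is a constant $\gamma_0>0$, depending only on the coefficients $r,q,\kappa,\theta,\rho,\sigma$ of $A$, such that for $\gamma\in(0,\gamma_0)$ the following holds. Assume $r>0$. Let $\psi\in H^1(\mathcal O,\mathfrak w)$ with $\psi\le0$ on $\Gamma_1$ in the sense that $\psi^+\in H^1_0(\mathcal O\cup\Gamma_0,\mathfrak w)$. Suppose there are $M,m\in H^2(\mathcal O,\mathfrak w)$ such that $$m\le0\le M\ \text{on }\Gamma_1,\quad m\le M\ \text{on }\mathcal O,\quad Am\le AM\ \text{a.e. on }\mathcal O,\quad \psi\le M\ \text{a.e. on }\mathcal O,$$ $$(1+y)^{1/2}M,\ (1+y)^{1/2}m\in L^s(\mathcal O,\mathfrak w)\ \text{for some }s>2,\qquad (1+y)M,\ (1+y)m\in L^2(\mathcal O,\mathfrak w),$$ and let $f\in L^2(\mathcal O,\mathfrak w)$ satisfy $Am\le f\le AM$ a.e. on $\mathcal O$. Then there exists $u\in H^1_0(\mathcal O\cup\Gamma_0,\mathfrak w)$ with $u\ge\psi$ a.e. on $\mathcal O$ and $$a(u,v-u)\ge(f,v-u)_{L^2(\mathcal O,\mathfrak w)}\qquad\forall v\in H^1_0(\mathcal O\cup\Gamma_0,\mathfrak w)\ \text{with }v\ge\psi\ \text{a.e. on }\mathcal O,$$ and $u$ obeys $\max\{m,\psi\}\le u\le M$ a.e. on $\mathcal O$. Moreover, if there is $\varphi\in H^2(\mathcal O,\mathfrak w)$ with $$A\varphi\ge0\ \text{a.e. on }\mathcal O,\quad A(m+\varphi)>0\ \text{a.e.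 on }\mathcal O,\quad \varphi\ge0\ \text{on }\mathcal O,\quad (1+y)\varphi,\ (1+y)^{1/2}A\varphi\in L^2(\mathcal O,\mathfrak w),$$ $$\operatorname*{ess\,sup}_{(x,y)\in\mathcal O}\frac{(1+y)(M+\varphi)(x,y)}{A(m+\varphi)(x,y)}<\infty,\qquad (1+y)^{1/2}\varphi\in L^s(\mathcal O,\mathfrak w)\ \text{for some }s>2,$$ then the solution $u$ is unique.
   Context: $\mathbb H=\mathbb R\times(0,\infty)$ with coordinates $(x,y)$. The constants satisfy $\sigma\ne0$, $-1<\rho<1$, $\kappa>0$, $\theta>0$, $r\ge0$, $q\ge0$, and (standing normalization) $b_1:=r-q-\kappa\theta\rho/\sigma=0$. The Heston operator is $$Av=-\tfrac y2\left(v_{xx}+2\rho\sigma v_{xy}+\sigma^2v_{yy}\right)-\left(r-q-\tfrac y2\right)v_x-\kappa(\theta-y)v_y+rv .$$ Put $\beta=2\kappa\theta/\sigma^2$, $\mu=2\kappa/\sigma^2$, $a_1=\kappa\rho/\sigma-\tfrac12$ and $\mathfrak w(x,y)=y^{\beta-1}e^{-\gamma|x|-\mu y}$ on $\mathbb H$. $\mathcal O\subset\mathbb H$ is a possibly unbounded domain, $\Gamma_1:=\mathbb H\cap\partial\mathcal O$, and $\Gamma_0$ is the interior (in $\{y=0\}$) of $\{y=0\}\cap\partial\mathcal O$, assumed non-empty. $L^s(\mathcal O,\mathfrak w)$ is the $L^s$ space for $\mathfrak w\,dx\,dy$. With distributional derivatives, $H^1(\mathcal O,\mathfrak w)$ and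 $H^2(\mathcal O,\mathfrak w)$ are the spaces with finite norms $$\|u\|_{H^1(\mathcal O,\mathfrak w)}^2=\int_{\mathcal O}\left(y|Du|^2+(1+y)u^2\right)\mathfrak w\,dx\,dy,$$ $$\|u\|_{H^2(\mathcal O,\mathfrak w)}^2=\int_{\mathcal O}\left(y^2|D^2u|^2+(1+y)^2|Du|^2+(1+y)u^2\right)\mathfrak w\,dx\,dy,$$ and $H^1_0(\mathcal O\cup\Gamma_0,\mathfrak w)$ is the closure in $H^1(\mathcal O,\mathfrak w)$ of $C^\infty_0(\mathcal O\cup\Gamma_0)$ (smooth functions with compact support in $\mathcal O\cup\Gamma_0$). The condition $m\le0\le M$ on $\Gamma_1$ is understood in the trace sense, i.e. $m^+,M^-\in H^1_0(\mathcal O\cup\Gamma_0,\mathfrak w)$, where $w^+=\max\{w,0\}$, $w^-=-\min\{w,0\}$. The Heston bilinear form is $$a(u,v)=\tfrac12\int_{\mathcal O}\left(u_xv_x+\rho\sigma u_yv_x+\rho\sigma u_xv_y+\sigma^2u_yv_y\right)y\,\mathfrak w\,dx\,dy-\tfrac\gamma2\int_{\mathcal O}(u_x+\rho\sigma u_y)v\,\operatorname{sign}(x)\,y\,\mathfrak w\,dx\,dy$$ $$\qquad-\int_{\mathcal O}a_1y\,u_xv\,\mathfrak w\,dx\,dy+\int_{\mathcal O}ruv\,\mathfrak w\,dx\,dy .$$ *)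

theory Defs
  imports "HOL-Analysis.Analysis" "HOL-Probability.Essential_Supremum"
begin

section \<open>Smooth functions and weak derivatives\<close>

text \<open>
  \<open>Ck_upto k U S f\<close>: the function \<open>f\<close> is of class \<open>C\<^sup>k\<close> on the open set \<open>U\<close>, and each of
  its partial derivatives of order at most \<open>k\<close> extends continuously to
  \<open>S\<close>, where \<open>U \<subseteq> S \<subseteq> closure U\<close>. The values of the functions \<open>g\<close> on \<open>S - U\<close> are
  precisely these continuous extensions. For \<open>S = U\<close> this is ordinary \<open>C\<^sup>k(U)\<close>.
\<close>

primrec Ck_upto ::
  "nat \<Rightarrow> 'a::euclidean_space set \<Rightarrow> 'a set \<Rightarrow> ('a \<Rightarrow> real) \<Rightarrow> bool" where
  "Ck_upto 0 U S f \<longleftrightarrow> continuous_on S f"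
| "Ck_upto (Suc k) U S f \<longleftrightarrow>
     continuous_on S f \<and> (\<forall>z\<in>U. f differentiable (at z)) \<and>
     (\<forall>e\<in>Basis. \<exists>g. (\<forall>z\<in>U. g z = frechet_derivative f (at z) e) \<and> Ck_upto k U S g)"

text \<open>
  \<open>C0_infinity U S\<close> is the space of smooth functions with compact support in \<open>S\<close>. A compact subset of
  \<open>S\<close> is closed in the whole space, so the closure may be taken there. Values off \<open>S\<close> are arbitrary.
\<close>

definition C0_infinity ::
  "'a::euclidean_space set \<Rightarrow> 'a set \<Rightarrow> ('a \<Rightarrow> real) set" where
  "C0_infinity U S =
     {\<phi>. (\<forall>k. Ck_upto k U S \<phi>) \<and>
          compact (closure {z\<in>S. \<phi> z \<noteq> 0}) \<and> closure {z\<in>S. \<phi> z \<noteq> 0} \<subseteq> S}"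

definition loc_integrable :: "'a::euclidean_space set \<Rightarrow> ('a \<Rightarrow> real) \<Rightarrow> bool" where
  "loc_integrable U u \<longleftrightarrow> (\<forall>K. compact K \<longrightarrow> K \<subseteq> U \<longrightarrow> set_integrable lebesgue K u)"

definition has_weak_deriv ::
  "'a::euclidean_space \<Rightarrow> 'a set \<Rightarrow> ('a \<Rightarrow> real) \<Rightarrow> ('a \<Rightarrow> real) \<Rightarrow> bool" where
  "has_weak_deriv e U u g \<longleftrightarrow>
     loc_integrable U u \<and> loc_integrable U g \<and>
     (\<forall>\<phi>\<in>C0_infinity U U.
        (LINT z:U|lebesgue. u z * frechet_derivative \<phi> (at z) e) =
        - (LINT z:U|lebesgue. g z * \<phi> z))"

definition weakly_differentiable :: "'a::euclidean_space set \<Rightarrow> ('a \<Rightarrow> real) \<Rightarrow> bool" where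
  "weakly_differentiable U u \<longleftrightarrow> (\<forall>e\<in>Basis. \<exists>g. has_weak_deriv e U u g)"

text \<open>
  Weak derivatives are unique up to null sets. The following choice of a representative is used only for
  weakly differentiable functions, inside integrals or almost-everywhere statements.
\<close>

definition weak_deriv ::
  "'a::euclidean_space \<Rightarrow> 'a set \<Rightarrow> ('a \<Rightarrow> real) \<Rightarrow> 'a \<Rightarrow> real" where
  "weak_deriv e U u = (SOME g. has_weak_deriv e U u g)"

abbreviation Dx :: "(real \<times> real) set \<Rightarrow> (real \<times> real \<Rightarrow> real) \<Rightarrow> real \<times> real \<Rightarrow> real" where
  "Dx \<equiv> weak_deriv (1, 0)"

abbreviation Dy :: "(real \<times> real) set \<Rightarrow> (real \<times> real \<Rightarrow> real) \<Rightarrow> real \<times> real \<Rightarrow> real" where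
  "Dy \<equiv> weak_deriv (0, 1)"


section \<open>Weighted spaces\<close>

text \<open>Points are pairs \<open>z = (x, y)\<close>, so \<open>fst z\<close> is \<open>x\<close> and \<open>snd z\<close> is \<open>y\<close>.\<close>

definition half_plane :: "(real \<times> real) set" where
  "half_plane = {z. snd z > 0}"

definition half_plane_domain :: "(real \<times> real) set \<Rightarrow> bool" where
  "half_plane_domain U \<longleftrightarrow> open U \<and> connected U \<and> U \<noteq> {} \<and> U \<subseteq> half_plane"

definition Gamma0 :: "(real \<times> real) set \<Rightarrow> (real \<times> real) set" where
  "Gamma0 U = (top_of_set {z. snd z = 0}) interior_of ({z. snd z = 0} \<inter> frontier U)"

definition heston_weight ::
  "real \<Rightarrow> real \<Rightarrow> real \<Rightarrow> real \<Rightarrow> real \<times> real \<Rightarrow> real" where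
  "heston_weight \<sigma> \<kappa> \<theta> \<gamma> z =
     (let \<beta> = 2 * \<kappa> * \<theta> / \<sigma>\<^sup>2; \<mu> = 2 * \<kappa> / \<sigma>\<^sup>2
      in snd z powr (\<beta> - 1) * exp (- \<gamma> * \<bar>fst z\<bar> - \<mu> * snd z))"

definition heston_measure ::
  "real \<Rightarrow> real \<Rightarrow> real \<Rightarrow> real \<Rightarrow> (real \<times> real) set \<Rightarrow> (real \<times> real) measure" where
  "heston_measure \<sigma> \<kappa> \<theta> \<gamma> U =
     density (lebesgue_on U) (\<lambda>z. ennreal (heston_weight \<sigma> \<kappa> \<theta> \<gamma> z))"

text \<open>
  In the following spaces, \<open>W\<close> is the weighted measure on \<open>U\<close>. Elements are representatives, not
  equivalence classes, and their values off \<open>U\<close> are irrelevant.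
\<close>

definition Lspace :: "real \<Rightarrow> 'a measure \<Rightarrow> ('a \<Rightarrow> real) set" where
  "Lspace s W = {u \<in> borel_measurable W. integrable W (\<lambda>z. \<bar>u z\<bar> powr s)}"

definition H1_density ::
  "(real \<times> real) set \<Rightarrow> (real \<times> real \<Rightarrow> real) \<Rightarrow> real \<times> real \<Rightarrow> real" where
  "H1_density U u z =
     snd z * ((Dx U u z)\<^sup>2 + (Dy U u z)\<^sup>2) + (1 + snd z) * (u z)\<^sup>2"

definition H2_density ::
  "(real \<times> real) set \<Rightarrow> (real \<times> real \<Rightarrow> real) \<Rightarrow> real \<times> real \<Rightarrow> real" where
  "H2_density U u z =
     (snd z)\<^sup>2 * ((Dx U (Dx U u) z)\<^sup>2 + (Dy U (Dx U u) z)\<^sup>2 +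
                 (Dx U (Dy U u) z)\<^sup>2 + (Dy U (Dy U u) z)\<^sup>2) +
     (1 + snd z)\<^sup>2 * ((Dx U u z)\<^sup>2 + (Dy U u z)\<^sup>2) + (1 + snd z) * (u z)\<^sup>2"

definition H1 ::
  "(real \<times> real) set \<Rightarrow> (real \<times> real) measure \<Rightarrow> (real \<times> real \<Rightarrow> real) set" where
  "H1 U W = {u. weakly_differentiable U u \<and> integrable W (H1_density U u)}"

definition H2 ::
  "(real \<times> real) set \<Rightarrow> (real \<times> real) measure \<Rightarrow> (real \<times> real \<Rightarrow> real) set" where
  "H2 U W = {u. weakly_differentiable U u \<and>
                weakly_differentiable U (Dx U u) \<and> weakly_differentiable U (Dy U u) \<and>
                integrable W (H2_density U u)}"

definition H1_norm ::
  "(real \<times> real) set \<Rightarrow> (real \<times> real) measure \<Rightarrow> (real \<times> real \<Rightarrow> real) \<Rightarrow> real" where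
  "H1_norm U W u = sqrt (LINT z|W. H1_density U u z)"

text \<open>\<open>H1_0 U W\<close> is \<open>H\<^sub>0\<^sup>1(U \<union> \<Gamma>\<^sub>0)\<close>: no boundary condition is imposed along \<open>\<Gamma>\<^sub>0\<close>.\<close>

definition H1_0 ::
  "(real \<times> real) set \<Rightarrow> (real \<times> real) measure \<Rightarrow> (real \<times> real \<Rightarrow> real) set" where
  "H1_0 U W =
     {u \<in> H1 U W. \<forall>\<epsilon>>0. \<exists>\<phi> \<in> C0_infinity U (U \<union> Gamma0 U) \<inter> H1 U W.
                      H1_norm U W (\<lambda>z. u z - \<phi> z) < \<epsilon>}"

text \<open>The inequalities \<open>w \<le> 0\<close> and \<open>w \<ge> 0\<close> on \<open>\<Gamma>\<^sub>1 = half_plane \<inter> frontier U\<close>, in the trace sense.\<close>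

definition Gamma1_le0 ::
  "(real \<times> real) set \<Rightarrow> (real \<times> real) measure \<Rightarrow> (real \<times> real \<Rightarrow> real) \<Rightarrow> bool" where
  "Gamma1_le0 U W w \<longleftrightarrow> (\<lambda>z. max (w z) 0) \<in> H1_0 U W"

definition Gamma1_ge0 ::
  "(real \<times> real) set \<Rightarrow> (real \<times> real) measure \<Rightarrow> (real \<times> real \<Rightarrow> real) \<Rightarrow> bool" where
  "Gamma1_ge0 U W w \<longleftrightarrow> (\<lambda>z. - min (w z) 0) \<in> H1_0 U W"


section \<open>The Heston operator and the obstacle problem\<close>

definition heston_op ::
  "real \<Rightarrow> real \<Rightarrow> real \<Rightarrow> real \<Rightarrow> real \<Rightarrow> real \<Rightarrow> (real \<times> real) set \<Rightarrow>
     (real \<times> real \<Rightarrow> real) \<Rightarrow> real \<times> real \<Rightarrow> real" where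
  "heston_op \<sigma> \<rho> \<kappa> \<theta> r q U v z =
     - (snd z / 2) * (Dx U (Dx U v) z + 2 * \<rho> * \<sigma> * Dy U (Dx U v) z
                      + \<sigma>\<^sup>2 * Dy U (Dy U v) z)
     - (r - q - snd z / 2) * Dx U v z
     - \<kappa> * (\<theta> - snd z) * Dy U v z
     + r * v z"

definition heston_form ::
  "real \<Rightarrow> real \<Rightarrow> real \<Rightarrow> real \<Rightarrow> real \<Rightarrow> real \<Rightarrow> (real \<times> real) set \<Rightarrow>
     (real \<times> real \<Rightarrow> real) \<Rightarrow> (real \<times> real \<Rightarrow> real) \<Rightarrow> real" where
  "heston_form \<sigma> \<rho> \<kappa> \<theta> r \<gamma> U u v =
     (let W = heston_measure \<sigma> \<kappa> \<theta> \<gamma> U; a\<^sub>1 = \<kappa> * \<rho> / \<sigma> - 1 / 2 in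
        1 / 2 * (LINT z|W. (Dx U u z * Dx U v z + \<rho> * \<sigma> * Dy U u z * Dx U v z
                            + \<rho> * \<sigma> * Dx U u z * Dy U v z
                            + \<sigma>\<^sup>2 * Dy U u z * Dy U v z) * snd z)
        - \<gamma> / 2 * (LINT z|W. (Dx U u z + \<rho> * \<sigma> * Dy U u z) * v z * sgn (fst z) * snd z)
        - (LINT z|W. a\<^sub>1 * snd z * Dx U u z * v z)
        + (LINT z|W. r * u z * v z))"

definition obstacle_solution ::
  "real \<Rightarrow> real \<Rightarrow> real \<Rightarrow> real \<Rightarrow> real \<Rightarrow> real \<Rightarrow> (real \<times> real) set \<Rightarrow>
     (real \<times> real \<Rightarrow> real) \<Rightarrow> (real \<times> real \<Rightarrow> real) \<Rightarrow> (real \<times> real \<Rightarrow> real) \<Rightarrow> bool" where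
  "obstacle_solution \<sigma> \<rho> \<kappa> \<theta> r \<gamma> U f \<psi> u \<longleftrightarrow>
     (let W = heston_measure \<sigma> \<kappa> \<theta> \<gamma> U in
        u \<in> H1_0 U W \<and> (AE z in lebesgue_on U. \<psi> z \<le> u z) \<and>
        (\<forall>v \<in> H1_0 U W. (AE z in lebesgue_on U. \<psi> z \<le> v z) \<longrightarrow>
           heston_form \<sigma> \<rho> \<kappa> \<theta> r \<gamma> U u (\<lambda>z. v z - u z) \<ge> (LINT z|W. f z * (v z - u z))))"

end

theory Submission
 imports Defs "HOL-Library.Function_Algebras" "HOL-Real_Asymp.Real_Asymp"
begin

text \<open>
 For small \<open>\<gamma>\<close> the Heston form is coercive, and this carries the whole theorem. By integration by parts
 in the weighted measure \<open>W\<close>, \<open>2 \<integral> y u u\<^sub>x dW = \<gamma> \<integral> sgn(x) y u\<^sup>2 dW\<close>, so the drift term and the term with the factor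
 \<open>\<gamma>\<close> are both of order \<open>\<gamma>\<close>; and \<open>2 \<integral> y u u\<^sub>y dW = \<integral> (\<mu> y - \<beta>) u\<^sup>2 dW\<close>, so the first moment
 \<open>\<integral> y u\<^sup>2 dW\<close> is controlled by \<open>\<integral> u\<^sup>2 dW\<close> and the gradient. The ellipticity of the second-order part
 and \<open>r > 0\<close> control the rest. The threshold \<open>coercivity_threshold\<close> depends on the coefficients only,
 among them \<open>r\<close>; when \<open>r = 0\<close> the implication is vacuous and any threshold will do.

 Existence is then the theorem of Lions and Stampacchia (\<open>Lions_Stampacchia\<close>) in the Hilbert space
 \<open>H1_0\<close>, and uniqueness follows by testing each of two solutions with the other one.

 The bounds come from the test functions \<open>v = u - (u - M)\<^sup>+\<close> and \<open>v = u + (m - u)\<^sup>+\<close>. With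
 \<open>w = (u - M)\<^sup>+\<close> the variational inequality and \<open>a(M, w) = (A M, w)\<close> (\<open>form_eq_heston_op\<close>) give
 \<open>a(w, w) = a(u - M, w) \<le> 0\<close>, whence \<open>w = 0\<close>. The formula for \<open>a(M, w)\<close> is four integrations by parts;
 the terms with \<open>\<gamma>\<close> cancel, and the first-order terms agree because of the normalization \<open>b\<^sub>1 = 0\<close>.

 The delicate point is that \<open>w\<close> vanishes on \<open>\<Gamma>\<^sub>1\<close>, that is, \<open>w \<in> H1_0\<close>. As \<open>w = (p - g)\<^sup>+\<close> with
 \<open>p = u + M\<^sup>- \<in> H1_0\<close> and \<open>g = M\<^sup>+ \<ge> 0\<close>, this is the order ideal property \<open>H1_0_minus_nonneg\<close>. One may take \<open>p\<close> to
 be a test function. Then \<open>(p - g - \<delta>)\<^sup>+\<close> extends by zero to the half plane, and mollifying it with a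
 kernel that only looks upwards gives test functions again. Their energies stay bounded because the
 degenerate weight increases upwards up to a constant (\<open>mollified_energy\<close>), and a norm-bounded
 sequence in \<open>H1_0\<close> that converges almost everywhere has its limit in \<open>H1_0\<close>.
\<close>


section \<open>Variational inequalities in complete semi-inner product spaces\<close>

locale semi_hilbert =
 fixes V :: "'v::real_vector set" and B :: "'v => 'v => real"
 assumes subspace: "subspace V"
  and add_left: "\<And>x y z. x \<in> V ==> y \<in> V ==> z \<in> V ==> B (x + y) z = B x z + B y z"
  and scale_left: "\<And>c x y. x \<in> V ==> y \<in> V ==> B (c *\<^sub>R x) y = c * B x y"
  and sym: "\<And>x y. x \<in> V ==> y \<in> V ==> B x y = B y x"
  and nonneg: "\<And>x. x \<in> V ==> 0 \<le> B x x"
  and complete: "\<And>X. (\<And>n::nat. X n \<in> V) ==>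
    (\<And>\<epsilon>. 0 < \<epsilon> ==> \<exists>N. \<forall>m\<ge>N. \<forall>n\<ge>N. B (X m - X n) (X m - X n) < \<epsilon>) ==>
    \<exists>x\<in>V. (\<lambda>n. B (X n - x) (X n - x)) \<longlonglongrightarrow> 0"
begin

definition nrm :: "'v => real" where "nrm x = sqrt (B x x)"

lemma V_add: "x \<in> V ==> y \<in> V ==> x + y \<in> V"
 and V_diff: "x \<in> V ==> y \<in> V ==> x - y \<in> V"
 and V_scale: "x \<in> V ==> c *\<^sub>R x \<in> V"
 using subspace by (auto intro: subspace_add subspace_diff subspace_scale)

lemma diff_left: "x \<in> V ==> y \<in> V ==> z \<in> V ==> B (x - y) z = B x z - B y z"
 using add_left[of x "(-1) *\<^sub>R y" z] scale_left[of y z "-1"] V_scale[of y "-1"] by simp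

lemma add_right: "x \<in> V ==> y \<in> V ==> z \<in> V ==> B x (y + z) = B x y + B x z"
 using add_left[of y z x] sym[of x] V_add by simp

lemma diff_right: "x \<in> V ==> y \<in> V ==> z \<in> V ==> B x (y - z) = B x y - B x z"
 using diff_left[of y z x] sym[of x] V_diff by simp

lemma scale_right: "x \<in> V ==> y \<in> V ==> B x (c *\<^sub>R y) = c * B x y"
 using scale_left[of y x c] sym[of x] V_scale by simp

lemmas bilin = add_left diff_left scale_left add_right diff_right scale_right
 V_add V_diff V_scale

lemma nrm_nonneg: "x \<in> V ==> 0 \<le> nrm x"
 by (simp add: nrm_def nonneg)

lemma nrm_sq: "x \<in> V ==> (nrm x)\<^sup>2 = B x x"
 by (simp add: nrm_def nonneg)

lemma nrm_scale: "x \<in> V ==> nrm (c *\<^sub>R x) = \<bar>c\<bar> * nrm x"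
 by (simp add: nrm_def bilin real_sqrt_mult flip: mult.assoc power2_eq_square)

text \<open>A bilinear form that is bounded by the sum of the squared norms is bounded by their product:
 the scaling \<open>t x, y / t\<close> leaves its value unchanged.\<close>

lemma bounded_form_product:
 assumes scl: "\<And>c x y. x \<in> V ==> y \<in> V ==> a (c *\<^sub>R x) y = c * a x y"
  and scr: "\<And>c x y. x \<in> V ==> y \<in> V ==> a x (c *\<^sub>R y) = c * (a x y :: real)"
  and bd: "\<And>x y. x \<in> V ==> y \<in> V ==> \<bar>a x y\<bar> \<le> C * (B x x + B y y)"
  and x: "x \<in> V" and y: "y \<in> V"
 shows "\<bar>a x y\<bar> \<le> 2 * C * nrm x * nrm y"
proof -
 have *: "\<bar>a x y\<bar> \<le> C * (t\<^sup>2 * (nrm x)\<^sup>2 + (nrm y)\<^sup>2 / t\<^sup>2)" if t: "t > 0" for t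
 proof -
  have "a x y = a (t *\<^sub>R x) ((1/t) *\<^sub>R y)"
   using t x y by (simp add: scl scr V_scale)
  also have "\<bar>\<dots>\<bar> \<le> C * (B (t *\<^sub>R x) (t *\<^sub>R x) + B ((1/t) *\<^sub>R y) ((1/t) *\<^sub>R y))"
   using x y by (intro bd V_scale)
  also have "\<dots> = C * (t\<^sup>2 * (nrm x)\<^sup>2 + (nrm y)\<^sup>2 / t\<^sup>2)"
   using x y by (simp add: bilin nrm_sq) (simp add: power2_eq_square)
  finally show ?thesis .
 qed
 show ?thesis
 proof (cases "nrm x = 0 \<or> nrm y = 0")
  case False
  then have pos: "nrm x > 0" "nrm y > 0"
   using nrm_nonneg[OF x] nrm_nonneg[OF y] by auto
  define t where "t = sqrt (nrm y / nrm x)"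
  have t: "t > 0" "t\<^sup>2 = nrm y / nrm x" using pos by (auto simp: t_def)
  have "t\<^sup>2 * (nrm x)\<^sup>2 + (nrm y)\<^sup>2 / t\<^sup>2 = 2 * (nrm x * nrm y)"
   using pos unfolding t(2) by (simp add: power2_eq_square)
  then show ?thesis using *[OF t(1)] by (simp add: mult.assoc)
 next
  case True
  have "\<bar>a x y\<bar> \<le> 0"
  proof (rule ccontr)
   assume "\<not> \<bar>a x y\<bar> \<le> 0"
   then have pos: "\<bar>a x y\<bar> > 0" by simp
   show False
   proof (cases "nrm x = 0")
    case True
    have "\<bar>a x y\<bar> \<le> C * (nrm y)\<^sup>2 / t\<^sup>2" if "t > 0" for t
     using *[OF that] True by simp
    from this[of "real (Suc _)"] have "\<forall>n. \<bar>a x y\<bar> \<le> C * (nrm y)\<^sup>2 * (1 / (real (Suc n))\<^sup>2)"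
     by simp
    moreover have "(\<lambda>n. C * (nrm y)\<^sup>2 * (1 / (real (Suc n))\<^sup>2)) \<longlonglongrightarrow> 0"
     by (rule tendsto_mult_right_zero) real_asymp
    ultimately have "\<bar>a x y\<bar> \<le> 0"
     by (intro LIMSEQ_le_const) auto
    with pos show False by simp
   next
    case False
    with \<open>nrm x = 0 \<or> nrm y = 0\<close> have y0: "nrm y = 0" by simp
    have "\<bar>a x y\<bar> \<le> C * (nrm x)\<^sup>2 * t\<^sup>2" if "t > 0" for t
     using *[OF that] y0 by (simp add: ac_simps)
    from this[of "1 / real (Suc _)"] have "\<forall>n. \<bar>a x y\<bar> \<le> C * (nrm x)\<^sup>2 * (1 / real (Suc n))\<^sup>2"
     by simp
    moreover have "(\<lambda>n. C * (nrm x)\<^sup>2 * (1 / real (Suc n))\<^sup>2) \<longlonglongrightarrow> 0"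
     by (rule tendsto_mult_right_zero) real_asymp
    ultimately have "\<bar>a x y\<bar> \<le> 0"
     by (intro LIMSEQ_le_const) auto
    with pos show False by simp
   qed
  qed
  with True show ?thesis by auto
 qed
qed

lemma Cauchy_Schwarz: "x \<in> V ==> y \<in> V ==> \<bar>B x y\<bar> \<le> nrm x * nrm y"
proof -
 assume x: "x \<in> V" and y: "y \<in> V"
 have "\<bar>B u v\<bar> \<le> 1/2 * (B u u + B v v)" if "u \<in> V" "v \<in> V" for u v
 proof -
  have "0 \<le> B (u - v) (u - v)" "0 \<le> B (u + v) (u + v)"
   using that by (auto intro!: nonneg V_add V_diff)
  then show ?thesis using that sym[of u v] by (simp add: bilin)
 qed
 from bounded_form_product[of B "1/2", OF _ _ this x y] show ?thesis
  by (simp add: bilin)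
qed

lemma nrm_triangle: "x \<in> V ==> y \<in> V ==> nrm (x + y) \<le> nrm x + nrm y"
proof -
 assume x: "x \<in> V" and y: "y \<in> V"
 have "(nrm (x + y))\<^sup>2 = (nrm x)\<^sup>2 + 2 * B x y + (nrm y)\<^sup>2"
  using x y sym[of x y] by (simp add: nrm_sq bilin)
 also have "\<dots> \<le> (nrm x + nrm y)\<^sup>2"
  using Cauchy_Schwarz[OF x y] by (simp add: power2_sum)
 finally show ?thesis
  using nrm_nonneg[OF x] nrm_nonneg[OF y] by (meson add_nonneg_nonneg power2_le_imp_le)
qed

lemma nrm_diff_sym: "x \<in> V ==> y \<in> V ==> nrm (x - y) = nrm (y - x)"
 using nrm_scale[of "x - y" "-1"] V_diff by simp

lemma nrm_diff_triangle:
 "x \<in> V ==> y \<in> V ==> z \<in> V ==> nrm (x - z) \<le> nrm (x - y) + nrm (y - z)"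
 using nrm_triangle[of "x - y" "y - z"] V_diff by simp

lemma nrm_abs_diff: "x \<in> V ==> y \<in> V ==> \<bar>nrm x - nrm y\<bar> \<le> nrm (x - y)"
 using nrm_triangle[of "x - y" y] nrm_triangle[of "y - x" x] nrm_diff_sym[of x y] V_diff
 by auto

lemma tendsto_iff_nrm:
 "(\<And>n. X n \<in> V) ==> x \<in> V ==>
  (\<lambda>n. B (X n - x) (X n - x)) \<longlonglongrightarrow> 0 \<longleftrightarrow> (\<lambda>n. nrm (X n - x)) \<longlonglongrightarrow> 0"
proof -
 assume X: "\<And>n. X n \<in> V" and x: "x \<in> V"
 have *: "B (X n - x) (X n - x) = (nrm (X n - x))\<^sup>2" for n
  using X x by (simp add: nrm_sq V_diff)
 show ?thesis
 proof
  assume "(\<lambda>n. B (X n - x) (X n - x)) \<longlonglongrightarrow> 0"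
  from tendsto_real_sqrt[OF this] show "(\<lambda>n. nrm (X n - x)) \<longlonglongrightarrow> 0"
   by (simp add: nrm_def)
 next
  assume "(\<lambda>n. nrm (X n - x)) \<longlonglongrightarrow> 0"
  from tendsto_power[OF this, of 2] show "(\<lambda>n. B (X n - x) (X n - x)) \<longlonglongrightarrow> 0"
   by (simp add: *)
 qed
qed

lemma tendsto_nrm:
 assumes "\<And>n. X n \<in> V" "x \<in> V" "(\<lambda>n. nrm (X n - x)) \<longlonglongrightarrow> 0"
 shows "(\<lambda>n. nrm (X n)) \<longlonglongrightarrow> nrm x"
proof (rule LIM_zero_cancel, rule tendsto_rabs_zero_cancel, rule tendsto_sandwich[OF _ _ tendsto_const assms(3)])
 show "\<forall>\<^sub>F n in sequentially. \<bar>nrm (X n) - nrm x\<bar> \<le> nrm (X n - x)"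
  using assms by (simp add: nrm_abs_diff)
qed auto

lemma parallelogram:
 "x \<in> V ==> y \<in> V ==>
  B (x - y) (x - y) = 2 * B x x + 2 * B y y - 4 * B ((1/2) *\<^sub>R (x + y)) ((1/2) *\<^sub>R (x + y))"
 by (simp add: bilin sym[of y x] field_simps)

definition nclosed :: "'v set => bool" where
 "nclosed K \<longleftrightarrow> (\<forall>X x. (\<forall>n::nat. X n \<in> K) \<longrightarrow> x \<in> V \<longrightarrow>
   (\<lambda>n. nrm (X n - x)) \<longlonglongrightarrow> 0 \<longrightarrow> x \<in> K)"

text \<open>The only step of the weak compactness of bounded sets that is used below: a minimizing sequence
 in the convex hulls of the tails is a Cauchy sequence, by the parallelogram identity.\<close>

lemma bounded_imp_convex_tails_converge:
 assumes X: "\<And>n. X n \<in> V" and bd: "\<And>n. B (X n) (X n) \<le> C"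
 obtains Y x where "x \<in> V" "\<And>n. Y n \<in> convex hull (X ` {n..})"
  "(\<lambda>n. nrm (Y n - x)) \<longlonglongrightarrow> 0"
proof -
 define H where "H n = convex hull (X ` {n..})" for n
 have HV: "H n \<subseteq> V" for n
  unfolding H_def by (rule hull_minimal) (use X subspace subspace_imp_convex in auto)
 have Hmono: "H m \<subseteq> H n" if "n \<le> m" for m n
  unfolding H_def by (rule hull_mono) (use that in auto)
 have XH: "X n \<in> H n" for n unfolding H_def by (rule hull_inc) auto
 define d where "d n = Inf ((\<lambda>v. B v v) ` H n)" for n
 have bdd: "bdd_below ((\<lambda>v. B v v) ` H n)" for n
  using HV[of n] nonneg by (intro bdd_belowI[of _ 0]) auto
 have d_le: "d n \<le> B v v" if "v \<in> H n" for n v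
  unfolding d_def using bdd that by (intro cInf_lower) auto
 have dC: "d n \<le> C" for n using d_le[OF XH] bd order_trans by blast
 have "incseq d"
 proof (rule incseq_SucI)
  fix n show "d n \<le> d (Suc n)"
   unfolding d_def[of "Suc n"]
   by (rule cInf_greatest) (use XH[of "Suc n"] Hmono[of n "Suc n"] d_le in auto)
 qed
 then have "convergent d" using dC by (metis incseq_convergent convergentI)
 then obtain D where D: "d \<longlonglongrightarrow> D" by (auto simp: convergent_def)
 have "\<exists>v\<in>H n. B v v < d n + 1 / real (Suc n)" for n
 proof -
  have "Inf ((\<lambda>v. B v v) ` H n) < d n + 1 / real (Suc n)" by (simp add: d_def)
  then show ?thesis
   using cInf_lessD[of "(\<lambda>v. B v v) ` H n"] XH[of n] by blast
 qed
 then obtain Y where Y: "\<And>n. Y n \<in> H n" "\<And>n. B (Y n) (Y n) < d n + 1 / real (Suc n)"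
  by metis
 have YV: "Y n \<in> V" for n using Y HV by blast
 have est: "B (Y m - Y n) (Y m - Y n) \<le> 2 * (d m - d n) + 4 / real (Suc n)" if "n \<le> m" for m n
 proof -
  have "(1/2) *\<^sub>R (Y m + Y n) \<in> H n"
  proof -
   have "Y m \<in> H n" "Y n \<in> H n" using Y Hmono that by blast+
   moreover have "convex (H n)" by (simp add: H_def)
   ultimately have "(1/2) *\<^sub>R Y m + (1/2) *\<^sub>R Y n \<in> H n"
    by (intro convexD) auto
   then show ?thesis by (simp add: scaleR_add_right)
  qed
  then have "d n \<le> B ((1/2) *\<^sub>R (Y m + Y n)) ((1/2) *\<^sub>R (Y m + Y n))" by (rule d_le)
  moreover have "1 / real (Suc m) \<le> 1 / real (Suc n)" using that by (simp add: field_simps)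
  ultimately show ?thesis
   using parallelogram[OF YV YV, of m n] Y(2)[of m] Y(2)[of n] by simp
 qed
 have "\<exists>x\<in>V. (\<lambda>n. B (Y n - x) (Y n - x)) \<longlonglongrightarrow> 0"
 proof (rule complete[OF YV])
  fix e :: real assume e: "0 < e"
  have "(\<lambda>n. 2 * (D - d n) + 4 / real (Suc n)) \<longlonglongrightarrow> 2 * (D - D) + 0"
   by (intro tendsto_intros D) real_asymp
  then have "\<forall>\<^sub>F n in sequentially. 2 * (D - d n) + 4 / real (Suc n) < e"
   using e by (intro order_tendstoD(2)) auto
  then obtain N where N: "\<And>n. n \<ge> N ==> 2 * (D - d n) + 4 / real (Suc n) < e"
   by (auto simp: eventually_sequentially)
  have dD: "d m \<le> D" for m using \<open>incseq d\<close> D by (rule incseq_le)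
  have half: "B (Y m - Y n) (Y m - Y n) < e" if "n \<ge> N" "n \<le> m" for m n
   using est[OF that(2)] N[OF that(1)] dD[of m] by simp
  have swap: "B (Y m - Y n) (Y m - Y n) = B (Y n - Y m) (Y n - Y m)" for m n
   using nrm_diff_sym[OF YV YV, of m n] nrm_sq[OF V_diff[OF YV YV]] by metis
  show "\<exists>N. \<forall>m\<ge>N. \<forall>n\<ge>N. B (Y m - Y n) (Y m - Y n) < e"
   using half swap by (metis nle_le)
 qed
 then obtain x where "x \<in> V" "(\<lambda>n. nrm (Y n - x)) \<longlonglongrightarrow> 0"
  using tendsto_iff_nrm[of Y] YV by blast
 with Y(1) show thesis by (intro that[of x Y]) (auto simp: H_def)
qed

text \<open>Minimization of a quadratic functional over a closed convex set.\<close>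

lemma symmetric_variational_inequality:
 assumes K: "K \<subseteq> V" "K \<noteq> {}" "convex K" "nclosed K"
  and l_add: "\<And>x y. x \<in> V ==> y \<in> V ==> l (x + y) = l x + (l y :: real)"
  and l_scale: "\<And>c x. x \<in> V ==> l (c *\<^sub>R x) = c * l x"
  and l_bd: "\<And>x. x \<in> V ==> \<bar>l x\<bar> \<le> L * nrm x"
 obtains u where "u \<in> K" "\<And>v. v \<in> K ==> l (v - u) \<le> B u (v - u)"
proof -
 define J where "J v = B v v - 2 * l v" for v
 have KV: "v \<in> V" if "v \<in> K" for v using that K by auto
 have l_diff: "l (x - y) = l x - l y" if "x \<in> V" "y \<in> V" for x y
  using l_add[of x "(-1) *\<^sub>R y"] l_scale[of y "-1"] V_scale[of y "-1"] that by simp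
 have low: "- L\<^sup>2 \<le> J v" if "v \<in> V" for v
 proof -
  have "0 \<le> (nrm v - L)\<^sup>2" by simp
  then have "2 * (L * nrm v) \<le> (nrm v)\<^sup>2 + L\<^sup>2" by (simp add: power2_diff ac_simps)
  then show ?thesis using l_bd[OF that] nrm_sq[OF that] by (simp add: J_def abs_le_iff)
 qed
 define d where "d = Inf (J ` K)"
 have bdd: "bdd_below (J ` K)" using low KV by (intro bdd_belowI[of _ "- L\<^sup>2"]) auto
 have d_le: "d \<le> J v" if "v \<in> K" for v
  unfolding d_def using bdd that by (intro cInf_lower) auto
 have "\<exists>v\<in>K. J v < d + 1 / real (Suc n)" for n
 proof -
  have "Inf (J ` K) < d + 1 / real (Suc n)" by (simp add: d_def)
  then show ?thesis using cInf_lessD[of "J ` K"] K(2) by blast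
 qed
 then obtain Y where Y: "\<And>n. Y n \<in> K" "\<And>n. J (Y n) < d + 1 / real (Suc n)" by metis
 have YV: "Y n \<in> V" for n using Y KV by blast
 have est: "B (Y m - Y n) (Y m - Y n) \<le> 2 / real (Suc m) + 2 / real (Suc n)" for m n
 proof -
  have mid: "(1/2) *\<^sub>R (Y m + Y n) \<in> K"
   using convexD[OF K(3) Y(1)[of m] Y(1)[of n], of "1/2" "1/2"] by (simp add: scaleR_add_right)
  have "l ((1/2) *\<^sub>R (Y m + Y n)) = (l (Y m) + l (Y n)) / 2"
   using YV by (simp add: l_scale l_add V_add)
  then show ?thesis
   using d_le[OF mid] parallelogram[OF YV YV, of m n] Y(2)[of m] Y(2)[of n]
   unfolding J_def by simp
 qed
 have "\<exists>x\<in>V. (\<lambda>n. B (Y n - x) (Y n - x)) \<longlonglongrightarrow> 0"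
 proof (rule complete[OF YV])
  fix e :: real assume e: "0 < e"
  have "(\<lambda>n. 2 / real (Suc n)) \<longlonglongrightarrow> 0" by real_asymp
  then have "\<forall>\<^sub>F n in sequentially. 2 / real (Suc n) < e / 2"
   using e by (intro order_tendstoD(2)) auto
  then obtain N where N: "\<And>n. n \<ge> N ==> 2 / real (Suc n) < e / 2"
   by (auto simp: eventually_sequentially)
  have "B (Y m - Y n) (Y m - Y n) < e" if "m \<ge> N" "n \<ge> N" for m n
   using est[of m n] N[OF that(1)] N[OF that(2)] by linarith
  then show "\<exists>N. \<forall>m\<ge>N. \<forall>n\<ge>N. B (Y m - Y n) (Y m - Y n) < e" by blast
 qed
 then obtain u where u: "u \<in> V" "(\<lambda>n. nrm (Y n - u)) \<longlonglongrightarrow> 0"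
  using tendsto_iff_nrm[of Y] YV by blast
 have uK: "u \<in> K" using K(4) Y(1) u unfolding nclosed_def by blast
 have "(\<lambda>n. l (Y n) - l u) \<longlonglongrightarrow> 0"
 proof (rule Lim_null_comparison)
  show "\<forall>\<^sub>F n in sequentially. norm (l (Y n) - l u) \<le> L * nrm (Y n - u)"
   using l_bd[OF V_diff[OF YV u(1)]] l_diff[OF YV u(1)] by simp
  show "(\<lambda>n. L * nrm (Y n - u)) \<longlonglongrightarrow> 0" using tendsto_mult_right_zero[OF u(2)] .
 qed
 then have lY: "(\<lambda>n. l (Y n)) \<longlonglongrightarrow> l u" by (rule LIM_zero_cancel)
 have "(\<lambda>n. (nrm (Y n))\<^sup>2 - 2 * l (Y n)) \<longlonglongrightarrow> (nrm u)\<^sup>2 - 2 * l u"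
  by (intro tendsto_intros lY tendsto_nrm[OF YV u])
 then have JY: "(\<lambda>n. J (Y n)) \<longlonglongrightarrow> J u" using YV u(1) by (simp add: J_def nrm_sq)
 have "J u \<le> d + 0"
 proof (rule LIMSEQ_le[OF JY])
  show "(\<lambda>n. d + 1 / real (Suc n)) \<longlonglongrightarrow> d + 0" by (intro tendsto_intros) real_asymp
 qed (use Y(2) less_imp_le in blast)
 then have Jmin: "J u \<le> J v" if "v \<in> K" for v using d_le[OF that] by simp
 have "l (v - u) \<le> B u (v - u)" if v: "v \<in> K" for v
 proof -
  let ?h = "v - u"
  have vV: "v \<in> V" and hV: "?h \<in> V" using v KV u(1) V_diff by auto
  have *: "0 \<le> 2 * (B u ?h - l ?h) + t * B ?h ?h" if t: "0 < t" "t \<le> 1" for t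
  proof -
   have "u + t *\<^sub>R ?h = (1 - t) *\<^sub>R u + t *\<^sub>R v" by (simp add: algebra_simps)
   also have "\<dots> \<in> K" using convexD[OF K(3) uK v] t by simp
   finally have "J u \<le> J (u + t *\<^sub>R ?h)" by (rule Jmin)
   also have "\<dots> = J u + t * (2 * (B u ?h - l ?h) + t * B ?h ?h)"
    using u(1) hV sym[OF u(1) hV] unfolding J_def
    by (simp only: l_add l_scale add_left add_right scale_left scale_right V_add V_scale) (simp add: algebra_simps)
   finally show ?thesis using t by (simp add: zero_le_mult_iff)
  qed
  have "(\<lambda>n. 2 * (B u ?h - l ?h) + 1 / real (Suc n) * B ?h ?h) \<longlonglongrightarrow> 2 * (B u ?h - l ?h) + 0 * B ?h ?h"
   by (intro tendsto_intros) real_asymp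
  moreover have "0 \<le> 2 * (B u ?h - l ?h) + 1 / real (Suc n) * B ?h ?h" for n
   by (rule *) auto
  ultimately have "0 \<le> 2 * (B u ?h - l ?h) + 0 * B ?h ?h" by (intro LIMSEQ_le_const) auto
  then show ?thesis by simp
 qed
 with uK show thesis by (rule that)
qed

text \<open>Solving the symmetric problem with the remaining terms frozen at \<open>p\<close> defines a map whose fixed
 points solve the problem for \<open>a\<close>. Damping by \<open>\<tau> = c / N\<^sup>2\<close> makes it a contraction: if \<open>g\<close>
 represents \<open>a d\<close>, then \<open>\<parallel>d - \<tau> g\<parallel>\<^sup>2 = \<parallel>d\<parallel>\<^sup>2 - 2 \<tau> a d d + \<tau>\<^sup>2 \<parallel>g\<parallel>\<^sup>2\<close>.\<close>

theorem Lions_Stampacchia: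
 assumes K: "K \<subseteq> V" "K \<noteq> {}" "convex K" "nclosed K"
  and l_add: "\<And>x y. x \<in> V ==> y \<in> V ==> l (x + y) = l x + (l y :: real)"
  and l_scale: "\<And>c x. x \<in> V ==> l (c *\<^sub>R x) = c * l x"
  and l_bd: "\<And>x. x \<in> V ==> \<bar>l x\<bar> \<le> L * nrm x"
  and a_addl: "\<And>x y z. x \<in> V ==> y \<in> V ==> z \<in> V ==> a (x + y) z = a x z + (a y z :: real)"
  and a_addr: "\<And>x y z. x \<in> V ==> y \<in> V ==> z \<in> V ==> a x (y + z) = a x y + a x z"
  and a_scaler: "\<And>c x y. x \<in> V ==> y \<in> V ==> a x (c *\<^sub>R y) = c * a x y"
  and a_bd: "\<And>x y. x \<in> V ==> y \<in> V ==> \<bar>a x y\<bar> \<le> M * nrm x * nrm y"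
  and c: "0 < c" and coercive: "\<And>x. x \<in> V ==> c * B x x \<le> a x x"
 obtains u where "u \<in> K" "\<And>v. v \<in> K ==> l (v - u) \<le> a u (v - u)"
proof -
 have KV: "v \<in> V" if "v \<in> K" for v using that K by auto
 have a_diffl: "a (x - y) z = a x z - a y z" if "x \<in> V" "y \<in> V" "z \<in> V" for x y z
  using a_addl[of "x - y" y z] that by (simp add: V_diff)
 have a_diffr: "a x (y - z) = a x y - a x z" if "x \<in> V" "y \<in> V" "z \<in> V" for x y z
  using a_addr[of x "y - z" z] that by (simp add: V_diff)
 have l_diff: "l (x - y) = - l (y - x)" if "x \<in> V" "y \<in> V" for x y
  using l_scale[of "y - x" "-1"] V_diff that by simp
 define N where "N = \<bar>M\<bar> + 1"
 have N: "0 < N" by (simp add: N_def)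
 have a_bd': "\<bar>a x y\<bar> \<le> N * nrm x * nrm y" if "x \<in> V" "y \<in> V" for x y
 proof -
  have "M * (nrm x * nrm y) \<le> N * (nrm x * nrm y)"
   using nrm_nonneg that by (intro mult_right_mono) (auto simp: N_def)
  then show ?thesis using a_bd[OF that] by (simp add: mult.assoc)
 qed
 have Riesz: "\<exists>g\<in>V. \<forall>x\<in>V. a p x = B g x" if p: "p \<in> V" for p
 proof -
  have "convex V" "nclosed V" using subspace by (auto intro: subspace_imp_convex simp: nclosed_def)
  then obtain g where g: "g \<in> V" "\<And>v. v \<in> V ==> a p (v - g) \<le> B g (v - g)"
   using symmetric_variational_inequality[of V "a p" "N * nrm p"] p a_addr[OF p] a_scaler[OF p] a_bd'[OF p] by blast
  have "a p x = B g x" if x: "x \<in> V" for x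
   using g(2)[OF V_add[OF g(1) x]] g(2)[OF V_add[OF g(1) V_scale[OF x, of "-1"]]] a_scaler[OF p x, of "-1"]
    scale_right[OF g(1) x, of "-1"] by simp
  then show ?thesis using g(1) by blast
 qed
 define \<tau> where "\<tau> = c / N\<^sup>2"
 have \<tau>: "0 < \<tau>" using c N by (simp add: \<tau>_def)
 define k where "k = sqrt (max 0 (1 - \<tau> * c))"
 have k: "0 \<le> k" "k < 1" using \<tau> c by (auto simp: k_def)
 define R where "R p x = B p x - \<tau> * a p x" for p x
 have Rbd: "\<bar>R p x\<bar> \<le> k * nrm p * nrm x" if p: "p \<in> V" and x: "x \<in> V" for p x
 proof -
  obtain g where g: "g \<in> V" "\<And>x. x \<in> V ==> a p x = B g x" using Riesz[OF p] by blast
  have d: "p - \<tau> *\<^sub>R g \<in> V" using p g(1) by (intro V_diff V_scale)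
  have "nrm g * nrm g \<le> N * nrm p * nrm g"
   using a_bd'[OF p g(1)] g(2)[OF g(1)] nrm_sq[OF g(1)] by (simp add: power2_eq_square)
  then have "nrm g \<le> N * nrm p" using nrm_nonneg[OF g(1)] nrm_nonneg[OF p] N by (cases "nrm g = 0") auto
  from power_mono[OF this nrm_nonneg[OF g(1)], of 2] have gg: "B g g \<le> N\<^sup>2 * B p p"
   by (simp add: power_mult_distrib nrm_sq p g(1))
  have "B (p - \<tau> *\<^sub>R g) (p - \<tau> *\<^sub>R g) = B p p - 2 * \<tau> * a p p + \<tau>\<^sup>2 * B g g"
   using p g(1) g(2)[OF p] sym[OF p g(1)] by (simp add: bilin V_diff V_scale) (simp add: algebra_simps power2_eq_square)
  also have "\<dots> \<le> B p p - 2 * \<tau> * (c * B p p) + \<tau>\<^sup>2 * (N\<^sup>2 * B p p)"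
   using coercive[OF p] gg \<tau> by (intro add_mono diff_mono mult_left_mono) auto
  also have "\<tau>\<^sup>2 * (N\<^sup>2 * B p p) = \<tau> * c * B p p" using N by (simp add: \<tau>_def power2_eq_square)
  also have "B p p - 2 * \<tau> * (c * B p p) + \<tau> * c * B p p = (1 - \<tau> * c) * B p p" by (simp add: algebra_simps)
  also have "\<dots> \<le> (k * nrm p)\<^sup>2"
   unfolding k_def power_mult_distrib nrm_sq[OF p] using nonneg[OF p] by (intro mult_right_mono) auto
  finally have n: "nrm (p - \<tau> *\<^sub>R g) \<le> k * nrm p"
   unfolding nrm_sq[OF d, symmetric] by (rule power2_le_imp_le) (simp add: k nrm_nonneg p)
  have "R p x = B (p - \<tau> *\<^sub>R g) x" using p x g by (simp add: R_def bilin V_scale)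
  then show ?thesis
   using Cauchy_Schwarz[OF d x] mult_right_mono[OF n nrm_nonneg[OF x]] by simp
 qed
 have R_diffl: "R (x - y) z = R x z - R y z" if "x \<in> V" "y \<in> V" "z \<in> V" for x y z
  using that by (simp add: R_def diff_left a_diffl algebra_simps)
 have "\<exists>w\<in>K. \<forall>v\<in>K. R p (v - w) + \<tau> * l (v - w) \<le> B w (v - w)" if p: "p \<in> V" for p
 proof -
  define l' where "l' x = R p x + \<tau> * l x" for x
  obtain w where "w \<in> K" "\<And>v. v \<in> K ==> l' (v - w) \<le> B w (v - w)"
  proof (rule symmetric_variational_inequality[OF K, of l' "k * nrm p + \<tau> * L"])
   show "l' (x + y) = l' x + l' y" if "x \<in> V" "y \<in> V" for x y
    using that p by (simp add: l'_def R_def l_add add_right a_addr algebra_simps)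
   show "l' (c *\<^sub>R x) = c * l' x" if "x \<in> V" for c x
    using that p by (simp add: l'_def R_def l_scale scale_right a_scaler algebra_simps)
   show "\<bar>l' x\<bar> \<le> (k * nrm p + \<tau> * L) * nrm x" if "x \<in> V" for x
   proof -
    have "\<bar>\<tau> * l x\<bar> \<le> \<tau> * (L * nrm x)"
     unfolding abs_mult using \<tau> l_bd[OF that] by simp
    then show ?thesis
     using Rbd[OF p that] abs_triangle_ineq[of "R p x" "\<tau> * l x"] unfolding l'_def distrib_right by simp
   qed
  qed blast
  then show ?thesis by (auto simp: l'_def)
 qed
 then obtain T where TK: "\<And>p. p \<in> V ==> T p \<in> K"
  and T: "\<And>p v. p \<in> V ==> v \<in> K ==> R p (v - T p) + \<tau> * l (v - T p) \<le> B (T p) (v - T p)"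
  by metis
 have TV: "T p \<in> V" if "p \<in> V" for p using TK[OF that] KV by blast
 have contr: "nrm (T p - T p') \<le> k * nrm (p - p')" if p: "p \<in> V" "p' \<in> V" for p p'
 proof -
  let ?w = "T p" and ?w' = "T p'"
  note w = TV[OF p(1)] TV[OF p(2)]
  have neg: "R p' (?w - ?w') = - R p' (?w' - ?w)" "B ?w' (?w - ?w') = - B ?w' (?w' - ?w)"
   using w p by (auto simp: R_def diff_right a_diffr algebra_simps)
  have "R p (?w' - ?w) + \<tau> * l (?w' - ?w) \<le> B ?w (?w' - ?w)"
   "R p' (?w - ?w') + \<tau> * l (?w - ?w') \<le> B ?w' (?w - ?w')"
   using T p TK by auto
  then have "R p (?w' - ?w) - R p' (?w' - ?w) \<le> B ?w (?w' - ?w) - B ?w' (?w' - ?w)"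
   using neg l_diff[OF w] by simp
  moreover have "B ?w (?w' - ?w) - B ?w' (?w' - ?w) = - (nrm (?w - ?w'))\<^sup>2"
   using w by (simp add: nrm_sq V_diff) (simp add: bilin algebra_simps)
  ultimately have "(nrm (?w - ?w'))\<^sup>2 \<le> - R (p - p') (?w' - ?w)"
   using R_diffl[of p p' "?w' - ?w"] p w V_diff by simp
  also have "\<dots> \<le> k * nrm (p - p') * nrm (?w - ?w')"
   using Rbd[of "p - p'" "?w' - ?w"] p w V_diff nrm_diff_sym[of ?w ?w'] by simp
  finally have *: "nrm (?w - ?w') * nrm (?w - ?w') \<le> k * nrm (p - p') * nrm (?w - ?w')"
   by (simp add: power2_eq_square)
  have "0 \<le> k * nrm (p - p')" using k p V_diff by (simp add: nrm_nonneg)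
  then show ?thesis using * nrm_nonneg[of "?w - ?w'"] w V_diff
   by (cases "nrm (?w - ?w') = 0") auto
 qed
 obtain p0 where p0: "p0 \<in> K" using K by auto
 define X where "X n = (T ^^ n) p0" for n
 have XS: "X (Suc n) = T (X n)" for n by (simp add: X_def)
 have XK: "X n \<in> K" for n
  by (induction n) (use p0 TK KV in \<open>auto simp: X_def\<close>)
 have XV: "X n \<in> V" for n using XK KV by blast
 define E where "E = nrm (X 1 - X 0) / (1 - k)"
 have E: "0 \<le> E" "k * E + nrm (X 1 - X 0) = E"
  using k nrm_nonneg[OF V_diff[OF XV XV], of 1 0] by (auto simp: E_def field_simps)
 have start: "nrm (X j - X 0) \<le> E" for j
 proof (induction j)
  case 0
  show ?case using E(1) nrm_scale[OF XV, of 0 0] by simp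
 next
  case (Suc j)
  have "nrm (X (Suc j) - X 0) \<le> nrm (X (Suc j) - X 1) + nrm (X 1 - X 0)"
   by (rule nrm_diff_triangle[OF XV XV XV])
  also have "\<dots> \<le> k * nrm (X j - X 0) + nrm (X 1 - X 0)" using contr[OF XV XV, of j 0] by (simp add: XS)
  also have "\<dots> \<le> k * E + nrm (X 1 - X 0)" using mult_left_mono[OF Suc k(1)] by simp
  finally show ?case using E(2) by simp
 qed
 have tail: "nrm (X (n + j) - X n) \<le> k ^ n * E" for n j
 proof (induction n)
  case (Suc n)
  have "nrm (X (Suc n + j) - X (Suc n)) \<le> k * nrm (X (n + j) - X n)"
   using contr[OF XV XV, of "n + j" n] by (simp add: XS)
  also have "\<dots> \<le> k * (k ^ n * E)" by (rule mult_left_mono[OF Suc k(1)])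
  finally show ?case by (simp add: mult.assoc)
 qed (simp add: start)
 have tail0: "(\<lambda>n. k ^ n * E) \<longlonglongrightarrow> 0"
  using k by (intro tendsto_mult_left_zero LIMSEQ_realpow_zero)
 have "\<exists>x\<in>V. (\<lambda>n. B (X n - x) (X n - x)) \<longlonglongrightarrow> 0"
 proof (rule complete[OF XV])
  fix e :: real assume e: "0 < e"
  then obtain n0 where n0: "\<And>n. n \<ge> n0 ==> k ^ n * E < sqrt e"
   using order_tendstoD(2)[OF tail0, of "sqrt e"] by (auto simp: eventually_sequentially)
  have half: "nrm (X m - X n) < sqrt e" if "n \<ge> n0" "n \<le> m" for m n
   using tail[of n "m - n"] n0[OF that(1)] that by simp
  have "nrm (X m - X n) < sqrt e" if "m \<ge> n0" "n \<ge> n0" for m n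
   using half[of n m] half[of m n] that nrm_diff_sym[OF XV XV, of m n] by (cases "n \<le> m") auto
  then show "\<exists>N. \<forall>m\<ge>N. \<forall>n\<ge>N. B (X m - X n) (X m - X n) < e"
   by (auto simp: nrm_def)
 qed
 then obtain u where u: "u \<in> V" "(\<lambda>n. nrm (X n - u)) \<longlonglongrightarrow> 0"
  using tendsto_iff_nrm[of X] XV by blast
 let ?w = "T u"
 note w = TV[OF u(1)]
 have "nrm (?w - u) \<le> 0"
 proof (rule LIMSEQ_le_const)
  have "(\<lambda>n. k * nrm (X n - u) + nrm (X (Suc n) - u)) \<longlonglongrightarrow> k * 0 + 0"
   by (intro tendsto_intros u LIMSEQ_Suc[OF u(2)])
  then show "(\<lambda>n. k * nrm (X n - u) + nrm (X (Suc n) - u)) \<longlonglongrightarrow> 0" by simp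
  have "nrm (?w - u) \<le> k * nrm (X n - u) + nrm (X (Suc n) - u)" for n
   using nrm_diff_triangle[OF w XV[of "Suc n"] u(1)] contr[OF u(1) XV[of n]] nrm_diff_sym[OF u(1) XV[of n]]
   by (simp add: XS)
  then show "\<exists>N. \<forall>n\<ge>N. nrm (?w - u) \<le> k * nrm (X n - u) + nrm (X (Suc n) - u)" by blast
 qed
 then have wu: "nrm (?w - u) = 0" using nrm_nonneg[OF V_diff[OF w u(1)]] by simp
 have "l (v - ?w) \<le> a ?w (v - ?w)" if v: "v \<in> K" for v
 proof -
  have x: "v - ?w \<in> V" using v KV w by (intro V_diff)
  have "B ?w (v - ?w) = B u (v - ?w)" "a ?w (v - ?w) = a u (v - ?w)"
   using Cauchy_Schwarz[OF V_diff[OF w u(1)] x] a_bd'[OF V_diff[OF w u(1)] x] wu w u(1) x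
   by (simp_all add: diff_left a_diffl)
  then have "\<tau> * l (v - ?w) \<le> \<tau> * a ?w (v - ?w)" using T[OF u(1) v] by (simp add: R_def)
  then show ?thesis using \<tau> by simp
 qed
 with TK[OF u(1)] show thesis by (rule that)
qed

end

text \<open>Partial derivatives of differentiable functions.\<close>

abbreviation pd where
 "pd f e \<equiv> \<lambda>z. frechet_derivative f (at z) e"

section \<open>Smooth functions, bumps and convolution\<close>

lemma Ck_upto_continuous: "Ck_upto k U S f ==> continuous_on S f"
 by (cases k) auto

lemma Ck_upto_Suc_imp: "Ck_upto (Suc k) U S f ==> Ck_upto k U S f"
proof (induction k arbitrary: f)
 case (Suc k)
 then show ?case unfolding Ck_upto.simps(2)[of "Suc k"] Ck_upto.simps(2)[of k] by blast
qed simp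

lemma Ck_upto_subset:
 "Ck_upto k U S f ==> U' \<subseteq> U ==> S' \<subseteq> S ==> Ck_upto k U' S' f"
proof (induction k arbitrary: f)
 case 0
 then show ?case by (auto intro: continuous_on_subset)
next
 case (Suc k)
 have "\<exists>g. (\<forall>z\<in>U'. g z = pd f e z) \<and> Ck_upto k U' S' g" if "e \<in> Basis" for e
  using Suc that by (metis (no_types, lifting) Ck_upto.simps(2) subsetD)
 with Suc.prems show ?case by (auto intro: continuous_on_subset)
qed

lemma Ck_upto_cong:
 assumes U: "open U" "U \<subseteq> S" and eq: "\<And>z. z \<in> S ==> f z = g z" and f: "Ck_upto k U S f"
 shows "Ck_upto k U S g"
proof (cases k)
 case 0
 then show ?thesis using f eq by (auto cong: continuous_on_cong)
next
 case (Suc k')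
 have d: "g differentiable (at z) \<and> frechet_derivative g (at z) = frechet_derivative f (at z)"
  if z: "z \<in> U" for z
 proof -
  have "(f has_derivative frechet_derivative f (at z)) (at z)"
   using f Suc z by (intro frechet_derivative_works[THEN iffD1]) simp
  then have "(g has_derivative frechet_derivative f (at z)) (at z)"
   by (rule has_derivative_transform_within_open[OF _ U(1) z]) (use eq U in auto)
  then show ?thesis using frechet_derivative_at[of g "frechet_derivative f (at z)" z]
   by (auto simp: differentiable_def)
 qed
 have "continuous_on S g" using f eq by (auto simp: Suc cong: continuous_on_cong)
 then show ?thesis using f d unfolding Suc by simp
qed

lemma Ck_upto_frechet:
 assumes "open U" "Ck_upto (Suc k) U U f" "e \<in> Basis"
 shows "Ck_upto k U U (pd f e)"
proof -
 obtain g where g: "\<forall>z\<in>U. g z = pd f e z" "Ck_upto k U U g"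
  using assms(2,3) unfolding Ck_upto.simps by blast
 show ?thesis by (rule Ck_upto_cong[OF assms(1) order_refl _ g(2)]) (use g(1) in blast)
qed

lemma Ck_upto_const: "Ck_upto k U S (\<lambda>z. c)"
proof (induction k arbitrary: c)
 case (Suc k)
 have "pd (\<lambda>z::'a. c) e z = 0" for e z
  using frechet_derivative_at[OF has_derivative_const, of c z, symmetric] by simp
 then show ?case using Suc[of 0] by (auto intro!: exI[of _ "\<lambda>z. 0"])
qed simp

lemma Ck_upto_add:
 "Ck_upto k U S f ==> Ck_upto k U S g ==> Ck_upto k U S (\<lambda>z. f z + g z)"
proof (induction k arbitrary: f g)
 case 0
 then show ?case by (auto intro: continuous_intros)
next
 case (Suc k)
 have "\<exists>h. (\<forall>z\<in>U. h z = pd (\<lambda>z. f z + g z) e z) \<and> Ck_upto k U S h"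
  if e: "e \<in> Basis" for e
 proof -
  obtain f' g' where *: "\<forall>z\<in>U. f' z = pd f e z" "Ck_upto k U S f'"
   "\<forall>z\<in>U. g' z = pd g e z" "Ck_upto k U S g'"
   using Suc.prems e by (metis Ck_upto.simps(2))
  have "pd (\<lambda>z. f z + g z) e z = f' z + g' z" if z: "z \<in> U" for z
  proof -
   have "(f has_derivative frechet_derivative f (at z)) (at z)"
    "(g has_derivative frechet_derivative g (at z)) (at z)"
    using Suc.prems z by (auto intro!: frechet_derivative_works[THEN iffD1])
   from frechet_derivative_at[OF has_derivative_add[OF this], symmetric]
   show ?thesis using * z by simp
  qed
  then show ?thesis using Suc.IH *(2,4) by (intro exI[of _ "\<lambda>z. f' z + g' z"]) auto
 qed
 with Suc.prems show ?case by (auto intro: continuous_intros)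
qed

lemma Ck_upto_mult:
 "Ck_upto k U S f ==> Ck_upto k U S g ==> Ck_upto k U S (\<lambda>z. f z * g z)"
proof (induction k arbitrary: f g)
 case 0
 then show ?case by (auto intro: continuous_intros)
next
 case (Suc k)
 have "\<exists>h. (\<forall>z\<in>U. h z = pd (\<lambda>z. f z * g z) e z) \<and> Ck_upto k U S h"
  if e: "e \<in> Basis" for e
 proof -
  obtain f' g' where *: "\<forall>z\<in>U. f' z = pd f e z" "Ck_upto k U S f'"
   "\<forall>z\<in>U. g' z = pd g e z" "Ck_upto k U S g'"
   using Suc.prems e by (metis Ck_upto.simps(2))
  have "pd (\<lambda>z. f z * g z) e z = f z * g' z + f' z * g z" if z: "z \<in> U" for z
  proof -
   have "(f has_derivative frechet_derivative f (at z)) (at z)"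
    "(g has_derivative frechet_derivative g (at z)) (at z)"
    using Suc.prems z by (auto intro!: frechet_derivative_works[THEN iffD1])
   from frechet_derivative_at[OF has_derivative_mult[OF this], symmetric]
   show ?thesis using * z by simp
  qed
  then show ?thesis using Suc.IH *(2,4) Ck_upto_Suc_imp[OF Suc.prems(1)] Ck_upto_Suc_imp[OF Suc.prems(2)]
   by (intro exI[of _ "\<lambda>z. f z * g' z + f' z * g z"]) (auto intro!: Ck_upto_add)
 qed
 with Suc.prems show ?case by (auto intro: continuous_intros)
qed

lemma Ck_upto_inner: "Ck_upto k U S (\<lambda>z. a \<bullet> (z - c))"
proof (cases k)
 case (Suc k')
 have d: "((\<lambda>z. a \<bullet> (z - c)) has_derivative (\<lambda>h. a \<bullet> h)) (at z)" for z
  by (auto intro!: derivative_eq_intros)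
 show ?thesis
  unfolding Suc using Ck_upto_const[of k' U S "a \<bullet> e" for e] d frechet_derivative_at[OF d, symmetric]
  by (auto simp: differentiable_def intro!: continuous_intros)
qed (auto intro!: continuous_intros)

text \<open>The functions \<open>P(1/t) exp(-1/t)\<close> with a polynomial \<open>P\<close> are closed under differentiation, so one
 induction on the order shows that the radial bumps are smooth.\<close>

definition exp_inverse :: "real poly => real => real" where
 "exp_inverse P t = (if 0 < t then poly P (1 / t) * exp (- (1 / t)) else 0)"

lemma tendsto_poly_exp_minus: "((\<lambda>s::real. poly P s * exp (- s)) \<longlongrightarrow> 0) at_top"
proof -
 have "((\<lambda>s. \<Sum>i\<le>degree P. coeff P i * (s ^ i / exp s)) \<longlongrightarrow> (\<Sum>i\<le>degree P. coeff P i * 0)) at_top"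
  by (intro tendsto_sum tendsto_mult tendsto_const tendsto_power_div_exp_0)
 then show ?thesis by (simp add: poly_altdef sum_distrib_right exp_minus divide_inverse mult.assoc)
qed

lemma tendsto_exp_inverse_0: "((\<lambda>t. exp_inverse P t) \<longlongrightarrow> 0) (at 0)"
proof (rule filterlim_split_at)
 show "(exp_inverse P \<longlongrightarrow> 0) (at_left 0)"
  by (rule tendsto_eventually) (auto simp: eventually_at_filter exp_inverse_def)
 have "((\<lambda>t. poly P (inverse t) * exp (- inverse t)) \<longlongrightarrow> 0) (at_right 0)"
  using tendsto_poly_exp_minus filterlim_inverse_at_top_right by (rule filterlim_compose)
 then show "(exp_inverse P \<longlongrightarrow> 0) (at_right 0)"
  by (rule Lim_transform_eventually)
   (auto simp: eventually_at_filter exp_inverse_def inverse_eq_divide)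
qed

lemma exp_inverse_has_derivative:
 "(exp_inverse P has_real_derivative exp_inverse ([:0, 0, 1:] * (P - pderiv P)) t) (at t)"
proof (cases t "0::real" rule: linorder_cases)
 case less
 then have "((\<lambda>t. 0) has_real_derivative 0) (at t)" "open {..<0::real}" "t \<in> {..<0}" by auto
 from has_field_derivative_transform_within_open[OF this, of "exp_inverse P"] less
 show ?thesis by (auto simp: exp_inverse_def)
next
 case greater
 have "((\<lambda>t. poly P (1 / t) * exp (- (1 / t))) has_real_derivative
   exp_inverse ([:0, 0, 1:] * (P - pderiv P)) t) (at t)"
  using greater
  by (auto intro!: derivative_eq_intros DERIV_chain2[OF poly_DERIV]
    simp: exp_inverse_def power2_eq_square field_simps)
 from has_field_derivative_transform_within_open[OF this, of "{0<..}" "exp_inverse P"] greater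
 show ?thesis by (auto simp: exp_inverse_def)
next
 case equal
 have "((\<lambda>h. exp_inverse ([:0, 1:] * P) h) \<longlongrightarrow> 0) (at 0)" by (rule tendsto_exp_inverse_0)
 moreover have "exp_inverse ([:0, 1:] * P) h = exp_inverse P h / h" for h
  by (auto simp: exp_inverse_def)
 ultimately show ?thesis using equal by (simp add: DERIV_def exp_inverse_def)
qed

text \<open>Squares of distances are used instead of distances, so that only products and the one-variable
 profile have to be differentiated.\<close>

lemma Ck_upto_radial:
 fixes c :: "'a::euclidean_space"
 shows "Ck_upto k U S (\<lambda>z. exp_inverse P (R - (norm (z - c))\<^sup>2))"
proof -
 have "Ck_upto k UNIV UNIV (\<lambda>z. exp_inverse P (R - (norm (z - c))\<^sup>2))"
 proof (induction k arbitrary: P)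
  case 0
  have "continuous_on UNIV (exp_inverse P)"
   using exp_inverse_has_derivative DERIV_isCont continuous_at_imp_continuous_on by blast
  then show ?case by (auto intro!: continuous_intros continuous_on_compose2[of UNIV "exp_inverse P"])
 next
  case (Suc k)
  let ?P = "[:0, 0, 1:] * (P - pderiv P)"
  have d: "((\<lambda>z. exp_inverse P (R - (norm (z - c))\<^sup>2)) has_derivative
    (\<lambda>h. exp_inverse ?P (R - (norm (z - c))\<^sup>2) * (- 2 * (h \<bullet> (z - c))))) (at z)" for z
  proof -
   have "((\<lambda>z. R - (z - c) \<bullet> (z - c)) has_derivative (\<lambda>h. - 2 * (h \<bullet> (z - c)))) (at z)"
    by (auto intro!: derivative_eq_intros simp: inner_commute)
   from DERIV_compose_FDERIV[OF exp_inverse_has_derivative this]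
   show ?thesis by (simp only: power2_norm_eq_inner mult.commute)
  qed
  have "Ck_upto k UNIV UNIV (\<lambda>z. exp_inverse ?P (R - (norm (z - c))\<^sup>2) * (- 2 * (e \<bullet> (z - c))))" for e
   by (intro Ck_upto_mult Suc Ck_upto_const Ck_upto_inner)
  moreover have "continuous_on UNIV (\<lambda>z. exp_inverse P (R - (norm (z - c))\<^sup>2))"
   using has_derivative_continuous[OF d] continuous_at_imp_continuous_on by blast
  ultimately show ?case
   using d frechet_derivative_at[OF d, symmetric]
   by (auto simp: differentiable_def simp del: mult_pCons_left)
 qed
 then show ?thesis by (rule Ck_upto_subset) auto
qed

lemma integrable_continuous_compact_support:
 fixes f :: "'a::euclidean_space => real"
 assumes "continuous_on UNIV f" "compact K" "\<And>z. z \<notin> K ==> f z = 0"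
 shows "integrable lborel f"
proof -
 have "integrable lborel (\<lambda>x. indicator K x *\<^sub>R f x)"
  using assms(1,2) by (intro borel_integrable_compact) (auto intro: continuous_on_subset)
 moreover have "(\<lambda>x. indicator K x *\<^sub>R f x) = f"
 proof
  fix x show "indicator K x *\<^sub>R f x = f x" by (cases "x \<in> K") (auto simp: assms(3))
 qed
 ultimately show ?thesis by simp
qed

lemma uniformly_continuous_compact_support:
 fixes f :: "'a::euclidean_space => real"
 assumes f: "continuous_on UNIV f" and K: "compact K" and 0: "\<And>z. z \<notin> K ==> f z = 0"
 shows "uniformly_continuous_on UNIV f"
 unfolding uniformly_continuous_on_def
proof (intro allI impI)
 fix e :: real assume e: "0 < e"
 obtain R where R: "K \<subseteq> cball 0 R" using compact_imp_bounded[OF K] by (auto simp: bounded_iff subset_eq)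
 have "uniformly_continuous_on (cball 0 (R + 1)) f"
  using f by (intro compact_uniformly_continuous compact_cball) (auto intro: continuous_on_subset)
 then obtain d where d: "0 < d"
  "\<And>x y. x \<in> cball 0 (R + 1) ==> y \<in> cball 0 (R + 1) ==> dist y x < d ==> dist (f y) (f x) < e"
  using e unfolding uniformly_continuous_on_def by blast
 have "dist (f y) (f x) < e" if xy: "dist y x < min d 1" for x y
 proof (cases "x \<in> cball 0 (R + 1) \<and> y \<in> cball 0 (R + 1)")
  case True
  then show ?thesis using d(2) xy by auto
 next
  case False
  then have "x \<notin> cball 0 R" "y \<notin> cball 0 R"
   using xy norm_triangle_ineq[of "x - y" y] norm_triangle_ineq[of "y - x" x]
   by (auto simp: dist_norm norm_minus_commute)
  then have "x \<notin> K" "y \<notin> K" using R by auto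
  then show ?thesis using 0 e by simp
 qed
 then show "\<exists>d>0. \<forall>x\<in>UNIV. \<forall>x'\<in>UNIV. dist x' x < d \<longrightarrow> dist (f x') (f x) < e"
  using d(1) by (intro exI[of _ "min d 1"]) auto
qed

definition bump :: "'a::euclidean_space => real => 'a => real" where
 "bump c r z = exp_inverse 1 (r\<^sup>2 - (norm (z - c))\<^sup>2) /
   (LINT z|lborel. exp_inverse 1 (r\<^sup>2 - (norm (z - c))\<^sup>2))"

lemma bump_smooth: "Ck_upto k U S (bump c r)"
 unfolding bump_def divide_inverse by (intro Ck_upto_mult Ck_upto_radial Ck_upto_const)

lemma exp_inverse_nonneg: "0 \<le> exp_inverse 1 t"
 by (simp add: exp_inverse_def)

lemma bump_nonneg: "0 \<le> bump c r z"
 unfolding bump_def by (intro divide_nonneg_nonneg integral_nonneg_AE) (auto simp: exp_inverse_nonneg)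

lemma radial_eq_0: "0 < r ==> z \<notin> ball c r ==> exp_inverse P (r\<^sup>2 - (norm (z - c))\<^sup>2) = 0"
proof -
 assume "0 < r" "z \<notin> ball c r"
 then have "r\<^sup>2 \<le> (norm (z - c))\<^sup>2"
  by (intro power_mono) (auto simp: dist_norm norm_minus_commute[of c])
 then show ?thesis by (simp add: exp_inverse_def)
qed

lemma bump_eq_0: "0 < r ==> z \<notin> ball c r ==> bump c r z = 0"
 by (simp add: bump_def radial_eq_0)

lemma bump_continuous: "continuous_on S (bump c r)"
 using bump_smooth Ck_upto_continuous by blast

lemma bump_borel [measurable]: "bump c r \<in> borel_measurable borel"
 by (intro borel_measurable_continuous_onI bump_continuous)

lemma bump_integrable: "0 < r ==> integrable lborel (bump c r)"
 by (rule integrable_continuous_compact_support[OF bump_continuous compact_cball[of c r]])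
  (auto intro: bump_eq_0)

lemma bump_integral:
 assumes r: "0 < r" shows "(LINT z|lborel. bump c r z) = 1"
proof -
 let ?g = "\<lambda>z. exp_inverse 1 (r\<^sup>2 - (norm (z - c))\<^sup>2)"
 have cont: "continuous_on UNIV ?g" using Ck_upto_radial Ck_upto_continuous by blast
 have int: "integrable lborel ?g"
  by (rule integrable_continuous_compact_support[OF cont compact_cball[of c r]])
   (use r in \<open>auto intro: radial_eq_0\<close>)
 have "(LINT z|lborel. ?g z) \<noteq> 0"
 proof
  assume "(LINT z|lborel. ?g z) = 0"
  then have "AE z in lborel. ?g z = 0"
   using integral_nonneg_eq_0_iff_AE[OF int] exp_inverse_nonneg by auto
  then have "AE z in lborel. z \<notin> ball c r"
  proof (rule eventually_mono)
   fix z assume "?g z = 0"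
   moreover have "0 < ?g z" if "z \<in> ball c r"
    using that by (simp add: exp_inverse_def dist_norm norm_minus_commute power_strict_mono)
   ultimately show "z \<notin> ball c r" by fastforce
  qed
  then have "emeasure lborel (ball c r) = 0"
   by (subst (asm) AE_iff_measurable[OF _ refl]) (auto simp: ball_def)
  then show False using r content_ball_pos[of r c] by (simp add: measure_def)
 qed
 then show ?thesis by (simp add: bump_def[abs_def])
qed

subsection \<open>Compactly supported test functions\<close>

text \<open>Unlike smooth test functions these are stable under products with the piecewise polynomial cutoffs
 used below. They vanish off a compact subset of \<open>U\<close>, so they can be integrated over the whole space.\<close>

definition C1_test :: "'a::euclidean_space set => ('a => real) => bool" where
 "C1_test U \<phi> \<longleftrightarrow> (\<forall>z. \<phi> differentiable (at z)) \<and>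
   (\<forall>e\<in>Basis. continuous_on UNIV (pd \<phi> e)) \<and>
   (\<exists>K. compact K \<and> K \<subseteq> U \<and> (\<forall>z. z \<notin> K \<longrightarrow> \<phi> z = 0))"

lemma frechet_derivative_eq_0_outside:
 fixes \<phi> :: "'a::euclidean_space => real"
 assumes "closed K" "\<And>z. z \<notin> K ==> \<phi> z = 0" "z \<notin> K"
 shows "pd \<phi> e z = 0"
proof -
 have "((\<lambda>z. 0) has_derivative (\<lambda>h. 0)) (at z)" "open (- K)" "z \<in> - K" using assms by auto
 from has_derivative_transform_within_open[OF this, of \<phi>] assms
 have "(\<phi> has_derivative (\<lambda>h. 0)) (at z)" by auto
 from frechet_derivative_at[OF this] show ?thesis by (metis)
qed

lemma frechet_derivative_sum_Basis:
 fixes \<phi> :: "'a::euclidean_space => real"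
 assumes "\<phi> differentiable (at z)"
 shows "pd \<phi> h z = (\<Sum>b\<in>Basis. (h \<bullet> b) * pd \<phi> b z)"
proof -
 interpret linear "frechet_derivative \<phi> (at z)"
  using assms linear_frechet_derivative by blast
 have "pd \<phi> h z = pd \<phi> (\<Sum>b\<in>Basis. (h \<bullet> b) *\<^sub>R b) z"
  by (simp add: euclidean_representation)
 then show ?thesis by (simp only: sum scaleR real_scaleR_def)
qed

lemma C1_testE:
 assumes "C1_test U \<phi>"
 obtains K where "compact K" "K \<subseteq> U" "\<And>z. z \<notin> K ==> \<phi> z = 0"
  "\<And>z e. z \<notin> K ==> pd \<phi> e z = 0"
 using assms frechet_derivative_eq_0_outside[of _ \<phi>] unfolding C1_test_def
 by (metis compact_imp_closed)

lemma C1_test_continuous: "C1_test U \<phi> ==> continuous_on S \<phi>"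
 unfolding C1_test_def
 by (meson continuous_at_imp_continuous_on differentiable_imp_continuous_within)

lemma C0_infinity_imp_C1_test:
 fixes U :: "'a::euclidean_space set"
 assumes U: "open U" and \<phi>: "\<phi> \<in> C0_infinity U U"
 shows "C1_test U (\<lambda>z. if z \<in> U then \<phi> z else 0)"
  and "\<And>z. z \<in> U ==> frechet_derivative (\<lambda>z. if z \<in> U then \<phi> z else 0) (at z) =
    frechet_derivative \<phi> (at z)"
proof -
 let ?f = "\<lambda>z. if z \<in> U then \<phi> z else 0"
 define K where "K = closure {z\<in>U. \<phi> z \<noteq> 0}"
 have K: "compact K" "K \<subseteq> U" using \<phi> by (auto simp: C0_infinity_def K_def)
 have "{z\<in>U. \<phi> z \<noteq> 0} \<subseteq> K" unfolding K_def by (rule closure_subset)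
 then have 0: "?f z = 0" if "z \<notin> K" for z using that by auto
 have C: "Ck_upto k U U \<phi>" for k using \<phi> by (simp add: C0_infinity_def)
 have eqU: "(?f has_derivative frechet_derivative \<phi> (at z)) (at z)" if z: "z \<in> U" for z
 proof (rule has_derivative_transform_within_open[OF _ U z])
  show "(\<phi> has_derivative frechet_derivative \<phi> (at z)) (at z)"
   using C[of "Suc 0"] z by (intro frechet_derivative_works[THEN iffD1]) simp
 qed simp
 show fr: "frechet_derivative ?f (at z) = frechet_derivative \<phi> (at z)" if "z \<in> U" for z
  using frechet_derivative_at[OF eqU[OF that]] by simp
 have out: "(?f has_derivative (\<lambda>h. 0)) (at z)" if z: "z \<notin> K" for z
 proof (rule has_derivative_transform_within_open[of "\<lambda>z. 0"])
  show "open (- K)" using K by (simp add: compact_imp_closed open_Compl)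
 qed (use z 0 in auto)
 have diff: "?f differentiable (at z)" for z
  using eqU[of z] out[of z] K(2) unfolding differentiable_def by blast
 have "continuous_on UNIV (\<lambda>z. pd ?f e z)" if e: "e \<in> Basis" for e
 proof (rule continuous_on_subset)
  show "continuous_on (U \<union> - K) (\<lambda>z. pd ?f e z)"
  proof (rule continuous_on_open_Un)
   have "continuous_on U (pd \<phi> e)"
    using Ck_upto_frechet[OF U C[of "Suc 0"] e] Ck_upto_continuous by blast
   then show "continuous_on U (\<lambda>z. pd ?f e z)"
    using fr by (simp cong: continuous_on_cong)
   have "pd ?f e z = 0" if "z \<in> - K" for z
    using frechet_derivative_eq_0_outside[OF compact_imp_closed[OF K(1)] 0] that by simp
   then have "continuous_on (- K) (\<lambda>z. pd ?f e z) \<longleftrightarrow> continuous_on (- K) (\<lambda>z. 0::real)"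
    by (intro continuous_on_cong) auto
   then show "continuous_on (- K) (\<lambda>z. pd ?f e z)" by simp
  qed (use U K in \<open>auto simp: compact_imp_closed open_Compl\<close>)
 qed (use K in auto)
 then show "C1_test U ?f" unfolding C1_test_def using diff K 0 by blast
qed

lemma C0_infinity_frechet:
 assumes U: "open U" and \<phi>: "\<phi> \<in> C0_infinity U U" and e: "e \<in> Basis"
 shows "(pd \<phi> e) \<in> C0_infinity U U"
proof -
 define K where "K = closure {z\<in>U. \<phi> z \<noteq> 0}"
 have K: "compact K" "K \<subseteq> U" using \<phi> by (auto simp: C0_infinity_def K_def)
 have "{z\<in>U. pd \<phi> e z \<noteq> 0} \<subseteq> K"
 proof (rule ccontr)
  assume "\<not> ?thesis"
  then obtain z where z: "z \<in> U" "z \<notin> K" "pd \<phi> e z \<noteq> 0" by auto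
  let ?f = "\<lambda>z. if z \<in> U then \<phi> z else 0"
  have "{z\<in>U. \<phi> z \<noteq> 0} \<subseteq> K" unfolding K_def by (rule closure_subset)
  then have "pd ?f e z = 0"
  proof (intro frechet_derivative_eq_0_outside[of K])
   show "?f z = 0" if "{z\<in>U. \<phi> z \<noteq> 0} \<subseteq> K" "z \<notin> K" for z using that by auto
  qed (use K z in \<open>auto simp: compact_imp_closed\<close>)
  then show False using C0_infinity_imp_C1_test(2)[OF U \<phi> z(1)] z(3) by simp
 qed
 then have "closure {z\<in>U. pd \<phi> e z \<noteq> 0} \<subseteq> K"
  using K by (intro closure_minimal) (auto simp: compact_imp_closed)
 moreover from this have "compact (closure {z\<in>U. pd \<phi> e z \<noteq> 0})"
  using K compact_Int_closed[of K "closure {z\<in>U. pd \<phi> e z \<noteq> 0}"]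
  by (simp add: Int_absorb1)
 moreover have "Ck_upto k U U (pd \<phi> e)" for k
  by (rule Ck_upto_frechet[OF U _ e]) (use \<phi> in \<open>simp add: C0_infinity_def del: Ck_upto.simps\<close>)
 ultimately show ?thesis using K by (auto simp: C0_infinity_def)
qed

lemma C1_test_uniformly_differentiable:
 fixes \<phi> :: "'a::euclidean_space => real"
 assumes \<phi>: "C1_test U \<phi>" and \<epsilon>: "0 < \<epsilon>"
 obtains \<delta> where "0 < \<delta>"
  "\<And>z h. norm h < \<delta> ==> \<bar>\<phi> (z + h) - \<phi> z - pd \<phi> h z\<bar> \<le> \<epsilon> * norm h"
proof -
 obtain K where K: "compact K" "\<And>z e. z \<notin> K ==> pd \<phi> e z = 0"
  using C1_testE[OF \<phi>] by metis
 define \<epsilon>' where "\<epsilon>' = \<epsilon> / real DIM('a)"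
 have \<epsilon>': "0 < \<epsilon>'" using \<epsilon> by (simp add: \<epsilon>'_def)
 have "\<exists>d>0. \<forall>z z'. dist z z' < d \<longrightarrow>
   \<bar>pd \<phi> e z - pd \<phi> e z'\<bar> < \<epsilon>'"
  if e: "e \<in> Basis" for e
 proof -
  have "uniformly_continuous_on UNIV (pd \<phi> e)"
   using \<phi> e K unfolding C1_test_def by (intro uniformly_continuous_compact_support[of _ K]) auto
  then show ?thesis using \<epsilon>' unfolding uniformly_continuous_on_def
   by (simp add: dist_real_def) (metis dist_commute)
 qed
 then obtain d where d: "\<And>e. e \<in> Basis ==> 0 < d e"
  "\<And>e z z'. e \<in> Basis ==> dist z z' < d e ==>
   \<bar>pd \<phi> e z - pd \<phi> e z'\<bar> < \<epsilon>'"
  by metis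
 define \<delta> where "\<delta> = Min (d ` Basis)"
 have \<delta>: "0 < \<delta>" "\<And>e. e \<in> Basis ==> \<delta> \<le> d e" using d(1) by (auto simp: \<delta>_def)
 have diff: "\<phi> differentiable (at z)" for z using \<phi> by (simp add: C1_test_def)
 show thesis
 proof (rule that[OF \<delta>(1)])
  fix z h :: 'a assume h: "norm h < \<delta>"
  have "\<exists>t\<in>{0<..<1}. \<phi> (z + 1 *\<^sub>R h) - \<phi> (z + 0 *\<^sub>R h) =
    pd \<phi> ((1 - 0) *\<^sub>R h) (z + t *\<^sub>R h)"
  proof (rule mvt_simple)
   fix t :: real
   have "((\<lambda>t. z + t *\<^sub>R h) has_derivative (\<lambda>s. s *\<^sub>R h)) (at t within {0..1})"
    by (auto intro!: derivative_eq_intros)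
   moreover have "(\<phi> has_derivative frechet_derivative \<phi> (at (z + t *\<^sub>R h))) (at (z + t *\<^sub>R h))"
    using diff frechet_derivative_works by blast
   ultimately show "((\<lambda>t. \<phi> (z + t *\<^sub>R h)) has_derivative
     (\<lambda>s. pd \<phi> (s *\<^sub>R h) (z + t *\<^sub>R h))) (at t within {0..1})"
    by (rule has_derivative_compose)
  qed simp
  then obtain t where t: "0 < t" "t < 1"
   and eq: "\<phi> (z + h) - \<phi> z = pd \<phi> h (z + t *\<^sub>R h)" by auto
  have "\<bar>\<phi> (z + h) - \<phi> z - pd \<phi> h z\<bar> =
    \<bar>\<Sum>b\<in>Basis. (h \<bullet> b) * (pd \<phi> b (z + t *\<^sub>R h) - pd \<phi> b z)\<bar>"
   unfolding eq frechet_derivative_sum_Basis[OF diff, of _ h]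
   by (simp add: sum_subtractf right_diff_distrib)
  also have "\<dots> \<le> (\<Sum>b\<in>(Basis::'a set). norm h * \<epsilon>')"
  proof (rule order_trans[OF sum_abs], rule sum_mono)
   fix b :: 'a assume b: "b \<in> Basis"
   have "dist (z + t *\<^sub>R h) z = t * norm h" using t by (simp add: dist_norm)
   also have "\<dots> \<le> norm h" using t by (simp add: mult_left_le_one_le)
   finally have "dist (z + t *\<^sub>R h) z < d b" using h \<delta>(2)[OF b] by simp
   from d(2)[OF b this] show "\<bar>(h \<bullet> b) * (pd \<phi> b (z + t *\<^sub>R h) -
     pd \<phi> b z)\<bar> \<le> norm h * \<epsilon>'"
    unfolding abs_mult using Basis_le_norm[OF b, of h] by (intro mult_mono) auto
  qed
  also have "\<dots> = \<epsilon> * norm h" by (simp add: \<epsilon>'_def)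
  finally show "\<bar>\<phi> (z + h) - \<phi> z - pd \<phi> h z\<bar> \<le> \<epsilon> * norm h" .
 qed
qed

lemma C1_test_frechet_borel:
 assumes "C1_test U \<phi>" "e \<in> Basis"
 shows "(pd \<phi> e) \<in> borel_measurable borel"
 using assms by (intro borel_measurable_continuous_onI) (auto simp: C1_test_def)

lemma C1_test_bounded:
 fixes \<phi> :: "'a::euclidean_space => real"
 assumes \<phi>: "C1_test U \<phi>"
 obtains C where "\<And>z. \<bar>\<phi> z\<bar> \<le> C" "\<And>z e. e \<in> Basis ==> \<bar>pd \<phi> e z\<bar> \<le> C"
proof -
 obtain K where K: "compact K" "\<And>z. z \<notin> K ==> \<phi> z = 0"
  "\<And>z e. z \<notin> K ==> pd \<phi> e z = 0"
  using C1_testE[OF \<phi>] by metis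
 have *: "\<exists>C. \<forall>z. \<bar>g z\<bar> \<le> C" if "continuous_on UNIV g" "\<And>z. z \<notin> K ==> g z = 0" for g :: "'a => real"
 proof -
  have "bounded (g ` K)"
   using that(1) K(1) by (meson compact_continuous_image compact_imp_bounded continuous_on_subset subset_UNIV)
  then obtain C where "\<And>z. z \<in> K ==> \<bar>g z\<bar> \<le> C" by (auto simp: bounded_iff)
  then have "\<bar>g z\<bar> \<le> max C 0" for z using that(2)[of z] by (cases "z \<in> K") (auto simp: le_max_iff_disj)
  then show ?thesis by blast
 qed
 obtain C0 where C0: "\<And>z. \<bar>\<phi> z\<bar> \<le> C0" using *[OF C1_test_continuous[OF \<phi>] K(2)] by blast
 have "\<exists>C. \<forall>z. \<bar>pd \<phi> e z\<bar> \<le> C" if "e \<in> Basis" for e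
  using \<phi> that K(3) by (intro *) (auto simp: C1_test_def)
 then obtain C1 where C1: "\<And>e z. e \<in> Basis ==> \<bar>pd \<phi> e z\<bar> \<le> C1 e" by metis
 define C where "C = C0 + (\<Sum>e\<in>Basis. \<bar>C1 e\<bar>)"
 have C0_nonneg: "0 \<le> C0" using C0[of 0] by linarith
 have "\<bar>pd \<phi> e z\<bar> \<le> C" if e: "e \<in> Basis" for z e
 proof -
  have "\<bar>C1 e\<bar> \<le> (\<Sum>e\<in>Basis. \<bar>C1 e\<bar>)" using e by (intro member_le_sum) auto
  then show ?thesis using C1[OF e, of z] C0_nonneg by (simp add: C_def)
 qed
 moreover have "\<bar>\<phi> z\<bar> \<le> C" for z proof -
  have "0 \<le> (\<Sum>e\<in>Basis. \<bar>C1 e\<bar>)" by (intro sum_nonneg) simp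
  then show ?thesis using C0[of z] unfolding C_def by linarith
 qed
 ultimately show thesis by (rule that[rotated])
qed

definition conv :: "('a::euclidean_space => real) => ('a => real) => 'a => real" where
 "conv k f z = (LINT \<zeta>|lborel. k (z - \<zeta>) * f \<zeta>)"

lemma integrable_bounded_mult:
 fixes f k :: "'a => real"
 assumes "integrable M f" "k \<in> borel_measurable M" "\<And>z. \<bar>k z\<bar> \<le> C"
 shows "integrable M (\<lambda>z. k z * f z)"
proof (rule Bochner_Integration.integrable_bound)
 show "integrable M (\<lambda>z. C * f z)" using assms by simp
 have "\<bar>k z\<bar> * \<bar>f z\<bar> \<le> \<bar>C\<bar> * \<bar>f z\<bar>" for z
  using assms(3)[of z] by (intro mult_right_mono) auto
 then show "AE z in M. norm (k z * f z) \<le> norm (C * f z)" by (simp add: abs_mult)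
qed (use assms in measurable)

lemma conv_integrand_integrable:
 fixes k f :: "'a::euclidean_space => real"
 assumes "continuous_on UNIV k" "\<And>z. \<bar>k z\<bar> \<le> C" "integrable lborel f"
 shows "integrable lborel (\<lambda>y. k (z - y) * f y)"
proof (rule integrable_bounded_mult[OF assms(3)])
 have [measurable]: "k \<in> borel_measurable borel" using assms by (intro borel_measurable_continuous_onI)
 show "(\<lambda>y. k (z - y)) \<in> borel_measurable lborel" by measurable
qed (use assms in auto)

text \<open>The difference quotients of the kernel converge uniformly, so that the derivative may be taken under
 the integral without any regularity of the other factor.\<close>

lemma conv_has_derivative:
 fixes k f :: "'a::euclidean_space => real"
 assumes k: "C1_test U k" and f: "integrable lborel f"
 shows "(conv k f has_derivative
  (\<lambda>h. \<Sum>b\<in>Basis. (h \<bullet> b) * conv (pd k b) f z)) (at z)"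
proof -
 obtain C where C: "\<And>z. \<bar>k z\<bar> \<le> C" "\<And>z e. e \<in> Basis ==> \<bar>pd k e z\<bar> \<le> C"
  using C1_test_bounded[OF k] by metis
 have int0: "integrable lborel (\<lambda>\<zeta>. k (z - \<zeta>) * f \<zeta>)" for z
  by (rule conv_integrand_integrable[OF C1_test_continuous[OF k] C(1) f])
 have intb: "integrable lborel (\<lambda>\<zeta>. pd k b (z - \<zeta>) * f \<zeta>)" if "b \<in> Basis" for b z
  by (rule conv_integrand_integrable[OF _ C(2)[OF that] f]) (use k that in \<open>simp add: C1_test_def\<close>)
 let ?D = "\<lambda>h. \<Sum>b\<in>Basis. (h \<bullet> b) * conv (pd k b) f z"
 have diff: "k differentiable (at z)" for z using k by (simp add: C1_test_def)
 show ?thesis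
  unfolding has_derivative_at_alt
 proof (intro conjI allI impI)
  show "bounded_linear ?D"
   by (intro bounded_linear_sum bounded_linear_mult_const bounded_linear_inner_left)
 next
  fix \<epsilon> :: real assume \<epsilon>: "0 < \<epsilon>"
  define F where "F = (LINT \<zeta>|lborel. \<bar>f \<zeta>\<bar>)"
  have F: "0 \<le> F" by (simp add: F_def)
  have "0 < \<epsilon> / (F + 1)" using \<epsilon> F by simp
  from C1_test_uniformly_differentiable[OF k this]
  obtain \<delta> where \<delta>: "0 < \<delta>" "\<And>z h. norm h < \<delta> ==>
   \<bar>k (z + h) - k z - pd k h z\<bar> \<le> \<epsilon> / (F + 1) * norm h" by blast
  have "norm (conv k f y - conv k f z - ?D (y - z)) \<le> \<epsilon> * norm (y - z)" if y: "norm (y - z) < \<delta>" for y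
  proof -
   let ?g = "\<lambda>\<zeta>. (k (y - \<zeta>) - k (z - \<zeta>) - pd k (y - z) (z - \<zeta>)) * f \<zeta>"
   have g_eq: "?g = (\<lambda>\<zeta>. k (y - \<zeta>) * f \<zeta> - k (z - \<zeta>) * f \<zeta> -
     (\<Sum>b\<in>Basis. ((y - z) \<bullet> b) * (pd k b (z - \<zeta>) * f \<zeta>)))"
    by (simp add: fun_eq_iff frechet_derivative_sum_Basis[OF diff, of _ "y - z"]
     left_diff_distrib sum_distrib_right mult.assoc)
   have ints: "integrable lborel (\<lambda>\<zeta>. \<Sum>b\<in>Basis. ((y - z) \<bullet> b) * (pd k b (z - \<zeta>) * f \<zeta>))"
    using intb by (intro Bochner_Integration.integrable_sum integrable_mult_right) auto
   have intg: "integrable lborel ?g"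
    unfolding g_eq by (intro Bochner_Integration.integrable_diff int0 ints)
   have "conv k f y - conv k f z - ?D (y - z) = (LINT \<zeta>|lborel. ?g \<zeta>)"
    unfolding g_eq conv_def using int0 ints intb
    by (simp add: Bochner_Integration.integral_sum Bochner_Integration.integrable_diff)
   also have "norm \<dots> \<le> (LINT \<zeta>|lborel. \<epsilon> / (F + 1) * norm (y - z) * \<bar>f \<zeta>\<bar>)"
   proof (rule order_trans[OF integral_norm_bound], rule integral_mono)
    fix \<zeta>
    have "\<bar>k ((z - \<zeta>) + (y - z)) - k (z - \<zeta>) - pd k (y - z) (z - \<zeta>)\<bar>
      \<le> \<epsilon> / (F + 1) * norm (y - z)" using y by (rule \<delta>(2))
    then show "norm (?g \<zeta>) \<le> \<epsilon> / (F + 1) * norm (y - z) * \<bar>f \<zeta>\<bar>"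
     using mult_right_mono[of _ "\<epsilon> / (F + 1) * norm (y - z)" "\<bar>f \<zeta>\<bar>"] by (simp add: abs_mult)
   qed (use intg f in auto)
   also have "\<dots> = \<epsilon> * norm (y - z) * (F / (F + 1))" by (simp add: F_def)
   also have "\<dots> \<le> \<epsilon> * norm (y - z)"
    using F \<epsilon> by (intro mult_left_le) (auto simp: divide_le_eq)
   finally show ?thesis .
  qed
  then show "\<exists>d>0. \<forall>y. norm (y - z) < d \<longrightarrow>
    norm (conv k f y - conv k f z - ?D (y - z)) \<le> \<epsilon> * norm (y - z)"
   using \<delta>(1) by blast
 qed
qed

lemma conv_frechet:
 fixes k f :: "'a::euclidean_space => real"
 assumes k: "C1_test U k" and f: "integrable lborel f" and e: "e \<in> Basis"
 shows "pd (conv k f) e z = conv (pd k e) f z"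
proof -
 have "(\<Sum>b\<in>Basis. (e \<bullet> b) * conv (pd k b) f z) =
   (\<Sum>b\<in>{e}. (e \<bullet> b) * conv (pd k b) f z)"
  using e by (intro sum.mono_neutral_right) (auto simp: inner_not_same_Basis)
 then show ?thesis
  using frechet_derivative_at[OF conv_has_derivative[OF k f, of z], symmetric] e by simp
qed

lemma C0_infinity_UNIV_C1_test: "k \<in> C0_infinity UNIV UNIV ==> C1_test UNIV k"
 using C0_infinity_imp_C1_test(1)[of UNIV k] by simp

lemma Ck_upto_conv:
 fixes k f :: "'a::euclidean_space => real"
 assumes "k \<in> C0_infinity UNIV UNIV" "integrable lborel f"
 shows "Ck_upto n U S (conv k f)"
proof -
 have cont: "continuous_on UNIV (conv k f)" if "k \<in> C0_infinity UNIV UNIV" for k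
  using has_derivative_continuous[OF conv_has_derivative[OF C0_infinity_UNIV_C1_test[OF that] assms(2)]]
   continuous_at_imp_continuous_on by blast
 have "Ck_upto n UNIV UNIV (conv k f)"
  using assms(1)
 proof (induction n arbitrary: k)
  case 0
  then show ?case by (simp add: cont)
 next
  case (Suc n)
  note k = C0_infinity_UNIV_C1_test[OF Suc.prems]
  have "\<exists>g. (\<forall>z\<in>UNIV. g z = pd (conv k f) e z) \<and> Ck_upto n UNIV UNIV g"
   if "e \<in> Basis" for e
   using conv_frechet[OF k assms(2) that] Suc.IH[OF C0_infinity_frechet[OF open_UNIV Suc.prems that]]
   by (intro exI[of _ "conv (pd k e) f"]) auto
  moreover have "conv k f differentiable (at z)" for z
   using conv_has_derivative[OF k assms(2)] unfolding differentiable_def by blast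
  ultimately show ?case using cont[OF Suc.prems] by simp
 qed
 then show ?thesis by (rule Ck_upto_subset) auto
qed

lemma bump_C0_infinity:
 assumes "0 < r" shows "bump c r \<in> C0_infinity UNIV UNIV"
proof -
 have "{z. bump c r z \<noteq> 0} \<subseteq> ball c r" using bump_eq_0[OF assms] by blast
 then have "bounded {z. bump c r z \<noteq> 0}" using bounded_ball bounded_subset by blast
 then show ?thesis by (simp add: C0_infinity_def bump_smooth)
qed

subsection \<open>Approximate identities\<close>

lemma lborel_distr_reflect: "distr lborel borel (\<lambda>x. z - x) = (lborel :: 'a::euclidean_space measure)"
 by (subst lborel_affine[of "-1" z]) (auto simp: density_1 one_ennreal_def[symmetric])

lemma nn_integral_lborel_translate:
 assumes "g \<in> borel_measurable borel"
 shows "(\<integral>\<^sup>+ x. g (c + x) \<partial>lborel) = (\<integral>\<^sup>+ x. g (x::'a::euclidean_space) \<partial>lborel)"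
 by (subst (2) lborel_distr_plus[of c, symmetric]) (use assms in \<open>simp add: nn_integral_distr\<close>)

lemma integral_lborel_reflect:
 fixes g :: "'a::euclidean_space => real"
 assumes "g \<in> borel_measurable borel"
 shows "(LINT x|lborel. g (z - x)) = (LINT x|lborel. g x)"
 by (subst (2) lborel_distr_reflect[of z, symmetric]) (use assms in \<open>simp add: integral_distr\<close>)

lemma integrable_lborel_reflect:
 fixes g :: "'a::euclidean_space => real"
 assumes "integrable lborel g"
 shows "integrable lborel (\<lambda>x. g (z - x))"
proof -
 have "integrable (distr lborel borel (\<lambda>x. z - x)) g" using assms by (simp add: lborel_distr_reflect)
 then show ?thesis by (subst (asm) integrable_distr_eq) (use assms in auto)
qed

lemma integrable_lborel_translate:
 fixes g :: "'a::euclidean_space => real"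
 assumes "integrable lborel g"
 shows "integrable lborel (\<lambda>x. g (x - c))"
proof -
 have "integrable (distr lborel borel ((+) (- c))) g" using assms by (simp add: lborel_distr_plus)
 then show ?thesis by (subst (asm) integrable_distr_eq) (use assms in auto)
qed

lemma integral_lborel_translate:
 fixes g :: "'a::euclidean_space => real"
 assumes "g \<in> borel_measurable borel"
 shows "(LINT x|lborel. g (x - c)) = (LINT x|lborel. g x)"
 by (subst (2) lborel_distr_plus[of "-c", symmetric]) (use assms in \<open>simp add: integral_distr\<close>)

text \<open>Measurable functions are limits of continuous ones almost everywhere; truncation turns this into
 density in the mean.\<close>

lemma integrable_approx_continuous:
 fixes f :: "'a::euclidean_space => real"
 assumes f: "integrable lborel f" and e: "0 < e"
 obtains g K where "continuous_on UNIV g" "compact K" "\<And>z. z \<notin> K ==> g z = 0"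
  "(LINT z|lborel. \<bar>f z - g z\<bar>) < e"
proof -
 have [measurable]: "f \<in> borel_measurable borel" using f by auto
 define h where "h n z = (if norm z < real n then max (- real n) (min (real n) (f z)) else 0)" for n z
 have [measurable]: "h n \<in> borel_measurable borel" for n unfolding h_def[abs_def] by measurable
 have "(\<lambda>n. LINT z|lborel. \<bar>f z - h n z\<bar>) \<longlonglongrightarrow> (LINT z|(lborel :: 'a measure). (0::real))"
 proof (rule integral_dominated_convergence[where w="\<lambda>z. \<bar>f z\<bar>"])
  show "AE z in lborel. (\<lambda>n. \<bar>f z - h n z\<bar>) \<longlonglongrightarrow> 0"
  proof (rule AE_I2, rule tendsto_eventually)
   fix z
   obtain N where N: "norm z < real N" "\<bar>f z\<bar> < real N"
    using reals_Archimedean2[of "max (norm z) \<bar>f z\<bar>"] by auto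
   have "h n z = f z" if "n \<ge> N" for n
    using N that by (auto simp: h_def max_def min_def)
   then show "\<forall>\<^sub>F n in sequentially. \<bar>f z - h n z\<bar> = 0"
    unfolding eventually_sequentially by (intro exI[of _ N]) simp
  qed
  show "AE z in lborel. norm \<bar>f z - h n z\<bar> \<le> \<bar>f z\<bar>" for n
   by (rule AE_I2) (auto simp: h_def max_def min_def)
 qed (use f in auto)
 then have "\<forall>\<^sub>F n in sequentially. (LINT z|lborel. \<bar>f z - h n z\<bar>) < e / 2"
  using e by (intro order_tendstoD(2)) auto
 then obtain n where n: "(LINT z|lborel. \<bar>f z - h n z\<bar>) < e / 2"
  by (auto simp: eventually_sequentially)
 define R where "R = real n"
 have "h n \<in> borel_measurable lebesgue" by (simp add: borel_measurable_if_I measurable_completion)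
 then have "h n measurable_on UNIV" by (rule lebesgue_measurable_imp_measurable_on) auto
 then obtain N G where N: "negligible N" and G: "\<And>j. continuous_on UNIV (G j)"
  and lim: "\<And>x. x \<notin> N ==> (\<lambda>j. G j x) \<longlonglongrightarrow> h n x"
  unfolding measurable_on_def by auto
 define H where "H j z = max (- R) (min R (G j z)) * max 0 (min 1 (R + 1 - norm z))" for j z
 have Hc: "continuous_on UNIV (H j)" for j
  unfolding H_def by (intro continuous_intros G)
 have [measurable]: "H j \<in> borel_measurable borel" for j
  by (intro borel_measurable_continuous_onI Hc)
 have H0: "H j z = 0" if "z \<notin> cball 0 (R + 1)" for j z using that by (simp add: H_def)
 have Hint: "integrable lborel (H j)" for j
  by (rule integrable_continuous_compact_support[OF Hc compact_cball H0])
 have hb: "\<bar>h n z\<bar> \<le> R * indicator (cball 0 (R + 1)) z" for z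
  by (auto simp: h_def R_def indicator_def max_def min_def)
 have hint: "integrable lborel (h n)"
  by (rule Bochner_Integration.integrable_bound[OF f]) (auto simp: h_def max_def min_def)
 have "(\<lambda>j. LINT z|lborel. \<bar>h n z - H j z\<bar>) \<longlonglongrightarrow> (LINT z|(lborel :: 'a measure). (0::real))"
 proof (rule integral_dominated_convergence[where w="\<lambda>z. 2 * R * indicator (cball 0 (R + 1)) z"])
  show "integrable lborel (\<lambda>z::'a. 2 * R * indicator (cball 0 (R + 1)) z)"
   using emeasure_lborel_cball_finite by (intro integrable_mult_right integrable_real_indicator) auto
  have "N \<in> null_sets lebesgue" using N by (simp add: negligible_iff_null_sets)
  then have "AE z in lebesgue. z \<notin> N" by (rule AE_not_in)
  then have "AE z in lborel. z \<notin> N" by (rule AE_completion_iff[THEN iffD1])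
  then show "AE z in lborel. (\<lambda>j. \<bar>h n z - H j z\<bar>) \<longlonglongrightarrow> 0"
  proof (rule eventually_mono)
   fix z assume "z \<notin> N"
   then have "(\<lambda>j. \<bar>h n z - H j z\<bar>) \<longlonglongrightarrow>
     \<bar>h n z - max (- R) (min R (h n z)) * max 0 (min 1 (R + 1 - norm z))\<bar>"
    unfolding H_def by (intro tendsto_intros lim)
   moreover have "max (- R) (min R (h n z)) * max 0 (min 1 (R + 1 - norm z)) = h n z"
    by (auto simp: h_def R_def max_def min_def)
   ultimately show "(\<lambda>j. \<bar>h n z - H j z\<bar>) \<longlonglongrightarrow> 0" by simp
  qed
  show "AE z in lborel. norm \<bar>h n z - H j z\<bar> \<le> 2 * R * indicator (cball 0 (R + 1)) z" for j
  proof (rule AE_I2)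
   fix z
   have "\<bar>H j z\<bar> \<le> R * indicator (cball 0 (R + 1)) z"
   proof (cases "z \<in> cball 0 (R + 1)")
    case True
    have "\<bar>max (- R) (min R (G j z))\<bar> * \<bar>max 0 (min 1 (R + 1 - norm z))\<bar> \<le> R * 1"
     by (intro mult_mono) (auto simp: R_def)
    then show ?thesis using True by (simp add: H_def abs_mult)
   qed (simp add: H0)
   then show "norm \<bar>h n z - H j z\<bar> \<le> 2 * R * indicator (cball 0 (R + 1)) z"
    using hb[of z] abs_triangle_ineq4[of "h n z" "H j z"] by simp
  qed
 qed auto
 then have "\<forall>\<^sub>F j in sequentially. (LINT z|lborel. \<bar>h n z - H j z\<bar>) < e / 2"
  using e by (intro order_tendstoD(2)) auto
 then obtain j where j: "(LINT z|lborel. \<bar>h n z - H j z\<bar>) < e / 2"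
  by (auto simp: eventually_sequentially)
 have "(LINT z|lborel. \<bar>f z - H j z\<bar>) \<le> (LINT z|lborel. \<bar>f z - h n z\<bar> + \<bar>h n z - H j z\<bar>)"
  using f hint Hint by (intro integral_mono) auto
 also have "\<dots> = (LINT z|lborel. \<bar>f z - h n z\<bar>) + (LINT z|lborel. \<bar>h n z - H j z\<bar>)"
  using f hint Hint by simp
 also have "\<dots> < e" using n j by simp
 finally show thesis by (intro that[OF Hc compact_cball H0])
qed

text \<open>Continuous functions with compact support are moved uniformly little by small translations, and they are
 dense in the mean.\<close>

lemma translation_continuous_L1:
 fixes f :: "'a::euclidean_space => real"
 assumes f: "integrable lborel f" and e: "0 < e"
 obtains d where "0 < d" "\<And>s. norm s < d ==> (LINT z|lborel. \<bar>f (z - s) - f z\<bar>) < e"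
proof -
 obtain g K where g: "continuous_on UNIV g" "compact K" "\<And>z. z \<notin> K ==> g z = 0"
  and fg: "(LINT z|lborel. \<bar>f z - g z\<bar>) < e / 3"
  using integrable_approx_continuous[OF f, of "e / 3"] e by auto
 have gint: "integrable lborel g" by (rule integrable_continuous_compact_support[OF g])
 obtain R where R: "K \<subseteq> cball 0 R" using compact_imp_bounded[OF g(2)] by (auto simp: bounded_iff subset_eq)
 define V where "V = measure lborel (cball (0::'a) (R + 1))"
 have V: "0 \<le> V" by (simp add: V_def)
 have "uniformly_continuous_on UNIV g" by (rule uniformly_continuous_compact_support[OF g])
 moreover have "0 < e / (3 * (V + 1))" using e V by simp
 ultimately obtain d where d: "0 < d" "\<And>x y. dist x y < d ==> dist (g x) (g y) < e / (3 * (V + 1))"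
  unfolding uniformly_continuous_on_def by (metis UNIV_I)
 show thesis
 proof (rule that[of "min d 1"])
  fix s :: 'a assume s: "norm s < min d 1"
  have gs: "\<bar>g (z - s) - g z\<bar> \<le> e / (3 * (V + 1)) * indicator (cball 0 (R + 1)) z" for z
  proof (cases "z \<in> cball 0 (R + 1)")
   case True
   then show ?thesis using d(2)[of "z - s" z] s by (auto simp: dist_norm less_imp_le)
  next
   case False
   then have "z \<notin> K" "z - s \<notin> K"
    using R s norm_triangle_ineq[of "z - s" s] by (auto simp: subset_eq)
   then show ?thesis using g(3) e V by (simp add: indicator_def)
  qed
  have ints: "integrable lborel (\<lambda>z. f (z - s))" "integrable lborel (\<lambda>z. g (z - s))"
   using f gint by (auto intro: integrable_lborel_translate)
  have "(LINT z|lborel. \<bar>f (z - s) - f z\<bar>) \<le>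
    (LINT z|lborel. \<bar>f (z - s) - g (z - s)\<bar> + \<bar>g (z - s) - g z\<bar> + \<bar>f z - g z\<bar>)"
   using f gint ints by (intro integral_mono) auto
  also have "\<dots> = (LINT z|lborel. \<bar>f (z - s) - g (z - s)\<bar>) + (LINT z|lborel. \<bar>g (z - s) - g z\<bar>) +
    (LINT z|lborel. \<bar>f z - g z\<bar>)"
   using f gint ints by simp
  also have "(LINT z|lborel. \<bar>f (z - s) - g (z - s)\<bar>) = (LINT z|lborel. \<bar>f z - g z\<bar>)"
   using f gint by (intro integral_lborel_translate[of "\<lambda>z. \<bar>f z - g z\<bar>"]) auto
  also have "(LINT z|lborel. \<bar>g (z - s) - g z\<bar>) \<le>
    (LINT z|lborel. e / (3 * (V + 1)) * indicator (cball 0 (R + 1)) (z::'a))"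
   using gint ints gs emeasure_lborel_cball_finite
   by (intro integral_mono integrable_mult_right integrable_real_indicator) auto
  also have "\<dots> = e / 3 * (V / (V + 1))" by (simp add: V_def)
  also have "\<dots> \<le> e / 3" using V e by (intro mult_left_le) auto
  finally show "(LINT z|lborel. \<bar>f (z - s) - f z\<bar>) < e" using fg by simp
 qed (use d in auto)
qed

text \<open>By Fubini, the distance of the mollification from \<open>f\<close> in the mean is an average, over the ball of the
 kernel, of the distances of \<open>f\<close> from its translates. The centres may move; the balls only have to
 shrink to the origin.\<close>

lemma approximate_identity:
 fixes f :: "'a::euclidean_space => real"
 assumes f: "integrable lborel f" and r: "\<And>n. 0 < r n" and lim: "(\<lambda>n. norm (c n) + r n) \<longlonglongrightarrow> 0"
 shows "integrable lborel (conv (bump (c n) (r n)) f)"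
  and "(\<lambda>n. LINT z|lborel. \<bar>conv (bump (c n) (r n)) f z - f z\<bar>) \<longlonglongrightarrow> 0"
proof -
 have [measurable]: "f \<in> borel_measurable borel" using f by auto
 have conv_eq: "conv (bump (c n) (r n)) f z = (LINT s|lborel. bump (c n) (r n) s * f (z - s))" for n z
  unfolding conv_def
  using integral_lborel_reflect[of "\<lambda>y. bump (c n) (r n) (z - y) * f y" z] by simp
 have bint: "integrable lborel (\<lambda>s. bump (c n) (r n) s * f (z - s))" for n z
 proof -
  obtain C where "\<And>z. \<bar>bump (c n) (r n) z\<bar> \<le> C"
   using C1_test_bounded[OF C0_infinity_UNIV_C1_test[OF bump_C0_infinity[OF r]]] by metis
  from integrable_lborel_reflect[OF conv_integrand_integrable[OF bump_continuous this f, of z], of z]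
  show ?thesis by simp
 qed
 have [measurable]: "conv (bump (c n) (r n)) f \<in> borel_measurable borel" for n
  using Ck_upto_conv[OF bump_C0_infinity[OF r] f, of 0 UNIV UNIV]
  by (intro borel_measurable_continuous_onI) simp
 have le: "ennreal \<bar>conv (bump (c n) (r n)) f z - f z\<bar> \<le>
   (\<integral>\<^sup>+ s. ennreal (bump (c n) (r n) s) * ennreal \<bar>f (z - s) - f z\<bar> \<partial>lborel)" for n z
 proof -
  have "integrable lborel (\<lambda>s. bump (c n) (r n) s * (f (z - s) - f z))"
   using bint[of n z] bump_integrable[OF r, of "c n"] by (simp add: right_diff_distrib)
  from integral_norm_bound_ennreal[OF this]
  have "ennreal \<bar>LINT s|lborel. bump (c n) (r n) s * (f (z - s) - f z)\<bar> \<le>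
    (\<integral>\<^sup>+ s. ennreal (norm (bump (c n) (r n) s * (f (z - s) - f z))) \<partial>lborel)" by simp
  moreover have "(LINT s|lborel. bump (c n) (r n) s * (f (z - s) - f z)) = conv (bump (c n) (r n)) f z - f z"
   using bint[of n z] bump_integral[OF r, of "c n"] bump_integrable[OF r, of "c n"]
   by (simp add: conv_eq right_diff_distrib)
  ultimately show ?thesis by (simp add: abs_mult bump_nonneg ennreal_mult)
 qed
 have est: "(\<integral>\<^sup>+ z. ennreal \<bar>conv (bump (c n) (r n)) f z - f z\<bar> \<partial>lborel) \<le> ennreal e"
  if E: "\<And>s. s \<in> ball (c n) (r n) ==> (LINT z|lborel. \<bar>f (z - s) - f z\<bar>) \<le> e" for n e
 proof -
  have "(\<integral>\<^sup>+ z. ennreal \<bar>conv (bump (c n) (r n)) f z - f z\<bar> \<partial>lborel) \<le>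
    (\<integral>\<^sup>+ z. \<integral>\<^sup>+ s. ennreal (bump (c n) (r n) s) * ennreal \<bar>f (z - s) - f z\<bar> \<partial>lborel \<partial>lborel)"
   by (intro nn_integral_mono le)
  also have "\<dots> = (\<integral>\<^sup>+ s. \<integral>\<^sup>+ z. ennreal (bump (c n) (r n) s) * ennreal \<bar>f (z - s) - f z\<bar> \<partial>lborel \<partial>lborel)"
   by (intro lborel_pair.Fubini') measurable
  also have "\<dots> = (\<integral>\<^sup>+ s. ennreal (bump (c n) (r n) s) * (\<integral>\<^sup>+ z. ennreal \<bar>f (z - s) - f z\<bar> \<partial>lborel) \<partial>lborel)"
   by (intro nn_integral_cong nn_integral_cmult) measurable
  also have "\<dots> \<le> (\<integral>\<^sup>+ s. ennreal (bump (c n) (r n) s) * ennreal e \<partial>lborel)"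
  proof (rule nn_integral_mono)
   fix s :: 'a
   show "ennreal (bump (c n) (r n) s) * (\<integral>\<^sup>+ z. ennreal \<bar>f (z - s) - f z\<bar> \<partial>lborel) \<le>
     ennreal (bump (c n) (r n) s) * ennreal e"
   proof (cases "s \<in> ball (c n) (r n)")
    case True
    have "(\<integral>\<^sup>+ z. ennreal \<bar>f (z - s) - f z\<bar> \<partial>lborel) = ennreal (LINT z|lborel. \<bar>f (z - s) - f z\<bar>)"
     using f integrable_lborel_translate[OF f] by (intro nn_integral_eq_integral) auto
    then show ?thesis using E[OF True] by (intro mult_left_mono) (auto intro: ennreal_leI)
   next
    case False
    then show ?thesis by (simp add: bump_eq_0[OF r])
   qed
  qed
  also have "\<dots> = (\<integral>\<^sup>+ s. ennreal (bump (c n) (r n) s) \<partial>lborel) * ennreal e"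
   by (intro nn_integral_multc) measurable
  also have "(\<integral>\<^sup>+ s. ennreal (bump (c n) (r n) s) \<partial>lborel) = ennreal (LINT s|lborel. bump (c n) (r n) s)"
   by (intro nn_integral_eq_integral bump_integrable r AE_I2 bump_nonneg)
  finally show ?thesis using bump_integral[OF r, of "c n"] by simp
 qed
 have "integrable lborel (\<lambda>z. conv (bump (c n) (r n)) f z - f z)" for n
 proof (rule integrableI_bounded)
  have "(LINT z|lborel. \<bar>f (z - s) - f z\<bar>) \<le> 2 * (LINT z|lborel. \<bar>f z\<bar>)" for s
  proof -
   note i = integrable_lborel_translate[OF f, of s]
   have "(LINT z|lborel. \<bar>f (z - s) - f z\<bar>) \<le> (LINT z|lborel. \<bar>f (z - s)\<bar> + \<bar>f z\<bar>)"
    using f i by (intro integral_mono) auto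
   also have "\<dots> = (LINT z|lborel. \<bar>f (z - s)\<bar>) + (LINT z|lborel. \<bar>f z\<bar>)" using f i by simp
   also have "(LINT z|lborel. \<bar>f (z - s)\<bar>) = (LINT z|lborel. \<bar>f z\<bar>)"
    by (rule integral_lborel_translate[of "\<lambda>z. \<bar>f z\<bar>"]) measurable
   finally show ?thesis by simp
  qed
  then show "(\<integral>\<^sup>+ z. ennreal (norm (conv (bump (c n) (r n)) f z - f z)) \<partial>lborel) < \<infinity>"
   using est[of n "2 * (LINT z|lborel. \<bar>f z\<bar>)"] by (simp add: le_less_trans)
 qed measurable
 from Bochner_Integration.integrable_add[OF this f] show ci: "integrable lborel (conv (bump (c n) (r n)) f)" for n
  by simp
 have key: "\<exists>N. \<forall>n\<ge>N. (\<integral>\<^sup>+ z. ennreal \<bar>conv (bump (c n) (r n)) f z - f z\<bar> \<partial>lborel) \<le> ennreal e"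
  if e: "0 < e" for e
 proof -
  obtain d where d: "0 < d" "\<And>s. norm s < d ==> (LINT z|lborel. \<bar>f (z - s) - f z\<bar>) < e"
   using translation_continuous_L1[OF f e] by blast
  obtain N where N: "\<And>n. n \<ge> N ==> norm (c n) + r n < d"
   using order_tendstoD(2)[OF lim d(1)] by (auto simp: eventually_sequentially)
  have "(LINT z|lborel. \<bar>f (z - s) - f z\<bar>) \<le> e" if "n \<ge> N" "s \<in> ball (c n) (r n)" for n s
  proof (rule less_imp_le[OF d(2)])
   show "norm s < d"
    using N[OF that(1)] that(2) norm_triangle_ineq[of "c n" "s - c n"] by (simp add: dist_norm norm_minus_commute)
  qed
  then show ?thesis by (intro exI[of _ N] allI impI est)
 qed
 show "(\<lambda>n. LINT z|lborel. \<bar>conv (bump (c n) (r n)) f z - f z\<bar>) \<longlonglongrightarrow> 0"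
 proof (rule LIMSEQ_I)
  fix e :: real assume e: "0 < e"
  obtain N where N: "\<And>n. n \<ge> N ==>
    (\<integral>\<^sup>+ z. ennreal \<bar>conv (bump (c n) (r n)) f z - f z\<bar> \<partial>lborel) \<le> ennreal (e / 2)"
   using key[of "e / 2"] e by auto
  have "(LINT z|lborel. \<bar>conv (bump (c n) (r n)) f z - f z\<bar>) \<le> e / 2" if "n \<ge> N" for n
  proof -
   have "(\<integral>\<^sup>+ z. ennreal \<bar>conv (bump (c n) (r n)) f z - f z\<bar> \<partial>lborel) =
     ennreal (LINT z|lborel. \<bar>conv (bump (c n) (r n)) f z - f z\<bar>)"
    using ci f by (intro nn_integral_eq_integral) auto
   then show ?thesis using N[OF that] e by simp
  qed
  then show "\<exists>no. \<forall>n\<ge>no. norm ((LINT z|lborel. \<bar>conv (bump (c n) (r n)) f z - f z\<bar>) - 0) < e"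
   using e by (intro exI[of _ N]) (fastforce)
 qed
qed

section \<open>Weak derivatives\<close>

lemma integrable_lebesgue_borel_representative:
 fixes f :: "'a::euclidean_space => real"
 assumes "integrable lebesgue f"
 obtains f' where "integrable lborel f'" "AE z in lebesgue. f z = f' z"
proof -
 have "f \<in> borel_measurable (completion lborel)" using assms by (rule borel_measurable_integrable)
 then obtain f' where f': "f' \<in> borel_measurable lborel" "AE z in lborel. f z = f' z"
  using completion_ex_borel_measurable_real by blast
 have ae: "AE z in lebesgue. f z = f' z" using f'(2) by (rule AE_completion_iff[THEN iffD2])
 have "integrable lebesgue f'"
  using assms f'(1) ae by (subst integrable_cong_AE[of _ _ f]) (auto intro: measurable_completion)
 then have "integrable lborel f'" using integrable_completion[OF f'(1)] by simp
 then show thesis using ae by (rule that)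
qed

lemma loc_integrableD:
 "loc_integrable U u ==> compact K ==> K \<subseteq> U ==> integrable lebesgue (\<lambda>z. indicator K z * u z)"
 unfolding loc_integrable_def set_integrable_def by simp

lemma set_integral_eq_compact:
 fixes u h :: "'a::euclidean_space => real"
 assumes "K \<subseteq> U" "\<And>z. z \<in> U ==> z \<notin> K ==> h z = 0"
 shows "(LINT z:U|lebesgue. u z * h z) = (LINT z|lebesgue. (indicator K z * u z) * h z)"
 unfolding set_lebesgue_integral_def
 by (rule Bochner_Integration.integral_cong) (use assms in \<open>auto simp: indicator_def\<close>)

lemma loc_integrable_borel_measurable:
 fixes u :: "'a::euclidean_space => real"
 assumes U: "open U" and u: "loc_integrable U u"
 shows "u \<in> borel_measurable (lebesgue_on U)"
proof -
 obtain C where C: "\<And>n::nat. compact (C n)" "\<And>n. C n \<subseteq> U" "\<And>z. z \<in> U ==> \<exists>N. \<forall>n\<ge>N. z \<in> C n"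
 proof (rule open_Union_compact_subsets[OF U])
  fix C :: "nat => 'a set"
  assume C: "\<And>n. compact (C n)" "\<And>n. C n \<subseteq> U" "\<And>K. compact K ==> K \<subseteq> U ==> \<exists>N. \<forall>n\<ge>N. K \<subseteq> C n"
  show thesis
  proof (rule that[OF C(1,2)])
   fix z assume "z \<in> U"
   then show "\<exists>N. \<forall>n\<ge>N. z \<in> C n" using C(3)[of "{z}"] by auto
  qed
 qed
 have "(\<lambda>z. indicator U z * u z) \<in> borel_measurable lebesgue"
 proof (rule borel_measurable_LIMSEQ_real)
  fix n show "(\<lambda>z. indicator (C n) z * u z) \<in> borel_measurable lebesgue"
   using loc_integrableD[OF u C(1,2)] by (rule borel_measurable_integrable)
 next
  fix z
  show "(\<lambda>n. indicator (C n) z * u z) \<longlonglongrightarrow> indicator U z * u z"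
  proof (cases "z \<in> U")
   case True
   then obtain N where "\<And>n. n \<ge> N ==> z \<in> C n" using C(3)[of z] by auto
   then show ?thesis using True
    by (intro tendsto_eventually) (auto simp: eventually_sequentially intro!: exI[of _ N])
  next
   case False
   then have "z \<notin> C n" for n using C(2) by auto
   then show ?thesis using False by simp
  qed
 qed
 moreover have "U \<in> sets lebesgue" using U by auto
 ultimately show ?thesis
  by (subst borel_measurable_restrict_space_iff) auto
qed

lemma compact_neighbourhood_subset_open:
 fixes K :: "'a::euclidean_space set"
 assumes K: "compact K" and U: "open U" "K \<subseteq> U"
 obtains \<rho> K' where "0 < \<rho>" "compact K'" "K' \<subseteq> U" "\<And>z z'. z \<in> K ==> dist z z' \<le> \<rho> ==> z' \<in> K'"
proof -
 obtain \<rho> where \<rho>: "0 < \<rho>" "(\<Union>x\<in>K. cball x \<rho>) \<subseteq> U"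
  using compact_subset_open_imp_cball_epsilon_subset[OF K U] by blast
 have "compact (\<Union>x\<in>K. cball x \<rho>)"
 proof -
  have "(\<Union>x\<in>K. cball x \<rho>) = (\<lambda>p. fst p + snd p) ` (K \<times> cball 0 \<rho>)" (is "?L = ?R")
  proof
   show "?L \<subseteq> ?R"
   proof
    fix z assume "z \<in> ?L"
    then obtain x where "x \<in> K" "dist x z \<le> \<rho>" by auto
    then show "z \<in> ?R"
     by (intro image_eqI[of _ _ "(x, z - x)"]) (auto simp: dist_norm norm_minus_commute)
   qed
   show "?R \<subseteq> ?L" by (force simp: dist_norm)
  qed
  moreover have "compact \<dots>"
   by (intro compact_continuous_image continuous_intros compact_Times K compact_cball)
  ultimately show ?thesis by simp
 qed
 with \<rho> show thesis by (intro that[of \<rho> "\<Union>x\<in>K. cball x \<rho>"]) auto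
qed

subsection \<open>Integration by parts against continuously differentiable test functions\<close>

lemma integral_frechet_C1_test:
 fixes \<phi> :: "'a::euclidean_space => real"
 assumes \<phi>: "C1_test U \<phi>" and e: "e \<in> Basis"
 shows "integrable lborel (pd \<phi> e)"
  and "(LINT z|lborel. pd \<phi> e z) = 0"
proof -
 let ?d = "\<lambda>z. pd \<phi> e z"
 obtain K where K: "compact K" "\<And>z. z \<notin> K ==> \<phi> z = 0" "\<And>z. z \<notin> K ==> ?d z = 0"
  using C1_testE[OF \<phi>] by metis
 have dc: "continuous_on UNIV ?d" using \<phi> e by (simp add: C1_test_def)
 show dint: "integrable lborel ?d"
  by (rule integrable_continuous_compact_support[OF dc K(1) K(3)])
 have \<phi>int: "integrable lborel \<phi>"
  by (rule integrable_continuous_compact_support[OF C1_test_continuous[OF \<phi>] K(1) K(2)])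
 have [measurable]: "\<phi> \<in> borel_measurable borel" using \<phi>int by auto
 obtain R where R: "K \<subseteq> cball 0 R" using compact_imp_bounded[OF K(1)] by (auto simp: bounded_iff subset_eq)
 define V where "V = measure lborel (cball (0::'a) (R + 1))"
 have V: "0 \<le> V" by (simp add: V_def)
 have diff: "\<phi> differentiable (at z)" for z using \<phi> by (simp add: C1_test_def)
 have lin: "pd \<phi> (t *\<^sub>R e) z = t * ?d z" for z t
  using linear_cmul[OF linear_frechet_derivative[OF diff, of z], of t e] by simp
 have "\<bar>LINT z|lborel. ?d z\<bar> \<le> 0 + \<epsilon>" if \<epsilon>: "0 < \<epsilon>" for \<epsilon>
 proof -
  have "0 < \<epsilon> / (V + 1)" using \<epsilon> V by simp
  from C1_test_uniformly_differentiable[OF \<phi> this] obtain \<delta> where \<delta>: "0 < \<delta>" "\<And>z h. norm h < \<delta> ==>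
   \<bar>\<phi> (z + h) - \<phi> z - pd \<phi> h z\<bar> \<le> \<epsilon> / (V + 1) * norm h" by blast
  define t where "t = min \<delta> 1 / 2"
  have t: "0 < t" "t < \<delta>" "t \<le> 1" using \<delta>(1) by (auto simp: t_def)
  have le: "\<bar>\<phi> (z + t *\<^sub>R e) - \<phi> z - t * ?d z\<bar> \<le> \<epsilon> / (V + 1) * t * indicator (cball 0 (R + 1)) z" for z
  proof (cases "z \<in> cball 0 (R + 1)")
   case True
   then show ?thesis using \<delta>(2)[of "t *\<^sub>R e" z] t e by (simp add: lin)
  next
   case False
   then have "z \<notin> K" "z + t *\<^sub>R e \<notin> K"
    using R t(1,3) e norm_triangle_ineq4[of "z + t *\<^sub>R e" "t *\<^sub>R e"] by force+
   then show ?thesis using K False by simp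
  qed
  have tr: "integrable lborel (\<lambda>z. \<phi> (z + t *\<^sub>R e))" "(LINT z|lborel. \<phi> (z + t *\<^sub>R e)) = (LINT z|lborel. \<phi> z)"
   using integrable_lborel_translate[OF \<phi>int, of "- (t *\<^sub>R e)"]
    integral_lborel_translate[of \<phi> "- (t *\<^sub>R e)"] by simp_all
  have "t * \<bar>LINT z|lborel. ?d z\<bar> = \<bar>LINT z|lborel. \<phi> (z + t *\<^sub>R e) - \<phi> z - t * ?d z\<bar>"
   using tr \<phi>int dint t by (simp add: abs_mult)
  also have "\<dots> \<le> (LINT z|lborel. \<bar>\<phi> (z + t *\<^sub>R e) - \<phi> z - t * ?d z\<bar>)"
   by (rule integral_abs_bound)
  also have "\<dots> \<le> (LINT z|lborel. \<epsilon> / (V + 1) * t * indicator (cball 0 (R + 1)) (z::'a))"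
   using tr(1) \<phi>int dint le emeasure_lborel_cball_finite
   by (intro integral_mono integrable_mult_right integrable_real_indicator) auto
  also have "\<dots> = t * (\<epsilon> * (V / (V + 1)))" by (simp add: V_def)
  finally have "\<bar>LINT z|lborel. ?d z\<bar> \<le> \<epsilon> * (V / (V + 1))" using t(1) by (rule mult_left_le_imp_le)
  also have "\<dots> \<le> \<epsilon>" using V \<epsilon> by (intro mult_left_le) auto
  finally show ?thesis by simp
 qed
 then have "\<bar>LINT z|lborel. ?d z\<bar> \<le> 0" by (rule field_le_epsilon)
 then show "(LINT z|lborel. ?d z) = 0" by simp
qed

lemma conv_commute:
 fixes k f :: "'a::euclidean_space => real"
 assumes [measurable]: "k \<in> borel_measurable borel" "f \<in> borel_measurable borel"
 shows "conv k f = conv f k"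
proof
 fix z show "conv k f z = conv f k z"
  unfolding conv_def
  using integral_lborel_reflect[of "\<lambda>y. k (z - y) * f y" z] by (simp add: mult.commute)
qed

lemma conv_bump_uniform:
 fixes h :: "'a::euclidean_space => real"
 assumes h: "continuous_on UNIV h" "\<And>z. \<bar>h z\<bar> \<le> C" and r: "0 < r"
  and osc: "\<And>s. norm s < r ==> \<bar>h (z - s) - h z\<bar> \<le> e"
 shows "\<bar>conv h (bump 0 r) z - h z\<bar> \<le> e"
proof -
 have i: "integrable lborel (\<lambda>s. h (z - s) * bump 0 r s)"
  by (rule conv_integrand_integrable[OF h bump_integrable[OF r]])
 have bi: "integrable lborel (bump (0::'a) r)" by (rule bump_integrable[OF r])
 have "conv h (bump 0 r) z - h z = (LINT s|lborel. (h (z - s) - h z) * bump 0 r s)"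
  using i bi bump_integral[OF r, of "0::'a"] by (simp add: conv_def left_diff_distrib)
 also have "\<bar>\<dots>\<bar> \<le> (LINT s|lborel. \<bar>(h (z - s) - h z) * bump 0 r s\<bar>)"
  by (rule integral_abs_bound)
 also have "\<dots> \<le> (LINT s|lborel. e * bump (0::'a) r s)"
 proof (rule integral_mono)
  fix s :: 'a
  show "\<bar>(h (z - s) - h z) * bump 0 r s\<bar> \<le> e * bump 0 r s"
  proof (cases "s \<in> ball 0 r")
   case True
   then show ?thesis using osc[of s] by (simp add: abs_mult bump_nonneg mult_right_mono)
  qed (simp add: bump_eq_0[OF r])
 qed (use i bi in \<open>auto simp: left_diff_distrib\<close>)
 also have "\<dots> = e" using bump_integral[OF r, of "0::'a"] by simp
 finally show ?thesis .
qed

text \<open>Mollification of the test function yields smooth test functions whose values and derivatives converge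
 boundedly on a fixed compact subset of \<open>U\<close>; dominated convergence transfers the identity.\<close>

lemma has_weak_deriv_C1_test:
 fixes u :: "'a::euclidean_space => real"
 assumes U: "open U" and e: "e \<in> Basis" and ug: "has_weak_deriv e U u g" and \<phi>: "C1_test U \<phi>"
 shows "(LINT z:U|lebesgue. u z * pd \<phi> e z) = - (LINT z:U|lebesgue. g z * \<phi> z)"
proof -
 let ?d = "\<lambda>z. pd \<phi> e z"
 obtain K where K: "compact K" "K \<subseteq> U" "\<And>z. z \<notin> K ==> \<phi> z = 0" "\<And>z. z \<notin> K ==> ?d z = 0"
  using C1_testE[OF \<phi>] by metis
 obtain \<rho> K' where K': "0 < \<rho>" "compact K'" "K' \<subseteq> U" "\<And>z z'. z \<in> K ==> dist z z' \<le> \<rho> ==> z' \<in> K'"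
  using compact_neighbourhood_subset_open[OF K(1) U K(2)] by metis
 obtain C where C: "\<And>z. \<bar>\<phi> z\<bar> \<le> C" "\<And>z. \<bar>?d z\<bar> \<le> C" using C1_test_bounded[OF \<phi>] e by metis
 define r where "r n = \<rho> / real (Suc n)" for n
 have r: "0 < r n" "r n \<le> \<rho>" for n using K'(1) by (auto simp: r_def field_simps)
 have r0: "r \<longlonglongrightarrow> 0" unfolding r_def by real_asymp
 have dc: "continuous_on UNIV ?d" using \<phi> e by (simp add: C1_test_def)
 note \<phi>c = C1_test_continuous[OF \<phi>, of UNIV]
 have [measurable]: "\<phi> \<in> borel_measurable borel" by (intro borel_measurable_continuous_onI \<phi>c)
 have \<phi>int: "integrable lborel \<phi>" by (rule integrable_continuous_compact_support[OF \<phi>c K(1) K(3)])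
 have conv0: "conv h (bump 0 (r n)) z = 0" if "z \<notin> K'" and "\<And>z. z \<notin> K ==> h z = 0" for h n z
 proof -
  have "h (z - \<zeta>) * bump 0 (r n) \<zeta> = 0" for \<zeta>
  proof (cases "\<zeta> \<in> ball 0 (r n)")
   case True
   then have "z - \<zeta> \<notin> K" using that(1) K'(4)[of "z - \<zeta>" z] r(2)[of n] by (auto simp: dist_norm)
   then show ?thesis using that(2) by simp
  qed (simp add: bump_eq_0[OF r(1)])
  then show ?thesis unfolding conv_def by (simp only: integral_zero)
 qed
 have lim: "(\<lambda>n. conv h (bump 0 (r n)) z) \<longlonglongrightarrow> h z"
  and bnd: "\<bar>conv h (bump 0 (r n)) z\<bar> \<le> 3 * C"
  if h: "continuous_on UNIV h" "\<And>z. \<bar>h z\<bar> \<le> C" "\<And>z. z \<notin> K ==> h z = 0" for h z n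
 proof -
  have uc: "uniformly_continuous_on UNIV h" by (rule uniformly_continuous_compact_support[OF h(1) K(1) h(3)])
  show "(\<lambda>n. conv h (bump 0 (r n)) z) \<longlonglongrightarrow> h z"
  proof (rule LIMSEQ_I)
   fix \<epsilon> :: real assume "0 < \<epsilon>"
   then obtain d where d: "0 < d" "\<And>x y. dist x y < d ==> dist (h x) (h y) < \<epsilon> / 2"
    using uc unfolding uniformly_continuous_on_def by (metis UNIV_I half_gt_zero)
   obtain N where N: "\<And>n. n \<ge> N ==> r n < d"
    using order_tendstoD(2)[OF r0 d(1)] by (auto simp: eventually_sequentially)
   have "\<bar>conv h (bump 0 (r n)) z - h z\<bar> \<le> \<epsilon> / 2" if "n \<ge> N" for n
   proof (rule conv_bump_uniform[OF h(1,2) r(1)])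
    fix s :: 'a assume "norm s < r n"
    then show "\<bar>h (z - s) - h z\<bar> \<le> \<epsilon> / 2"
     using d(2)[of "z - s" z] N[OF that] by (simp add: dist_norm)
   qed
   then show "\<exists>no. \<forall>n\<ge>no. norm (conv h (bump 0 (r n)) z - h z) < \<epsilon>"
    using \<open>0 < \<epsilon>\<close> by (intro exI[of _ N]) fastforce
  qed
  have "\<bar>conv h (bump 0 (r n)) z - h z\<bar> \<le> 2 * C"
  proof (rule conv_bump_uniform[OF h(1,2) r(1)])
   show "\<bar>h (z - s) - h z\<bar> \<le> 2 * C" for s using h(2)[of "z - s"] h(2)[of z] by linarith
  qed
  then show "\<bar>conv h (bump 0 (r n)) z\<bar> \<le> 3 * C" using h(2)[of z] by linarith
 qed
 define \<phi>' where "\<phi>' n = conv \<phi> (bump 0 (r n))" for n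
 have \<phi>'_eq: "\<phi>' n = conv (bump 0 (r n)) \<phi>" for n unfolding \<phi>'_def by (intro conv_commute) measurable
 have fr: "pd (\<phi>' n) e z = conv ?d (bump 0 (r n)) z" for n z
  unfolding \<phi>'_def by (rule conv_frechet[OF \<phi> bump_integrable[OF r(1)] e])
 have "\<phi>' n \<in> C0_infinity U U" for n
 proof -
  have sub: "closure {z\<in>U. \<phi>' n z \<noteq> 0} \<subseteq> K'"
  proof (rule closure_minimal)
   show "{z\<in>U. \<phi>' n z \<noteq> 0} \<subseteq> K'" using conv0[of _ \<phi>] K(3) unfolding \<phi>'_def by blast
  qed (use K' in \<open>simp add: compact_imp_closed\<close>)
  moreover have "compact (closure {z\<in>U. \<phi>' n z \<noteq> 0})"
   using sub compact_Int_closed[OF K'(2), of "closure {z\<in>U. \<phi>' n z \<noteq> 0}"] by (simp add: Int_absorb1)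
  moreover have "Ck_upto k U U (\<phi>' n)" for k
   unfolding \<phi>'_eq by (rule Ck_upto_conv[OF bump_C0_infinity[OF r(1)] \<phi>int])
  ultimately show ?thesis using K'(3) by (auto simp: C0_infinity_def)
 qed
 then have eq: "(LINT z:U|lebesgue. u z * pd (\<phi>' n) e z) =
   - (LINT z:U|lebesgue. g z * \<phi>' n z)" for n
  using ug by (auto simp: has_weak_deriv_def)
 have limI: "(\<lambda>n. LINT z:U|lebesgue. w z * conv h (bump 0 (r n)) z) \<longlonglongrightarrow> (LINT z:U|lebesgue. w z * h z)"
  if w: "loc_integrable U w" and h: "continuous_on UNIV h" "\<And>z. \<bar>h z\<bar> \<le> C" "\<And>z. z \<notin> K ==> h z = 0" for w h
 proof -
  have wi: "integrable lebesgue (\<lambda>z. indicator K' z * w z)" by (rule loc_integrableD[OF w K'(2,3)])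
  have KK': "z \<in> K'" if "z \<in> K" for z using K'(1) K'(4)[OF that, of z] by simp
  have 1: "(LINT z:U|lebesgue. w z * conv h (bump 0 (r n)) z) =
    (LINT z|lebesgue. (indicator K' z * w z) * conv h (bump 0 (r n)) z)" for n
   by (rule set_integral_eq_compact[OF K'(3)]) (use conv0[of _ h] h(3) in blast)
  have 2: "(LINT z:U|lebesgue. w z * h z) = (LINT z|lebesgue. (indicator K' z * w z) * h z)"
   by (rule set_integral_eq_compact[OF K'(3)]) (use KK' h(3) in blast)
  have [measurable]: "h \<in> borel_measurable borel" by (intro borel_measurable_continuous_onI h)
  have hint: "integrable lborel h" by (rule integrable_continuous_compact_support[OF h(1) K(1) h(3)])
  have cm: "conv h (bump 0 (r n)) \<in> borel_measurable lebesgue" for n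
  proof -
   have "continuous_on UNIV (conv (bump 0 (r n)) h)"
    using Ck_upto_conv[OF bump_C0_infinity[OF r(1)] hint, of 0 UNIV UNIV] by simp
   moreover have "conv h (bump 0 (r n)) = conv (bump 0 (r n)) h" by (intro conv_commute) measurable
   ultimately show ?thesis by (simp add: borel_measurable_continuous_onI measurable_completion)
  qed
  show ?thesis
   unfolding 1 2
  proof (rule integral_dominated_convergence[where w="\<lambda>z. 3 * C * \<bar>indicator K' z * w z\<bar>"])
   show "(\<lambda>z. indicator K' z * w z * h z) \<in> borel_measurable lebesgue"
    by (rule borel_measurable_times[OF borel_measurable_integrable[OF wi]]) (simp add: measurable_completion)
   show "(\<lambda>z. indicator K' z * w z * conv h (bump 0 (r n)) z) \<in> borel_measurable lebesgue" for n
    by (rule borel_measurable_times[OF borel_measurable_integrable[OF wi] cm])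
   show "integrable lebesgue (\<lambda>z. 3 * C * \<bar>indicator K' z * w z\<bar>)" using wi by simp
   show "AE z in lebesgue. (\<lambda>n. indicator K' z * w z * conv h (bump 0 (r n)) z) \<longlonglongrightarrow> indicator K' z * w z * h z"
    by (intro AE_I2 tendsto_intros lim[OF h])
   show "AE z in lebesgue. norm (indicator K' z * w z * conv h (bump 0 (r n)) z) \<le> 3 * C * \<bar>indicator K' z * w z\<bar>" for n
   proof (rule AE_I2)
    fix z
    show "norm (indicator K' z * w z * conv h (bump 0 (r n)) z) \<le> 3 * C * \<bar>indicator K' z * w z\<bar>"
     using mult_right_mono[OF bnd[OF h, of n z] abs_ge_zero[of "indicator K' z * w z"]]
     by (simp add: abs_mult mult.commute mult.left_commute)
   qed
  qed
 qed
 have "(\<lambda>n. LINT z:U|lebesgue. u z * pd (\<phi>' n) e z) \<longlonglongrightarrow> (LINT z:U|lebesgue. u z * ?d z)"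
  unfolding fr using ug by (intro limI dc C K(4)) (auto simp: has_weak_deriv_def)
 moreover have "(\<lambda>n. - (LINT z:U|lebesgue. g z * \<phi>' n z)) \<longlonglongrightarrow> - (LINT z:U|lebesgue. g z * \<phi> z)"
  unfolding \<phi>'_def using ug by (intro tendsto_minus limI \<phi>c C K(3)) (auto simp: has_weak_deriv_def)
 ultimately show ?thesis unfolding eq by (rule LIMSEQ_unique)
qed

subsection \<open>Uniqueness\<close>

lemma integral_radial_translate:
 fixes c :: "'a::euclidean_space"
 shows "(LINT z|lborel. exp_inverse 1 (r\<^sup>2 - (norm (z - c))\<^sup>2)) =
  (LINT z|(lborel :: 'a measure). exp_inverse 1 (r\<^sup>2 - (norm z)\<^sup>2))"
proof -
 have "continuous_on UNIV (\<lambda>z::'a. exp_inverse 1 (r\<^sup>2 - (norm (z - 0))\<^sup>2))"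
  using Ck_upto_radial Ck_upto_continuous by blast
 then show ?thesis
  by (intro integral_lborel_translate borel_measurable_continuous_onI) simp
qed

lemma bump_reflect: "bump c r (z - y) = bump (z - c) r y"
proof -
 have "norm (z - y - c) = norm (y - (z - c))"
  by (subst norm_minus_commute) (simp add: algebra_simps)
 then show ?thesis unfolding bump_def integral_radial_translate by simp
qed

text \<open>The values of a mollification are tests against bumps, and mollifications converge almost everywhere
 along a subsequence.\<close>

lemma loc_integrable_eq_0_AE:
 fixes g :: "'a::euclidean_space => real"
 assumes U: "open U" and g: "loc_integrable U g"
  and 0: "\<And>c r. 0 < r ==> cball c r \<subseteq> U ==> (LINT z:U|lebesgue. g z * bump c r z) = 0"
 shows "AE z in lebesgue_on U. g z = 0"
proof -
 have loc: "AE z in lebesgue. z \<in> ball a \<rho> \<longrightarrow> g z = 0" if \<rho>: "0 < \<rho>" "cball a (2 * \<rho>) \<subseteq> U" for a \<rho>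
 proof -
  let ?K = "cball a (2 * \<rho>)"
  obtain f where f: "integrable lborel f" "AE z in lebesgue. indicator ?K z * g z = f z"
   using integrable_lebesgue_borel_representative[OF loc_integrableD[OF g compact_cball \<rho>(2)]] by metis
  define r where "r n = \<rho> / real (Suc n)" for n
  have r: "0 < r n" "r n \<le> \<rho>" for n using \<rho>(1) by (auto simp: r_def field_simps)
  have r0: "(\<lambda>n. norm (0::'a) + r n) \<longlonglongrightarrow> 0" unfolding r_def by simp real_asymp
  have conv0: "conv (bump 0 (r n)) f z = 0" if z: "z \<in> ball a \<rho>" for z n
  proof -
   have sub: "cball z (r n) \<subseteq> ?K"
   proof
    fix w assume "w \<in> cball z (r n)"
    then show "w \<in> ?K" using z r(2)[of n] dist_triangle[of a w z] by simp
   qed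
   have "conv (bump 0 (r n)) f z = (LINT y|lborel. bump z (r n) y * f y)"
    by (simp add: conv_def bump_reflect)
   also have "\<dots> = (LINT y|lebesgue. bump z (r n) y * f y)"
    using f(1) by (intro integral_completion[symmetric]) auto
   also have "\<dots> = (LINT y|lebesgue. (indicator ?K y * g y) * bump z (r n) y)"
   proof (rule integral_cong_AE)
    show "AE y in lebesgue. bump z (r n) y * f y = (indicator ?K y * g y) * bump z (r n) y"
     using f(2) by eventually_elim simp
    show "(\<lambda>y. bump z (r n) y * f y) \<in> borel_measurable lebesgue"
     using f(1) by (intro measurable_completion) auto
    show "(\<lambda>y. (indicator ?K y * g y) * bump z (r n) y) \<in> borel_measurable lebesgue"
     by (rule borel_measurable_times[OF borel_measurable_integrable[OF loc_integrableD[OF g compact_cball \<rho>(2)]]])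
      (simp add: measurable_completion)
   qed
   also have "\<dots> = (LINT z':U|lebesgue. g z' * bump z (r n) z')"
   proof (rule set_integral_eq_compact[OF \<rho>(2), symmetric])
    fix z' assume "z' \<notin> ?K"
    then have "z' \<notin> ball z (r n)" using sub ball_subset_cball by blast
    then show "bump z (r n) z' = 0" by (rule bump_eq_0[OF r(1)])
   qed
   also have "\<dots> = 0" using sub \<rho>(2) by (intro 0 r) auto
   finally show ?thesis .
  qed
  note ai = approximate_identity[where c="\<lambda>n. 0", OF f(1) r(1) r0]
  have "\<exists>s. strict_mono s \<and> (AE z in lborel. (\<lambda>n. conv (bump 0 (r (s n))) f z - f z) \<longlonglongrightarrow> 0)"
   by (rule tendsto_L1_AE_subseq[of lborel "\<lambda>n z. conv (bump 0 (r n)) f z - f z"]) (use ai f(1) in simp_all)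
  then obtain s where s: "AE z in lborel. (\<lambda>n. conv (bump 0 (r (s n))) f z - f z) \<longlonglongrightarrow> 0" by blast
  have "AE z in lborel. z \<in> ball a \<rho> \<longrightarrow> f z = 0"
   using s
  proof (rule eventually_mono, intro impI)
   fix z assume "(\<lambda>n. conv (bump 0 (r (s n))) f z - f z) \<longlonglongrightarrow> 0" "z \<in> ball a \<rho>"
   then have "(\<lambda>n::nat. - f z) \<longlonglongrightarrow> 0" by (simp add: conv0)
   then show "f z = 0" by (simp add: LIMSEQ_const_iff)
  qed
  then have "AE z in lebesgue. z \<in> ball a \<rho> \<longrightarrow> f z = 0" by (rule AE_completion_iff[THEN iffD2])
  with f(2) show ?thesis
   by eventually_elim (use \<rho>(1) in \<open>auto simp: indicator_def\<close>)
 qed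
 define F where "F = {ball a \<rho> | a \<rho>. 0 < \<rho> \<and> cball a (2 * \<rho>) \<subseteq> U}"
 have FU: "\<Union>F = U"
 proof
  show "\<Union>F \<subseteq> U"
  proof
   fix z assume "z \<in> \<Union>F"
   then obtain a \<rho> where "z \<in> ball a \<rho>" "0 < \<rho>" "cball a (2 * \<rho>) \<subseteq> U" by (auto simp: F_def)
   then show "z \<in> U" by (auto simp: subset_eq)
  qed
  show "U \<subseteq> \<Union>F"
  proof
   fix z assume "z \<in> U"
   then obtain e where "0 < e" "cball z e \<subseteq> U" using U open_contains_cball by blast
   then have "ball z (e / 2) \<in> F" unfolding F_def
    by (intro CollectI exI[of _ z] exI[of _ "e / 2"]) simp
   moreover have "z \<in> ball z (e / 2)" using \<open>0 < e\<close> by simp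
   ultimately show "z \<in> \<Union>F" by blast
  qed
 qed
 obtain F' where F': "F' \<subseteq> F" "countable F'" "\<Union>F' = \<Union>F"
 proof (rule Lindelof[of F])
  show "open S" if "S \<in> F" for S using that by (auto simp: F_def)
 qed (rule that)
 have "AE z in lebesgue. \<forall>B\<in>F'. z \<in> B \<longrightarrow> g z = 0"
  using F'(1,2) loc by (subst AE_ball_countable) (auto simp: F_def)
 then have "AE z in lebesgue. z \<in> U \<longrightarrow> g z = 0"
  using F'(3) FU by (elim eventually_mono) blast
 then show ?thesis using U by (subst AE_restrict_space_iff) auto
qed

lemma bump_C0_infinity_subset:
 assumes "0 < r" "cball c r \<subseteq> U"
 shows "bump c r \<in> C0_infinity U U"
proof -
 have sub: "closure {z\<in>U. bump c r z \<noteq> 0} \<subseteq> cball c r"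
 proof (rule closure_minimal)
  show "{z\<in>U. bump c r z \<noteq> 0} \<subseteq> cball c r" using bump_eq_0[OF assms(1)] ball_subset_cball by blast
 qed simp
 moreover have "compact (closure {z\<in>U. bump c r z \<noteq> 0})"
  using sub compact_Int_closed[OF compact_cball[of c r], of "closure {z\<in>U. bump c r z \<noteq> 0}"]
  by (simp only: Int_absorb1 closed_closure)
 ultimately show ?thesis using assms by (auto simp: C0_infinity_def bump_smooth simp del: Ck_upto.simps)
qed

lemma loc_integrable_add:
 "loc_integrable U u ==> loc_integrable U v ==> loc_integrable U (\<lambda>z. u z + v z)"
 by (simp add: loc_integrable_def set_integral_add)

lemma loc_integrable_cmult: "loc_integrable U u ==> loc_integrable U (\<lambda>z. c * u z)"
 by (simp add: loc_integrable_def)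

lemma loc_integrable_test_integrable:
 fixes u :: "'a::euclidean_space => real"
 assumes u: "loc_integrable U u" and h: "continuous_on UNIV h" "compact K" "K \<subseteq> U" "\<And>z. z \<notin> K ==> h z = 0"
 shows "set_integrable lebesgue U (\<lambda>z. u z * h z)"
proof -
 have "bounded (h ` K)"
  using h(1,2) by (meson compact_continuous_image compact_imp_bounded continuous_on_subset subset_UNIV)
 then obtain C where C: "\<And>z. z \<in> K ==> \<bar>h z\<bar> \<le> C" by (auto simp: bounded_iff)
 have "integrable lebesgue (\<lambda>z. h z * (indicator K z * u z))"
 proof (rule integrable_bounded_mult[OF loc_integrableD[OF u h(2,3)]])
  show "h \<in> borel_measurable lebesgue" using h(1) by (simp add: borel_measurable_continuous_onI measurable_completion)
  show "\<bar>h z\<bar> \<le> max C 0" for z using C[of z] h(4)[of z] by (cases "z \<in> K") (auto simp: le_max_iff_disj)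
 qed
 moreover have "h z * (indicator K z * u z) = indicator U z * (u z * h z)" for z
  using h(3,4) by (cases "z \<in> K") (auto simp: indicator_def)
 ultimately show ?thesis by (simp add: set_integrable_def)
qed

lemma weak_deriv_unique:
 fixes u :: "'a::euclidean_space => real"
 assumes U: "open U" and g: "has_weak_deriv e U u g" and h: "has_weak_deriv e U u h"
 shows "AE z in lebesgue_on U. g z = h z"
proof -
 have loc: "loc_integrable U (\<lambda>z. g z + (-1) * h z)"
  using g h by (intro loc_integrable_add loc_integrable_cmult) (auto simp: has_weak_deriv_def)
 have "AE z in lebesgue_on U. g z + (-1) * h z = 0"
 proof (rule loc_integrable_eq_0_AE[OF U loc])
  fix c :: 'a and r :: real assume r: "0 < r" "cball c r \<subseteq> U"
  have *: "set_integrable lebesgue U (\<lambda>z. w z * bump c r z)" if "loc_integrable U w" for w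
   by (rule loc_integrable_test_integrable[OF that bump_continuous compact_cball r(2)])
    (use r bump_eq_0[of r _ c] in auto)
  have "(LINT z:U|lebesgue. (g z + (-1) * h z) * bump c r z) =
    (LINT z:U|lebesgue. g z * bump c r z - h z * bump c r z)"
   by (simp add: left_diff_distrib)
  also have "\<dots> = (LINT z:U|lebesgue. g z * bump c r z) - (LINT z:U|lebesgue. h z * bump c r z)"
   using * g h by (intro set_integral_diff) (auto simp: has_weak_deriv_def)
  also have "\<dots> = 0" using g h bump_C0_infinity_subset[OF r] by (auto simp: has_weak_deriv_def)
  finally show "(LINT z:U|lebesgue. (g z + (-1) * h z) * bump c r z) = 0" .
 qed
 then show ?thesis by simp
qed

subsection \<open>Mollification and the chain rule\<close>

text \<open>Mollification commutes with weak differentiation at points whose mollification ball lies inside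
 the domain. The kernel need not be centred at the origin; a kernel that only looks in one direction
 is needed near the boundary.\<close>

lemma mollify_weak_deriv:
 fixes u :: "'a::euclidean_space => real"
 assumes U: "open U" and e: "e \<in> Basis" and ug: "has_weak_deriv e U u g"
  and r: "0 < r" and f: "integrable lborel f" and h: "integrable lborel h"
  and sub: "cball (z - c) r \<subseteq> U"
  and eqf: "AE y in lebesgue. y \<in> cball (z - c) r \<longrightarrow> f y = u y"
  and eqh: "AE y in lebesgue. y \<in> cball (z - c) r \<longrightarrow> h y = g y"
 shows "pd (conv (bump c r) f) e z = conv (bump c r) h z"
proof -
 let ?K = "cball (z - c) r"
 let ?b = "bump (z - c) r"
 have bC: "?b \<in> C0_infinity U U" by (rule bump_C0_infinity_subset[OF r sub])
 have bT: "C1_test UNIV (bump c r)" by (rule C0_infinity_UNIV_C1_test[OF bump_C0_infinity[OF r]])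
 have b'T: "C1_test UNIV ?b" by (rule C0_infinity_UNIV_C1_test[OF bump_C0_infinity[OF r]])
 have [measurable]: "(\<lambda>z. pd ?b e z) \<in> borel_measurable borel"
  "(pd (bump c r) e) \<in> borel_measurable borel"
  by (rule C1_test_frechet_borel[OF b'T e], rule C1_test_frechet_borel[OF bT e])
 have 0: "?b y = 0" "pd ?b e y = 0" if "y \<notin> ?K" for y
 proof -
  show "?b y = 0" using that bump_eq_0[OF r] ball_subset_cball by blast
  show "pd ?b e y = 0"
  proof (rule frechet_derivative_eq_0_outside[of ?K])
   show "?b z' = 0" if "z' \<notin> ?K" for z' using that bump_eq_0[OF r] ball_subset_cball by blast
  qed (use that in auto)
 qed
 have refl: "pd ?b e y = - pd (bump c r) e (z - y)" for y
 proof -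
  have "bump c r differentiable (at (z - y))" using bT by (simp add: C1_test_def)
  then have d: "(bump c r has_derivative frechet_derivative (bump c r) (at (z - y))) (at (z - y))"
   by (rule frechet_derivative_works[THEN iffD1])
  have "((\<lambda>y. z - y) has_derivative uminus) (at y)" by (auto intro!: derivative_eq_intros)
  from has_derivative_compose[OF this d]
  have "(?b has_derivative (\<lambda>v. pd (bump c r) (- v) (z - y))) (at y)"
   by (simp add: bump_reflect)
  from frechet_derivative_at[OF this]
  have "pd ?b e y = pd (bump c r) (- e) (z - y)" by metis
  also have "\<dots> = - pd (bump c r) e (z - y)"
   using linear_neg[OF has_derivative_linear[OF d]] .
  finally show ?thesis .
 qed
 have to_set: "(LINT y|lborel. k y * F y) = (LINT y:U|lebesgue. w y * k y)"
  if k: "k \<in> borel_measurable borel" "\<And>y. y \<notin> ?K ==> k y = 0" and F: "integrable lborel F"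
   and w: "loc_integrable U w" and ae: "AE y in lebesgue. y \<in> ?K \<longrightarrow> F y = w y" for k F w
 proof -
  have [measurable]: "F \<in> borel_measurable borel" using F by auto
  note [measurable] = k(1)
  have "(LINT y|lborel. k y * F y) = (LINT y|lebesgue. k y * F y)"
   by (intro integral_completion[symmetric]) measurable
  also have "\<dots> = (LINT y|lebesgue. (indicator ?K y * w y) * k y)"
  proof (rule integral_cong_AE)
   show "AE y in lebesgue. k y * F y = (indicator ?K y * w y) * k y"
    using ae by eventually_elim (use k(2) in \<open>auto simp: indicator_def\<close>)
   show "(\<lambda>y. k y * F y) \<in> borel_measurable lebesgue" by (intro measurable_completion) measurable
   show "(\<lambda>y. (indicator ?K y * w y) * k y) \<in> borel_measurable lebesgue"
    by (rule borel_measurable_times[OF borel_measurable_integrable[OF loc_integrableD[OF w compact_cball sub]]])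
     (simp add: measurable_completion k(1))
  qed
  also have "\<dots> = (LINT y:U|lebesgue. w y * k y)"
   by (rule set_integral_eq_compact[OF sub, symmetric]) (use k(2) in auto)
  finally show ?thesis .
 qed
 have "pd (conv (bump c r) f) e z =
   (LINT y|lborel. pd (bump c r) e (z - y) * f y)"
  by (simp add: conv_frechet[OF bT f e] conv_def)
 also have "\<dots> = - (LINT y|lborel. pd ?b e y * f y)"
  by (simp add: refl)
 also have "(LINT y|lborel. pd ?b e y * f y) =
   (LINT y:U|lebesgue. u y * pd ?b e y)"
  using ug 0 by (intro to_set f eqf) (auto simp: has_weak_deriv_def)
 also have "\<dots> = - (LINT y:U|lebesgue. g y * ?b y)"
  using ug bC by (simp add: has_weak_deriv_def)
 also have "(LINT y:U|lebesgue. g y * ?b y) = (LINT y|lborel. ?b y * h y)"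
  using ug 0 by (intro to_set[symmetric] h eqh) (auto simp: has_weak_deriv_def)
 finally show ?thesis by (simp add: conv_def[of _ h] bump_reflect)
qed

lemma C1_testI:
 fixes f :: "'a::euclidean_space => real"
 assumes U: "open U" and K: "compact K" "K \<subseteq> U" and 0: "\<And>z. z \<notin> K ==> f z = 0"
  and d: "\<And>z. z \<in> U ==> f differentiable (at z)"
  and c: "\<And>e. e \<in> Basis ==> continuous_on U (pd f e)"
 shows "C1_test U f"
proof -
 have opK: "open (- K)" using K(1) by (simp add: compact_imp_closed open_Compl)
 have out: "(f has_derivative (\<lambda>h. 0)) (at z)" if z: "z \<notin> K" for z
  by (rule has_derivative_transform_within_open[of "\<lambda>z. 0", OF _ opK]) (use z 0 in auto)
 have diff: "f differentiable (at z)" for z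
  using d[of z] out[of z] K(2) unfolding differentiable_def by blast
 have "continuous_on UNIV (pd f e)" if e: "e \<in> Basis" for e
 proof (rule continuous_on_subset)
  show "continuous_on (U \<union> - K) (pd f e)"
  proof (rule continuous_on_open_Un[OF U opK c[OF e]])
   have "pd f e z = 0" if "z \<in> - K" for z
    using frechet_derivative_eq_0_outside[OF compact_imp_closed[OF K(1)] 0] that by simp
   then have "continuous_on (- K) (pd f e) \<longleftrightarrow> continuous_on (- K) (\<lambda>z. 0::real)"
    by (intro continuous_on_cong) auto
   then show "continuous_on (- K) (pd f e)" by simp
  qed
 qed (use K in auto)
 then show ?thesis unfolding C1_test_def using diff K 0 by blast
qed

lemma continuous_imp_loc_integrable:
 fixes f :: "'a::euclidean_space => real"
 assumes "continuous_on U f" shows "loc_integrable U f"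
 unfolding loc_integrable_def set_integrable_def
proof (intro allI impI)
 fix K assume K: "compact K" "K \<subseteq> U"
 have i: "integrable lborel (\<lambda>x. indicator K x *\<^sub>R f x)"
  by (rule borel_integrable_compact[OF K(1) continuous_on_subset[OF assms K(2)]])
 have "(\<lambda>x. indicator K x *\<^sub>R f x) \<in> borel_measurable lborel" using i by (rule borel_measurable_integrable)
 from integrable_completion[OF this] i show "integrable lebesgue (\<lambda>z. indicator K z *\<^sub>R f z)" by blast
qed

text \<open>The converse of \<open>has_weak_deriv_C1_test\<close>. The values of a smooth test function off \<open>U\<close> are arbitrary, hence the extension
 by zero.\<close>

lemma has_weak_derivI_C1_test:
 fixes u :: "'a::euclidean_space => real"
 assumes U: "open U" and li: "loc_integrable U u" "loc_integrable U g"
  and test: "\<And>\<psi>. C1_test U \<psi> ==> (LINT z:U|lebesgue. u z * pd \<psi> e z) = - (LINT z:U|lebesgue. g z * \<psi> z)"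
 shows "has_weak_deriv e U u g"
 unfolding has_weak_deriv_def
proof (intro conjI li ballI)
 fix \<phi> assume \<phi>: "\<phi> \<in> C0_infinity U U"
 define \<psi> where "\<psi> = (\<lambda>z. if z \<in> U then \<phi> z else 0)"
 have \<psi>: "C1_test U \<psi>" unfolding \<psi>_def by (rule C0_infinity_imp_C1_test(1)[OF U \<phi>])
 have \<psi>d: "frechet_derivative \<psi> (at z) = frechet_derivative \<phi> (at z)" if "z \<in> U" for z
  unfolding \<psi>_def by (rule C0_infinity_imp_C1_test(2)[OF U \<phi> that])
 have "(LINT z:U|lebesgue. u z * pd \<phi> e z) = (LINT z:U|lebesgue. u z * pd \<psi> e z)"
  by (rule set_lebesgue_integral_cong) (use U \<psi>d in auto)
 also have "\<dots> = - (LINT z:U|lebesgue. g z * \<psi> z)" by (rule test[OF \<psi>])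
 also have "(LINT z:U|lebesgue. g z * \<psi> z) = (LINT z:U|lebesgue. g z * \<phi> z)"
  by (rule set_lebesgue_integral_cong) (use U in \<open>auto simp: \<psi>_def\<close>)
 finally show "(LINT z:U|lebesgue. u z * pd \<phi> e z) = - (LINT z:U|lebesgue. g z * \<phi> z)" .
qed

lemma C1_has_weak_deriv:
 fixes f :: "'a::euclidean_space => real"
 assumes U: "open U" and e: "e \<in> Basis" and d: "\<And>z. z \<in> U ==> f differentiable (at z)"
  and c: "\<And>e. e \<in> Basis ==> continuous_on U (pd f e)"
 shows "has_weak_deriv e U f (pd f e)"
proof (rule has_weak_derivI_C1_test[OF U])
 have fc: "continuous_on U f"
  by (intro continuous_at_imp_continuous_on ballI differentiable_imp_continuous_within d)
 then show fl: "loc_integrable U f" by (rule continuous_imp_loc_integrable)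
 show dl: "loc_integrable U (pd f e)" by (rule continuous_imp_loc_integrable[OF c[OF e]])
 fix \<psi> assume \<psi>: "C1_test U \<psi>"
 obtain K where K: "compact K" "K \<subseteq> U" "\<And>z. z \<notin> K ==> \<psi> z = 0" "\<And>z e. z \<notin> K ==> pd \<psi> e z = 0"
  using C1_testE[OF \<psi>] by metis
 define p where "p z = f z * \<psi> z" for z
 have pd: "(p has_derivative (\<lambda>h. f z * pd \<psi> h z + pd f h z * \<psi> z)) (at z)"
  if "z \<in> U" for z
 proof -
  have "(f has_derivative frechet_derivative f (at z)) (at z)"
   using d[OF that] by (rule frechet_derivative_works[THEN iffD1])
  moreover have "(\<psi> has_derivative frechet_derivative \<psi> (at z)) (at z)"
   using \<psi> by (intro frechet_derivative_works[THEN iffD1]) (simp add: C1_test_def)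
  ultimately show ?thesis unfolding p_def by (rule has_derivative_mult)
 qed
 have pfr: "pd p h z = f z * pd \<psi> h z + pd f h z * \<psi> z"
  if "z \<in> U" for z h
  using frechet_derivative_at[OF pd[OF that], symmetric] by metis
 have pT: "C1_test U p"
 proof (rule C1_testI[OF U K(1,2)])
  show "p z = 0" if "z \<notin> K" for z using K(3)[OF that] by (simp add: p_def)
  show "p differentiable (at z)" if "z \<in> U" for z using pd[OF that] unfolding differentiable_def by blast
  fix e' :: 'a assume e': "e' \<in> Basis"
  have "continuous_on U (\<lambda>z. f z * pd \<psi> e' z + pd f e' z * \<psi> z)"
   using \<psi> e' by (intro continuous_intros fc c[OF e'] C1_test_continuous[OF \<psi>])
    (auto simp: C1_test_def intro: continuous_on_subset)
  then show "continuous_on U (pd p e')"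
   using pfr by (simp cong: continuous_on_cong)
 qed
 have i1: "set_integrable lebesgue U (\<lambda>z. f z * pd \<psi> e z)"
  by (rule loc_integrable_test_integrable[OF fl _ K(1,2)]) (use \<psi> e K in \<open>auto simp: C1_test_def\<close>)
 have i2: "set_integrable lebesgue U (\<lambda>z. pd f e z * \<psi> z)"
  by (rule loc_integrable_test_integrable[OF dl C1_test_continuous[OF \<psi>] K(1-3)])
 have "0 = (LINT z|lborel. pd p e z)" using integral_frechet_C1_test(2)[OF pT e] by simp
 also have "\<dots> = (LINT z|lebesgue. pd p e z)"
  using C1_test_frechet_borel[OF pT e] by (intro integral_completion[symmetric]) simp
 also have "\<dots> = (LINT z:U|lebesgue. f z * pd \<psi> e z + pd f e z * \<psi> z)"
  unfolding set_lebesgue_integral_def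
 proof (rule Bochner_Integration.integral_cong[OF refl])
  fix z
  have "pd p e z = 0" if "z \<notin> U"
   by (rule frechet_derivative_eq_0_outside[OF compact_imp_closed[OF K(1)]]) (use K that in \<open>auto simp: p_def\<close>)
  then show "pd p e z = indicator U z *\<^sub>R (f z * pd \<psi> e z + pd f e z * \<psi> z)"
   using pfr[of z e] by (cases "z \<in> U") auto
 qed
 also have "\<dots> = (LINT z:U|lebesgue. f z * pd \<psi> e z) + (LINT z:U|lebesgue. pd f e z * \<psi> z)"
  by (rule set_integral_add(2)[OF i1 i2])
 finally show "(LINT z:U|lebesgue. f z * pd \<psi> e z) = - (LINT z:U|lebesgue. pd f e z * \<psi> z)"
  by simp
qed

lemma test_integral_L1_limit:
 fixes u :: "nat => 'a::euclidean_space => real"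
 assumes u: "\<And>n. loc_integrable U (u n)" and v: "loc_integrable U v"
  and k: "continuous_on UNIV k" "compact K" "K \<subseteq> U" "\<And>z. z \<notin> K ==> k z = 0"
  and lim: "(\<lambda>n. LINT z|lebesgue. indicator K z * \<bar>u n z - v z\<bar>) \<longlonglongrightarrow> 0"
 shows "(\<lambda>n. LINT z:U|lebesgue. u n z * k z) \<longlonglongrightarrow> (LINT z:U|lebesgue. v z * k z)"
proof -
 have "bounded (k ` K)"
  using k(1,2) by (meson compact_continuous_image compact_imp_bounded continuous_on_subset subset_UNIV)
 then obtain C where C: "\<And>z. z \<in> K ==> \<bar>k z\<bar> \<le> C" by (auto simp: bounded_iff)
 have i: "set_integrable lebesgue U (\<lambda>z. w z * k z)" if "loc_integrable U w" for w
  by (rule loc_integrable_test_integrable[OF that k])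
 have iK: "integrable lebesgue (\<lambda>z. indicator K z * \<bar>u n z - v z\<bar>)" for n
 proof -
  have "integrable lebesgue (\<lambda>z. \<bar>indicator K z * u n z - indicator K z * v z\<bar>)"
   by (intro integrable_abs Bochner_Integration.integrable_diff loc_integrableD[OF u k(2,3)] loc_integrableD[OF v k(2,3)])
  moreover have "\<bar>indicator K z * u n z - indicator K z * v z\<bar> = indicator K z * \<bar>u n z - v z\<bar>" for z
   by (simp add: indicator_def)
  ultimately show ?thesis by simp
 qed
 show ?thesis
 proof (rule LIM_zero_cancel, rule Lim_null_comparison)
  show "(\<lambda>n. C * (LINT z|lebesgue. indicator K z * \<bar>u n z - v z\<bar>)) \<longlonglongrightarrow> 0"
   by (rule tendsto_mult_right_zero[OF lim])
  show "\<forall>\<^sub>F n in sequentially. norm ((LINT z:U|lebesgue. u n z * k z) - (LINT z:U|lebesgue. v z * k z)) \<le>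
    C * (LINT z|lebesgue. indicator K z * \<bar>u n z - v z\<bar>)"
  proof (intro always_eventually allI)
   fix n
   have "norm ((LINT z:U|lebesgue. u n z * k z) - (LINT z:U|lebesgue. v z * k z)) =
     \<bar>LINT z|lebesgue. indicator U z *\<^sub>R (u n z * k z) - indicator U z *\<^sub>R (v z * k z)\<bar>"
    using i[OF u[of n]] i[OF v] unfolding set_integrable_def set_lebesgue_integral_def by simp
   also have "\<dots> \<le> (LINT z|lebesgue. \<bar>indicator U z *\<^sub>R (u n z * k z) - indicator U z *\<^sub>R (v z * k z)\<bar>)"
    by (rule integral_abs_bound)
   also have "\<dots> \<le> (LINT z|lebesgue. C * (indicator K z * \<bar>u n z - v z\<bar>))"
   proof (rule integral_mono)
    fix z
    show "\<bar>indicator U z *\<^sub>R (u n z * k z) - indicator U z *\<^sub>R (v z * k z)\<bar> \<le> C * (indicator K z * \<bar>u n z - v z\<bar>)"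
    proof (cases "z \<in> K")
     case True
     have "\<bar>(u n z - v z) * k z\<bar> \<le> \<bar>u n z - v z\<bar> * C"
      unfolding abs_mult using C[OF True] by (intro mult_left_mono) auto
     moreover have "z \<in> U" using True k(3) by blast
     then have "indicator U z *\<^sub>R (u n z * k z) - indicator U z *\<^sub>R (v z * k z) = (u n z - v z) * k z"
      by (simp add: left_diff_distrib)
     ultimately show ?thesis using True by (simp add: mult.commute)
    qed (simp add: k(4))
    show "integrable lebesgue (\<lambda>z. \<bar>indicator U z *\<^sub>R (u n z * k z) - indicator U z *\<^sub>R (v z * k z)\<bar>)"
     using i[OF u[of n]] i[OF v] unfolding set_integrable_def
     by (intro integrable_abs Bochner_Integration.integrable_diff)
   qed (use iK[of n] in simp)
   also have "\<dots> = C * (LINT z|lebesgue. indicator K z * \<bar>u n z - v z\<bar>)" by simp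
   finally show "norm ((LINT z:U|lebesgue. u n z * k z) - (LINT z:U|lebesgue. v z * k z)) \<le>
    C * (LINT z|lebesgue. indicator K z * \<bar>u n z - v z\<bar>)" .
  qed
 qed
qed

lemma weak_deriv_L1_limit:
 fixes u :: "nat => 'a::euclidean_space => real"
 assumes U: "open U" and e: "e \<in> Basis" and ug: "\<And>n. has_weak_deriv e U (u n) (g n)"
  and v: "loc_integrable U v" and h: "loc_integrable U h"
  and limu: "\<And>K. compact K ==> K \<subseteq> U ==> (\<lambda>n. LINT z|lebesgue. indicator K z * \<bar>u n z - v z\<bar>) \<longlonglongrightarrow> 0"
  and limg: "\<And>K. compact K ==> K \<subseteq> U ==> (\<lambda>n. LINT z|lebesgue. indicator K z * \<bar>g n z - h z\<bar>) \<longlonglongrightarrow> 0"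
 shows "has_weak_deriv e U v h"
proof (rule has_weak_derivI_C1_test[OF U v h])
 fix \<psi> assume \<psi>: "C1_test U \<psi>"
 let ?d = "\<lambda>z. pd \<psi> e z"
 obtain K where K: "compact K" "K \<subseteq> U" "\<And>z. z \<notin> K ==> \<psi> z = 0" "\<And>z. z \<notin> K ==> ?d z = 0"
  using C1_testE[OF \<psi>] by metis
 have eq: "(LINT z:U|lebesgue. u n z * ?d z) = - (LINT z:U|lebesgue. g n z * \<psi> z)" for n
  by (rule has_weak_deriv_C1_test[OF U e ug \<psi>])
 have "(\<lambda>n. LINT z:U|lebesgue. u n z * ?d z) \<longlonglongrightarrow> (LINT z:U|lebesgue. v z * ?d z)"
  using ug \<psi> e by (intro test_integral_L1_limit[OF _ v _ K(1,2,4)] limu K) (auto simp: has_weak_deriv_def C1_test_def)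
 moreover have "(\<lambda>n. - (LINT z:U|lebesgue. g n z * \<psi> z)) \<longlonglongrightarrow> - (LINT z:U|lebesgue. h z * \<psi> z)"
  using ug C1_test_continuous[OF \<psi>]
  by (intro tendsto_minus test_integral_L1_limit[OF _ h _ K(1,2,3)] limg K) (auto simp: has_weak_deriv_def)
 ultimately show "(LINT z:U|lebesgue. v z * ?d z) = - (LINT z:U|lebesgue. h z * \<psi> z)"
  unfolding eq by (rule LIMSEQ_unique)
qed

text \<open>The chain rule holds for the mollified functions on a neighbourhood \<open>V\<close> of the support of the test
 function, where mollification commutes with differentiation. Along a subsequence that converges
 almost everywhere, dominated convergence deals with the factor that contains \<open>G'\<close>.\<close>

lemma weak_deriv_compose_C1:
 fixes u :: "'a::euclidean_space => real"
 assumes U: "open U" and e: "e \<in> Basis" and ug: "has_weak_deriv e U u g"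
  and G: "\<And>s. (G has_real_derivative G' s) (at s)" and G'c: "continuous_on UNIV G'"
  and L: "\<And>s. \<bar>G' s\<bar> \<le> L" and G0: "G 0 = 0"
 shows "has_weak_deriv e U (\<lambda>z. G (u z)) (\<lambda>z. G' (u z) * g z)"
proof -
 have L0: "0 \<le> L" using L[of 0] by simp
 have lip: "\<bar>G s - G t\<bar> \<le> L * \<bar>s - t\<bar>" for s t
  using field_differentiable_bound[of UNIV G G' L s t] G L by auto
 have Gc: "continuous_on UNIV G" using G DERIV_isCont continuous_at_imp_continuous_on by blast
 have [measurable]: "G \<in> borel_measurable borel" "G' \<in> borel_measurable borel"
  using Gc G'c by (auto intro: borel_measurable_continuous_onI)
 have ul: "loc_integrable U u" and gl: "loc_integrable U g" using ug by (auto simp: has_weak_deriv_def)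
 have Gl: "loc_integrable U (\<lambda>z. G (u z))"
  unfolding loc_integrable_def set_integrable_def
 proof (intro allI impI)
  fix K assume K: "compact K" "K \<subseteq> U"
  note i = loc_integrableD[OF ul K]
  have eq: "indicator K z *\<^sub>R G (u z) = G (indicator K z * u z)" for z by (simp add: indicator_def G0)
  show "integrable lebesgue (\<lambda>z. indicator K z *\<^sub>R G (u z))"
   unfolding eq
  proof (rule Bochner_Integration.integrable_bound)
   show "integrable lebesgue (\<lambda>z. L * (indicator K z * u z))" using i by simp
   show "(\<lambda>z. G (indicator K z * u z)) \<in> borel_measurable lebesgue"
    using borel_measurable_integrable[OF i] by measurable
   show "AE z in lebesgue. norm (G (indicator K z * u z)) \<le> norm (L * (indicator K z * u z))"
    using lip[of "indicator K _ * u _" 0] L0 by (intro AE_I2) (simp add: G0 abs_mult[of L])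
  qed
 qed
 have G'l: "loc_integrable U (\<lambda>z. G' (u z) * g z)"
  unfolding loc_integrable_def set_integrable_def
 proof (intro allI impI)
  fix K assume K: "compact K" "K \<subseteq> U"
  have eq: "indicator K z *\<^sub>R (G' (u z) * g z) = G' (indicator K z * u z) * (indicator K z * g z)" for z
   by (simp add: indicator_def)
  show "integrable lebesgue (\<lambda>z. indicator K z *\<^sub>R (G' (u z) * g z))"
   unfolding eq
   by (rule integrable_bounded_mult[OF loc_integrableD[OF gl K], of _ L])
    (use L borel_measurable_integrable[OF loc_integrableD[OF ul K]] in \<open>auto intro: measurable_compose\<close>)
 qed
 show ?thesis
 proof (rule has_weak_derivI_C1_test[OF U Gl G'l])
  fix \<psi> assume \<psi>: "C1_test U \<psi>"
  let ?d = "\<lambda>z. pd \<psi> e z"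
  obtain K where K: "compact K" "K \<subseteq> U" "\<And>z. z \<notin> K ==> \<psi> z = 0" "\<And>z. z \<notin> K ==> ?d z = 0"
   using C1_testE[OF \<psi>] by metis
  obtain \<rho> K' where K': "0 < \<rho>" "compact K'" "K' \<subseteq> U" "\<And>z z'. z \<in> K ==> dist z z' \<le> \<rho> ==> z' \<in> K'"
   using compact_neighbourhood_subset_open[OF K(1) U K(2)] by metis
  define V where "V = (\<Union>x\<in>K. ball x (\<rho> / 2))"
  have V: "open V" "K \<subseteq> V" using K'(1) by (auto simp: V_def)
  have V': "cball z (\<rho> / 2) \<subseteq> K'" if "z \<in> V" for z
  proof
   fix y assume y: "y \<in> cball z (\<rho> / 2)"
   obtain x where x: "x \<in> K" "dist x z < \<rho> / 2" using \<open>z \<in> V\<close> unfolding V_def by auto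
   then show "y \<in> K'" using K'(4)[OF x(1), of y] y dist_triangle[of x y z] by simp
  qed
  have VK': "V \<subseteq> K'" using V' K'(1) by (meson centre_in_cball half_gt_zero less_imp_le subset_eq)
  then have VU: "V \<subseteq> U" using K'(3) by blast
  obtain f where f: "integrable lborel f" "AE z in lebesgue. indicator K' z * u z = f z"
   using integrable_lebesgue_borel_representative[OF loc_integrableD[OF ul K'(2,3)]] by metis
  obtain h where h: "integrable lborel h" "AE z in lebesgue. indicator K' z * g z = h z"
   using integrable_lebesgue_borel_representative[OF loc_integrableD[OF gl K'(2,3)]] by metis
  have [measurable]: "f \<in> borel_measurable borel" "h \<in> borel_measurable borel" using f h by auto
  \<comment> \<open>Balls of radius at most \<open>\<rho> / 2\<close> around points of \<open>V\<close> stay in \<open>K'\<close>.\<close>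
  define r where "r n = \<rho> / 2 / real (Suc n)" for n
  have r: "0 < r n" "r n \<le> \<rho> / 2" for n using K'(1) by (auto simp: r_def field_simps)
  have r0: "(\<lambda>n. norm (0::'a) + r n) \<longlonglongrightarrow> 0" unfolding r_def by simp real_asymp
  note af = approximate_identity[where c="\<lambda>n. 0", OF f(1) r(1) r0]
  note ah = approximate_identity[where c="\<lambda>n. 0", OF h(1) r(1) r0]
  obtain s where s: "strict_mono s" "AE z in lborel. (\<lambda>n. conv (bump 0 (r (s n))) f z - f z) \<longlonglongrightarrow> 0"
  proof -
   have "\<exists>s. strict_mono s \<and> (AE z in lborel. (\<lambda>n. conv (bump 0 (r (s n))) f z - f z) \<longlonglongrightarrow> 0)"
    by (rule tendsto_L1_AE_subseq[of lborel "\<lambda>n z. conv (bump 0 (r n)) f z - f z"]) (use af f(1) in simp_all)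
   then show thesis using that by blast
  qed
  define f' where "f' n = conv (bump 0 (r (s n))) f" for n
  define h' where "h' n = conv (bump 0 (r (s n))) h" for n
  have f'i: "integrable lborel (f' n)" and h'i: "integrable lborel (h' n)" for n
   using af(1) ah(1) by (auto simp: f'_def h'_def)
  have [measurable]: "f' n \<in> borel_measurable borel" "h' n \<in> borel_measurable borel" for n
   using f'i[of n] h'i[of n] by auto
  have f'lim: "(\<lambda>n. LINT z|lborel. \<bar>f' n z - f z\<bar>) \<longlonglongrightarrow> 0"
   using LIMSEQ_subseq_LIMSEQ[OF af(2) s(1)] by (simp add: f'_def o_def)
  have h'lim: "(\<lambda>n. LINT z|lborel. \<bar>h' n z - h z\<bar>) \<longlonglongrightarrow> 0"
   using LIMSEQ_subseq_LIMSEQ[OF ah(2) s(1)] by (simp add: h'_def o_def)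
  have f'C: "Ck_upto k UNIV UNIV (f' n)" for k n
   unfolding f'_def by (rule Ck_upto_conv[OF bump_C0_infinity[OF r(1)] f(1)])
  have f'h': "pd (f' n) e z = h' n z" if z: "z \<in> V" for n z
  proof -
   have sub: "cball z (r (s n)) \<subseteq> K'" using V'[OF z] subset_cball[OF r(2)[of "s n"], of z] by blast
   show ?thesis
    unfolding f'_def h'_def
   proof (rule mollify_weak_deriv[OF U e ug r(1) f(1) h(1)])
    show "cball (z - 0) (r (s n)) \<subseteq> U" using sub K'(3) by simp
    show "AE \<zeta> in lebesgue. \<zeta> \<in> cball (z - 0) (r (s n)) \<longrightarrow> f \<zeta> = u \<zeta>"
     using f(2) by eventually_elim (use sub in \<open>auto simp: indicator_def subset_eq\<close>)
    show "AE \<zeta> in lebesgue. \<zeta> \<in> cball (z - 0) (r (s n)) \<longrightarrow> h \<zeta> = g \<zeta>"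
     using h(2) by eventually_elim (use sub in \<open>auto simp: indicator_def subset_eq\<close>)
   qed
  qed
  have vd: "((\<lambda>z. G (f' n z)) has_derivative (\<lambda>x. G' (f' n z) * pd (f' n) x z)) (at z)" for n z
  proof -
   have "(f' n has_derivative frechet_derivative (f' n) (at z)) (at z)"
    using f'C[of "Suc 0" n] by (intro frechet_derivative_works[THEN iffD1]) simp
   from DERIV_compose_FDERIV[OF G this] show ?thesis by (simp add: mult.commute)
  qed
  have vfr: "pd (\<lambda>z. G (f' n z)) x z = G' (f' n z) * pd (f' n) x z" for n z x
   using frechet_derivative_at[OF vd, symmetric] by metis
  have wd: "has_weak_deriv e V (\<lambda>z. G (f' n z)) (\<lambda>z. G' (f' n z) * pd (f' n) e z)" for n
  proof -
   have "continuous_on V (\<lambda>z. pd (\<lambda>z. G (f' n z)) e' z)" if "e' \<in> Basis" for e'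
    unfolding vfr using f'C[of 0 n] Ck_upto_frechet[OF open_UNIV f'C[of "Suc 0" n] that]
    by (intro continuous_intros continuous_on_compose2[OF G'c]) (auto intro: continuous_on_subset)
   moreover have "(\<lambda>z. G (f' n z)) differentiable (at z)" for z using vd unfolding differentiable_def by blast
   ultimately show ?thesis using C1_has_weak_deriv[OF V(1) e, of "\<lambda>z. G (f' n z)"] unfolding vfr by simp
  qed
  have fu: "AE z in lebesgue. z \<in> V \<longrightarrow> f z = u z" and hg: "AE z in lebesgue. z \<in> V \<longrightarrow> h z = g z"
   using f(2) h(2) by (eventually_elim, use VK' in \<open>auto simp: indicator_def\<close>)+
  have to_lborel: "(\<lambda>n. LINT z|lebesgue. indicator C z * \<bar>p n z - w z\<bar>) \<longlonglongrightarrow> 0"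
   if C: "C \<subseteq> V" "C \<in> sets lebesgue" and P: "\<And>n. integrable lborel (P n)" "(\<lambda>n. LINT z|lborel. P n z) \<longlonglongrightarrow> 0"
    and le: "\<And>n. AE z in lebesgue. z \<in> V \<longrightarrow> \<bar>p n z - w z\<bar> \<le> P n z" "\<And>n z. 0 \<le> P n z" for C p w and P :: "nat => 'a => real"
  proof (rule Lim_null_comparison[OF _ P(2)], intro always_eventually allI)
   fix n
   have Pi: "integrable lebesgue (P n)" using P(1)[of n] integrable_completion[of "P n" lborel] by simp
   have "AE z in lebesgue. indicator C z * \<bar>p n z - w z\<bar> \<le> P n z"
    using le(1)[of n] by eventually_elim (use C(1) le(2) in \<open>auto simp: indicator_def\<close>)
   then have "(LINT z|lebesgue. indicator C z * \<bar>p n z - w z\<bar>) \<le> (LINT z|lebesgue. P n z)"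
    by (rule integral_mono_AE'[OF Pi]) (use le(2) in auto)
   also have "\<dots> = (LINT z|lborel. P n z)" using P(1)[of n] by (intro integral_completion) simp
   finally show "norm (LINT z|lebesgue. indicator C z * \<bar>p n z - w z\<bar>) \<le> (LINT z|lborel. P n z)"
    by (simp add: abs_of_nonneg Bochner_Integration.integral_nonneg)
  qed
  have i3: "integrable lborel (\<lambda>z. \<bar>G' (f' n z) - G' (f z)\<bar> * \<bar>h z\<bar>)" for n
  proof -
   have "\<bar>\<bar>G' (f' n z) - G' (f z)\<bar>\<bar> \<le> 2 * L" for z
    using L[of "f' n z"] L[of "f z"] by (simp add: abs_le_iff)
   from integrable_bounded_mult[of lborel "\<lambda>z. \<bar>h z\<bar>", OF _ _ this] h(1) show ?thesis by simp
  qed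
  have l3: "(\<lambda>n. LINT z|lborel. \<bar>G' (f' n z) - G' (f z)\<bar> * \<bar>h z\<bar>) \<longlonglongrightarrow> (LINT z|(lborel::'a measure). (0::real))"
  proof (rule integral_dominated_convergence[where w="\<lambda>z. 2 * L * \<bar>h z\<bar>"])
   show "AE z in lborel. (\<lambda>n. \<bar>G' (f' n z) - G' (f z)\<bar> * \<bar>h z\<bar>) \<longlonglongrightarrow> 0"
    using s(2)
   proof (rule eventually_mono)
    fix z assume "(\<lambda>n. conv (bump 0 (r (s n))) f z - f z) \<longlonglongrightarrow> 0"
    then have "(\<lambda>n. f' n z) \<longlonglongrightarrow> f z" unfolding f'_def by (rule LIM_zero_cancel)
    moreover have "isCont G' (f z)" using G'c by (simp add: continuous_on_eq_continuous_at)
    ultimately have "(\<lambda>n. G' (f' n z)) \<longlonglongrightarrow> G' (f z)" by (rule isCont_tendsto_compose[rotated])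
    then have "(\<lambda>n. \<bar>G' (f' n z) - G' (f z)\<bar> * \<bar>h z\<bar>) \<longlonglongrightarrow> \<bar>G' (f z) - G' (f z)\<bar> * \<bar>h z\<bar>"
     by (intro tendsto_intros)
    then show "(\<lambda>n. \<bar>G' (f' n z) - G' (f z)\<bar> * \<bar>h z\<bar>) \<longlonglongrightarrow> 0" by simp
   qed
   show "AE z in lborel. norm (\<bar>G' (f' n z) - G' (f z)\<bar> * \<bar>h z\<bar>) \<le> 2 * L * \<bar>h z\<bar>" for n
   proof (rule AE_I2)
    fix z
    have "\<bar>G' (f' n z) - G' (f z)\<bar> \<le> 2 * L" using L[of "f' n z"] L[of "f z"] by (simp add: abs_le_iff)
    then show "norm (\<bar>G' (f' n z) - G' (f z)\<bar> * \<bar>h z\<bar>) \<le> 2 * L * \<bar>h z\<bar>"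
     by (simp add: abs_mult mult_right_mono)
   qed
  qed (use h(1) in auto)
  have eqK: "(LINT z:U|lebesgue. w z * k z) = (LINT z:V|lebesgue. w z * k z)"
   if "\<forall>z. z \<notin> K \<longrightarrow> k z = 0" for w k :: "'a => real"
   using set_integral_eq_compact[of K U k w] set_integral_eq_compact[of K V k w] that K(2) V(2) by simp
  have off: "\<forall>z. z \<notin> K \<longrightarrow> \<psi> z = 0" "\<forall>z. z \<notin> K \<longrightarrow> ?d z = 0" using K(3,4) by auto
  have "has_weak_deriv e V (\<lambda>z. G (u z)) (\<lambda>z. G' (u z) * g z)"
  proof (rule weak_deriv_L1_limit[OF V(1) e wd])
   show "loc_integrable V (\<lambda>z. G (u z))" "loc_integrable V (\<lambda>z. G' (u z) * g z)"
    using Gl G'l VU by (auto simp: loc_integrable_def)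
   fix C assume C: "compact C" "C \<subseteq> V"
   have Cs: "C \<in> sets lebesgue" using C(1) by (simp add: compact_imp_closed)
   show "(\<lambda>n. LINT z|lebesgue. indicator C z * \<bar>G (f' n z) - G (u z)\<bar>) \<longlonglongrightarrow> 0"
   proof (rule to_lborel[OF C(2) Cs, of "\<lambda>n z. L * \<bar>f' n z - f z\<bar>"])
    show "integrable lborel (\<lambda>z. L * \<bar>f' n z - f z\<bar>)" for n using f(1) f'i by auto
    show "(\<lambda>n. LINT z|lborel. L * \<bar>f' n z - f z\<bar>) \<longlonglongrightarrow> 0" using tendsto_mult_right_zero[OF f'lim] by simp
    show "AE z in lebesgue. z \<in> V \<longrightarrow> \<bar>G (f' n z) - G (u z)\<bar> \<le> L * \<bar>f' n z - f z\<bar>" for n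
     using fu by eventually_elim (use lip in auto)
   qed (use L0 in simp)
   show "(\<lambda>n. LINT z|lebesgue. indicator C z * \<bar>G' (f' n z) * pd (f' n) e z - G' (u z) * g z\<bar>) \<longlonglongrightarrow> 0"
   proof (rule to_lborel[OF C(2) Cs, of "\<lambda>n z. L * \<bar>h' n z - h z\<bar> + \<bar>G' (f' n z) - G' (f z)\<bar> * \<bar>h z\<bar>"])
    show "integrable lborel (\<lambda>z. L * \<bar>h' n z - h z\<bar> + \<bar>G' (f' n z) - G' (f z)\<bar> * \<bar>h z\<bar>)" for n
     using h(1) h'i i3 by auto
    show "(\<lambda>n. LINT z|lborel. L * \<bar>h' n z - h z\<bar> + \<bar>G' (f' n z) - G' (f z)\<bar> * \<bar>h z\<bar>) \<longlonglongrightarrow> 0"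
     using tendsto_add[OF tendsto_mult_right_zero[OF h'lim, of L] l3[simplified]] h(1) h'i i3 by simp
    show "AE z in lebesgue. z \<in> V \<longrightarrow> \<bar>G' (f' n z) * pd (f' n) e z - G' (u z) * g z\<bar> \<le>
      L * \<bar>h' n z - h z\<bar> + \<bar>G' (f' n z) - G' (f z)\<bar> * \<bar>h z\<bar>" for n
     using fu hg
    proof (eventually_elim, intro impI)
     fix z assume *: "z \<in> V \<longrightarrow> f z = u z" "z \<in> V \<longrightarrow> h z = g z" and z: "z \<in> V"
     have "G' (f' n z) * h' n z - G' (f z) * h z = G' (f' n z) * (h' n z - h z) + (G' (f' n z) - G' (f z)) * h z"
      by (simp add: algebra_simps)
     also have "\<bar>\<dots>\<bar> \<le> L * \<bar>h' n z - h z\<bar> + \<bar>G' (f' n z) - G' (f z)\<bar> * \<bar>h z\<bar>"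
      using mult_right_mono[OF L[of "f' n z"] abs_ge_zero[of "h' n z - h z"]]
       abs_triangle_ineq[of "G' (f' n z) * (h' n z - h z)" "(G' (f' n z) - G' (f z)) * h z"] by (simp add: abs_mult)
     finally show "\<bar>G' (f' n z) * pd (f' n) e z - G' (u z) * g z\<bar> \<le>
      L * \<bar>h' n z - h z\<bar> + \<bar>G' (f' n z) - G' (f z)\<bar> * \<bar>h z\<bar>" using * z f'h'[OF z] by simp
    qed
   qed (use L0 in simp)
  qed
  moreover have "C1_test V \<psi>" using \<psi> K(1,3) V(2) unfolding C1_test_def by blast
  ultimately have "(LINT z:V|lebesgue. G (u z) * ?d z) = - (LINT z:V|lebesgue. G' (u z) * g z * \<psi> z)"
   by (rule has_weak_deriv_C1_test[OF V(1) e])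
  then show "(LINT z:U|lebesgue. G (u z) * ?d z) = - (LINT z:U|lebesgue. G' (u z) * g z * \<psi> z)"
   unfolding eqK[OF off(1)] eqK[OF off(2)] .
 qed
qed

lemma weak_deriv_lincomb:
 fixes u :: "'a::euclidean_space => real"
 assumes U: "open U" and e: "e \<in> Basis" and u: "has_weak_deriv e U u g" and v: "has_weak_deriv e U v h"
 shows "has_weak_deriv e U (\<lambda>z. a * u z + b * v z) (\<lambda>z. a * g z + b * h z)"
proof (rule has_weak_derivI_C1_test[OF U])
 show "loc_integrable U (\<lambda>z. a * u z + b * v z)" "loc_integrable U (\<lambda>z. a * g z + b * h z)"
  using u v by (auto intro!: loc_integrable_add loc_integrable_cmult simp: has_weak_deriv_def)
 fix \<psi> assume \<psi>: "C1_test U \<psi>"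
 let ?d = "\<lambda>z. pd \<psi> e z"
 obtain K where K: "compact K" "K \<subseteq> U" "\<And>z. z \<notin> K ==> \<psi> z = 0" "\<And>z. z \<notin> K ==> ?d z = 0"
  using C1_testE[OF \<psi>] by metis
 have dc: "continuous_on UNIV ?d" using \<psi> e by (simp add: C1_test_def)
 have lin: "(LINT z:U|lebesgue. (a * w z + b * w' z) * k z) =
   a * (LINT z:U|lebesgue. w z * k z) + b * (LINT z:U|lebesgue. w' z * k z)"
  if w: "loc_integrable U w" "loc_integrable U w'" and k: "continuous_on UNIV k" "\<And>z. z \<notin> K ==> k z = 0" for w w' k
 proof -
  have "set_integrable lebesgue U (\<lambda>z. a * (w z * k z))" "set_integrable lebesgue U (\<lambda>z. b * (w' z * k z))"
   using loc_integrable_test_integrable[OF w(1) k(1) K(1,2) k(2)]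
    loc_integrable_test_integrable[OF w(2) k(1) K(1,2) k(2)] by auto
  from set_integral_add(2)[OF this] show ?thesis by (simp add: distrib_right mult.assoc)
 qed
 show "(LINT z:U|lebesgue. (a * u z + b * v z) * ?d z) = - (LINT z:U|lebesgue. (a * g z + b * h z) * \<psi> z)"
  using u v has_weak_deriv_C1_test[OF U e u \<psi>] has_weak_deriv_C1_test[OF U e v \<psi>]
  by (subst (1 2) lin) (auto simp: has_weak_deriv_def dc K C1_test_continuous[OF \<psi>])
qed

lemma loc_integrable_cong_AE:
 fixes u :: "'a::euclidean_space => real"
 assumes U: "open U" and u: "loc_integrable U u" and eq: "AE z in lebesgue_on U. u z = u' z"
 shows "loc_integrable U u'"
 unfolding loc_integrable_def set_integrable_def
proof (intro allI impI)
 fix K assume K: "compact K" "K \<subseteq> U"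
 have "AE z in lebesgue. z \<in> U \<longrightarrow> u z = u' z" using eq U by (subst (asm) AE_restrict_space_iff) auto
 then have ae: "AE z in lebesgue. indicator K z * u z = indicator K z *\<^sub>R u' z"
  by eventually_elim (use K(2) in \<open>auto simp: indicator_def\<close>)
 note i = loc_integrableD[OF u K]
 have "(\<lambda>z. indicator K z *\<^sub>R u' z) \<in> borel_measurable lebesgue"
  by (rule borel_measurable_AE[OF borel_measurable_integrable[OF i] ae])
 with i ae show "integrable lebesgue (\<lambda>z. indicator K z *\<^sub>R u' z)"
  using integrable_cong_AE[of "\<lambda>z. indicator K z * u z" lebesgue] borel_measurable_integrable[OF i] by blast
qed

lemma integral_lebesgue_cong_AE:
 fixes f g :: "'a::euclidean_space => real"
 assumes ae: "AE z in lebesgue. f z = g z"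
 shows "(LINT z|lebesgue. f z) = (LINT z|lebesgue. g z)"
proof -
 have ae': "AE z in lebesgue. g z = f z" using ae by eventually_elim simp
 show ?thesis
 proof (cases "f \<in> borel_measurable lebesgue")
  case True
  show ?thesis by (rule integral_cong_AE[OF True borel_measurable_AE[OF True ae] ae])
 next
  case False
  then have "g \<notin> borel_measurable lebesgue" using borel_measurable_AE[OF _ ae'] by blast
  then have "\<not> integrable lebesgue f" "\<not> integrable lebesgue g"
   using False borel_measurable_integrable by blast+
  then show ?thesis by (simp add: not_integrable_integral_eq)
 qed
qed

lemma weak_deriv_cong_AE:
 fixes u :: "'a::euclidean_space => real"
 assumes U: "open U" and ug: "has_weak_deriv e U u g"
  and u: "AE z in lebesgue_on U. u z = u' z" and g: "AE z in lebesgue_on U. g z = g' z"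
 shows "has_weak_deriv e U u' g'"
proof -
 have cong: "(LINT z:U|lebesgue. w z * k z) = (LINT z:U|lebesgue. w' z * k z)"
  if "AE z in lebesgue_on U. w z = w' z" "loc_integrable U w" for w w' k :: "'a => real"
 proof -
  have "AE z in lebesgue. z \<in> U \<longrightarrow> w z = w' z" using that(1) U by (subst (asm) AE_restrict_space_iff) auto
  then have "AE z in lebesgue. indicator U z *\<^sub>R (w z * k z) = indicator U z *\<^sub>R (w' z * k z)"
   by eventually_elim (auto simp: indicator_def)
  then show ?thesis unfolding set_lebesgue_integral_def by (rule integral_lebesgue_cong_AE)
 qed
 show ?thesis
  unfolding has_weak_deriv_def
  using ug loc_integrable_cong_AE[OF U _ u] loc_integrable_cong_AE[OF U _ g] cong[OF u] cong[OF g]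
  by (auto simp: has_weak_deriv_def)
qed

subsection \<open>Positive parts\<close>

text \<open>Continuously differentiable approximations of the positive part that vanish on the negative axis. Their
 derivatives converge to the indicator of the open positive axis, so no derivative is left on the
 zero set.\<close>

definition pos_smooth :: "real => real => real" where
 "pos_smooth \<tau> s = (max s 0)\<^sup>2 / (max s 0 + \<tau>)"

definition pos_smooth' :: "real => real => real" where
 "pos_smooth' \<tau> s = 1 - \<tau>\<^sup>2 / (max s 0 + \<tau>)\<^sup>2"

lemma pos_smooth_has_derivative:
 assumes \<tau>: "0 < \<tau>"
 shows "(pos_smooth \<tau> has_real_derivative pos_smooth' \<tau> s) (at s)"
proof (cases s "0::real" rule: linorder_cases)
 case less
 then have "((\<lambda>t. 0) has_real_derivative 0) (at s)" "open {..<0::real}" "s \<in> {..<0}" by auto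
 from has_field_derivative_transform_within_open[OF this, of "pos_smooth \<tau>"] less \<tau>
 show ?thesis by (auto simp: pos_smooth_def pos_smooth'_def max_def)
next
 case greater
 have "((\<lambda>t. t\<^sup>2 / (t + \<tau>)) has_real_derivative pos_smooth' \<tau> s) (at s)"
 proof -
  have n: "(s + \<tau>)\<^sup>2 \<noteq> 0" using greater \<tau> by simp
  have "((\<lambda>t. t\<^sup>2 / (t + \<tau>)) has_real_derivative (2 * s * (s + \<tau>) - s\<^sup>2) / (s + \<tau>)\<^sup>2) (at s)"
   using greater \<tau> by (auto intro!: derivative_eq_intros simp: power2_eq_square)
  also have "(2 * s * (s + \<tau>) - s\<^sup>2) / (s + \<tau>)\<^sup>2 = ((s + \<tau>)\<^sup>2 - \<tau>\<^sup>2) / (s + \<tau>)\<^sup>2"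
   by (simp add: power2_eq_square algebra_simps)
  also have "\<dots> = pos_smooth' \<tau> s"
   using greater n by (simp add: pos_smooth'_def max_def diff_divide_distrib)
  finally show ?thesis .
 qed
 from has_field_derivative_transform_within_open[OF this, of "{0<..}" "pos_smooth \<tau>"] greater
 show ?thesis by (auto simp: pos_smooth_def max_def)
next
 case equal
 have "((\<lambda>h. pos_smooth \<tau> h / h) \<longlongrightarrow> 0) (at 0)"
 proof (rule Lim_null_comparison)
  show "\<forall>\<^sub>F h in at 0. norm (pos_smooth \<tau> h / h) \<le> \<bar>h\<bar> / \<tau>"
  proof (intro always_eventually allI)
   fix h :: real
   show "norm (pos_smooth \<tau> h / h) \<le> \<bar>h\<bar> / \<tau>"
   proof (cases "0 < h")
    case True
    then have "pos_smooth \<tau> h / h = h / (h + \<tau>)" by (simp add: pos_smooth_def max_def power2_eq_square)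
    also have "\<dots> \<le> h / \<tau>" using True \<tau> by (intro divide_left_mono) auto
    finally show ?thesis using True \<tau> by (simp add: pos_smooth_def)
   qed (use \<tau> in \<open>simp add: pos_smooth_def max_def divide_nonpos_pos\<close>)
  qed
  show "((\<lambda>h. \<bar>h\<bar> / \<tau>) \<longlongrightarrow> 0) (at 0)" using \<tau> by (auto intro!: tendsto_eq_intros)
 qed
 moreover have "pos_smooth' \<tau> 0 = 0" "pos_smooth \<tau> 0 = 0" using \<tau> by (simp_all add: pos_smooth'_def pos_smooth_def)
 ultimately show ?thesis using equal by (simp add: DERIV_def)
qed

lemma pos_smooth'_bounds: "0 < \<tau> ==> 0 \<le> pos_smooth' \<tau> s \<and> pos_smooth' \<tau> s \<le> 1"
 using power_mono[of \<tau> "max s 0 + \<tau>" 2] by (auto simp: pos_smooth'_def divide_le_eq)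

lemma weak_deriv_max_0:
 fixes u :: "'a::euclidean_space => real"
 assumes U: "open U" and e: "e \<in> Basis" and ug: "has_weak_deriv e U u g"
 shows "has_weak_deriv e U (\<lambda>z. max (u z) 0) (\<lambda>z. if 0 < u z then g z else 0)"
proof -
 define \<tau> where "\<tau> n = 1 / real (Suc n)" for n
 have \<tau>: "0 < \<tau> n" for n by (simp add: \<tau>_def)
 have \<tau>0: "\<tau> \<longlonglongrightarrow> 0" unfolding \<tau>_def by real_asymp
 have ul: "loc_integrable U u" and gl: "loc_integrable U g" using ug by (auto simp: has_weak_deriv_def)
 have wd: "has_weak_deriv e U (\<lambda>z. pos_smooth (\<tau> n) (u z)) (\<lambda>z. pos_smooth' (\<tau> n) (u z) * g z)" for n
 proof (rule weak_deriv_compose_C1[OF U e ug pos_smooth_has_derivative[OF \<tau>], of _ 1])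
  show "continuous_on UNIV (pos_smooth' (\<tau> n))"
   unfolding pos_smooth'_def using \<tau>[of n]
   by (intro continuous_intros) (auto simp: add_nonneg_pos less_imp_neq[symmetric])
  show "\<bar>pos_smooth' (\<tau> n) s\<bar> \<le> 1" for s using pos_smooth'_bounds[OF \<tau>, of n s] by (simp add: abs_le_iff)
 qed (simp add: pos_smooth_def)
 have limp: "(\<lambda>n. pos_smooth (\<tau> n) s) \<longlonglongrightarrow> max s 0" for s
 proof (cases "0 < s")
  case True
  have "(\<lambda>n. pos_smooth (\<tau> n) s) \<longlonglongrightarrow> (max s 0)\<^sup>2 / (max s 0 + 0)"
   unfolding pos_smooth_def using True by (intro tendsto_intros \<tau>0) auto
  then show ?thesis using True by (simp add: power2_eq_square)
 next
  case False
  then show ?thesis by (simp add: pos_smooth_def max_def)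
 qed
 have limp': "(\<lambda>n. pos_smooth' (\<tau> n) s) \<longlonglongrightarrow> (if 0 < s then 1 else 0)" for s
 proof (cases "0 < s")
  case True
  have "(\<lambda>n. pos_smooth' (\<tau> n) s) \<longlonglongrightarrow> 1 - 0\<^sup>2 / (max s 0 + 0)\<^sup>2"
   unfolding pos_smooth'_def using True by (intro tendsto_intros \<tau>0) auto
  then show ?thesis using True by simp
 next
  case False
  then have "pos_smooth' (\<tau> n) s = 0" for n using \<tau>[of n] by (simp add: pos_smooth'_def max_def)
  then show ?thesis using False by simp
 qed
 have bndp: "\<bar>pos_smooth (\<tau> n) s - max s 0\<bar> \<le> \<bar>s\<bar>" for n s
 proof (cases "0 < s")
  case True
  have "0 \<le> pos_smooth (\<tau> n) s" using \<tau>[of n] by (simp add: pos_smooth_def)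
  moreover have "pos_smooth (\<tau> n) s \<le> s"
   using True \<tau>[of n] by (simp add: pos_smooth_def max_def divide_le_eq power2_eq_square)
  ultimately show ?thesis using True by simp
 qed (simp add: pos_smooth_def max_def)
 have bndp': "\<bar>pos_smooth' (\<tau> n) s * t - (if 0 < s then t else 0)\<bar> \<le> \<bar>t\<bar>" for n s t
 proof -
  have "\<bar>pos_smooth' (\<tau> n) s * t - (if 0 < s then t else 0)\<bar> = \<bar>pos_smooth' (\<tau> n) s - (if 0 < s then 1 else 0)\<bar> * \<bar>t\<bar>"
   by (simp add: left_diff_distrib flip: abs_mult)
  also have "\<dots> \<le> 1 * \<bar>t\<bar>"
   using pos_smooth'_bounds[OF \<tau>, of n s] by (intro mult_right_mono) auto
  finally show ?thesis by simp
 qed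
 have vl: "loc_integrable U (\<lambda>z. max (u z) 0)"
  unfolding loc_integrable_def set_integrable_def
 proof (intro allI impI)
  fix K assume K: "compact K" "K \<subseteq> U"
  have "integrable lebesgue (\<lambda>z. max (indicator K z * u z) 0)" by (intro integrable_max loc_integrableD[OF ul K]) simp
  moreover have "max (indicator K z * u z) 0 = indicator K z *\<^sub>R max (u z) 0" for z by (simp add: indicator_def)
  ultimately show "integrable lebesgue (\<lambda>z. indicator K z *\<^sub>R max (u z) 0)" by simp
 qed
 have hl: "loc_integrable U (\<lambda>z. if 0 < u z then g z else 0)"
  unfolding loc_integrable_def set_integrable_def
 proof (intro allI impI)
  fix K assume K: "compact K" "K \<subseteq> U"
  note [measurable] = borel_measurable_integrable[OF loc_integrableD[OF ul K]]
  have "integrable lebesgue (\<lambda>z. (if 0 < indicator K z * u z then 1 else 0) * (indicator K z * g z))"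
   by (rule integrable_bounded_mult[OF loc_integrableD[OF gl K], of _ 1]) auto
  moreover have "(if 0 < indicator K z * u z then 1 else 0) * (indicator K z * g z) =
    indicator K z *\<^sub>R (if 0 < u z then g z else 0)" for z by (simp add: indicator_def)
  ultimately show "integrable lebesgue (\<lambda>z. indicator K z *\<^sub>R (if 0 < u z then g z else 0))" by simp
 qed
 have lim: "(\<lambda>n. LINT z|lebesgue. indicator K z * \<bar>w n z - v z\<bar>) \<longlonglongrightarrow> 0"
  if K: "compact K" "K \<subseteq> U" and w: "\<And>n. loc_integrable U (w n)" and v: "loc_integrable U v"
   and d: "loc_integrable U d" and le: "\<And>n z. \<bar>w n z - v z\<bar> \<le> \<bar>d z\<bar>" and l: "\<And>z. (\<lambda>n. w n z) \<longlonglongrightarrow> v z"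
  for K :: "'a set" and w :: "nat => 'a => real" and v d
 proof -
  have "(\<lambda>n. LINT z|lebesgue. indicator K z * \<bar>w n z - v z\<bar>) \<longlonglongrightarrow> (LINT z|(lebesgue::'a measure). (0::real))"
  proof (rule integral_dominated_convergence[where w="\<lambda>z. \<bar>indicator K z * d z\<bar>"])
   show "(\<lambda>z. indicator K z * \<bar>w n z - v z\<bar>) \<in> borel_measurable lebesgue" for n
   proof -
    have "(\<lambda>z. \<bar>indicator K z * w n z - indicator K z * v z\<bar>) \<in> borel_measurable lebesgue"
     using borel_measurable_integrable[OF loc_integrableD[OF w K]] borel_measurable_integrable[OF loc_integrableD[OF v K]]
     by measurable
    moreover have "\<bar>indicator K z * w n z - indicator K z * v z\<bar> = indicator K z * \<bar>w n z - v z\<bar>" for z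
     by (simp add: indicator_def)
    ultimately show ?thesis by simp
   qed
   show "AE z in lebesgue. (\<lambda>n. indicator K z * \<bar>w n z - v z\<bar>) \<longlonglongrightarrow> 0"
   proof (rule AE_I2)
    fix z
    have "(\<lambda>n. indicator K z * \<bar>w n z - v z\<bar>) \<longlonglongrightarrow> indicator K z * \<bar>v z - v z\<bar>"
     by (intro tendsto_intros l)
    then show "(\<lambda>n. indicator K z * \<bar>w n z - v z\<bar>) \<longlonglongrightarrow> 0" by simp
   qed
   show "AE z in lebesgue. norm (indicator K z * \<bar>w n z - v z\<bar>) \<le> \<bar>indicator K z * d z\<bar>" for n
    using le by (intro AE_I2) (simp add: indicator_def)
  qed (use loc_integrableD[OF d K] in simp_all)
  then show ?thesis by simp
 qed
 show ?thesis
 proof (rule weak_deriv_L1_limit[OF U e wd vl hl])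
  fix K assume K: "compact K" "K \<subseteq> U"
  show "(\<lambda>n. LINT z|lebesgue. indicator K z * \<bar>pos_smooth (\<tau> n) (u z) - max (u z) 0\<bar>) \<longlonglongrightarrow> 0"
   using wd by (intro lim[OF K _ vl ul bndp limp]) (auto simp: has_weak_deriv_def)
  show "(\<lambda>n. LINT z|lebesgue. indicator K z * \<bar>pos_smooth' (\<tau> n) (u z) * g z - (if 0 < u z then g z else 0)\<bar>) \<longlonglongrightarrow> 0"
  proof (rule lim[OF K _ hl gl bndp'])
   show "(\<lambda>n. pos_smooth' (\<tau> n) (u z) * g z) \<longlonglongrightarrow> (if 0 < u z then g z else 0)" for z
    using tendsto_mult[OF limp'[of "u z"] tendsto_const[of "g z"]] by (auto split: if_splits)
  qed (use wd in \<open>auto simp: has_weak_deriv_def\<close>)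
 qed
qed

section \<open>The weighted Sobolev space\<close>

instantiation "fun" :: (type, real_vector) real_vector
begin

definition scaleR_fun :: "real => ('a => 'b) => 'a => 'b" where
 "scaleR_fun c f = (\<lambda>x. c *\<^sub>R f x)"

instance
 by standard (auto simp: scaleR_fun_def fun_eq_iff algebra_simps)

end

text \<open>A subsequence whose consecutive squared distances are below \<open>(1/4)^k\<close> converges almost everywhere,
 because \<open>\<bar>t\<bar> \<le> (1/2)^k + 2^k * t\<^sup>2\<close> makes its increments summable. Fatou's lemma shows that the limit is
 also the limit in the mean square.\<close>

lemma L2_complete:
 fixes f :: "nat => 'a => real"
 assumes [measurable]: "\<And>n. f n \<in> borel_measurable M"
  and sq: "\<And>m n. integrable M (\<lambda>x. (f m x - f n x)\<^sup>2)"
  and cau: "\<And>e. 0 < e ==> \<exists>N. \<forall>m\<ge>N. \<forall>n\<ge>N. (LINT x|M. (f m x - f n x)\<^sup>2) < e"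
 obtains g where "g \<in> borel_measurable M" "\<And>n. integrable M (\<lambda>x. (f n x - g x)\<^sup>2)"
  "(\<lambda>n. LINT x|M. (f n x - g x)\<^sup>2) \<longlonglongrightarrow> 0"
proof -
 have nn: "(\<integral>\<^sup>+ x. ennreal ((f m x - f n x)\<^sup>2) \<partial>M) = ennreal (LINT x|M. (f m x - f n x)\<^sup>2)" for m n
  using sq by (intro nn_integral_eq_integral) auto
 have "\<exists>N. \<forall>m\<ge>N. \<forall>n\<ge>N. (LINT x|M. (f m x - f n x)\<^sup>2) < (1/4)^k" for k
  by (rule cau) simp
 then obtain N where N: "\<And>k m n. m \<ge> N k ==> n \<ge> N k ==> (LINT x|M. (f m x - f n x)\<^sup>2) < (1/4)^k"
  by metis
 define r where "r = rec_nat (N 0) (\<lambda>k rk. max (Suc rk) (N (Suc k)))"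
 have r: "r 0 = N 0" "r (Suc k) = max (Suc (r k)) (N (Suc k))" for k by (simp_all add: r_def)
 have rN: "N k \<le> r k" for k by (cases k) (auto simp: r)
 have "strict_mono r" by (rule strict_monoI_Suc) (simp add: r)
 then have r_ge: "k \<le> r k" for k by (rule strict_mono_imp_increasing)
 have rmono: "r k \<le> r (Suc k)" for k by (simp add: r)
 define \<Delta> where "\<Delta> k x = f (r (Suc k)) x - f (r k) x" for k x
 have [measurable]: "\<Delta> k \<in> borel_measurable M" for k unfolding \<Delta>_def[abs_def] by measurable
 have "(\<integral>\<^sup>+ x. (\<Sum>k. ennreal (2^k * (\<Delta> k x)\<^sup>2)) \<partial>M) = (\<Sum>k. \<integral>\<^sup>+ x. ennreal (2^k * (\<Delta> k x)\<^sup>2) \<partial>M)"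
  by (intro nn_integral_suminf) measurable
 also have "\<dots> \<le> (\<Sum>k. ennreal ((1/2)^k))"
 proof (intro suminf_le summableI)
  fix k
  have "(\<integral>\<^sup>+ x. ennreal (2^k * (\<Delta> k x)\<^sup>2) \<partial>M) = ennreal (2^k) * (\<integral>\<^sup>+ x. ennreal ((\<Delta> k x)\<^sup>2) \<partial>M)"
   by (subst nn_integral_cmult[symmetric]) (auto simp: ennreal_mult)
  also have "\<dots> \<le> ennreal (2^k) * ennreal ((1/4)^k)"
   unfolding \<Delta>_def nn using N[of k "r (Suc k)" "r k"] rN[of k] rmono[of k]
   by (intro mult_left_mono ennreal_leI) auto
  also have "\<dots> = ennreal ((1/2)^k)" by (simp add: ennreal_mult[symmetric] power_mult_distrib[symmetric])
  finally show "(\<integral>\<^sup>+ x. ennreal (2^k * (\<Delta> k x)\<^sup>2) \<partial>M) \<le> ennreal ((1/2)^k)" .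
 qed
 also have "\<dots> < \<infinity>" by (subst suminf_ennreal2) (auto intro: summable_geometric)
 finally have "AE x in M. (\<Sum>k. ennreal (2^k * (\<Delta> k x)\<^sup>2)) \<noteq> \<infinity>"
  by (intro nn_integral_noteq_infinite) auto
 then have ae: "AE x in M. convergent (\<lambda>k. f (r k) x)"
 proof (rule eventually_mono)
  fix x assume "(\<Sum>k. ennreal (2^k * (\<Delta> k x)\<^sup>2)) \<noteq> \<infinity>"
  then have s1: "summable (\<lambda>k. 2^k * (\<Delta> k x)\<^sup>2)" by (intro summable_suminf_not_top) auto
  have "summable (\<lambda>k. \<Delta> k x)"
  proof (rule summable_comparison_test)
   show "summable (\<lambda>k. (1/2)^k + 2^k * (\<Delta> k x)\<^sup>2)" using s1 by (intro summable_add summable_geometric) auto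
   have "\<bar>\<Delta> k x\<bar> \<le> (1/2)^k + 2^k * (\<Delta> k x)\<^sup>2" for k
   proof (cases "\<bar>\<Delta> k x\<bar> \<le> (1/2)^k")
    case False
    then have "1 \<le> 2^k * \<bar>\<Delta> k x\<bar>" by (simp add: power_divide field_simps)
    then have "1 * \<bar>\<Delta> k x\<bar> \<le> 2^k * \<bar>\<Delta> k x\<bar> * \<bar>\<Delta> k x\<bar>" by (intro mult_right_mono) auto
    moreover have "2^k * \<bar>\<Delta> k x\<bar> * \<bar>\<Delta> k x\<bar> = 2^k * (\<Delta> k x)\<^sup>2" by (simp add: power2_eq_square)
    moreover have "(0::real) \<le> (1/2)^k" by simp
    ultimately show ?thesis by linarith
   qed (simp add: add_increasing2)
   then show "\<exists>N. \<forall>k\<ge>N. norm (\<Delta> k x) \<le> (1/2)^k + 2^k * (\<Delta> k x)\<^sup>2" by auto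
  qed
  then have "convergent (\<lambda>n. \<Sum>k<n. \<Delta> k x)" by (simp add: summable_iff_convergent)
  moreover have "(\<Sum>k<n. \<Delta> k x) = f (r n) x - f (r 0) x" for n
   unfolding \<Delta>_def by (rule sum_lessThan_telescope)
  ultimately have "convergent (\<lambda>n. (f (r n) x - f (r 0) x) + f (r 0) x)"
   by (intro convergent_add convergent_const) simp
  then show "convergent (\<lambda>k. f (r k) x)" by simp
 qed
 define g where "g x = lim (\<lambda>k. f (r k) x)" for x
 have [measurable]: "g \<in> borel_measurable M" unfolding g_def[abs_def] by measurable
 have lim: "AE x in M. (\<lambda>k. f (r k) x) \<longlonglongrightarrow> g x"
  using ae by eventually_elim (simp add: g_def convergent_LIMSEQ_iff)
 have est: "(\<integral>\<^sup>+ x. ennreal ((f m x - g x)\<^sup>2) \<partial>M) \<le> ennreal e"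
  if m: "\<forall>n\<ge>N'. (LINT x|M. (f m x - f n x)\<^sup>2) < e" for m N' e
 proof -
  have "(\<integral>\<^sup>+ x. ennreal ((f m x - g x)\<^sup>2) \<partial>M) = (\<integral>\<^sup>+ x. liminf (\<lambda>k. ennreal ((f m x - f (r k) x)\<^sup>2)) \<partial>M)"
  proof (rule nn_integral_cong_AE)
   show "AE x in M. ennreal ((f m x - g x)\<^sup>2) = liminf (\<lambda>k. ennreal ((f m x - f (r k) x)\<^sup>2))"
    using lim
   proof eventually_elim
    fix x assume "(\<lambda>k. f (r k) x) \<longlonglongrightarrow> g x"
    then have "(\<lambda>k. ennreal ((f m x - f (r k) x)\<^sup>2)) \<longlonglongrightarrow> ennreal ((f m x - g x)\<^sup>2)"
     by (intro tendsto_intros)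
    then show "ennreal ((f m x - g x)\<^sup>2) = liminf (\<lambda>k. ennreal ((f m x - f (r k) x)\<^sup>2))"
     by (intro lim_imp_Liminf[symmetric]) auto
   qed
  qed
  also have "\<dots> \<le> liminf (\<lambda>k. \<integral>\<^sup>+ x. ennreal ((f m x - f (r k) x)\<^sup>2) \<partial>M)"
   by (intro nn_integral_liminf) measurable
  also have "\<dots> \<le> liminf (\<lambda>k::nat. ennreal e)"
  proof (rule Liminf_mono)
   show "\<forall>\<^sub>F k in sequentially. (\<integral>\<^sup>+ x. ennreal ((f m x - f (r k) x)\<^sup>2) \<partial>M) \<le> ennreal e"
    unfolding nn eventually_sequentially
   proof (intro exI[of _ N'] allI impI ennreal_leI less_imp_le)
    fix k assume "N' \<le> k"
    then have "N' \<le> r k" using r_ge[of k] by linarith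
    then show "(LINT x|M. (f m x - f (r k) x)\<^sup>2) < e" using m by simp
   qed
  qed
  also have "\<dots> = ennreal e" by (simp add: Liminf_const)
  finally show ?thesis .
 qed
 obtain N1 where N1: "\<forall>m\<ge>N1. \<forall>n\<ge>N1. (LINT x|M. (f m x - f n x)\<^sup>2) < 1" using cau[of 1] by auto
 have i1: "integrable M (\<lambda>x. (f N1 x - g x)\<^sup>2)"
 proof (rule integrableI_bounded)
  have "(\<integral>\<^sup>+ x. ennreal (norm ((f N1 x - g x)\<^sup>2)) \<partial>M) \<le> ennreal 1" using est[of N1 N1 1] N1 by simp
  also have "\<dots> < \<infinity>" by simp
  finally show "(\<integral>\<^sup>+ x. ennreal (norm ((f N1 x - g x)\<^sup>2)) \<partial>M) < \<infinity>" .
 qed measurable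
 have gi: "integrable M (\<lambda>x. (f n x - g x)\<^sup>2)" for n
 proof (rule Bochner_Integration.integrable_bound)
  show "integrable M (\<lambda>x. 2 * (f n x - f N1 x)\<^sup>2 + 2 * (f N1 x - g x)\<^sup>2)" using sq i1 by simp
  show "AE x in M. norm ((f n x - g x)\<^sup>2) \<le> norm (2 * (f n x - f N1 x)\<^sup>2 + 2 * (f N1 x - g x)\<^sup>2)"
  proof (rule AE_I2)
   fix x
   have "0 \<le> ((f n x - f N1 x) - (f N1 x - g x))\<^sup>2" by simp
   then have "(f n x - g x)\<^sup>2 \<le> 2 * (f n x - f N1 x)\<^sup>2 + 2 * (f N1 x - g x)\<^sup>2"
    by (simp add: power2_eq_square algebra_simps)
   then show "norm ((f n x - g x)\<^sup>2) \<le> norm (2 * (f n x - f N1 x)\<^sup>2 + 2 * (f N1 x - g x)\<^sup>2)" by simp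
  qed
 qed measurable
 have "(\<lambda>n. LINT x|M. (f n x - g x)\<^sup>2) \<longlonglongrightarrow> 0"
 proof (rule LIMSEQ_I)
  fix e :: real assume e: "0 < e"
  then obtain N' where N': "\<forall>m\<ge>N'. \<forall>n\<ge>N'. (LINT x|M. (f m x - f n x)\<^sup>2) < e / 2"
   using cau[of "e / 2"] by auto
  have "(LINT x|M. (f m x - g x)\<^sup>2) \<le> e / 2" if "m \<ge> N'" for m
  proof -
   have "ennreal (LINT x|M. (f m x - g x)\<^sup>2) = (\<integral>\<^sup>+ x. ennreal ((f m x - g x)\<^sup>2) \<partial>M)"
    using gi by (intro nn_integral_eq_integral[symmetric]) auto
   also have "\<dots> \<le> ennreal (e / 2)" by (rule est) (use N' that in blast)
   finally show ?thesis using e by simp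
  qed
  then show "\<exists>no. \<forall>n\<ge>no. norm ((LINT x|M. (f n x - g x)\<^sup>2) - 0) < e"
   using e by (intro exI[of _ N']) fastforce
 qed
 then show thesis using gi by (intro that[of g]) auto
qed

locale weighted_domain =
 fixes U :: "(real \<times> real) set" and w :: "real \<times> real => real"
 assumes open_U: "open U" and U_half: "U \<subseteq> half_plane"
  and w_cont: "continuous_on half_plane w" and w_pos: "\<And>z. z \<in> half_plane ==> 0 < w z"
begin

definition W :: "(real \<times> real) measure" where
 "W = density (lebesgue_on U) (\<lambda>z. ennreal (w z))"

lemma U_lebesgue [measurable, simp]: "U \<in> sets lebesgue"
 using open_U by auto

lemma snd_pos: "z \<in> U ==> 0 < snd z"
 using U_half by (auto simp: half_plane_def)

lemma w_pos': "z \<in> U ==> 0 < w z"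
 using U_half w_pos by blast

lemma space_W [simp]: "space W = U"
 by (simp add: W_def)

lemma borel_W: "f \<in> borel_measurable W \<longleftrightarrow> f \<in> borel_measurable (lebesgue_on U)"
 by (simp add: W_def)

lemma continuous_borel_W:
 assumes "continuous_on U f" shows "(f :: _ => real) \<in> borel_measurable W"
 unfolding borel_W using assms by (rule continuous_imp_measurable_on_sets_lebesgue) simp

lemma snd_W [measurable]: "snd \<in> borel_measurable W" "fst \<in> borel_measurable W"
 by (auto intro!: continuous_borel_W continuous_intros)

lemma w_borel: "w \<in> borel_measurable (lebesgue_on U)"
 using continuous_borel_W[OF continuous_on_subset[OF w_cont U_half]] by (simp add: borel_W)

lemma AE_W: "(AE z in W. P z) \<longleftrightarrow> (AE z in lebesgue_on U. P z)"
proof -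
 have "(AE z in W. P z) \<longleftrightarrow> (AE z in lebesgue_on U. 0 < ennreal (w z) \<longrightarrow> P z)"
  unfolding W_def using w_borel by (subst AE_density) auto
 also have "\<dots> \<longleftrightarrow> (AE z in lebesgue_on U. P z)"
 proof (intro iffI)
  assume "AE z in lebesgue_on U. 0 < ennreal (w z) \<longrightarrow> P z"
  moreover have "AE z in lebesgue_on U. z \<in> U" using AE_space[of "lebesgue_on U"] by simp
  ultimately show "AE z in lebesgue_on U. P z" by eventually_elim (simp add: w_pos')
 qed auto
 finally show ?thesis .
qed

lemma integral_W:
 assumes "f \<in> borel_measurable W"
 shows "(LINT z|W. f z) = (LINT z:U|lebesgue. w z * (f z :: real))"
proof -
 have ae: "AE z in lebesgue_on U. 0 \<le> w z"
  using w_pos' by (intro AE_I2) (auto intro: less_imp_le)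
 have "(LINT z|W. f z) = (LINT z|lebesgue_on U. w z * f z)"
  unfolding W_def using assms w_borel ae by (subst integral_density) (auto simp: borel_W)
 then show ?thesis by (simp add: integral_restrict_space set_lebesgue_integral_def)
qed

lemma integrable_W:
 assumes "f \<in> borel_measurable W"
 shows "integrable W f \<longleftrightarrow> set_integrable lebesgue U (\<lambda>z. w z * (f z :: real))"
proof -
 have ae: "AE z in lebesgue_on U. 0 \<le> w z"
  using w_pos' by (intro AE_I2) (auto intro: less_imp_le)
 have "integrable W f \<longleftrightarrow> integrable (lebesgue_on U) (\<lambda>z. w z * f z)"
  unfolding W_def using assms w_borel ae by (subst integrable_density) (auto simp: borel_W)
 then show ?thesis by (simp add: integrable_restrict_space set_integrable_def)
qed

lemma loc_integrable_borel_W: "loc_integrable U u ==> u \<in> borel_measurable W"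
 unfolding borel_W by (rule loc_integrable_borel_measurable[OF open_U])

lemma weight_lower_bound:
 assumes "compact K" "K \<subseteq> U"
 obtains c where "0 < c" "\<And>z. z \<in> K ==> c \<le> w z * snd z"
proof (cases "K = {}")
 case False
 have "continuous_on K (\<lambda>z. w z * snd z)"
  using assms U_half by (intro continuous_intros continuous_on_subset[OF w_cont]) auto
 from continuous_attains_inf[OF assms(1) False this]
 obtain x where "x \<in> K" "\<And>z. z \<in> K ==> w x * snd x \<le> w z * snd z" by blast
 moreover from this have "x \<in> U" using assms(2) by blast
 ultimately show thesis by (intro that[of "w x * snd x"] mult_pos_pos w_pos' snd_pos)
qed (use that[of 1] in simp)

text \<open>On compact subsets of the open domain the degenerate weight is bounded below, so there the weighted mean
 square controls the mean.\<close>

lemma L1_on_compact: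
 assumes K: "compact K" "K \<subseteq> U" and c: "0 < c" "\<And>z. z \<in> K ==> c \<le> w z * snd z"
  and g: "g \<in> borel_measurable W" "integrable W (\<lambda>z. snd z * (g z)\<^sup>2)" and e: "0 < e"
 shows "integrable lebesgue (\<lambda>z. indicator K z * \<bar>g z\<bar>)"
  "(LINT z|lebesgue. indicator K z * \<bar>g z\<bar>) \<le> e * measure lebesgue K + (LINT z|W. snd z * (g z)\<^sup>2) / (c * e)"
proof -
 have m [measurable]: "(\<lambda>z. snd z * (g z)\<^sup>2) \<in> borel_measurable W" using g(1) by measurable
 have i: "integrable lebesgue (\<lambda>z. indicator U z *\<^sub>R (w z * (snd z * (g z)\<^sup>2)))"
  using g(2) unfolding integrable_W[OF m] set_integrable_def .
 have fin: "emeasure lebesgue K < \<infinity>" using lmeasurable_compact[OF K(1)] by (auto simp only: fmeasurable_def infinity_ennreal_def)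
 have Ks: "K \<in> sets lebesgue" using K(1) by (simp add: compact_imp_closed)
 have iK: "integrable lebesgue (\<lambda>z. indicator K z :: real)" using fin Ks by simp
 have le: "indicator K z * \<bar>g z\<bar> \<le> e * indicator K z + 1 / (c * e) * (indicator U z *\<^sub>R (w z * (snd z * (g z)\<^sup>2)))" for z
 proof (cases "z \<in> K")
  case True
  then have zU: "z \<in> U" using K(2) by auto
  have "\<bar>g z\<bar> \<le> e + (g z)\<^sup>2 / e"
  proof -
   have "0 \<le> (e - \<bar>g z\<bar>) * (e - \<bar>g z\<bar>)" "0 \<le> e * \<bar>g z\<bar>" using e by simp_all
   then have "e * \<bar>g z\<bar> \<le> e * e + \<bar>g z\<bar> * \<bar>g z\<bar>"
    unfolding left_diff_distrib right_diff_distrib by (simp add: mult.commute)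
   then show ?thesis using e by (simp add: field_simps power2_eq_square)
  qed
  also have "(g z)\<^sup>2 / e \<le> 1 / (c * e) * (w z * (snd z * (g z)\<^sup>2))"
  proof -
   have "c * (g z)\<^sup>2 \<le> w z * snd z * (g z)\<^sup>2" using c(2)[OF True] by (intro mult_right_mono) auto
   then show ?thesis using c(1) e by (simp add: field_simps)
  qed
  finally show ?thesis using True zU by simp
 next
  case False
  have "0 \<le> indicator U z *\<^sub>R (w z * (snd z * (g z)\<^sup>2))"
   using snd_pos[of z] w_pos'[of z] by (auto simp: indicator_def)
  then show ?thesis using False c e by simp
 qed
 have gm: "(\<lambda>z. indicator U z * g z) \<in> borel_measurable lebesgue"
  using g(1) unfolding borel_W by (subst (asm) borel_measurable_restrict_space_iff) auto
 have eq: "indicator K z * \<bar>g z\<bar> = indicator K z * \<bar>indicator U z * g z\<bar>" for z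
  using K(2) by (auto simp: indicator_def)
 have m2: "(\<lambda>z. indicator K z * \<bar>g z\<bar>) \<in> borel_measurable lebesgue"
  unfolding eq using gm Ks by measurable
 show int: "integrable lebesgue (\<lambda>z. indicator K z * \<bar>g z\<bar>)"
 proof (rule Bochner_Integration.integrable_bound[OF _ m2])
  show "integrable lebesgue (\<lambda>z. e * indicator K z + 1 / (c * e) * (indicator U z *\<^sub>R (w z * (snd z * (g z)\<^sup>2))))"
   using iK i by (intro Bochner_Integration.integrable_add integrable_mult_right)
  show "AE z in lebesgue. norm (indicator K z * \<bar>g z\<bar>) \<le>
    norm (e * indicator K z + 1 / (c * e) * (indicator U z *\<^sub>R (w z * (snd z * (g z)\<^sup>2))))"
  proof (rule AE_I2)
   fix z
   have "0 \<le> indicator K z * \<bar>g z\<bar>" by (simp add: indicator_def)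
   with le[of z] show "norm (indicator K z * \<bar>g z\<bar>) \<le>
    norm (e * indicator K z + 1 / (c * e) * (indicator U z *\<^sub>R (w z * (snd z * (g z)\<^sup>2))))"
    unfolding real_norm_def by linarith
  qed
 qed
 have "(LINT z|lebesgue. indicator K z * \<bar>g z\<bar>) \<le>
   (LINT z|lebesgue. e * indicator K z + 1 / (c * e) * (indicator U z *\<^sub>R (w z * (snd z * (g z)\<^sup>2))))"
  using int iK i le by (intro integral_mono Bochner_Integration.integrable_add integrable_mult_right)
 also have "\<dots> = e * measure lebesgue K + 1 / (c * e) * (LINT z|W. snd z * (g z)\<^sup>2)"
  using iK i Ks unfolding integral_W[OF m] set_lebesgue_integral_def by simp
 finally show "(LINT z|lebesgue. indicator K z * \<bar>g z\<bar>) \<le>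
   e * measure lebesgue K + (LINT z|W. snd z * (g z)\<^sup>2) / (c * e)" by simp
qed

lemma L2_imp_loc_integrable:
 assumes "g \<in> borel_measurable W" "integrable W (\<lambda>z. snd z * (g z)\<^sup>2)"
 shows "loc_integrable U g"
 unfolding loc_integrable_def set_integrable_def
proof (intro allI impI)
 fix K assume K: "compact K" "K \<subseteq> U"
 obtain c where c: "0 < c" "\<And>z. z \<in> K ==> c \<le> w z * snd z" using weight_lower_bound[OF K] by blast
 have gm: "(\<lambda>z. indicator U z * g z) \<in> borel_measurable lebesgue"
  using assms(1) unfolding borel_W by (subst (asm) borel_measurable_restrict_space_iff) auto
 have Ks: "K \<in> sets lebesgue" using K(1) by (simp add: compact_imp_closed)
 have eq: "indicator K z *\<^sub>R g z = indicator K z * (indicator U z * g z)" for z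
  using K(2) by (auto simp: indicator_def)
 have "(\<lambda>z. indicator K z *\<^sub>R g z) \<in> borel_measurable lebesgue" unfolding eq using gm Ks by measurable
 then show "integrable lebesgue (\<lambda>z. indicator K z *\<^sub>R g z)"
  by (rule Bochner_Integration.integrable_bound[OF L1_on_compact(1)[OF K c assms, of 1, simplified]])
   (auto simp: indicator_def)
qed

lemma L2_imp_L1_loc_limit:
 assumes g: "\<And>n. g n \<in> borel_measurable W" "h \<in> borel_measurable W"
  and i: "\<And>n. integrable W (\<lambda>z. snd z * (g n z - h z)\<^sup>2)"
  and lim: "(\<lambda>n. LINT z|W. snd z * (g n z - h z)\<^sup>2) \<longlonglongrightarrow> 0"
  and K: "compact K" "K \<subseteq> U"
 shows "(\<lambda>n. LINT z|lebesgue. indicator K z * \<bar>g n z - h z\<bar>) \<longlonglongrightarrow> 0"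
proof -
 obtain c where c: "0 < c" "\<And>z. z \<in> K ==> c \<le> w z * snd z" using weight_lower_bound[OF K] by blast
 have m: "(\<lambda>z. g n z - h z) \<in> borel_measurable W" for n using g by measurable
 define a where "a n = (LINT z|W. snd z * (g n z - h z)\<^sup>2)" for n
 show ?thesis
 proof (rule LIMSEQ_I)
  fix e :: real assume e: "0 < e"
  define V where "V = measure lebesgue K"
  have V: "0 \<le> V" by (simp add: V_def)
  define d where "d = e / (2 * (V + 1))"
  have d: "0 < d" using e V by (simp add: d_def)
  have "0 < c * d * (e / 2)" using c d e by simp
  then obtain N where N: "\<And>n. n \<ge> N ==> a n < c * d * (e / 2)"
   using order_tendstoD(2)[OF lim] unfolding a_def eventually_sequentially by metis
  have "norm ((LINT z|lebesgue. indicator K z * \<bar>g n z - h z\<bar>) - 0) < e" if "n \<ge> N" for n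
  proof -
   have "(LINT z|lebesgue. indicator K z * \<bar>g n z - h z\<bar>) \<le> d * V + a n / (c * d)"
    unfolding a_def V_def by (rule L1_on_compact(2)[OF K c m i d])
   also have "a n / (c * d) < e / 2" using N[OF that] c d by (simp add: field_simps)
   also have "d * V \<le> e / 2" using V e by (simp add: d_def field_simps)
   finally have "(LINT z|lebesgue. indicator K z * \<bar>g n z - h z\<bar>) < e" by simp
   moreover have "0 \<le> (LINT z|lebesgue. indicator K z * \<bar>g n z - h z\<bar>)"
    by (intro integral_nonneg_AE AE_I2) (simp add: indicator_def)
   ultimately show ?thesis by simp
  qed
  then show "\<exists>no. \<forall>n\<ge>no. norm ((LINT z|lebesgue. indicator K z * \<bar>g n z - h z\<bar>) - 0) < e" by blast
 qed
qed

end

lemma C0_infinity_lincomb: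
 assumes "\<phi> \<in> C0_infinity U S" "\<psi> \<in> C0_infinity U S"
 shows "(\<lambda>z. a * \<phi> z + b * \<psi> z) \<in> C0_infinity U S"
proof -
 let ?A = "closure {z\<in>S. \<phi> z \<noteq> 0}" and ?B = "closure {z\<in>S. \<psi> z \<noteq> 0}"
  and ?C = "closure {z\<in>S. a * \<phi> z + b * \<psi> z \<noteq> 0}"
 have AB: "compact ?A" "?A \<subseteq> S" "compact ?B" "?B \<subseteq> S" using assms by (auto simp: C0_infinity_def)
 have sub: "?C \<subseteq> ?A \<union> ?B"
 proof (rule closure_minimal)
  have "{z\<in>S. a * \<phi> z + b * \<psi> z \<noteq> 0} \<subseteq> {z\<in>S. \<phi> z \<noteq> 0} \<union> {z\<in>S. \<psi> z \<noteq> 0}" by auto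
  also have "\<dots> \<subseteq> ?A \<union> ?B" by (intro Un_mono closure_subset)
  finally show "{z\<in>S. a * \<phi> z + b * \<psi> z \<noteq> 0} \<subseteq> ?A \<union> ?B" .
 qed auto
 have "compact (?A \<union> ?B)" using AB by (intro compact_Un)
 then have "compact ?C"
  using compact_Int_closed[of "?A \<union> ?B" ?C] sub by (simp add: Int_absorb1)
 moreover have "Ck_upto k U S (\<lambda>z. a * \<phi> z + b * \<psi> z)" for k
  using assms by (intro Ck_upto_add Ck_upto_mult Ck_upto_const) (auto simp: C0_infinity_def simp del: Ck_upto.simps)
 ultimately show ?thesis using sub AB unfolding C0_infinity_def by blast
qed

lemma Basis_real2: "(1, 0) \<in> (Basis :: (real \<times> real) set)" "(0, 1) \<in> (Basis :: (real \<times> real) set)"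
 by (auto simp: Basis_prod_def)

lemma Basis_real2_cases: "e \<in> (Basis :: (real \<times> real) set) ==> e = (1, 0) \<or> e = (0, 1)"
 by (auto simp: Basis_prod_def)

context weighted_domain
begin

text \<open>The representatives chosen by \<open>weak_deriv\<close> are known only up to null sets. Explicit pairs of weak
 derivatives are easier to compute with.\<close>

definition wd :: "(real \<times> real => real) => (real \<times> real => real) => (real \<times> real => real) => bool" where
 "wd u ux uy \<longleftrightarrow> has_weak_deriv (1, 0) U u ux \<and> has_weak_deriv (0, 1) U u uy"

definition dens :: "(real \<times> real => real) => (real \<times> real => real) => (real \<times> real => real) => real \<times> real => real" where
 "dens u ux uy z = snd z * ((ux z)\<^sup>2 + (uy z)\<^sup>2) + (1 + snd z) * (u z)\<^sup>2"

text \<open>The symmetric form that induces \<open>H1_norm\<close>. It is only semidefinite, since functions that agree almost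
 everywhere are not identified.\<close>

definition ip :: "(real \<times> real => real) => (real \<times> real => real) => real" where
 "ip u v = (LINT z|W. snd z * (Dx U u z * Dx U v z + Dy U u z * Dy U v z) + (1 + snd z) * (u z * v z))"

lemma weakly_differentiable_wd: "weakly_differentiable U u \<longleftrightarrow> (\<exists>ux uy. wd u ux uy)"
 unfolding weakly_differentiable_def wd_def using Basis_real2 Basis_real2_cases by blast

lemma wd_Dxy: "weakly_differentiable U u ==> wd u (Dx U u) (Dy U u)"
 unfolding weakly_differentiable_wd wd_def weak_deriv_def by (metis someI)

lemma wd_AE_unique:
 assumes "wd u ux uy" "wd u ux' uy'"
 shows "AE z in W. ux z = ux' z \<and> uy z = uy' z"
 using weak_deriv_unique[OF open_U, of "(1,0)" u ux ux'] weak_deriv_unique[OF open_U, of "(0,1)" u uy uy'] assms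
 unfolding AE_W wd_def by auto

lemma wd_AE: "wd u ux uy ==> AE z in W. Dx U u z = ux z \<and> Dy U u z = uy z"
 using wd_AE_unique[OF wd_Dxy] weakly_differentiable_wd by blast

lemma wd_cong_AE:
 assumes "wd u ux uy" "AE z in W. u z = u' z" "AE z in W. ux z = ux' z" "AE z in W. uy z = uy' z"
 shows "wd u' ux' uy'"
 using assms weak_deriv_cong_AE[OF open_U] unfolding wd_def AE_W by blast

lemma wd_borel:
 assumes "wd u ux uy"
 shows "u \<in> borel_measurable W" "ux \<in> borel_measurable W" "uy \<in> borel_measurable W"
 using assms loc_integrable_borel_W by (auto simp: wd_def has_weak_deriv_def)

lemma wd_lincomb:
 assumes "wd u ux uy" "wd v vx vy"
 shows "wd (\<lambda>z. a * u z + b * v z) (\<lambda>z. a * ux z + b * vx z) (\<lambda>z. a * uy z + b * vy z)"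
 using assms weak_deriv_lincomb[OF open_U Basis_real2(1)] weak_deriv_lincomb[OF open_U Basis_real2(2)]
 unfolding wd_def by blast

lemma snd_nonneg: "z \<in> U ==> 0 \<le> snd z"
 using snd_pos[of z] by (rule less_imp_le)

lemma snd1_W: "(\<lambda>z. 1 + snd z) \<in> borel_measurable W"
 by measurable

lemma snd_nonneg': "\<forall>z\<in>U. 0 \<le> snd z" and snd1_nonneg: "\<forall>z\<in>U. 0 \<le> 1 + snd z"
 using snd_nonneg by (blast intro: add_nonneg_nonneg zero_le_one)+

lemma L2_product:
 fixes k p q :: "real \<times> real => real"
 assumes "p \<in> borel_measurable W" "q \<in> borel_measurable W" "k \<in> borel_measurable W" "\<forall>z\<in>U. 0 \<le> k z"
  and i: "integrable W (\<lambda>z. k z * (p z)\<^sup>2)" "integrable W (\<lambda>z. k z * (q z)\<^sup>2)"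
 shows "integrable W (\<lambda>z. k z * (p z * q z))"
proof (rule Bochner_Integration.integrable_bound)
 show "integrable W (\<lambda>z. k z * (p z)\<^sup>2 + k z * (q z)\<^sup>2)" using i by simp
 show "(\<lambda>z. k z * (p z * q z)) \<in> borel_measurable W" using assms(1-3) by measurable
 show "AE z in W. norm (k z * (p z * q z)) \<le> norm (k z * (p z)\<^sup>2 + k z * (q z)\<^sup>2)"
 proof (rule AE_I2)
  fix z assume "z \<in> space W"
  then have k: "0 \<le> k z" using assms(4) by simp
  have "2 * \<bar>p z * q z\<bar> \<le> (p z)\<^sup>2 + (q z)\<^sup>2"
   using sum_squares_bound[of "\<bar>p z\<bar>" "\<bar>q z\<bar>"] by (simp add: abs_mult mult.assoc)
  then have "\<bar>p z * q z\<bar> \<le> (p z)\<^sup>2 + (q z)\<^sup>2" using abs_ge_zero[of "p z * q z"] by linarith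
  from mult_left_mono[OF this k] show "norm (k z * (p z * q z)) \<le> norm (k z * (p z)\<^sup>2 + k z * (q z)\<^sup>2)"
   using k by (simp add: abs_mult distrib_left)
 qed
qed

lemma integrable_W_mono:
 assumes "integrable W g" "f \<in> borel_measurable W" "\<And>z. z \<in> U ==> \<bar>f z\<bar> \<le> (g z :: real)"
 shows "integrable W (f :: _ => real)"
 by (rule Bochner_Integration.integrable_bound[OF assms(1,2)], rule AE_I2)
  (use assms(3) in \<open>fastforce\<close>)

lemma dens_integrable:
 assumes m: "u \<in> borel_measurable W" "ux \<in> borel_measurable W" "uy \<in> borel_measurable W"
 shows "integrable W (dens u ux uy) \<longleftrightarrow>
  integrable W (\<lambda>z. snd z * (ux z)\<^sup>2) \<and> integrable W (\<lambda>z. snd z * (uy z)\<^sup>2) \<and> integrable W (\<lambda>z. (1 + snd z) * (u z)\<^sup>2)"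
proof
 note [measurable] = m
 assume i: "integrable W (dens u ux uy)"
 have "0 \<le> snd z * (ux z)\<^sup>2 \<and> 0 \<le> snd z * (uy z)\<^sup>2 \<and> 0 \<le> (1 + snd z) * (u z)\<^sup>2" if "z \<in> U" for z
  using snd_nonneg[OF that] by simp
 then show "integrable W (\<lambda>z. snd z * (ux z)\<^sup>2) \<and> integrable W (\<lambda>z. snd z * (uy z)\<^sup>2) \<and> integrable W (\<lambda>z. (1 + snd z) * (u z)\<^sup>2)"
  by (intro conjI integrable_W_mono[OF i]; (measurable; fail)?) (auto simp: dens_def distrib_left abs_of_nonneg)
next
 assume "integrable W (\<lambda>z. snd z * (ux z)\<^sup>2) \<and> integrable W (\<lambda>z. snd z * (uy z)\<^sup>2) \<and> integrable W (\<lambda>z. (1 + snd z) * (u z)\<^sup>2)"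
 then show "integrable W (dens u ux uy)"
  unfolding dens_def[abs_def] by (simp add: distrib_left[of "snd _"])
qed

lemma H1_iff:
 assumes wd: "wd u ux uy" shows "u \<in> H1 U W \<longleftrightarrow> integrable W (dens u ux uy)"
proof -
 have w: "weakly_differentiable U u" using wd weakly_differentiable_wd by blast
 note [measurable] = wd_borel[OF wd] wd_borel[OF wd_Dxy[OF w]]
 have "integrable W (H1_density U u) \<longleftrightarrow> integrable W (dens u ux uy)"
 proof (rule integrable_cong_AE)
  show "H1_density U u \<in> borel_measurable W" unfolding H1_density_def[abs_def] by measurable
  show "dens u ux uy \<in> borel_measurable W" unfolding dens_def[abs_def] by measurable
  show "AE z in W. H1_density U u z = dens u ux uy z"
   using wd_AE[OF wd] by eventually_elim (simp add: H1_density_def dens_def)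
 qed
 with w show ?thesis by (simp add: H1_def)
qed

lemma H1D:
 assumes "u \<in> H1 U W"
 shows "wd u (Dx U u) (Dy U u)" "integrable W (\<lambda>z. snd z * (Dx U u z)\<^sup>2)"
  "integrable W (\<lambda>z. snd z * (Dy U u z)\<^sup>2)" "integrable W (\<lambda>z. (1 + snd z) * (u z)\<^sup>2)"
  "u \<in> borel_measurable W" "Dx U u \<in> borel_measurable W" "Dy U u \<in> borel_measurable W"
proof -
 show wd: "wd u (Dx U u) (Dy U u)" using assms wd_Dxy by (simp add: H1_def)
 show "u \<in> borel_measurable W" "Dx U u \<in> borel_measurable W" "Dy U u \<in> borel_measurable W"
  using wd_borel[OF wd] .
 then show "integrable W (\<lambda>z. snd z * (Dx U u z)\<^sup>2)"
  "integrable W (\<lambda>z. snd z * (Dy U u z)\<^sup>2)" "integrable W (\<lambda>z. (1 + snd z) * (u z)\<^sup>2)"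
  using H1_iff[OF wd] assms dens_integrable by auto
qed

lemma H1I:
 assumes "wd u ux uy" "integrable W (\<lambda>z. snd z * (ux z)\<^sup>2)" "integrable W (\<lambda>z. snd z * (uy z)\<^sup>2)"
  "integrable W (\<lambda>z. (1 + snd z) * (u z)\<^sup>2)"
 shows "u \<in> H1 U W"
 using assms H1_iff[OF assms(1)] dens_integrable[OF wd_borel[OF assms(1)]] by simp

lemma integrable_lincomb_square:
 fixes k p q :: "real \<times> real => real"
 assumes "p \<in> borel_measurable W" "q \<in> borel_measurable W" "k \<in> borel_measurable W" "\<forall>z\<in>U. 0 \<le> k z"
  and i: "integrable W (\<lambda>z. k z * (p z)\<^sup>2)" "integrable W (\<lambda>z. k z * (q z)\<^sup>2)"
 shows "integrable W (\<lambda>z. k z * (a * p z + b * q z)\<^sup>2)"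
proof -
 have "k z * (a * p z + b * q z)\<^sup>2 = a\<^sup>2 * (k z * (p z)\<^sup>2) + 2 * a * b * (k z * (p z * q z)) + b\<^sup>2 * (k z * (q z)\<^sup>2)" for z
  by (simp add: power2_eq_square algebra_simps)
 then show ?thesis using i L2_product[OF assms] by simp
qed

lemma H1_lincomb:
 assumes u: "u \<in> H1 U W" and v: "v \<in> H1 U W"
 shows "(\<lambda>z. a * u z + b * v z) \<in> H1 U W"
proof (rule H1I[OF wd_lincomb[OF H1D(1)[OF u] H1D(1)[OF v]]])
 show "integrable W (\<lambda>z. snd z * (a * Dx U u z + b * Dx U v z)\<^sup>2)"
  by (rule integrable_lincomb_square[OF H1D(6)[OF u] H1D(6)[OF v] snd_W(1) snd_nonneg' H1D(2)[OF u] H1D(2)[OF v]])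
 show "integrable W (\<lambda>z. snd z * (a * Dy U u z + b * Dy U v z)\<^sup>2)"
  by (rule integrable_lincomb_square[OF H1D(7)[OF u] H1D(7)[OF v] snd_W(1) snd_nonneg' H1D(3)[OF u] H1D(3)[OF v]])
 show "integrable W (\<lambda>z. (1 + snd z) * (a * u z + b * v z)\<^sup>2)"
  by (rule integrable_lincomb_square[OF H1D(5)[OF u] H1D(5)[OF v] snd1_W snd1_nonneg H1D(4)[OF u] H1D(4)[OF v]])
qed

lemma ip_integrable:
 assumes u: "u \<in> H1 U W" and v: "v \<in> H1 U W"
 shows "integrable W (\<lambda>z. snd z * (Dx U u z * Dx U v z))" "integrable W (\<lambda>z. snd z * (Dy U u z * Dy U v z))"
  "integrable W (\<lambda>z. (1 + snd z) * (u z * v z))"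
 using L2_product[OF H1D(6)[OF u] H1D(6)[OF v] snd_W(1) snd_nonneg' H1D(2)[OF u] H1D(2)[OF v]]
  L2_product[OF H1D(7)[OF u] H1D(7)[OF v] snd_W(1) snd_nonneg' H1D(3)[OF u] H1D(3)[OF v]]
  L2_product[OF H1D(5)[OF u] H1D(5)[OF v] snd1_W snd1_nonneg H1D(4)[OF u] H1D(4)[OF v]] .

lemma ip_integrable':
 assumes u: "u \<in> H1 U W" and v: "v \<in> H1 U W"
 shows "integrable W (\<lambda>z. snd z * (Dx U u z * Dx U v z + Dy U u z * Dy U v z) + (1 + snd z) * (u z * v z))"
 using ip_integrable[OF u v] by (simp add: distrib_left[of "snd _"])

lemma ip_self: "ip u u = (LINT z|W. H1_density U u z)"
 by (simp add: ip_def H1_density_def power2_eq_square)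

lemma H1_norm_eq: "H1_norm U W u = sqrt (ip u u)"
 by (simp add: H1_norm_def ip_self)

lemma ip_nonneg: "0 \<le> ip u u"
 unfolding ip_self by (intro integral_nonneg_AE AE_I2) (use snd_nonneg in \<open>auto simp: H1_density_def\<close>)

lemma ip_sym: "ip u v = ip v u"
 by (simp add: ip_def mult.commute)

lemma ip_lincomb_left:
 assumes u: "u \<in> H1 U W" and v: "v \<in> H1 U W" and x: "x \<in> H1 U W"
 shows "ip (\<lambda>z. a * u z + b * v z) x = a * ip u x + b * ip v x"
proof -
 let ?c = "\<lambda>z. a * u z + b * v z"
 note c = H1_lincomb[where a=a and b=b, OF u v]
 note [measurable] = H1D(5-7)[OF u] H1D(5-7)[OF v] H1D(5-7)[OF x] H1D(5-7)[OF c]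
 have "ip ?c x = (LINT z|W. a * (snd z * (Dx U u z * Dx U x z + Dy U u z * Dy U x z) + (1 + snd z) * (u z * x z)) +
   b * (snd z * (Dx U v z * Dx U x z + Dy U v z * Dy U x z) + (1 + snd z) * (v z * x z)))"
  unfolding ip_def
 proof (rule integral_cong_AE)
  show "AE z in W. snd z * (Dx U ?c z * Dx U x z + Dy U ?c z * Dy U x z) + (1 + snd z) * (?c z * x z) =
   a * (snd z * (Dx U u z * Dx U x z + Dy U u z * Dy U x z) + (1 + snd z) * (u z * x z)) +
   b * (snd z * (Dx U v z * Dx U x z + Dy U v z * Dy U x z) + (1 + snd z) * (v z * x z))"
   using wd_AE[OF wd_lincomb[where a=a and b=b, OF H1D(1)[OF u] H1D(1)[OF v]]]
   by eventually_elim (simp add: algebra_simps)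
 qed measurable
 also have "\<dots> = a * ip u x + b * ip v x"
  unfolding ip_def using ip_integrable'[OF u x] ip_integrable'[OF v x] by simp
 finally show ?thesis .
qed

text \<open>Each component of a Cauchy sequence has a limit in the mean square for its own weight. This implies
 convergence in the mean on compact subsets of \<open>U\<close>, where weak derivatives pass to the limit.\<close>

lemma H1_complete:
 assumes X: "\<And>n::nat. X n \<in> H1 U W"
  and cau: "\<And>e. 0 < e ==> \<exists>N. \<forall>m\<ge>N. \<forall>n\<ge>N. ip (X m - X n) (X m - X n) < e"
 shows "\<exists>x\<in>H1 U W. (\<lambda>n. ip (X n - x) (X n - x)) \<longlonglongrightarrow> 0"
proof -
 let ?d = "\<lambda>m n. dens (\<lambda>z. X m z - X n z) (\<lambda>z. Dx U (X m) z - Dx U (X n) z) (\<lambda>z. Dy U (X m) z - Dy U (X n) z)"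
 note XD = H1D[OF X]
 note [measurable] = XD(5-7)
 have diff: "X m - X n = (\<lambda>z. 1 * X m z + (-1) * X n z)" for m n by (auto simp: fun_diff_def)
 have dH1: "(\<lambda>z. 1 * X m z + (-1) * X n z) \<in> H1 U W" for m n by (rule H1_lincomb[OF X X])
 have ipd: "ip (X m - X n) (X m - X n) =
   (LINT z|W. ?d m n z)" for m n
  unfolding diff ip_self
 proof (rule integral_cong_AE)
  note [measurable] = H1D(5-7)[OF dH1]
  show "H1_density U (\<lambda>z. 1 * X m z + - 1 * X n z) \<in> borel_measurable W"
   unfolding H1_density_def[abs_def] by measurable
  show "AE z in W. H1_density U (\<lambda>z. 1 * X m z + - 1 * X n z) z = ?d m n z"
   using wd_AE[OF wd_lincomb[where a=1 and b="-1", OF XD(1)[of m] XD(1)[of n]]]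
   by eventually_elim (simp add: H1_density_def dens_def)
 qed (unfold dens_def[abs_def], measurable)
 have comp: "\<exists>g. g \<in> borel_measurable W \<and> (\<forall>n. integrable W (\<lambda>z. k z * (F n z - g z)\<^sup>2)) \<and>
   (\<lambda>n. LINT z|W. k z * (F n z - g z)\<^sup>2) \<longlonglongrightarrow> 0"
  if [measurable]: "k \<in> borel_measurable W" "\<And>n. F n \<in> borel_measurable W" and k: "\<And>z. z \<in> U ==> 0 < k z"
   and i: "\<And>n. integrable W (\<lambda>z. k z * (F n z)\<^sup>2)"
   and le: "\<And>m n z. z \<in> U ==> k z * (F m z - F n z)\<^sup>2 \<le> ?d m n z"
  for k and F :: "nat => real \<times> real => real"
 proof -
  define f where "f n z = sqrt (k z) * F n z" for n z
  have [measurable]: "f n \<in> borel_measurable W" for n unfolding f_def[abs_def] by measurable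
  have fsq: "(f m z - f n z)\<^sup>2 = k z * (1 * F m z + (-1) * F n z)\<^sup>2" if "z \<in> U" for m n z
   using k[OF that] by (simp add: f_def right_diff_distrib[symmetric] power_mult_distrib)
  have ki: "integrable W (\<lambda>z. k z * (1 * F m z + (-1) * F n z)\<^sup>2)" for m n
   by (rule integrable_lincomb_square[OF _ _ _ _ i i]) (use k in \<open>auto intro: less_imp_le\<close>)
  have di: "integrable W (?d m n)" for m n
   using H1_iff[OF wd_lincomb[where a=1 and b="-1", OF XD(1)[of m] XD(1)[of n]]] dH1[of m n] by simp
  have fi: "integrable W (\<lambda>z. (f m z - f n z)\<^sup>2)" for m n
   using ki[of m n] by (subst Bochner_Integration.integrable_cong[OF refl fsq]) auto
  obtain g where g: "g \<in> borel_measurable W" "\<And>n. integrable W (\<lambda>z. (f n z - g z)\<^sup>2)"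
   "(\<lambda>n. LINT z|W. (f n z - g z)\<^sup>2) \<longlonglongrightarrow> 0"
  proof (rule L2_complete[of f W])
   fix e :: real assume "0 < e"
   then obtain N where N: "\<forall>m\<ge>N. \<forall>n\<ge>N. ip (X m - X n) (X m - X n) < e" using cau by blast
   have "(LINT z|W. (f m z - f n z)\<^sup>2) < e" if "m \<ge> N" "n \<ge> N" for m n
   proof -
    have "(LINT z|W. (f m z - f n z)\<^sup>2) \<le> ip (X m - X n) (X m - X n)"
     unfolding ipd by (intro integral_mono fi di) (use le fsq in simp)
    then show ?thesis using N that by force
   qed
   then show "\<exists>N. \<forall>m\<ge>N. \<forall>n\<ge>N. (LINT z|W. (f m z - f n z)\<^sup>2) < e" by blast
  qed (use fi in auto)
  note [measurable] = g(1)
  define G where "G z = g z / sqrt (k z)" for z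
  have eq: "(f n z - g z)\<^sup>2 = k z * (F n z - G z)\<^sup>2" if "z \<in> U" for n z
  proof -
   have "g z = sqrt (k z) * G z" using k[OF that] by (simp add: G_def)
   then have "f n z - g z = sqrt (k z) * (F n z - G z)" by (simp add: f_def right_diff_distrib)
   then show ?thesis using k[OF that] by (simp add: power_mult_distrib)
  qed
  have "integrable W (\<lambda>z. k z * (F n z - G z)\<^sup>2)" for n
   using g(2)[of n] by (subst (asm) Bochner_Integration.integrable_cong[OF refl eq]) auto
  moreover have "(LINT z|W. (f n z - g z)\<^sup>2) = (LINT z|W. k z * (F n z - G z)\<^sup>2)" for n
   by (rule Bochner_Integration.integral_cong) (auto simp: eq)
  ultimately show ?thesis using g(3) unfolding G_def[abs_def]
   by (intro exI[of _ "\<lambda>z. g z / sqrt (k z)"]) auto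
 qed
 have sn: "0 \<le> snd z * s\<^sup>2" if "z \<in> U" for z and s :: real using snd_nonneg[OF that] by simp
 have sn1: "0 \<le> (1 + snd z) * s\<^sup>2" if "z \<in> U" for z and s :: real using snd_nonneg[OF that] by simp
 obtain x where x: "x \<in> borel_measurable W" "\<And>n. integrable W (\<lambda>z. (1 + snd z) * (X n z - x z)\<^sup>2)"
  "(\<lambda>n. LINT z|W. (1 + snd z) * (X n z - x z)\<^sup>2) \<longlonglongrightarrow> 0"
 proof -
  have "\<exists>g. g \<in> borel_measurable W \<and> (\<forall>n. integrable W (\<lambda>z. (1 + snd z) * (X n z - g z)\<^sup>2)) \<and>
   (\<lambda>n. LINT z|W. (1 + snd z) * (X n z - g z)\<^sup>2) \<longlonglongrightarrow> 0"
  proof (rule comp)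
   show "0 < 1 + snd z" if "z \<in> U" for z using snd_pos[OF that] by simp
   show "(1 + snd z) * (X m z - X n z)\<^sup>2 \<le> ?d m n z" if "z \<in> U" for m n z
    unfolding dens_def distrib_left[of "snd z"] using sn[OF that] by simp
  qed (use XD in measurable)
  then show thesis using that by blast
 qed
 obtain xx where xx: "xx \<in> borel_measurable W" "\<And>n. integrable W (\<lambda>z. snd z * (Dx U (X n) z - xx z)\<^sup>2)"
  "(\<lambda>n. LINT z|W. snd z * (Dx U (X n) z - xx z)\<^sup>2) \<longlonglongrightarrow> 0"
 proof -
  have "\<exists>g. g \<in> borel_measurable W \<and> (\<forall>n. integrable W (\<lambda>z. snd z * (Dx U (X n) z - g z)\<^sup>2)) \<and>
   (\<lambda>n. LINT z|W. snd z * (Dx U (X n) z - g z)\<^sup>2) \<longlonglongrightarrow> 0"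
  proof (rule comp)
   show "snd z * (Dx U (X m) z - Dx U (X n) z)\<^sup>2 \<le> ?d m n z" if "z \<in> U" for m n z
    unfolding dens_def distrib_left[of "snd z"] using sn[OF that] sn1[OF that] by simp
  qed (use XD snd_pos in measurable)
  then show thesis using that by blast
 qed
 obtain xy where xy: "xy \<in> borel_measurable W" "\<And>n. integrable W (\<lambda>z. snd z * (Dy U (X n) z - xy z)\<^sup>2)"
  "(\<lambda>n. LINT z|W. snd z * (Dy U (X n) z - xy z)\<^sup>2) \<longlonglongrightarrow> 0"
 proof -
  have "\<exists>g. g \<in> borel_measurable W \<and> (\<forall>n. integrable W (\<lambda>z. snd z * (Dy U (X n) z - g z)\<^sup>2)) \<and>
   (\<lambda>n. LINT z|W. snd z * (Dy U (X n) z - g z)\<^sup>2) \<longlonglongrightarrow> 0"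
  proof (rule comp)
   show "snd z * (Dy U (X m) z - Dy U (X n) z)\<^sup>2 \<le> ?d m n z" if "z \<in> U" for m n z
    unfolding dens_def distrib_left[of "snd z"] using sn[OF that] sn1[OF that] by simp
  qed (use XD snd_pos in measurable)
  then show thesis using that by blast
 qed
 note [measurable] = x(1) xx(1) xy(1)
 have limit_sq: "integrable W (\<lambda>z. k z * (g z)\<^sup>2)"
  if "k \<in> borel_measurable W" and "F \<in> borel_measurable W" and "g \<in> borel_measurable W"
   and "\<forall>z\<in>U. 0 \<le> k z" and "integrable W (\<lambda>z. k z * (F z)\<^sup>2)"
   and "integrable W (\<lambda>z. k z * (F z - g z)\<^sup>2)"
  for k F g :: "real \<times> real => real"
  using integrable_lincomb_square[of F "\<lambda>z. F z - g z" k 1 "-1"] borel_measurable_diff[of F W g] that by simp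
 have snd1: "integrable W (\<lambda>z. snd z * (X n z - x z)\<^sup>2)" for n
  by (rule integrable_W_mono[OF x(2)[of n]]) (measurable, use snd_nonneg in \<open>auto simp: abs_mult intro!: mult_right_mono\<close>)
 have snd1lim: "(\<lambda>n. LINT z|W. snd z * (X n z - x z)\<^sup>2) \<longlonglongrightarrow> 0"
 proof (rule Lim_null_comparison[OF _ x(3)], intro always_eventually allI)
  fix n
  have "0 \<le> (LINT z|W. snd z * (X n z - x z)\<^sup>2)" using sn by (intro integral_nonneg_AE AE_I2) auto
  moreover have "(LINT z|W. snd z * (X n z - x z)\<^sup>2) \<le> (LINT z|W. (1 + snd z) * (X n z - x z)\<^sup>2)"
   by (intro integral_mono snd1 x(2)) (auto intro!: mult_right_mono)
  ultimately show "norm (LINT z|W. snd z * (X n z - x z)\<^sup>2) \<le> (LINT z|W. (1 + snd z) * (X n z - x z)\<^sup>2)" by simp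
 qed
 have x2: "integrable W (\<lambda>z. (1 + snd z) * (x z)\<^sup>2)" "integrable W (\<lambda>z. snd z * (xx z)\<^sup>2)"
  "integrable W (\<lambda>z. snd z * (xy z)\<^sup>2)"
  using limit_sq[OF snd1_W XD(5) x(1) snd1_nonneg XD(4) x(2)] limit_sq[OF snd_W(1) XD(6) xx(1) snd_nonneg' XD(2) xx(2)]
   limit_sq[OF snd_W(1) XD(7) xy(1) snd_nonneg' XD(3) xy(2)] by blast+
 have x2': "integrable W (\<lambda>z. snd z * (x z)\<^sup>2)"
  by (rule integrable_W_mono[OF x2(1)]) (measurable, use snd_nonneg in \<open>auto simp: abs_mult intro!: mult_right_mono\<close>)
 have li: "loc_integrable U x" "loc_integrable U xx" "loc_integrable U xy"
  using L2_imp_loc_integrable[OF x(1) x2'] L2_imp_loc_integrable[OF xx(1) x2(2)] L2_imp_loc_integrable[OF xy(1) x2(3)] .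
 have wdx: "wd x xx xy"
  unfolding wd_def
 proof
  show "has_weak_deriv (1, 0) U x xx"
  proof (rule weak_deriv_L1_limit[OF open_U Basis_real2(1) _ li(1) li(2), of X "\<lambda>n. Dx U (X n)"])
   show "has_weak_deriv (1, 0) U (X n) (Dx U (X n))" for n using XD(1) by (simp add: wd_def)
  qed (rule L2_imp_L1_loc_limit[OF XD(5) x(1) snd1 snd1lim] L2_imp_L1_loc_limit[OF XD(6) xx]; assumption)+
  show "has_weak_deriv (0, 1) U x xy"
  proof (rule weak_deriv_L1_limit[OF open_U Basis_real2(2) _ li(1) li(3), of X "\<lambda>n. Dy U (X n)"])
   show "has_weak_deriv (0, 1) U (X n) (Dy U (X n))" for n using XD(1) by (simp add: wd_def)
  qed (rule L2_imp_L1_loc_limit[OF XD(5) x(1) snd1 snd1lim] L2_imp_L1_loc_limit[OF XD(7) xy]; assumption)+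
 qed
 have xH: "x \<in> H1 U W" by (rule H1I[OF wdx x2(2,3,1)])
 have "ip (X n - x) (X n - x) = (LINT z|W. snd z * (Dx U (X n) z - xx z)\<^sup>2) + (LINT z|W. snd z * (Dy U (X n) z - xy z)\<^sup>2) +
   (LINT z|W. (1 + snd z) * (X n z - x z)\<^sup>2)" for n
 proof -
  have d: "X n - x = (\<lambda>z. 1 * X n z + (-1) * x z)" by (auto simp: fun_diff_def)
  note [measurable] = H1D(5-7)[OF H1_lincomb[where a=1 and b="-1", OF X[of n] xH]]
  have "ip (X n - x) (X n - x) = (LINT z|W. snd z * (Dx U (X n) z - xx z)\<^sup>2 + snd z * (Dy U (X n) z - xy z)\<^sup>2 +
   (1 + snd z) * (X n z - x z)\<^sup>2)"
   unfolding d ip_self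
  proof (rule integral_cong_AE)
   show "H1_density U (\<lambda>z. 1 * X n z + - 1 * x z) \<in> borel_measurable W"
    unfolding H1_density_def[abs_def] by measurable
   show "AE z in W. H1_density U (\<lambda>z. 1 * X n z + - 1 * x z) z = snd z * (Dx U (X n) z - xx z)\<^sup>2 +
     snd z * (Dy U (X n) z - xy z)\<^sup>2 + (1 + snd z) * (X n z - x z)\<^sup>2"
    using wd_AE[OF wd_lincomb[where a=1 and b="-1", OF XD(1)[of n] wdx]]
    by eventually_elim (simp add: H1_density_def distrib_left)
  qed measurable
  then show ?thesis using x(2)[of n] xx(2)[of n] xy(2)[of n] by simp
 qed
 moreover have "(\<lambda>n. (LINT z|W. snd z * (Dx U (X n) z - xx z)\<^sup>2) + (LINT z|W. snd z * (Dy U (X n) z - xy z)\<^sup>2) +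
   (LINT z|W. (1 + snd z) * (X n z - x z)\<^sup>2)) \<longlonglongrightarrow> 0 + 0 + 0"
  by (intro tendsto_add x(3) xx(3) xy(3))
 ultimately have "(\<lambda>n. ip (X n - x) (X n - x)) \<longlonglongrightarrow> 0" by (simp only: add_0_right)
 with xH show ?thesis by blast
qed

end

context weighted_domain
begin

lemma H1_subspace: "subspace (H1 U W)"
 unfolding subspace_def
proof (intro conjI ballI allI)
 have "has_weak_deriv e U (\<lambda>z. 0) (\<lambda>z. 0)" for e
  by (simp add: has_weak_deriv_def loc_integrable_def set_integrable_def set_lebesgue_integral_def)
 then have "wd (\<lambda>z. 0) (\<lambda>z. 0) (\<lambda>z. 0)" by (simp add: wd_def)
 then show z: "0 \<in> H1 U W" unfolding zero_fun_def by (rule H1I) auto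
 show "u + v \<in> H1 U W" if "u \<in> H1 U W" "v \<in> H1 U W" for u v
  using H1_lincomb[OF that, of 1 1] by (simp add: plus_fun_def)
 show "c *\<^sub>R u \<in> H1 U W" if "u \<in> H1 U W" for c u
  using H1_lincomb[OF that z, of c 0] by (simp add: scaleR_fun_def)
qed

lemma H1_semi_hilbert: "semi_hilbert (H1 U W) ip"
proof
 show "ip (x + y) z = ip x z + ip y z" if "x \<in> H1 U W" "y \<in> H1 U W" "z \<in> H1 U W" for x y z
  using ip_lincomb_left[OF that, of 1 1] by (simp add: plus_fun_def)
 show "ip (c *\<^sub>R x) y = c * ip x y" if "x \<in> H1 U W" "y \<in> H1 U W" for c x y
  using ip_lincomb_left[OF that(1) that(1) that(2), of c 0] by (simp add: scaleR_fun_def)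
qed (use H1_subspace ip_sym ip_nonneg H1_complete in auto)

sublocale H: semi_hilbert "H1 U W" ip
 by (rule H1_semi_hilbert)

lemma H1_norm_nrm: "H1_norm U W u = H.nrm u"
 by (simp add: H1_norm_eq H.nrm_def)

lemma H1_0_H1: "u \<in> H1_0 U W ==> u \<in> H1 U W"
 by (simp add: H1_0_def)

lemma H1_0_iff:
 "u \<in> H1_0 U W \<longleftrightarrow> u \<in> H1 U W \<and>
  (\<forall>e>0. \<exists>\<phi>. \<phi> \<in> C0_infinity U (U \<union> Gamma0 U) \<and> \<phi> \<in> H1 U W \<and> H.nrm (u - \<phi>) < e)"
 unfolding H1_0_def H1_norm_nrm fun_diff_def by auto

lemma test_function_H1_0: "\<phi> \<in> C0_infinity U (U \<union> Gamma0 U) ==> \<phi> \<in> H1 U W ==> \<phi> \<in> H1_0 U W"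
 unfolding H1_0_iff
 by (metis H.nrm_def H.scale_left H.V_scale diff_self mult_zero_left real_sqrt_zero scaleR_zero_left)

lemma H1_0_approx:
 assumes "u \<in> H1_0 U W"
 obtains \<phi> where "\<And>n::nat. \<phi> n \<in> C0_infinity U (U \<union> Gamma0 U)" "\<And>n. \<phi> n \<in> H1 U W"
  "(\<lambda>n. H.nrm (\<phi> n - u)) \<longlonglongrightarrow> 0"
proof -
 have u: "u \<in> H1 U W" using assms by (rule H1_0_H1)
 have "\<forall>n. \<exists>\<phi>. \<phi> \<in> C0_infinity U (U \<union> Gamma0 U) \<and> \<phi> \<in> H1 U W \<and> H.nrm (u - \<phi>) < 1 / real (Suc n)"
  using assms by (simp add: H1_0_iff)
 then obtain \<phi> where \<phi>: "\<And>n. \<phi> n \<in> C0_infinity U (U \<union> Gamma0 U)" "\<And>n. \<phi> n \<in> H1 U W"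
  "\<And>n. H.nrm (u - \<phi> n) < 1 / real (Suc n)" by metis
 have "(\<lambda>n. H.nrm (\<phi> n - u)) \<longlonglongrightarrow> 0"
 proof (rule Lim_null_comparison)
  show "\<forall>\<^sub>F n in sequentially. norm (H.nrm (\<phi> n - u)) \<le> 1 / real (Suc n)"
   using \<phi>(3) H.nrm_diff_sym[OF u \<phi>(2)] H.nrm_nonneg[OF H.V_diff[OF \<phi>(2) u]]
   by (intro always_eventually allI) (simp add: less_imp_le)
  show "(\<lambda>n. 1 / real (Suc n)) \<longlonglongrightarrow> 0" by real_asymp
 qed
 with \<phi> show thesis using that by blast
qed

lemma H1_0_limit:
 assumes X: "\<And>n::nat. X n \<in> H1_0 U W" and u: "u \<in> H1 U W" and lim: "(\<lambda>n. H.nrm (X n - u)) \<longlonglongrightarrow> 0"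
 shows "u \<in> H1_0 U W"
 unfolding H1_0_iff
proof (intro conjI u allI impI)
 fix e :: real assume e: "0 < e"
 then have "\<forall>\<^sub>F n in sequentially. H.nrm (X n - u) < e / 2" by (intro order_tendstoD(2)[OF lim]) auto
 then obtain n where n: "H.nrm (X n - u) < e / 2" by (auto simp: eventually_sequentially)
 obtain \<phi> where \<phi>: "\<phi> \<in> C0_infinity U (U \<union> Gamma0 U)" "\<phi> \<in> H1 U W" "H.nrm (X n - \<phi>) < e / 2"
  using X[of n] e unfolding H1_0_iff by (metis half_gt_zero)
 have Xn: "X n \<in> H1 U W" using X H1_0_H1 by blast
 have "H.nrm (u - \<phi>) \<le> H.nrm (u - X n) + H.nrm (X n - \<phi>)" by (rule H.nrm_diff_triangle[OF u Xn \<phi>(2)])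
 also have "\<dots> < e" using n \<phi>(3) H.nrm_diff_sym[OF u Xn] by simp
 finally show "\<exists>\<phi>. \<phi> \<in> C0_infinity U (U \<union> Gamma0 U) \<and> \<phi> \<in> H1 U W \<and> H.nrm (u - \<phi>) < e" using \<phi> by blast
qed

lemma H1_0_lincomb:
 assumes u: "u \<in> H1_0 U W" and v: "v \<in> H1_0 U W"
 shows "(\<lambda>z. a * u z + b * v z) \<in> H1_0 U W"
proof -
 obtain \<phi> where \<phi>: "\<And>n::nat. \<phi> n \<in> C0_infinity U (U \<union> Gamma0 U)" "\<And>n. \<phi> n \<in> H1 U W"
  "(\<lambda>n. H.nrm (\<phi> n - u)) \<longlonglongrightarrow> 0" using H1_0_approx[OF u] by metis
 obtain \<psi> where \<psi>: "\<And>n::nat. \<psi> n \<in> C0_infinity U (U \<union> Gamma0 U)" "\<And>n. \<psi> n \<in> H1 U W"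
  "(\<lambda>n. H.nrm (\<psi> n - v)) \<longlonglongrightarrow> 0" using H1_0_approx[OF v] by metis
 note u' = H1_0_H1[OF u] and v' = H1_0_H1[OF v]
 let ?x = "\<lambda>n. (\<lambda>z. a * \<phi> n z + b * \<psi> n z)"
 show ?thesis
 proof (rule H1_0_limit)
  show "?x n \<in> H1_0 U W" for n
   by (intro test_function_H1_0 C0_infinity_lincomb H1_lincomb \<phi> \<psi>)
  show "(\<lambda>n. H.nrm (?x n - (\<lambda>z. a * u z + b * v z))) \<longlonglongrightarrow> 0"
  proof (rule Lim_null_comparison)
   show "(\<lambda>n. \<bar>a\<bar> * H.nrm (\<phi> n - u) + \<bar>b\<bar> * H.nrm (\<psi> n - v)) \<longlonglongrightarrow> 0"
    using tendsto_add[OF tendsto_mult_right_zero[OF \<phi>(3)] tendsto_mult_right_zero[OF \<psi>(3)], of "\<bar>a\<bar>" "\<bar>b\<bar>"] by simp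
   show "\<forall>\<^sub>F n in sequentially. norm (H.nrm (?x n - (\<lambda>z. a * u z + b * v z))) \<le>
     \<bar>a\<bar> * H.nrm (\<phi> n - u) + \<bar>b\<bar> * H.nrm (\<psi> n - v)"
   proof (intro always_eventually allI)
    fix n
    have eq: "?x n - (\<lambda>z. a * u z + b * v z) = a *\<^sub>R (\<phi> n - u) + b *\<^sub>R (\<psi> n - v)"
     by (simp add: fun_eq_iff scaleR_fun_def algebra_simps)
    have m: "a *\<^sub>R (\<phi> n - u) \<in> H1 U W" "b *\<^sub>R (\<psi> n - v) \<in> H1 U W"
     by (intro H.V_scale H.V_diff \<phi> \<psi> u' v')+
    show "norm (H.nrm (?x n - (\<lambda>z. a * u z + b * v z))) \<le> \<bar>a\<bar> * H.nrm (\<phi> n - u) + \<bar>b\<bar> * H.nrm (\<psi> n - v)"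
     unfolding eq using H.nrm_triangle[OF m] H.nrm_nonneg[OF H.V_add[OF m]]
     by (simp add: H.nrm_scale[OF H.V_diff[OF \<phi>(2) u']] H.nrm_scale[OF H.V_diff[OF \<psi>(2) v']])
   qed
  qed
 qed (rule H1_lincomb[OF u' v'])
qed

lemma H1_0_subspace: "subspace (H1_0 U W)"
 unfolding subspace_def
proof (intro conjI ballI allI)
 have "(\<lambda>z. 0) \<in> C0_infinity U (U \<union> Gamma0 U)" by (simp add: C0_infinity_def Ck_upto_const del: Ck_upto.simps)
 moreover have "(\<lambda>z. 0) \<in> H1 U W" using H1_subspace subspace_0 by (fastforce simp: zero_fun_def)
 ultimately show z: "0 \<in> H1_0 U W" unfolding zero_fun_def by (rule test_function_H1_0)
 show "u + v \<in> H1_0 U W" if "u \<in> H1_0 U W" "v \<in> H1_0 U W" for u v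
  using H1_0_lincomb[OF that, of 1 1] by (simp add: plus_fun_def)
 show "c *\<^sub>R u \<in> H1_0 U W" if "u \<in> H1_0 U W" for c u
  using H1_0_lincomb[OF that z, of c 0] by (simp add: scaleR_fun_def)
qed

lemma H1_0_semi_hilbert: "semi_hilbert (H1_0 U W) ip"
proof
 fix X assume X: "\<And>n::nat. X n \<in> H1_0 U W"
  and cau: "\<And>e. 0 < e ==> \<exists>N. \<forall>m\<ge>N. \<forall>n\<ge>N. ip (X m - X n) (X m - X n) < e"
 have X': "X n \<in> H1 U W" for n using X H1_0_H1 by blast
 obtain x where x: "x \<in> H1 U W" "(\<lambda>n. ip (X n - x) (X n - x)) \<longlonglongrightarrow> 0"
  using H1_complete[OF X' cau] by blast
 moreover have "x \<in> H1_0 U W"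
  using x H.tendsto_iff_nrm[of X x] X' by (intro H1_0_limit[OF X]) auto
 ultimately show "\<exists>x\<in>H1_0 U W. (\<lambda>n. ip (X n - x) (X n - x)) \<longlonglongrightarrow> 0" by blast
qed (use H1_0_subspace H1_0_H1 H.add_left H.scale_left ip_sym ip_nonneg in auto)

sublocale H0: semi_hilbert "H1_0 U W" ip
 by (rule H1_0_semi_hilbert)

lemma ip_eq_wd:
 assumes "wd u ux uy" "u \<in> H1 U W"
 shows "ip u u = (LINT z|W. dens u ux uy z)"
 unfolding ip_self
proof (rule integral_cong_AE)
 note [measurable] = H1D(5-7)[OF assms(2)] wd_borel[OF assms(1)]
 show "H1_density U u \<in> borel_measurable W" unfolding H1_density_def[abs_def] by measurable
 show "dens u ux uy \<in> borel_measurable W" unfolding dens_def[abs_def] by measurable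
 show "AE z in W. H1_density U u z = dens u ux uy z"
  using wd_AE[OF assms(1)] by eventually_elim (simp add: H1_density_def dens_def)
qed

lemma L2_le_ip:
 assumes u: "u \<in> H1 U W"
 shows "(LINT z|W. (1 + snd z) * (u z)\<^sup>2) \<le> ip u u"
 unfolding ip_self
proof (rule integral_mono[OF H1D(4)[OF u]])
 show "integrable W (H1_density U u)" using u by (simp add: H1_def)
 fix z assume "z \<in> space W"
 then have "0 \<le> snd z * ((Dx U u z)\<^sup>2 + (Dy U u z)\<^sup>2)" using snd_nonneg by simp
 then show "(1 + snd z) * (u z)\<^sup>2 \<le> H1_density U u z" by (simp add: H1_density_def)
qed

lemma H1_limit_AE_subseq:
 assumes X: "\<And>n::nat. X n \<in> H1 U W" and u: "u \<in> H1 U W" and lim: "(\<lambda>n. H.nrm (X n - u)) \<longlonglongrightarrow> 0"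
 obtains r :: "nat => nat" where "strict_mono r" "AE z in W. (\<lambda>n. X (r n) z) \<longlonglongrightarrow> u z"
proof -
 have d: "X n - u \<in> H1 U W" for n by (rule H.V_diff[OF X u])
 have i: "integrable W (\<lambda>z. (1 + snd z) * ((X n - u) z)\<^sup>2)" for n by (rule H1D(4)[OF d])
 have "(\<lambda>n. LINT z|W. norm ((1 + snd z) * ((X n - u) z)\<^sup>2)) \<longlonglongrightarrow> 0"
 proof (rule Lim_null_comparison)
  show "(\<lambda>n. ip (X n - u) (X n - u)) \<longlonglongrightarrow> 0" using lim H.tendsto_iff_nrm[of X u] X u by blast
  show "\<forall>\<^sub>F n in sequentially. norm (LINT z|W. norm ((1 + snd z) * ((X n - u) z)\<^sup>2)) \<le> ip (X n - u) (X n - u)"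
  proof (intro always_eventually allI)
   fix n
   have "(LINT z|W. norm ((1 + snd z) * ((X n - u) z)\<^sup>2)) = (LINT z|W. (1 + snd z) * ((X n - u) z)\<^sup>2)"
    using snd1_nonneg by (intro Bochner_Integration.integral_cong) (auto simp: abs_mult)
   moreover have "0 \<le> (LINT z|W. norm ((1 + snd z) * ((X n - u) z)\<^sup>2))"
    by (intro integral_nonneg_AE) simp
   ultimately show "norm (LINT z|W. norm ((1 + snd z) * ((X n - u) z)\<^sup>2)) \<le> ip (X n - u) (X n - u)"
    using L2_le_ip[OF d, of n] by simp
  qed
 qed
 from tendsto_L1_AE_subseq[OF i this] obtain r :: "nat => nat" where r: "strict_mono r"
  "AE z in W. (\<lambda>n. (1 + snd z) * ((X (r n) - u) z)\<^sup>2) \<longlonglongrightarrow> 0" by blast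
 have "AE z in W. (\<lambda>n. X (r n) z) \<longlonglongrightarrow> u z"
  using r(2) AE_space
 proof eventually_elim
  fix z assume l: "(\<lambda>n. (1 + snd z) * ((X (r n) - u) z)\<^sup>2) \<longlonglongrightarrow> 0" and "z \<in> space W"
  then have p: "0 < 1 + snd z" using snd_pos[of z] by simp
  have "(\<lambda>n. 1 / (1 + snd z) * ((1 + snd z) * ((X (r n) - u) z)\<^sup>2)) \<longlonglongrightarrow> 1 / (1 + snd z) * 0"
   by (intro tendsto_intros l)
  then have "(\<lambda>n. (X (r n) z - u z)\<^sup>2) \<longlonglongrightarrow> 0" using p by (simp add: fun_diff_def)
  from tendsto_real_sqrt[OF this] have "(\<lambda>n. \<bar>X (r n) z - u z\<bar>) \<longlonglongrightarrow> 0" by simp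
  then show "(\<lambda>n. X (r n) z) \<longlonglongrightarrow> u z"
   by (rule LIM_zero_cancel[OF tendsto_rabs_zero_cancel])
 qed
 with r(1) show thesis by (rule that)
qed

lemma H1_cong_AE:
 assumes u: "u \<in> H1 U W" and eq: "AE z in W. u z = v z"
 shows "v \<in> H1 U W" "wd v (Dx U u) (Dy U u)"
proof -
 show wd: "wd v (Dx U u) (Dy U u)" by (rule wd_cong_AE[OF H1D(1)[OF u] eq]) auto
 have "integrable W (\<lambda>z. (1 + snd z) * (v z)\<^sup>2)"
 proof (subst integrable_cong_AE[of _ W "\<lambda>z. (1 + snd z) * (u z)\<^sup>2"])
  note [measurable] = wd_borel[OF wd] H1D(5)[OF u]
  show "(\<lambda>z. (1 + snd z) * (v z)\<^sup>2) \<in> borel_measurable W" "(\<lambda>z. (1 + snd z) * (u z)\<^sup>2) \<in> borel_measurable W"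
   by measurable
  show "AE z in W. (1 + snd z) * (v z)\<^sup>2 = (1 + snd z) * (u z)\<^sup>2" using eq by eventually_elim simp
 qed (rule H1D(4)[OF u])
 then show "v \<in> H1 U W" by (rule H1I[OF wd H1D(2,3)[OF u]])
qed

lemma nrm_diff_cong_AE:
 assumes u: "u \<in> H1 U W" and eq: "AE z in W. u z = v z"
 shows "H.nrm (u - v) = 0"
proof -
 have v: "v \<in> H1 U W" by (rule H1_cong_AE(1)[OF assms])
 have "wd (\<lambda>z. 1 * u z + (-1) * v z) (\<lambda>z. 1 * Dx U u z + (-1) * Dx U u z) (\<lambda>z. 1 * Dy U u z + (-1) * Dy U u z)"
  by (rule wd_lincomb[OF H1D(1)[OF u] H1_cong_AE(2)[OF assms]])
 then have wd: "wd (u - v) (\<lambda>z. 0) (\<lambda>z. 0)" by (simp add: fun_diff_def)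
 note [measurable] = wd_borel[OF wd]
 have "ip (u - v) (u - v) = (LINT z|W. dens (u - v) (\<lambda>z. 0) (\<lambda>z. 0) z)"
  by (rule ip_eq_wd[OF wd H.V_diff[OF u v]])
 also have "\<dots> = (LINT z|W. 0)"
  by (rule integral_cong_AE) (unfold dens_def[abs_def], measurable, use eq in \<open>auto simp: fun_diff_def elim: eventually_mono\<close>)
 finally show ?thesis by (simp add: H.nrm_def)
qed

lemma H1_0_cong_AE:
 assumes u: "u \<in> H1_0 U W" and eq: "AE z in W. u z = v z"
 shows "v \<in> H1_0 U W"
proof (rule H1_0_limit[of "\<lambda>n. u"])
 show "v \<in> H1 U W" by (rule H1_cong_AE(1)[OF H1_0_H1[OF u] eq])
 show "(\<lambda>n. H.nrm (u - v)) \<longlonglongrightarrow> 0" using nrm_diff_cong_AE[OF H1_0_H1[OF u] eq] by simp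
qed (rule u)

text \<open>Convex combinations of the tails of a pointwise convergent sequence have the same pointwise limit.
 Hence bounds in the norm and pointwise convergence are enough to stay in the closed subspace.\<close>

lemma H1_0_bounded_AE_limit:
 assumes X: "\<And>n::nat. X n \<in> H1_0 U W" and bd: "\<And>n. ip (X n) (X n) \<le> C"
  and lim: "AE z in W. (\<lambda>n. X n z) \<longlonglongrightarrow> u z"
 shows "u \<in> H1_0 U W"
proof -
 obtain Y x where x: "x \<in> H1_0 U W" and Y: "\<And>n. Y n \<in> convex hull (X ` {n..})"
  and Yx: "(\<lambda>n. H0.nrm (Y n - x)) \<longlonglongrightarrow> 0"
  using H0.bounded_imp_convex_tails_converge[of X C, OF X bd] by metis
 have x': "x \<in> H1 U W" using x by (rule H1_0_H1)
 have "convex hull (X ` {n..}) \<subseteq> H1_0 U W" for n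
  by (rule hull_minimal) (use X H1_0_subspace subspace_imp_convex in auto)
 then have YH: "Y n \<in> H1 U W" for n using Y H1_0_H1 by blast
 obtain r :: "nat => nat" where r: "strict_mono r" "AE z in W. (\<lambda>n. Y (r n) z) \<longlonglongrightarrow> x z"
  using H1_limit_AE_subseq[OF YH x' Yx] by blast
 have "AE z in W. x z = u z"
  using lim r(2)
 proof eventually_elim
  fix z assume l: "(\<lambda>n. X n z) \<longlonglongrightarrow> u z" and rl: "(\<lambda>n. Y (r n) z) \<longlonglongrightarrow> x z"
  have "(\<lambda>n. Y n z) \<longlonglongrightarrow> u z"
  proof (rule LIMSEQ_I)
   fix e :: real assume e: "0 < e"
   obtain N where N: "\<And>n. n \<ge> N ==> norm (X n z - u z) < e" using LIMSEQ_D[OF l e] by blast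
   have conv: "convex {f :: real \<times> real => real. f z \<in> ball (u z) e}"
   proof (rule convexI)
    fix f g :: "real \<times> real => real" and s t :: real
    assume "f \<in> {f. f z \<in> ball (u z) e}" "g \<in> {f. f z \<in> ball (u z) e}" "0 \<le> s" "0 \<le> t" "s + t = 1"
    then have "s *\<^sub>R f z + t *\<^sub>R g z \<in> ball (u z) e" by (intro convexD[OF convex_ball]) auto
    then show "s *\<^sub>R f + t *\<^sub>R g \<in> {f. f z \<in> ball (u z) e}" by (simp add: scaleR_fun_def)
   qed
   have "norm (Y n z - u z) < e" if "n \<ge> N" for n
   proof -
    have "convex hull (X ` {n..}) \<subseteq> {f. f z \<in> ball (u z) e}"
    proof (rule hull_minimal)
     show "X ` {n..} \<subseteq> {f. f z \<in> ball (u z) e}"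
      using N that by (auto simp: dist_real_def abs_minus_commute)
    qed (rule conv)
    then show ?thesis using Y[of n] by (auto simp: dist_real_def abs_minus_commute)
   qed
   then show "\<exists>no. \<forall>n\<ge>no. norm (Y n z - u z) < e" by blast
  qed
  from LIMSEQ_subseq_LIMSEQ[OF this r(1)] have "(\<lambda>n. Y (r n) z) \<longlonglongrightarrow> u z" by (simp add: o_def)
  with rl show "x z = u z" by (rule LIMSEQ_unique)
 qed
 then show ?thesis by (rule H1_0_cong_AE[OF x])
qed

lemma wd_max_0:
 assumes "wd u ux uy"
 shows "wd (\<lambda>z. max (u z) 0) (\<lambda>z. if 0 < u z then ux z else 0) (\<lambda>z. if 0 < u z then uy z else 0)"
 using assms weak_deriv_max_0[OF open_U Basis_real2(1)] weak_deriv_max_0[OF open_U Basis_real2(2)]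
 unfolding wd_def by blast

lemma H1_max_0:
 assumes u: "u \<in> H1 U W"
 shows "(\<lambda>z. max (u z) 0) \<in> H1 U W" "ip (\<lambda>z. max (u z) 0) (\<lambda>z. max (u z) 0) \<le> ip u u"
proof -
 note wd = wd_max_0[OF H1D(1)[OF u]]
 note [measurable] = H1D(5-7)[OF u]
 have b: "integrable W (dens u (Dx U u) (Dy U u))" using H1_iff[OF H1D(1)[OF u]] u by simp
 have le: "0 \<le> dens (\<lambda>z. max (u z) 0) (\<lambda>z. if 0 < u z then Dx U u z else 0) (\<lambda>z. if 0 < u z then Dy U u z else 0) z \<and>
   dens (\<lambda>z. max (u z) 0) (\<lambda>z. if 0 < u z then Dx U u z else 0) (\<lambda>z. if 0 < u z then Dy U u z else 0) z \<le>
   dens u (Dx U u) (Dy U u) z" if "z \<in> U" for z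
  using snd_nonneg[OF that] by (simp add: dens_def max_def)
 have i: "integrable W (dens (\<lambda>z. max (u z) 0) (\<lambda>z. if 0 < u z then Dx U u z else 0) (\<lambda>z. if 0 < u z then Dy U u z else 0))"
  by (rule integrable_W_mono[OF b]) (unfold dens_def[abs_def], measurable, use le in \<open>simp add: dens_def\<close>)
 show H: "(\<lambda>z. max (u z) 0) \<in> H1 U W" using i H1_iff[OF wd] by simp
 show "ip (\<lambda>z. max (u z) 0) (\<lambda>z. max (u z) 0) \<le> ip u u"
  unfolding ip_eq_wd[OF wd H] ip_eq_wd[OF H1D(1)[OF u] u] by (intro integral_mono i b) (use le in simp)
qed

end

section \<open>Order intervals below test functions\<close>


lemma pos_square_has_derivative: "((\<lambda>s::real. (max s 0)\<^sup>2) has_real_derivative 2 * max s 0) (at s)"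
proof (cases s "0::real" rule: linorder_cases)
 case less
 then have "((\<lambda>t. 0) has_real_derivative 0) (at s)" "open {..<0::real}" "s \<in> {..<0}" by auto
 from has_field_derivative_transform_within_open[OF this, of "\<lambda>s. (max s 0)\<^sup>2"] less
 show ?thesis by (auto simp: max_def)
next
 case greater
 have "((\<lambda>t. t\<^sup>2) has_real_derivative 2 * s) (at s)" by (auto intro!: derivative_eq_intros)
 from has_field_derivative_transform_within_open[OF this, of "{0<..}" "\<lambda>s. (max s 0)\<^sup>2"] greater
 show ?thesis by (auto simp: max_def)
next
 case equal
 have "((\<lambda>h. (max h 0)\<^sup>2 / h) \<longlongrightarrow> 0) (at (0::real))"
 proof (rule Lim_null_comparison)
  show "\<forall>\<^sub>F h in at (0::real). norm ((max h 0)\<^sup>2 / h) \<le> \<bar>h\<bar>"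
   by (intro always_eventually allI) (auto simp: max_def power2_eq_square)
  show "((\<lambda>h. \<bar>h\<bar>) \<longlongrightarrow> 0) (at (0::real))" by (auto intro!: tendsto_eq_intros)
 qed
 then show ?thesis using equal by (simp add: DERIV_def)
qed

text \<open>A continuously differentiable step from 0 on \<open>{..a}\<close> to 1 on \<open>{2 * a..}\<close>.\<close>

definition C1_step :: "real => real => real" where
 "C1_step a t = 1 - (max (1 - (max (t / a - 1) 0)\<^sup>2) 0)\<^sup>2"

lemma C1_step_has_derivative:
 assumes "0 < a"
 shows "(C1_step a has_real_derivative 4 / a * (max (1 - (max (t / a - 1) 0)\<^sup>2) 0) * max (t / a - 1) 0) (at t)"
proof -
 have "((\<lambda>t. t / a - 1) has_real_derivative 1 / a) (at t)" using assms by (auto intro!: derivative_eq_intros)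
 from DERIV_diff[OF DERIV_const[of 1] DERIV_chain2[OF pos_square_has_derivative this]]
 have "((\<lambda>t. 1 - (max (t / a - 1) 0)\<^sup>2) has_real_derivative - (2 * max (t / a - 1) 0 * (1 / a))) (at t)"
  by simp
 from DERIV_chain2[OF pos_square_has_derivative this]
 have "((\<lambda>t. (max (1 - (max (t / a - 1) 0)\<^sup>2) 0)\<^sup>2) has_real_derivative
  2 * max (1 - (max (t / a - 1) 0)\<^sup>2) 0 * - (2 * max (t / a - 1) 0 * (1 / a))) (at t)" .
 from DERIV_diff[OF DERIV_const[of 1] this]
 show ?thesis unfolding C1_step_def[abs_def] by (simp add: mult.commute mult.left_commute)
qed

lemma C1_step_eq_0: "0 < a ==> t \<le> a ==> C1_step a t = 0"
 by (simp add: C1_step_def max_def divide_le_eq)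

lemma C1_step_eq_1: "0 < a ==> 2 * a \<le> t ==> C1_step a t = 1"
 and C1_step_deriv_eq_0: "0 < a ==> 2 * a \<le> t ==> max (1 - (max (t / a - 1) 0)\<^sup>2) 0 = 0"
proof -
 assume a: "0 < a" "2 * a \<le> t"
 then have "1 \<le> t / a - 1" by (simp add: field_simps)
 then have "1 \<le> (max (t / a - 1) 0)\<^sup>2" by simp
 then show "max (1 - (max (t / a - 1) 0)\<^sup>2) 0 = 0" by simp
 then show "C1_step a t = 1" by (simp add: C1_step_def)
qed

lemma Jensen_square:
 fixes k G :: "'a::euclidean_space => real"
 assumes k: "k \<in> borel_measurable borel" "\<And>z. 0 \<le> k z" "integrable lborel k" "(LINT z|lborel. k z) = 1"
  and kG: "integrable lborel (\<lambda>z. k z * G z)" and [measurable]: "G \<in> borel_measurable borel"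
 shows "ennreal ((LINT z|lborel. k z * G z)\<^sup>2) \<le> (\<integral>\<^sup>+ z. ennreal (k z * (G z)\<^sup>2) \<partial>lborel)"
proof (cases "(\<integral>\<^sup>+ z. ennreal (k z * (G z)\<^sup>2) \<partial>lborel) < \<infinity>")
 case True
 note [measurable] = k(1)
 have i: "integrable lborel (\<lambda>z. k z * (G z)\<^sup>2)"
  using True k(2) by (intro integrableI_bounded) auto
 define m where "m = (LINT z|lborel. k z * G z)"
 have "0 \<le> (LINT z|lborel. k z * (G z - m)\<^sup>2)" using k(2) by (intro integral_nonneg_AE) auto
 also have "\<dots> = (LINT z|lborel. k z * (G z)\<^sup>2 - 2 * m * (k z * G z) + m\<^sup>2 * k z)"
  by (intro Bochner_Integration.integral_cong) (auto simp: power2_eq_square algebra_simps)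
 also have "\<dots> = (LINT z|lborel. k z * (G z)\<^sup>2) - 2 * m * m + m\<^sup>2 * 1"
  using i kG k(3,4) by (simp add: m_def)
 finally have "m\<^sup>2 \<le> (LINT z|lborel. k z * (G z)\<^sup>2)" by (simp add: power2_eq_square)
 moreover have "(\<integral>\<^sup>+ z. ennreal (k z * (G z)\<^sup>2) \<partial>lborel) = ennreal (LINT z|lborel. k z * (G z)\<^sup>2)"
  using i k(2) by (intro nn_integral_eq_integral) auto
 ultimately show ?thesis by (simp add: m_def ennreal_leI)
next
 case False
 then have "(\<integral>\<^sup>+ z. ennreal (k z * (G z)\<^sup>2) \<partial>lborel) = top" by (metis infinity_ennreal_def top.not_eq_extremum)
 then show ?thesis by simp
qed

subsection \<open>Extending test functions across the complement of the domain\<close>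

lemma closed_half_plane: "closed {z :: real \<times> real. 0 \<le> snd z}"
 by (intro closed_Collect_le continuous_intros)

lemma open_half_plane: "open half_plane"
 unfolding half_plane_def by (intro open_Collect_less continuous_intros)

lemma convex_half_plane: "convex half_plane"
proof -
 have "half_plane = {z. (0, 1) \<bullet> z > 0}" by (auto simp: half_plane_def inner_prod_def)
 then show ?thesis by (metis convex_halfspace_gt)
qed

lemma Gamma0_open:
 obtains T where "open T" "Gamma0 U = {z. snd z = 0} \<inter> T"
proof -
 have "openin (top_of_set {z. snd z = 0}) (Gamma0 U)" unfolding Gamma0_def by (rule openin_interior_of)
 then show thesis using that unfolding openin_open by blast
qed

lemma Gamma0_subset: "Gamma0 U \<subseteq> {z. snd z = 0} \<inter> frontier U"
 unfolding Gamma0_def by (rule interior_of_subset)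

text \<open>Near a point of the degenerate boundary where a test function does not vanish, the domain fills a
 whole half disk: any other boundary point in the half disk would be a limit of points of the support.\<close>

lemma test_function_half_disk:
 assumes U: "open U" "U \<subseteq> half_plane" and \<eta>: "\<eta> \<in> C0_infinity U (U \<union> Gamma0 U)"
  and p: "p \<in> Gamma0 U" "\<eta> p \<noteq> 0"
 obtains r where "0 < r" "ball p r \<inter> {z. 0 \<le> snd z} \<subseteq> U \<union> Gamma0 U"
proof -
 let ?S = "U \<union> Gamma0 U"
 define K where "K = closure {z\<in>?S. \<eta> z \<noteq> 0}"
 have KS: "K \<subseteq> ?S" using \<eta> by (simp add: C0_infinity_def K_def)
 have cont: "continuous_on ?S \<eta>" using \<eta> Ck_upto_continuous[of 0 U ?S \<eta>] by (simp add: C0_infinity_def)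
 obtain T where T: "open T" "Gamma0 U = {z. snd z = 0} \<inter> T" using Gamma0_open by blast
 have "p \<in> T" using p T by auto
 then obtain r1 where r1: "0 < r1" "ball p r1 \<subseteq> T" using T(1) open_contains_ball by blast
 have "0 < \<bar>\<eta> p\<bar>" using p by simp
 then obtain r2 where r2: "0 < r2" "\<And>z. z \<in> ?S ==> dist z p < r2 ==> dist (\<eta> z) (\<eta> p) < \<bar>\<eta> p\<bar>"
  using cont p unfolding continuous_on_iff by (metis UnI2)
 have ne: "\<eta> z \<noteq> 0" if "z \<in> ?S" "dist z p < r2" for z using r2(2)[OF that] by (auto simp: dist_real_def)
 define r where "r = min r1 r2"
 have r: "0 < r" using r1 r2 by (simp add: r_def)
 define B where "B = ball p r \<inter> half_plane"
 have "connected B" unfolding B_def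
  by (intro convex_connected convex_Int convex_ball convex_half_plane)
 moreover have "openin (top_of_set B) (B \<inter> U)" using U(1) by (simp add: openin_open_Int)
 moreover have "closedin (top_of_set B) (B \<inter> U)"
  unfolding closedin_closed
 proof (intro exI[of _ "closure (B \<inter> U)"] conjI)
  show "B \<inter> U = B \<inter> closure (B \<inter> U)"
  proof
   show "B \<inter> U \<subseteq> B \<inter> closure (B \<inter> U)" using closure_subset[of "B \<inter> U"] by blast
   have "B \<inter> U \<subseteq> {z\<in>?S. \<eta> z \<noteq> 0}" using ne by (auto simp: B_def r_def dist_commute)
   then have "closure (B \<inter> U) \<subseteq> K" unfolding K_def by (rule closure_mono)
   then have "closure (B \<inter> U) \<subseteq> ?S" using KS by blast
   moreover have "B \<inter> Gamma0 U = {}" using T by (auto simp: B_def half_plane_def)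
   ultimately show "B \<inter> closure (B \<inter> U) \<subseteq> B \<inter> U" by blast
  qed
 qed simp
 ultimately have "B \<inter> U = {} \<or> B \<inter> U = B" unfolding connected_clopen by blast
 moreover have "B \<inter> U \<noteq> {}"
 proof -
  have "p \<in> closure U" using p(1) Gamma0_subset[of U] by (auto simp: frontier_def)
  then obtain z where "z \<in> U" "dist z p < r" using r unfolding closure_approachable by blast
  then show ?thesis using U(2) by (auto simp: B_def dist_commute)
 qed
 ultimately have BU: "B \<subseteq> U" by blast
 have "ball p r \<inter> {z. 0 \<le> snd z} \<subseteq> ?S"
 proof
  fix z assume z: "z \<in> ball p r \<inter> {z. 0 \<le> snd z}"
  show "z \<in> ?S"
  proof (cases "snd z = 0")
   case True
   then show ?thesis using z r1(2) T(2) by (auto simp: r_def)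
  next
   case False
   then show ?thesis using z BU by (auto simp: B_def half_plane_def)
  qed
 qed
 with r show thesis by (rule that)
qed

lemma test_function_extension:
 assumes U: "open U" "U \<subseteq> half_plane" and \<eta>: "\<eta> \<in> C0_infinity U (U \<union> Gamma0 U)"
 defines "X \<equiv> \<lambda>z. if z \<in> U \<union> Gamma0 U then \<eta> z else 0"
 shows "continuous_on {z. 0 \<le> snd z} X"
  and "\<exists>K. compact K \<and> K \<subseteq> U \<union> Gamma0 U \<and> (\<forall>z. z \<notin> K \<longrightarrow> X z = 0)"
proof -
 let ?S = "U \<union> Gamma0 U"
 define K where "K = closure {z\<in>?S. \<eta> z \<noteq> 0}"
 have K: "compact K" "K \<subseteq> ?S" using \<eta> by (auto simp: C0_infinity_def K_def)
 have "{z\<in>?S. \<eta> z \<noteq> 0} \<subseteq> K" unfolding K_def by (rule closure_subset)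
 then have X0: "X z = 0" if "z \<notin> K" for z using that by (auto simp: X_def)
 then show "\<exists>K. compact K \<and> K \<subseteq> ?S \<and> (\<forall>z. z \<notin> K \<longrightarrow> X z = 0)" using K by blast
 have cont: "continuous_on ?S \<eta>" using \<eta> Ck_upto_continuous[of 0 U ?S \<eta>] by (simp add: C0_infinity_def)
 show "continuous_on {z. 0 \<le> snd z} X"
  unfolding continuous_on_iff
 proof (intro ballI allI impI)
  fix p :: "real \<times> real" and e :: real assume p: "p \<in> {z. 0 \<le> snd z}" and e: "0 < e"
  show "\<exists>d>0. \<forall>z\<in>{z. 0 \<le> snd z}. dist z p < d \<longrightarrow> dist (X z) (X p) < e"
  proof (cases "p \<in> ?S")
   case False
   then have "p \<in> - K" using K by auto
   moreover have "open (- K)" using K(1) by (simp add: compact_imp_closed open_Compl)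
   ultimately obtain d where d: "0 < d" "ball p d \<subseteq> - K" using open_contains_ball by blast
   have "dist (X z) (X p) < e" if "dist z p < d" for z
   proof -
    have "z \<in> ball p d" using that by (simp add: dist_commute)
    then have "z \<notin> K" using d(2) by blast
    then show ?thesis using X0 \<open>p \<in> - K\<close> e by simp
   qed
   then show ?thesis using d(1) by blast
  next
   case True
   obtain d where d: "0 < d" "\<And>z. z \<in> ?S ==> dist z p < d ==> dist (\<eta> z) (\<eta> p) < e"
    using cont True e unfolding continuous_on_iff by metis
   have XS: "X z = \<eta> z" if "z \<in> ?S" for z using that by (simp add: X_def)
   show ?thesis
   proof (cases "\<eta> p = 0")
    case True
    have "dist (X z) (X p) < e" if "dist z p < d" for z
     using d(2)[OF _ that] XS \<open>p \<in> ?S\<close> True e by (cases "z \<in> ?S") (auto simp: X_def)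
    then show ?thesis using d(1) by blast
   next
    case False
    obtain r where r: "0 < r" "ball p r \<inter> {z. 0 \<le> snd z} \<subseteq> ?S"
    proof (cases "p \<in> U")
     case True
     then obtain r where "0 < r" "ball p r \<subseteq> U" using U(1) open_contains_ball by blast
     then show thesis using that[of r] by blast
    next
     case False
     then have "p \<in> Gamma0 U" using \<open>p \<in> ?S\<close> by blast
     then show thesis using test_function_half_disk[OF U \<eta> _ \<open>\<eta> p \<noteq> 0\<close>] that by blast
    qed
    have "dist (X z) (X p) < e" if z: "0 \<le> snd z" "dist z p < min d r" for z
    proof -
     have "z \<in> ball p r \<inter> {z. 0 \<le> snd z}" using z by (simp add: dist_commute)
     then have "z \<in> ?S" using r(2) by blast
     then show ?thesis using d(2)[of z] z XS \<open>p \<in> ?S\<close> by simp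
    qed
    then show ?thesis using d(1) r(1) by (intro exI[of _ "min d r"]) auto
   qed
  qed
 qed
qed

lemma conv_bump_between:
 fixes f :: "'a::euclidean_space => real"
 assumes r: "0 < r" and f: "integrable lborel f"
  and b: "AE y in lborel. y \<in> cball (z - c) r \<longrightarrow> l \<le> f y \<and> f y \<le> u"
 shows "l \<le> conv (bump c r) f z" "conv (bump c r) f z \<le> u"
proof -
 let ?b = "bump (z - c) r"
 have bi: "integrable lborel ?b" by (rule bump_integrable[OF r])
 obtain C where "\<And>z. \<bar>bump c r z\<bar> \<le> C"
  using C1_test_bounded[OF C0_infinity_UNIV_C1_test[OF bump_C0_infinity[OF r]]] by metis
 from conv_integrand_integrable[OF bump_continuous this f, of z]
 have i: "integrable lborel (\<lambda>y. ?b y * f y)" by (simp add: bump_reflect)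
 have eq: "conv (bump c r) f z = (LINT y|lborel. ?b y * f y)" by (simp add: conv_def bump_reflect)
 have ae: "AE y in lborel. ?b y * l \<le> ?b y * f y \<and> ?b y * f y \<le> ?b y * u"
  using b
 proof eventually_elim
  fix y assume *: "y \<in> cball (z - c) r \<longrightarrow> l \<le> f y \<and> f y \<le> u"
  show "?b y * l \<le> ?b y * f y \<and> ?b y * f y \<le> ?b y * u"
  proof (cases "y \<in> ball (z - c) r")
   case True
   then have "l \<le> f y \<and> f y \<le> u" using * ball_subset_cball by blast
   then show ?thesis using bump_nonneg[of "z - c" r y] by (auto intro: mult_left_mono)
  qed (simp add: bump_eq_0[OF r])
 qed
 have "(LINT y|lborel. ?b y * l) \<le> (LINT y|lborel. ?b y * f y)"
  using ae by (intro integral_mono_AE i integrable_mult_left bi) (auto elim: eventually_mono)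
 then show "l \<le> conv (bump c r) f z" unfolding eq using bump_integral[OF r, of "z - c"] by simp
 have "(LINT y|lborel. ?b y * f y) \<le> (LINT y|lborel. ?b y * u)"
  using ae by (intro integral_mono_AE i integrable_mult_left bi) (auto elim: eventually_mono)
 then show "conv (bump c r) f z \<le> u" unfolding eq using bump_integral[OF r, of "z - c"] by simp
qed

text \<open>Within unit distance the weight of the gradient does not decrease upwards, up to a constant factor. For
 the Heston weight it is \<open>y powr \<beta>\<close> times a factor that varies slowly.\<close>

locale degenerate_domain = weighted_domain +
 fixes C\<^sub>w :: real
 assumes weight_mono: "\<And>z z'. 0 < snd z ==> snd z \<le> snd z' ==> norm (z' - z) \<le> 1 ==>
   snd z * w z \<le> C\<^sub>w * (snd z' * w z')"
begin

lemma C_w_ge_1: "1 \<le> C\<^sub>w"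
proof -
 have "(0, 1) \<in> half_plane" by (simp add: half_plane_def)
 then have "0 < w (0, 1)" by (rule w_pos)
 then show ?thesis using weight_mono[of "(0, 1)" "(0, 1)"] by simp
qed

text \<open>Mollification with a kernel that looks upwards does not increase the energy, up to a constant:
 the degenerate weight at a point is controlled by the weight at the points above it.\<close>

lemma mollified_energy:
 assumes g: "g \<in> borel_measurable W" "integrable W (\<lambda>z. snd z * (g z)\<^sup>2)"
  and G: "integrable lborel G" "AE z in lebesgue. \<bar>G z\<bar> \<le> \<bar>if z \<in> U then g z else 0\<bar>"
  and h: "0 < h" "h \<le> 1/2"
 shows "integrable W (\<lambda>z. snd z * (conv (bump (0, - h) (h / 2)) G z)\<^sup>2)"
  "(LINT z|W. snd z * (conv (bump (0, - h) (h / 2)) G z)\<^sup>2) \<le> C\<^sub>w * (LINT z|W. snd z * (g z)\<^sup>2)"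
proof -
 let ?k = "bump (0 :: real, - h) (h / 2)"
 have r: "0 < h / 2" using h by simp
 have [measurable]: "G \<in> borel_measurable borel" using G by auto
 define D where "D = conv ?k G"
 have Dc: "continuous_on UNIV D"
  using Ck_upto_conv[OF bump_C0_infinity[OF r] G(1), of 0 UNIV UNIV] by (simp add: D_def)
 have [measurable]: "D \<in> borel_measurable borel" by (intro borel_measurable_continuous_onI Dc)
 have DW [measurable]: "D \<in> borel_measurable W"
  by (intro continuous_borel_W continuous_on_subset[OF Dc]) auto
 \<comment> \<open>The weight of the gradient, extended by zero to the plane, so that Fubini applies to Lebesgue measure.\<close>
 define a where "a z = indicator half_plane z * (snd z * w z)" for z
 have "(\<lambda>z. indicator half_plane z *\<^sub>R (snd z * w z)) \<in> borel_measurable borel"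
  using open_half_plane by (intro borel_measurable_continuous_on_indicator continuous_intros w_cont) auto
 then have [measurable]: "a \<in> borel_measurable borel" by (simp add: a_def[abs_def])
 have a0: "0 \<le> a z" for z using w_pos[of z] by (auto simp: a_def indicator_def half_plane_def)
 have a_mono: "a z \<le> C\<^sub>w * a y" if "?k (z - y) \<noteq> 0" for z y
 proof (cases "z \<in> half_plane")
  case True
  have "z - y \<in> ball (0, - h) (h / 2)" using that bump_eq_0[OF r] by blast
  then have n: "norm (z - y - (0, - h)) < h / 2" by (simp add: dist_norm norm_minus_commute)
  have "\<bar>snd (z - y - (0, - h))\<bar> \<le> norm (z - y - (0, - h))"
   by (metis norm_snd_le real_norm_def prod.collapse)
  then have "\<bar>snd z - snd y + h\<bar> < h / 2" using n by simp
  then have s: "snd z \<le> snd y" using h by linarith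
  have "norm (z - y) \<le> norm (z - y - (0, - h)) + norm ((0, - h) :: real \<times> real)"
   using norm_triangle_ineq[of "z - y - (0, - h)" "(0, - h)"] by simp
  also have "norm ((0, - h) :: real \<times> real) = h" using h by (simp add: norm_Pair)
  finally have "norm (y - z) \<le> 1" using n h by (simp add: norm_minus_commute)
  then have "snd z * w z \<le> C\<^sub>w * (snd y * w y)"
   using True s by (intro weight_mono) (auto simp: half_plane_def)
  moreover have "y \<in> half_plane" using True s by (simp add: half_plane_def)
  ultimately show ?thesis using True by (simp add: a_def)
 next
  case False
  then show ?thesis using a0[of y] C_w_ge_1 by (simp add: a_def)
 qed
 have kG: "integrable lborel (\<lambda>y. ?k (z - y) * G y)" for z
 proof -
  obtain C where "\<And>z. \<bar>?k z\<bar> \<le> C"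
   using C1_test_bounded[OF C0_infinity_UNIV_C1_test[OF bump_C0_infinity[OF r]]] by metis
  from conv_integrand_integrable[OF bump_continuous this G(1)] show ?thesis .
 qed
 have kint: "integrable lborel (\<lambda>y. ?k (z - y))" "(LINT y|lborel. ?k (z - y)) = 1" for z
  using bump_integrable[OF r] bump_integral[OF r] by (simp_all add: bump_reflect)
 have key: "(\<integral>\<^sup>+ z. ennreal (a z * (D z)\<^sup>2) \<partial>lborel) \<le> ennreal C\<^sub>w * (\<integral>\<^sup>+ z. ennreal (a z * (G z)\<^sup>2) \<partial>lborel)"
 proof -
  have "(\<integral>\<^sup>+ z. ennreal (a z * (D z)\<^sup>2) \<partial>lborel) \<le>
    (\<integral>\<^sup>+ z. \<integral>\<^sup>+ y. ennreal (?k (z - y)) * ennreal (C\<^sub>w * a y * (G y)\<^sup>2) \<partial>lborel \<partial>lborel)"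
  proof (rule nn_integral_mono)
   fix z
   have "ennreal (a z * (D z)\<^sup>2) \<le> ennreal (a z) * (\<integral>\<^sup>+ y. ennreal (?k (z - y) * (G y)\<^sup>2) \<partial>lborel)"
    unfolding ennreal_mult[OF a0 zero_le_power2] D_def conv_def
    by (intro mult_left_mono Jensen_square kG kint bump_nonneg) auto
   also have "\<dots> = (\<integral>\<^sup>+ y. ennreal (a z) * ennreal (?k (z - y) * (G y)\<^sup>2) \<partial>lborel)"
    by (intro nn_integral_cmult[symmetric]) measurable
   also have "\<dots> \<le> (\<integral>\<^sup>+ y. ennreal (?k (z - y)) * ennreal (C\<^sub>w * a y * (G y)\<^sup>2) \<partial>lborel)"
   proof (rule nn_integral_mono)
    fix y
    have "a z * (?k (z - y) * (G y)\<^sup>2) \<le> ?k (z - y) * (C\<^sub>w * a y * (G y)\<^sup>2)"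
    proof (cases "?k (z - y) = 0")
     case False
     have "a z * (?k (z - y) * (G y)\<^sup>2) \<le> C\<^sub>w * a y * (?k (z - y) * (G y)\<^sup>2)"
      by (intro mult_right_mono a_mono[OF False] mult_nonneg_nonneg bump_nonneg) simp
     then show ?thesis by (simp add: ac_simps)
    qed simp
    then show "ennreal (a z) * ennreal (?k (z - y) * (G y)\<^sup>2) \<le> ennreal (?k (z - y)) * ennreal (C\<^sub>w * a y * (G y)\<^sup>2)"
     using a0 C_w_ge_1 by (simp add: ennreal_mult[symmetric] bump_nonneg ennreal_leI)
   qed
   finally show "ennreal (a z * (D z)\<^sup>2) \<le> (\<integral>\<^sup>+ y. ennreal (?k (z - y)) * ennreal (C\<^sub>w * a y * (G y)\<^sup>2) \<partial>lborel)" .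
  qed
  also have "\<dots> = (\<integral>\<^sup>+ y. \<integral>\<^sup>+ z. ennreal (?k (z - y)) * ennreal (C\<^sub>w * a y * (G y)\<^sup>2) \<partial>lborel \<partial>lborel)"
   by (intro lborel_pair.Fubini') measurable
  also have "\<dots> = (\<integral>\<^sup>+ y. ennreal (C\<^sub>w * a y * (G y)\<^sup>2) \<partial>lborel)"
  proof (rule nn_integral_cong)
   fix y :: "real \<times> real"
   have "(\<integral>\<^sup>+ z. ennreal (?k (z - y)) \<partial>lborel) = (\<integral>\<^sup>+ z. ennreal (?k z) \<partial>lborel)"
    using nn_integral_lborel_translate[of "\<lambda>z. ennreal (?k z)" "- y"] by simp
   also have "\<dots> = ennreal (LINT z|lborel. ?k z)"
    by (intro nn_integral_eq_integral bump_integrable r AE_I2 bump_nonneg)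
   finally have "(\<integral>\<^sup>+ z. ennreal (?k (z - y)) \<partial>lborel) = 1" using bump_integral[OF r] by simp
   then show "(\<integral>\<^sup>+ z. ennreal (?k (z - y)) * ennreal (C\<^sub>w * a y * (G y)\<^sup>2) \<partial>lborel) = ennreal (C\<^sub>w * a y * (G y)\<^sup>2)"
    by (subst nn_integral_multc) auto
  qed
  also have "\<dots> = (\<integral>\<^sup>+ y. ennreal C\<^sub>w * ennreal (a y * (G y)\<^sup>2) \<partial>lborel)"
   using C_w_ge_1 a0 by (simp add: ennreal_mult[symmetric] mult.assoc)
  also have "\<dots> = ennreal C\<^sub>w * (\<integral>\<^sup>+ z. ennreal (a z * (G z)\<^sup>2) \<partial>lborel)"
   by (intro nn_integral_cmult) measurable
  finally show ?thesis .
 qed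
 have W_nn: "(\<integral>\<^sup>+ z. ennreal (snd z * (F z)\<^sup>2) \<partial>W) = (\<integral>\<^sup>+ z. ennreal (indicator U z * (a z * (F z)\<^sup>2)) \<partial>lebesgue)"
  if [measurable]: "F \<in> borel_measurable W" for F
 proof -
  have "(\<lambda>z. ennreal (snd z * (F z)\<^sup>2)) \<in> borel_measurable W" by measurable
  then have m: "(\<lambda>z. ennreal (snd z * (F z)\<^sup>2)) \<in> borel_measurable (lebesgue_on U)" by (simp add: W_def)
  have "(\<integral>\<^sup>+ z. ennreal (snd z * (F z)\<^sup>2) \<partial>W) = (\<integral>\<^sup>+ z. ennreal (w z) * ennreal (snd z * (F z)\<^sup>2) \<partial>lebesgue_on U)"
   unfolding W_def using w_borel m by (intro nn_integral_density) auto
  also have "\<dots> = (\<integral>\<^sup>+ z. ennreal (w z) * ennreal (snd z * (F z)\<^sup>2) * indicator U z \<partial>lebesgue)"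
   by (rule nn_integral_restrict_space) simp
  also have "\<dots> = (\<integral>\<^sup>+ z. ennreal (indicator U z * (a z * (F z)\<^sup>2)) \<partial>lebesgue)"
  proof (rule nn_integral_cong)
   fix z
   show "ennreal (w z) * ennreal (snd z * (F z)\<^sup>2) * indicator U z = ennreal (indicator U z * (a z * (F z)\<^sup>2))"
   proof (cases "z \<in> U")
    case True
    then have "z \<in> half_plane" using U_half by blast
    then show ?thesis using True snd_nonneg[OF True] w_pos'[OF True]
     by (simp add: a_def ennreal_mult[symmetric] ac_simps)
   qed simp
  qed
  finally show ?thesis .
 qed
 have "(\<integral>\<^sup>+ z. ennreal (snd z * (D z)\<^sup>2) \<partial>W) \<le> (\<integral>\<^sup>+ z. ennreal (a z * (D z)\<^sup>2) \<partial>lebesgue)"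
  unfolding W_nn[OF DW] using a0 by (intro nn_integral_mono ennreal_leI) (auto simp: indicator_def)
 also have "\<dots> = (\<integral>\<^sup>+ z. ennreal (a z * (D z)\<^sup>2) \<partial>lborel)" by (rule nn_integral_completion)
 also have "\<dots> \<le> ennreal C\<^sub>w * (\<integral>\<^sup>+ z. ennreal (a z * (G z)\<^sup>2) \<partial>lborel)" by (rule key)
 also have "(\<integral>\<^sup>+ z. ennreal (a z * (G z)\<^sup>2) \<partial>lborel) = (\<integral>\<^sup>+ z. ennreal (a z * (G z)\<^sup>2) \<partial>lebesgue)"
  by (rule nn_integral_completion[symmetric])
 also have "\<dots> \<le> (\<integral>\<^sup>+ z. ennreal (indicator U z * (a z * (g z)\<^sup>2)) \<partial>lebesgue)"
 proof (rule nn_integral_mono_AE)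
  show "AE z in lebesgue. ennreal (a z * (G z)\<^sup>2) \<le> ennreal (indicator U z * (a z * (g z)\<^sup>2))"
   using G(2)
  proof eventually_elim
   fix z assume le: "\<bar>G z\<bar> \<le> \<bar>if z \<in> U then g z else 0\<bar>"
   have "(G z)\<^sup>2 \<le> indicator U z * (g z)\<^sup>2"
   proof (cases "z \<in> U")
    case True
    then show ?thesis using le by (simp add: abs_le_square_iff)
   qed (use le in simp)
   from mult_left_mono[OF this a0[of z]] show "ennreal (a z * (G z)\<^sup>2) \<le> ennreal (indicator U z * (a z * (g z)\<^sup>2))"
    by (intro ennreal_leI) (simp add: ac_simps)
  qed
 qed
 also have "\<dots> = (\<integral>\<^sup>+ z. ennreal (snd z * (g z)\<^sup>2) \<partial>W)" by (rule W_nn[OF g(1), symmetric])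
 also have "\<dots> = ennreal (LINT z|W. snd z * (g z)\<^sup>2)"
  using snd_nonneg by (intro nn_integral_eq_integral g(2) AE_I2) simp
 finally have fin: "(\<integral>\<^sup>+ z. ennreal (snd z * (D z)\<^sup>2) \<partial>W) \<le> ennreal (C\<^sub>w * (LINT z|W. snd z * (g z)\<^sup>2))"
  using C_w_ge_1 by (simp add: ennreal_mult' mult_left_mono)
 have nn: "AE z in W. 0 \<le> snd z * (D z)\<^sup>2" using snd_nonneg by (intro AE_I2) simp
 have i: "integrable W (\<lambda>z. snd z * (D z)\<^sup>2)"
 proof (rule integrableI_nonneg[OF _ nn])
  show "(\<integral>\<^sup>+ z. ennreal (snd z * (D z)\<^sup>2) \<partial>W) < \<infinity>" using fin by (rule le_less_trans) simp
 qed measurable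
 then show "integrable W (\<lambda>z. snd z * (conv ?k G z)\<^sup>2)" by (simp add: D_def)
 have "0 \<le> (LINT z|W. snd z * (g z)\<^sup>2)" using snd_nonneg by (intro integral_nonneg_AE AE_I2) simp
 then show "(LINT z|W. snd z * (conv ?k G z)\<^sup>2) \<le> C\<^sub>w * (LINT z|W. snd z * (g z)\<^sup>2)"
  using fin nn_integral_eq_integral[OF i nn] C_w_ge_1 by (simp add: D_def)
qed

lemma test_function_C1:
 assumes \<eta>: "\<eta> \<in> C0_infinity U (U \<union> Gamma0 U)"
 shows "\<And>z. z \<in> U ==> \<eta> differentiable (at z)"
  "\<And>e. e \<in> Basis ==> continuous_on U (pd \<eta> e)" "continuous_on U \<eta>"
proof -
 have "Ck_upto (Suc 0) U (U \<union> Gamma0 U) \<eta>" using \<eta> by (simp add: C0_infinity_def del: Ck_upto.simps)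
 then have c: "Ck_upto (Suc 0) U U \<eta>" by (rule Ck_upto_subset) auto
 then show "\<And>z. z \<in> U ==> \<eta> differentiable (at z)" "continuous_on U \<eta>" by auto
 show "\<And>e. e \<in> Basis ==> continuous_on U (pd \<eta> e)"
  using Ck_upto_frechet[OF open_U c] by simp
qed

context
 fixes \<eta> X :: "real \<times> real => real" and v vx vy :: "real \<times> real => real" and \<epsilon> :: real
 assumes \<eta>: "\<eta> \<in> C0_infinity U (U \<union> Gamma0 U)"
  and X_def: "X = (\<lambda>z. if z \<in> U \<union> Gamma0 U then \<eta> z else 0)"
  and wdv: "wd v vx vy" and \<epsilon>: "0 < \<epsilon>"
  and vanish: "\<And>z. z \<in> U ==> X z < \<epsilon> ==> v z = 0 \<and> vx z = 0 \<and> vy z = 0"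
begin

lemma X_cont: "continuous_on {z. 0 \<le> snd z} X"
 using test_function_extension(1)[OF open_U U_half \<eta>] by (simp add: X_def)

lemma X_support: "\<exists>K. compact K \<and> K \<subseteq> U \<union> Gamma0 U \<and> (\<forall>z. z \<notin> K \<longrightarrow> X z = 0)"
 using test_function_extension(2)[OF open_U U_half \<eta>] by (simp add: X_def)

lemma S_half: "z \<in> U \<union> Gamma0 U ==> 0 \<le> snd z"
 using snd_nonneg[of z] Gamma0_subset[of U] by auto

lemma X_superlevel:
 assumes "0 < a"
 shows "compact {z. 0 \<le> snd z \<and> a \<le> X z}" "{z. 0 \<le> snd z \<and> a \<le> X z} \<subseteq> U \<union> Gamma0 U"
proof -
 obtain K where K: "compact K" "K \<subseteq> U \<union> Gamma0 U" "\<And>z. z \<notin> K ==> X z = 0" using X_support by blast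
 have sub: "{z. 0 \<le> snd z \<and> a \<le> X z} \<subseteq> K" using K(3) assms by force
 have "closed ({z. 0 \<le> snd z} \<inter> X -` {a..})"
  by (rule continuous_closed_preimage[OF X_cont closed_half_plane closed_atLeast])
 also have "{z. 0 \<le> snd z} \<inter> X -` {a..} = {z. 0 \<le> snd z \<and> a \<le> X z}" by auto
 finally have "closed {z. 0 \<le> snd z \<and> a \<le> X z}" .
 with sub K(1) show "compact {z. 0 \<le> snd z \<and> a \<le> X z}"
  using compact_Int_closed[of K "{z. 0 \<le> snd z \<and> a \<le> X z}"] by (simp add: Int_absorb1)
 show "{z. 0 \<le> snd z \<and> a \<le> X z} \<subseteq> U \<union> Gamma0 U" using sub K(2) by blast
qed

lemma compact_superlevel:
 assumes "compact K" "K \<subseteq> half_plane" "0 < a"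
 shows "compact {z\<in>K. a \<le> X z}" "{z\<in>K. a \<le> X z} \<subseteq> U"
proof -
 have eq: "{z\<in>K. a \<le> X z} = K \<inter> {z. 0 \<le> snd z \<and> a \<le> X z}" using assms(2) by (auto simp: half_plane_def)
 then show "compact {z\<in>K. a \<le> X z}" using assms(1) X_superlevel(1)[OF assms(3)] by (simp add: compact_Int)
 have "{z\<in>K. a \<le> X z} \<subseteq> U \<union> Gamma0 U" using eq X_superlevel(2)[OF assms(3)] by blast
 moreover have "z \<notin> Gamma0 U" if "z \<in> K" for z
 proof -
  have "z \<in> half_plane" using that assms(2) by blast
  then have "0 < snd z" by (simp add: half_plane_def)
  moreover have "snd z = 0" if "z \<in> Gamma0 U" using subsetD[OF Gamma0_subset that] by simp
  ultimately show ?thesis by force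
 qed
 ultimately show "{z\<in>K. a \<le> X z} \<subseteq> U" by blast
qed

lemma X_eq: "z \<in> U ==> X z = \<eta> z"
 by (simp add: X_def)

lemmas \<eta>_C1 = test_function_C1[OF \<eta>]

text \<open>A function that vanishes where the test function is small is extended by zero without creating
 a jump at the boundary of the domain.\<close>

lemma zero_extension_weak_deriv:
 assumes e: "e \<in> Basis" and vg: "has_weak_deriv e U v g" and g0: "\<And>z. z \<in> U ==> X z < \<epsilon> ==> g z = 0"
 shows "has_weak_deriv e half_plane (\<lambda>z. if z \<in> U then v z else 0) (\<lambda>z. if z \<in> U then g z else 0)"
proof -
 have li: "loc_integrable half_plane (\<lambda>z. if z \<in> U then f z else 0)"
  if f: "loc_integrable U f" and f0: "\<And>z. z \<in> U ==> X z < \<epsilon> ==> f z = 0" for f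
  unfolding loc_integrable_def set_integrable_def
 proof (intro allI impI)
  fix K assume K: "compact K" "K \<subseteq> half_plane"
  note K1 = compact_superlevel[OF K \<epsilon>]
  have "indicator K z *\<^sub>R (if z \<in> U then f z else 0) = indicator {z\<in>K. \<epsilon> \<le> X z} z * f z" for z
   using f0[of z] K1(2) by (auto simp: indicator_def not_le)
  then show "integrable lebesgue (\<lambda>z. indicator K z *\<^sub>R (if z \<in> U then f z else 0))"
   using loc_integrableD[OF f K1] by simp
 qed
 \<comment> \<open>The cutoff \<open>C1_step a (X z)\<close> is 1 where \<open>X z \<ge> \<epsilon>\<close> and vanishes near the boundary of the domain.\<close>
 define a where "a = \<epsilon> / 2"
 have a: "0 < a" "2 * a = \<epsilon>" using \<epsilon> by (auto simp: a_def)
 show ?thesis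
 proof (rule has_weak_derivI_C1_test[OF open_half_plane li li])
  show "loc_integrable U v" "loc_integrable U g" using vg by (auto simp: has_weak_deriv_def)
  show "v z = 0" if "z \<in> U" "X z < \<epsilon>" for z using vanish[OF that] by simp
  show "g z = 0" if "z \<in> U" "X z < \<epsilon>" for z using g0[OF that] .
  fix \<psi> assume \<psi>: "C1_test half_plane \<psi>"
  obtain K where K: "compact K" "K \<subseteq> half_plane" "\<And>z. z \<notin> K ==> \<psi> z = 0" using C1_testE[OF \<psi>] by metis
  define K2 where "K2 = {z\<in>K. a \<le> X z}"
  have K2: "compact K2" "K2 \<subseteq> U" unfolding K2_def by (rule compact_superlevel[OF K(1,2) a(1)])+
  define y where "y z = C1_step a (X z) * \<psi> z" for z
  have y0: "y z = 0" if "z \<notin> K2" for z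
   using that K(3) C1_step_eq_0[OF a(1), of "X z"] by (cases "z \<in> K") (auto simp: K2_def y_def)
  define s' where "s' t = 4 / a * (max (1 - (max (t / a - 1) 0)\<^sup>2) 0) * max (t / a - 1) 0" for t
  have step: "(C1_step a has_real_derivative s' t) (at t)" for t
   unfolding s'_def by (rule C1_step_has_derivative[OF a(1)])
  have yd: "(y has_derivative (\<lambda>h. C1_step a (\<eta> z) * pd \<psi> h z +
    s' (\<eta> z) * pd \<eta> h z * \<psi> z)) (at z)" if z: "z \<in> U" for z
  proof (rule has_derivative_transform_within_open[OF _ open_U z])
   have d1: "(\<eta> has_derivative frechet_derivative \<eta> (at z)) (at z)"
    using \<eta>_C1(1)[OF z] by (rule frechet_derivative_works[THEN iffD1])
   have d2: "(\<psi> has_derivative frechet_derivative \<psi> (at z)) (at z)"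
    using \<psi> unfolding C1_test_def by (intro frechet_derivative_works[THEN iffD1]) blast
   from has_derivative_mult[OF DERIV_compose_FDERIV[OF step d1] d2]
   show "((\<lambda>z. C1_step a (\<eta> z) * \<psi> z) has_derivative (\<lambda>h. C1_step a (\<eta> z) * pd \<psi> h z +
    s' (\<eta> z) * pd \<eta> h z * \<psi> z)) (at z)" by (simp add: mult.commute mult.left_commute)
  qed (simp add: y_def X_eq)
  have yfr: "pd y h z = C1_step a (\<eta> z) * pd \<psi> h z +
    s' (\<eta> z) * pd \<eta> h z * \<psi> z" if "z \<in> U" for z h
   using frechet_derivative_at[OF yd[OF that], symmetric] by metis
  have yT: "C1_test U y"
  proof (rule C1_testI[OF open_U K2 y0])
   show "y differentiable (at z)" if "z \<in> U" for z using yd[OF that] unfolding differentiable_def by blast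
   fix e' :: "real \<times> real" assume e': "e' \<in> Basis"
   have cs: "continuous_on UNIV (C1_step a)"
    using step DERIV_isCont continuous_at_imp_continuous_on by blast
   have cs': "continuous_on UNIV s'" unfolding s'_def using a(1) by (intro continuous_intros) auto
   have "continuous_on U (\<lambda>z. C1_step a (\<eta> z) * pd \<psi> e' z +
    s' (\<eta> z) * pd \<eta> e' z * \<psi> z)"
    using \<psi> e'
    by (intro continuous_intros \<eta>_C1(2)[OF e'] C1_test_continuous[OF \<psi>]
      continuous_on_compose2[OF cs \<eta>_C1(3)] continuous_on_compose2[OF cs' \<eta>_C1(3)])
     (auto simp: C1_test_def intro: continuous_on_subset)
   then show "continuous_on U (pd y e')" using yfr by (simp cong: continuous_on_cong)
  qed
  have "(LINT z:half_plane|lebesgue. (if z \<in> U then v z else 0) * pd \<psi> e z) =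
    (LINT z:U|lebesgue. v z * pd y e z)"
   unfolding set_lebesgue_integral_def
  proof (rule Bochner_Integration.integral_cong[OF refl])
   fix z
   show "indicator half_plane z *\<^sub>R ((if z \<in> U then v z else 0) * pd \<psi> e z) =
    indicator U z *\<^sub>R (v z * pd y e z)"
   proof (cases "z \<in> U \<and> \<epsilon> \<le> X z")
    case True
    then have "\<epsilon> \<le> \<eta> z" "z \<in> half_plane" using U_half by (auto simp: X_eq)
    then have "C1_step a (\<eta> z) = 1" "s' (\<eta> z) = 0"
     using C1_step_eq_1[OF a(1)] C1_step_deriv_eq_0[OF a(1)] a(2) by (auto simp: s'_def)
    then show ?thesis using True yfr[of z e] \<open>z \<in> half_plane\<close> by simp
   qed (use vanish[of z] in \<open>auto simp: not_le\<close>)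
  qed
  also have "\<dots> = - (LINT z:U|lebesgue. g z * y z)"
   by (rule has_weak_deriv_C1_test[OF open_U e vg yT])
  also have "(LINT z:U|lebesgue. g z * y z) = (LINT z:half_plane|lebesgue. (if z \<in> U then g z else 0) * \<psi> z)"
   unfolding set_lebesgue_integral_def
  proof (rule Bochner_Integration.integral_cong[OF refl])
   fix z
   show "indicator U z *\<^sub>R (g z * y z) = indicator half_plane z *\<^sub>R ((if z \<in> U then g z else 0) * \<psi> z)"
   proof (cases "z \<in> U \<and> \<epsilon> \<le> X z")
    case True
    then have "z \<in> half_plane" using U_half by auto
    then show ?thesis using True C1_step_eq_1[OF a(1)] a(2) by (simp add: y_def)
   qed (use g0[of z] in \<open>auto simp: not_le\<close>)
  qed
  finally show "(LINT z:half_plane|lebesgue. (if z \<in> U then v z else 0) * pd \<psi> e z) =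
    - (LINT z:half_plane|lebesgue. (if z \<in> U then g z else 0) * \<psi> z)" .
 qed
qed

lemma X_uniformly_continuous:
 assumes "0 < a"
 obtains d where "0 < d" "\<And>z z'. 0 \<le> snd z ==> 0 \<le> snd z' ==> dist z z' < d ==> \<bar>X z - X z'\<bar> < a"
proof -
 let ?H = "{z :: real \<times> real. 0 \<le> snd z}"
 obtain K where K: "compact K" "\<And>z. z \<notin> K ==> X z = 0" using X_support by blast
 obtain R where R: "K \<subseteq> cball 0 R" using compact_imp_bounded[OF K(1)] by (auto simp: bounded_iff subset_eq)
 have "compact (cball 0 (R + 1) \<inter> ?H)" by (rule compact_Int_closed[OF compact_cball closed_half_plane])
 then have "uniformly_continuous_on (cball 0 (R + 1) \<inter> ?H) X"
  by (intro compact_uniformly_continuous continuous_on_subset[OF X_cont]) auto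
 then obtain d where d: "0 < d" "\<And>z z'. z \<in> cball 0 (R + 1) \<inter> ?H ==> z' \<in> cball 0 (R + 1) \<inter> ?H ==>
   dist z' z < d ==> dist (X z') (X z) < a"
  using assms unfolding uniformly_continuous_on_def by metis
 show thesis
 proof (rule that[of "min d 1"])
  fix z z' :: "real \<times> real" assume z: "0 \<le> snd z" "0 \<le> snd z'" "dist z z' < min d 1"
  show "\<bar>X z - X z'\<bar> < a"
  proof (cases "z \<in> cball 0 (R + 1) \<and> z' \<in> cball 0 (R + 1)")
   case True
   then have "dist (X z) (X z') < a" using z by (intro d(2)) auto
   then show ?thesis by (simp add: dist_real_def)
  next
   case False
   then have "z \<notin> cball 0 R" "z' \<notin> cball 0 R"
    using z(3) norm_triangle_ineq[of "z - z'" z'] norm_triangle_ineq[of "z' - z" z]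
    by (auto simp: dist_norm norm_minus_commute simp del: norm_Pair)
   then have "z \<notin> K" "z' \<notin> K" using R by auto
   then show ?thesis using K(2) assms by simp
  qed
 qed (use d in auto)
qed

text \<open>At a point of the domain or of the degenerate boundary the upward kernel sees only points strictly
 above, so the mollification is smooth up to the boundary. By uniform continuity of \<open>X\<close> it is at most
 \<open>(X - \<epsilon> / 2)\<^sup>+\<close>, and therefore has compact support in \<open>U \<union> Gamma0 U\<close>.\<close>

lemma dominated_by_test_function_H1_0:
 assumes vH: "v \<in> H1 U W" and \<eta>H: "\<eta> \<in> H1 U W"
  and bd: "\<And>z. z \<in> U ==> 0 \<le> v z \<and> v z \<le> max (X z - \<epsilon>) 0"
 shows "v \<in> H1_0 U W"
proof -
 let ?H = "{z :: real \<times> real. 0 \<le> snd z}"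
 define vt where "vt z = (if z \<in> U then v z else 0)" for z
 have UH: "U \<subseteq> ?H" using snd_nonneg by auto
 define L where "L = {z. 0 \<le> snd z \<and> \<epsilon> \<le> X z}"
 have L: "compact L" "L \<subseteq> ?H" using X_superlevel[OF \<epsilon>] by (auto simp: L_def)
 have "bounded (X ` L)"
  by (intro compact_imp_bounded compact_continuous_image continuous_on_subset[OF X_cont L(2)] L(1))
 then obtain B where B: "\<And>z. z \<in> L ==> \<bar>X z\<bar> \<le> B" by (auto simp: bounded_iff)
 have vt_int: "integrable lebesgue vt"
 proof (rule Bochner_Integration.integrable_bound)
  have "L \<in> sets lebesgue" "emeasure lebesgue L < \<infinity>"
   using lmeasurable_compact[OF L(1)] by (auto simp only: fmeasurable_def infinity_ennreal_def)
  then show "integrable lebesgue (\<lambda>z. B * indicator L z)" by (intro integrable_mult_right integrable_real_indicator)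
  have "(\<lambda>z. indicator U z *\<^sub>R v z) \<in> borel_measurable lebesgue"
   using H1D(5)[OF vH] unfolding borel_W by (subst (asm) borel_measurable_restrict_space_iff) auto
  moreover have "(\<lambda>z. indicator U z *\<^sub>R v z) = vt" by (auto simp: vt_def indicator_def)
  ultimately show "vt \<in> borel_measurable lebesgue" by simp
  show "AE z in lebesgue. norm (vt z) \<le> norm (B * indicator L z)"
  proof (rule AE_I2)
   fix z
   show "norm (vt z) \<le> norm (B * indicator L z)"
   proof (cases "z \<in> U \<and> \<epsilon> \<le> X z")
    case True
    then have zL: "z \<in> L" using UH by (auto simp: L_def)
    then have "0 \<le> v z" "v z \<le> B" using bd[of z] True B[OF zL] \<epsilon> by auto
    then show ?thesis using True zL by (simp add: vt_def)
   next
    case False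
    then have "vt z = 0" using vanish[of z] by (auto simp: vt_def not_le)
    then show ?thesis by simp
   qed
  qed
 qed
 obtain f where f: "integrable lborel f" "AE z in lebesgue. vt z = f z"
  using integrable_lebesgue_borel_representative[OF vt_int] by blast
 have f_ae: "AE z in lborel. vt z = f z" using f(2) by (rule AE_completion_iff[THEN iffD1])
 have "0 < \<epsilon> / 2" using \<epsilon> by simp
 from X_uniformly_continuous[OF this]
 obtain d where d: "0 < d" "\<And>z z'. 0 \<le> snd z ==> 0 \<le> snd z' ==> dist z z' < d ==> \<bar>X z - X z'\<bar> < \<epsilon> / 2"
  by blast
 \<comment> \<open>\<open>2 * h n \<le> d\<close> keeps the kernel within the modulus of continuity of \<open>X\<close>, and \<open>h n \<le> 1/2\<close> is the
  range of the energy estimate.\<close>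
 define h where "h n = min d 1 / (2 * real (Suc n))" for n
 have h: "0 < h n" "2 * h n \<le> d" "h n \<le> 1 / 2" for n
 proof -
  show "0 < h n" using d(1) by (simp add: h_def)
  have "h n \<le> min d 1 / 2" unfolding h_def using d(1) by (intro divide_left_mono) auto
  then show "2 * h n \<le> d" "h n \<le> 1 / 2" by auto
 qed
 have r: "0 < h n / 2" for n using h(1) by simp
 have ball: "dist z y < d" "snd z + h n / 2 \<le> snd y" if "y \<in> cball (z - (0, - h n)) (h n / 2)" for z y :: "real \<times> real" and n
 proof -
  have v: "(0, h n) - (y - z) = z - (0, - h n) - y" by (simp add: prod_eq_iff)
  have n: "norm (y - z - (0, h n)) \<le> h n / 2"
   using that unfolding norm_minus_commute[of "y - z"] v by (simp add: dist_norm)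
  have "\<bar>snd (y - z - (0, h n))\<bar> \<le> norm (y - z - (0, h n))" by (metis norm_snd_le real_norm_def prod.collapse)
  then have "\<bar>snd y - snd z - h n\<bar> \<le> h n / 2" using n by simp
  then show "snd z + h n / 2 \<le> snd y" by linarith
  have "norm (y - z) \<le> norm (y - z - (0, h n)) + norm ((0, h n) :: real \<times> real)"
   using norm_triangle_ineq[of "y - z - (0, h n)" "(0, h n)"] by simp
  also have "norm ((0, h n) :: real \<times> real) = h n" using h(1)[of n] by (simp add: norm_Pair)
  finally show "dist z y < d" using n h(1,2)[of n] by (simp add: dist_norm norm_minus_commute)
 qed
 define V where "V n = conv (bump (0, - h n) (h n / 2)) f" for n
 have Vb: "0 \<le> V n z \<and> V n z \<le> max (X z - \<epsilon> / 2) 0" if z: "0 \<le> snd z" for n z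
 proof -
  have "AE y in lborel. y \<in> cball (z - (0, - h n)) (h n / 2) \<longrightarrow> 0 \<le> f y \<and> f y \<le> max (X z - \<epsilon> / 2) 0"
   using f_ae
  proof eventually_elim
   fix y assume eq: "vt y = f y"
   show "y \<in> cball (z - (0, - h n)) (h n / 2) \<longrightarrow> 0 \<le> f y \<and> f y \<le> max (X z - \<epsilon> / 2) 0"
   proof
    assume "y \<in> cball (z - (0, - h n)) (h n / 2)"
    note b = ball[OF this]
    have "0 \<le> snd y" using b(2) z h(1)[of n] by linarith
    then have "\<bar>X z - X y\<bar> < \<epsilon> / 2" using d(2)[OF z _ b(1)] by simp
    then have "X y - \<epsilon> \<le> X z - \<epsilon> / 2" by linarith
    then have "max (X y - \<epsilon>) 0 \<le> max (X z - \<epsilon> / 2) 0" by (intro max.mono) auto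
    then show "0 \<le> f y \<and> f y \<le> max (X z - \<epsilon> / 2) 0"
     using bd[of y] eq by (cases "y \<in> U") (auto simp: vt_def simp del: max.bounded_iff)
   qed
  qed
  from conv_bump_between[OF r f(1) this] show ?thesis by (simp add: V_def)
 qed
 have VC: "Ck_upto k A A' (V n)" for k A A' n
  unfolding V_def by (rule Ck_upto_conv[OF bump_C0_infinity[OF r] f(1)])
 have Vtest: "V n \<in> C0_infinity U (U \<union> Gamma0 U)" for n
 proof -
  have a: "0 < \<epsilon> / 2" using \<epsilon> by simp
  define K where "K = {z. 0 \<le> snd z \<and> \<epsilon> / 2 \<le> X z}"
  have K: "compact K" "K \<subseteq> U \<union> Gamma0 U" unfolding K_def by (rule X_superlevel[OF a])+
  have sub: "closure {z \<in> U \<union> Gamma0 U. V n z \<noteq> 0} \<subseteq> K"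
  proof (rule closure_minimal)
   show "{z \<in> U \<union> Gamma0 U. V n z \<noteq> 0} \<subseteq> K"
   proof
    fix z assume "z \<in> {z \<in> U \<union> Gamma0 U. V n z \<noteq> 0}"
    then have "0 \<le> snd z" "V n z \<noteq> 0" using S_half by auto
    then show "z \<in> K" using Vb[of z n] by (auto simp: K_def)
   qed
  qed (use K in \<open>simp add: compact_imp_closed\<close>)
  have "compact (closure {z \<in> U \<union> Gamma0 U. V n z \<noteq> 0})"
   using sub compact_Int_closed[OF K(1), of "closure {z \<in> U \<union> Gamma0 U. V n z \<noteq> 0}"] by (simp add: Int_absorb1)
  then show ?thesis using sub K(2) VC unfolding C0_infinity_def by blast
 qed
 have energy: "has_weak_deriv e U (V n) (pd (V n) e) \<and>
   integrable W (\<lambda>z. snd z * (pd (V n) e z)\<^sup>2) \<and>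
   (LINT z|W. snd z * (pd (V n) e z)\<^sup>2) \<le> C\<^sub>w * (LINT z|W. snd z * (g z)\<^sup>2)"
  if e: "e \<in> Basis" and vg: "has_weak_deriv e U v g" and g: "g \<in> borel_measurable W" "integrable W (\<lambda>z. snd z * (g z)\<^sup>2)"
   and g0: "\<And>z. z \<in> U ==> X z < \<epsilon> ==> g z = 0" for e g n
 proof -
  have VC1: "Ck_upto (Suc 0) U U (V n)" by (rule VC)
  have wdV: "has_weak_deriv e U (V n) (pd (V n) e)"
   using VC1 Ck_upto_frechet[OF open_U VC1] by (intro C1_has_weak_deriv open_U e) auto
  define gt where "gt z = (if z \<in> U then g z else 0)" for z
  have ext: "has_weak_deriv e half_plane vt gt"
   unfolding vt_def[abs_def] gt_def[abs_def] by (rule zero_extension_weak_deriv[OF e vg g0])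
  define K where "K = {z. h n / 2 \<le> snd z} \<inter> L"
  have "closed {z :: real \<times> real. h n / 2 \<le> snd z}" by (intro closed_Collect_le continuous_intros)
  then have K: "compact K" unfolding K_def by (rule closed_Int_compact) (rule L(1))
  have KU: "K \<subseteq> U"
  proof
   fix z assume "z \<in> K"
   then have z: "h n / 2 \<le> snd z" "z \<in> L" by (auto simp: K_def)
   have "z \<in> U \<union> Gamma0 U" using X_superlevel(2)[OF \<epsilon>] z(2) unfolding L_def by blast
   moreover have "z \<notin> Gamma0 U"
   proof
    assume "z \<in> Gamma0 U"
    from subsetD[OF Gamma0_subset this] z(1) h(1)[of n] show False by auto
   qed
   ultimately show "z \<in> U" by blast
  qed
  have gl: "loc_integrable U g" using vg by (simp add: has_weak_deriv_def)
  obtain G where G: "integrable lborel G" "AE z in lebesgue. indicator K z * g z = G z"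
   using integrable_lebesgue_borel_representative[OF loc_integrableD[OF gl K KU]] by blast
  have fr: "pd (V n) e z = conv (bump (0, - h n) (h n / 2)) G z" if z: "z \<in> U" for z
   unfolding V_def
  proof (rule mollify_weak_deriv[OF open_half_plane e ext r f(1) G(1)])
   have pos: "h n / 2 \<le> snd y" if "y \<in> cball (z - (0, - h n)) (h n / 2)" for y
    using ball(2)[OF that] snd_nonneg[OF z] by linarith
   show "cball (z - (0, - h n)) (h n / 2) \<subseteq> half_plane"
   proof
    fix y assume "y \<in> cball (z - (0, - h n)) (h n / 2)"
    then have "h n / 2 \<le> snd y" by (rule pos)
    then show "y \<in> half_plane" using h(1)[of n] by (simp add: half_plane_def)
   qed
   show "AE y in lebesgue. y \<in> cball (z - (0, - h n)) (h n / 2) \<longrightarrow> f y = vt y"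
    using f(2) by eventually_elim simp
   show "AE y in lebesgue. y \<in> cball (z - (0, - h n)) (h n / 2) \<longrightarrow> G y = gt y"
    using G(2)
   proof eventually_elim
    fix y assume eq: "indicator K y * g y = G y"
    show "y \<in> cball (z - (0, - h n)) (h n / 2) \<longrightarrow> G y = gt y"
    proof
     assume c: "y \<in> cball (z - (0, - h n)) (h n / 2)"
     have p: "h n / 2 \<le> snd y" by (rule pos[OF c])
     show "G y = gt y"
     proof (cases "y \<in> K")
      case True
      then show ?thesis using eq KU by (auto simp: gt_def)
     next
      case False
      then have "gt y = 0"
       using g0[of y] p h(1)[of n] by (auto simp: gt_def K_def L_def not_le)
      then show ?thesis using False eq by simp
     qed
    qed
   qed
  qed
  have Gb: "AE z in lebesgue. \<bar>G z\<bar> \<le> \<bar>if z \<in> U then g z else 0\<bar>"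
   using G(2)
  proof eventually_elim
   fix z assume "indicator K z * g z = G z"
   then show "\<bar>G z\<bar> \<le> \<bar>if z \<in> U then g z else 0\<bar>" using KU by (cases "z \<in> K") auto
  qed
  note E = mollified_energy[OF g G(1) Gb h(1)[of n] h(3)[of n]]
  have sp: "z \<in> space W ==> snd z * (pd (V n) e z)\<^sup>2 =
    snd z * (conv (bump (0, - h n) (h n / 2)) G z)\<^sup>2" for z using fr by simp
  have "integrable W (\<lambda>z. snd z * (pd (V n) e z)\<^sup>2)"
   using E(1) by (subst Bochner_Integration.integrable_cong[OF refl sp]) auto
  moreover have "(LINT z|W. snd z * (pd (V n) e z)\<^sup>2) \<le> C\<^sub>w * (LINT z|W. snd z * (g z)\<^sup>2)"
   using E(2) by (subst Bochner_Integration.integral_cong[OF refl sp]) auto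
  ultimately show ?thesis using wdV by blast
 qed
 note [measurable] = wd_borel[OF wdv]
 have wd1: "has_weak_deriv (1, 0) U v vx" "has_weak_deriv (0, 1) U v vy" using wdv by (auto simp: wd_def)
 have vi: "integrable W (\<lambda>z. snd z * (vx z)\<^sup>2)" "integrable W (\<lambda>z. snd z * (vy z)\<^sup>2)"
  using H1_iff[OF wdv] vH dens_integrable[OF wd_borel[OF wdv]] by auto
 note Ex = energy[OF Basis_real2(1) wd1(1) wd_borel(2)[OF wdv] vi(1)]
 note Ey = energy[OF Basis_real2(2) wd1(2) wd_borel(3)[OF wdv] vi(2)]
 have Ex: "has_weak_deriv (1, 0) U (V n) (pd (V n) (1, 0))"
   "integrable W (\<lambda>z. snd z * (pd (V n) (1, 0) z)\<^sup>2)"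
   "(LINT z|W. snd z * (pd (V n) (1, 0) z)\<^sup>2) \<le> C\<^sub>w * (LINT z|W. snd z * (vx z)\<^sup>2)" for n
  using Ex[of n] vanish by auto
 have Ey: "has_weak_deriv (0, 1) U (V n) (pd (V n) (0, 1))"
   "integrable W (\<lambda>z. snd z * (pd (V n) (0, 1) z)\<^sup>2)"
   "(LINT z|W. snd z * (pd (V n) (0, 1) z)\<^sup>2) \<le> C\<^sub>w * (LINT z|W. snd z * (vy z)\<^sup>2)" for n
  using Ey[of n] vanish by auto
 have wdV: "wd (V n) (pd (V n) (1, 0)) (pd (V n) (0, 1))" for n
  using Ex(1) Ey(1) by (simp add: wd_def)
 have V2: "(1 + snd z) * (V n z)\<^sup>2 \<le> (1 + snd z) * (\<eta> z)\<^sup>2" if z: "z \<in> U" for n z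
 proof -
  have "0 \<le> V n z \<and> V n z \<le> \<bar>\<eta> z\<bar>" using Vb[OF snd_nonneg[OF z], of n] X_eq[OF z] \<epsilon> by auto
  then have "(V n z)\<^sup>2 \<le> (\<eta> z)\<^sup>2" by (simp flip: abs_le_square_iff)
  then show ?thesis using snd_nonneg[OF z] by (intro mult_left_mono) auto
 qed
 have V2i: "integrable W (\<lambda>z. (1 + snd z) * (V n z)\<^sup>2)" for n
 proof (rule integrable_W_mono[OF H1D(4)[OF \<eta>H]])
  note [measurable] = wd_borel[OF wdV[of n]]
  show "(\<lambda>z. (1 + snd z) * (V n z)\<^sup>2) \<in> borel_measurable W" by measurable
  show "\<bar>(1 + snd z) * (V n z)\<^sup>2\<bar> \<le> (1 + snd z) * (\<eta> z)\<^sup>2" if "z \<in> U" for z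
   using V2[OF that, of n] snd_nonneg[OF that] by (simp add: abs_mult)
 qed
 have VH: "V n \<in> H1 U W" for n by (rule H1I[OF wdV Ex(2) Ey(2) V2i])
 have bound: "ip (V n) (V n) \<le> C\<^sub>w * (LINT z|W. snd z * (vx z)\<^sup>2) + C\<^sub>w * (LINT z|W. snd z * (vy z)\<^sup>2) +
   (LINT z|W. (1 + snd z) * (\<eta> z)\<^sup>2)" for n
 proof -
  have "ip (V n) (V n) = (LINT z|W. snd z * (pd (V n) (1, 0) z)\<^sup>2) +
    (LINT z|W. snd z * (pd (V n) (0, 1) z)\<^sup>2) + (LINT z|W. (1 + snd z) * (V n z)\<^sup>2)"
   unfolding ip_eq_wd[OF wdV VH] dens_def using Ex(2) Ey(2) V2i by (simp add: distrib_left[of "snd _"])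
  moreover have "(LINT z|W. (1 + snd z) * (V n z)\<^sup>2) \<le> (LINT z|W. (1 + snd z) * (\<eta> z)\<^sup>2)"
   by (intro integral_mono V2i H1D(4)[OF \<eta>H]) (use V2 in simp)
  ultimately show ?thesis using Ex(3)[of n] Ey(3)[of n] by linarith
 qed
 have h0: "(\<lambda>n. norm ((0, - h n) :: real \<times> real) + h n / 2) \<longlonglongrightarrow> 0"
 proof -
  have "(\<lambda>n. 3 / 2 * min d 1 * (1 / (2 * real (Suc n)))) \<longlonglongrightarrow> 0" by (rule tendsto_mult_right_zero) real_asymp
  moreover have "norm ((0, - h n) :: real \<times> real) + h n / 2 = 3 / 2 * min d 1 * (1 / (2 * real (Suc n)))" for n
  proof -
   have "norm ((0, - h n) :: real \<times> real) = h n" using h(1)[of n] by (simp add: norm_Pair)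
   then have "norm ((0, - h n) :: real \<times> real) + h n / 2 = 3 / 2 * h n" by simp
   then show ?thesis by (simp only: h_def times_divide_eq_right mult_1_right)
  qed
  ultimately show ?thesis by simp
 qed
 note ai = approximate_identity[OF f(1) r h0]
 have "\<exists>s. strict_mono s \<and> (AE z in lborel. (\<lambda>n. V (s n) z - f z) \<longlonglongrightarrow> 0)"
  unfolding V_def
  by (rule tendsto_L1_AE_subseq[of lborel "\<lambda>n z. conv (bump (0, - h n) (h n / 2)) f z - f z"]) (use ai f(1) in simp_all)
 then obtain s where s: "strict_mono s" "AE z in lborel. (\<lambda>n. V (s n) z - f z) \<longlonglongrightarrow> 0" by blast
 have "AE z in lebesgue. (\<lambda>n. V (s n) z - f z) \<longlonglongrightarrow> 0" using s(2) by (rule AE_completion_iff[THEN iffD2])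
 then have "AE z in lebesgue. z \<in> U \<longrightarrow> (\<lambda>n. V (s n) z) \<longlonglongrightarrow> v z"
  using f(2)
 proof eventually_elim
  fix z assume l: "(\<lambda>n. V (s n) z - f z) \<longlonglongrightarrow> 0" and eq: "vt z = f z"
  show "z \<in> U \<longrightarrow> (\<lambda>n. V (s n) z) \<longlonglongrightarrow> v z" using LIM_zero_cancel[OF l] eq[symmetric] by (auto simp: vt_def)
 qed
 then have "AE z in W. (\<lambda>n. V (s n) z) \<longlonglongrightarrow> v z" unfolding AE_W by (subst AE_restrict_space_iff) auto
 then show ?thesis
  by (rule H1_0_bounded_AE_limit[rotated 2]) (use test_function_H1_0[OF Vtest VH] bound in auto)
qed

end

lemma wd_const: "wd (\<lambda>z. c) (\<lambda>z. 0) (\<lambda>z. 0)"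
proof -
 have d: "((\<lambda>z. c) has_derivative (\<lambda>h. 0)) (at z)" for z :: "real \<times> real" by simp
 have fr: "frechet_derivative (\<lambda>z :: real \<times> real. c) (at z) = (\<lambda>h. 0)" for z
  using frechet_derivative_at[OF d, symmetric] by simp
 have "has_weak_deriv e U (\<lambda>z. c) (\<lambda>z. 0)" if "e \<in> Basis" for e
  using C1_has_weak_deriv[OF open_U that, of "\<lambda>z. c"] by (simp add: fr)
 then show ?thesis using Basis_real2 by (simp add: wd_def)
qed

text \<open>Subtracting \<open>\<delta>\<close> first makes room for the mollification: \<open>(\<eta> - g - \<delta>)\<^sup>+\<close> vanishes where \<open>\<eta> < \<delta>\<close>.\<close>

lemma test_function_minus_nonneg_H1_0:
 assumes \<eta>: "\<eta> \<in> C0_infinity U (U \<union> Gamma0 U)" and \<eta>H: "\<eta> \<in> H1 U W"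
  and g: "g \<in> H1 U W" "\<And>z. 0 \<le> g z"
 shows "(\<lambda>z. max (\<eta> z - g z) 0) \<in> H1_0 U W"
proof -
 define d where "d n = 1 / real (Suc n)" for n
 have d: "0 < d n" for n by (simp add: d_def)
 define D where "D z = 1 * \<eta> z + (-1) * g z" for z
 have DH: "D \<in> H1 U W" unfolding D_def[abs_def] by (rule H1_lincomb[OF \<eta>H g(1)])
 note wdD = H1D(1)[OF DH]
 define v where "v n z = max (D z - d n) 0" for n z
 have wdv: "wd (v n) (\<lambda>z. if 0 < D z - d n then Dx U D z else 0) (\<lambda>z. if 0 < D z - d n then Dy U D z else 0)" for n
 proof -
  have "wd (\<lambda>z. 1 * D z + (-1) * d n) (\<lambda>z. 1 * Dx U D z + (-1) * 0) (\<lambda>z. 1 * Dy U D z + (-1) * 0)"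
   by (rule wd_lincomb[OF wdD wd_const])
  then have "wd (\<lambda>z. D z - d n) (Dx U D) (Dy U D)" by simp
  from wd_max_0[OF this] show ?thesis by (simp add: v_def[abs_def])
 qed
 have le: "0 \<le> dens (v n) (\<lambda>z. if 0 < D z - d n then Dx U D z else 0) (\<lambda>z. if 0 < D z - d n then Dy U D z else 0) z \<and>
   dens (v n) (\<lambda>z. if 0 < D z - d n then Dx U D z else 0) (\<lambda>z. if 0 < D z - d n then Dy U D z else 0) z \<le>
   dens D (Dx U D) (Dy U D) z" if z: "z \<in> U" for n z
 proof -
  have "(v n z)\<^sup>2 \<le> (D z)\<^sup>2" using d[of n] by (auto simp: v_def max_def simp flip: abs_le_square_iff)
  then have "(1 + snd z) * (v n z)\<^sup>2 \<le> (1 + snd z) * (D z)\<^sup>2" using snd_nonneg[OF z] by (intro mult_left_mono) auto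
  moreover have "0 \<le> snd z * ((Dx U D z)\<^sup>2 + (Dy U D z)\<^sup>2)" "0 \<le> (1 + snd z) * (v n z)\<^sup>2" using snd_nonneg[OF z] by simp_all
  ultimately show ?thesis unfolding dens_def by (cases "0 < D z - d n") auto
 qed
 have Di: "integrable W (dens D (Dx U D) (Dy U D))" using H1_iff[OF wdD] DH by simp
 have vi: "integrable W (dens (v n) (\<lambda>z. if 0 < D z - d n then Dx U D z else 0) (\<lambda>z. if 0 < D z - d n then Dy U D z else 0))" for n
 proof (rule integrable_W_mono[OF Di])
  note [measurable] = wd_borel[OF wdv[of n]]
  show "dens (v n) (\<lambda>z. if 0 < D z - d n then Dx U D z else 0) (\<lambda>z. if 0 < D z - d n then Dy U D z else 0) \<in> borel_measurable W"
   unfolding dens_def[abs_def] by measurable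
 qed (use le in simp)
 have vH: "v n \<in> H1 U W" for n using vi H1_iff[OF wdv] by simp
 have v0: "v n \<in> H1_0 U W" for n
 proof (rule dominated_by_test_function_H1_0[OF \<eta> refl wdv d _ vH \<eta>H])
  fix z assume z: "z \<in> U"
  have le: "D z \<le> \<eta> z" using g(2)[of z] by (simp add: D_def)
  show "v n z = 0 \<and> (if 0 < D z - d n then Dx U D z else 0) = 0 \<and> (if 0 < D z - d n then Dy U D z else 0) = 0"
   if "(if z \<in> U \<union> Gamma0 U then \<eta> z else 0) < d n"
   using that z le by (simp add: v_def)
  show "0 \<le> v n z \<and> v n z \<le> max ((if z \<in> U \<union> Gamma0 U then \<eta> z else 0) - d n) 0"
   using z le by (auto simp: v_def)
 qed
 show ?thesis
 proof (rule H1_0_bounded_AE_limit[OF v0])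
  show "ip (v n) (v n) \<le> ip D D" for n
   unfolding ip_eq_wd[OF wdv vH] ip_eq_wd[OF wdD DH] by (intro integral_mono vi Di) (use le in simp)
  show "AE z in W. (\<lambda>n. v n z) \<longlonglongrightarrow> max (\<eta> z - g z) 0"
  proof (rule AE_I2)
   fix z
   have "(\<lambda>n. max (D z - 1 / real (Suc n)) 0) \<longlonglongrightarrow> max (D z - 0) 0"
    by (intro tendsto_intros) real_asymp
   then show "(\<lambda>n. v n z) \<longlonglongrightarrow> max (\<eta> z - g z) 0" by (simp add: v_def d_def D_def)
  qed
 qed
qed

text \<open>The order ideal property. Approximate \<open>p\<close> by test functions: the resulting positive parts are bounded
 in the norm and converge almost everywhere along a subsequence.\<close>

theorem H1_0_minus_nonneg:
 assumes p: "p \<in> H1_0 U W" and g: "g \<in> H1 U W" "\<And>z. 0 \<le> g z"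
 shows "(\<lambda>z. max (p z - g z) 0) \<in> H1_0 U W"
proof -
 note pH = H1_0_H1[OF p]
 obtain \<phi> where \<phi>: "\<And>n::nat. \<phi> n \<in> C0_infinity U (U \<union> Gamma0 U)" "\<And>n. \<phi> n \<in> H1 U W"
  "(\<lambda>n. H.nrm (\<phi> n - p)) \<longlonglongrightarrow> 0" using H1_0_approx[OF p] by metis
 obtain s :: "nat => nat" where s: "strict_mono s" "AE z in W. (\<lambda>n. \<phi> (s n) z) \<longlonglongrightarrow> p z"
  using H1_limit_AE_subseq[OF \<phi>(2) pH \<phi>(3)] by blast
 have "convergent (\<lambda>n. H.nrm (\<phi> n))" using H.tendsto_nrm[OF \<phi>(2) pH \<phi>(3)] by (rule convergentI)
 then have "Bseq (\<lambda>n. H.nrm (\<phi> n))" by (rule convergent_imp_Bseq)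
 then obtain C where C: "\<And>n. H.nrm (\<phi> n) \<le> C" unfolding Bseq_def by (metis abs_le_D1 real_norm_def)
 show ?thesis
 proof (rule H1_0_bounded_AE_limit)
  show "(\<lambda>z. max (\<phi> (s n) z - g z) 0) \<in> H1_0 U W" for n
   by (rule test_function_minus_nonneg_H1_0[OF \<phi>(1,2) g])
  show "ip (\<lambda>z. max (\<phi> (s n) z - g z) 0) (\<lambda>z. max (\<phi> (s n) z - g z) 0) \<le> (C + H.nrm g)\<^sup>2" for n
  proof -
   have d: "\<phi> (s n) - g \<in> H1 U W" by (rule H.V_diff[OF \<phi>(2) g(1)])
   have "ip (\<lambda>z. max ((\<phi> (s n) - g) z) 0) (\<lambda>z. max ((\<phi> (s n) - g) z) 0) \<le> ip (\<phi> (s n) - g) (\<phi> (s n) - g)"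
    by (rule H1_max_0(2)[OF d])
   also have "\<dots> = (H.nrm (\<phi> (s n) - g))\<^sup>2" by (rule H.nrm_sq[OF d, symmetric])
   also have "\<dots> \<le> (C + H.nrm g)\<^sup>2"
   proof (rule power_mono)
    have "H.nrm (\<phi> (s n) - g) \<le> H.nrm (\<phi> (s n) - 0) + H.nrm (0 - g)"
     by (rule H.nrm_diff_triangle[OF \<phi>(2) subspace_0[OF H1_subspace] g(1)])
    also have "H.nrm (0 - g) = H.nrm g" using H.nrm_diff_sym[OF subspace_0[OF H1_subspace] g(1)] by simp
    also have "\<phi> (s n) - 0 = \<phi> (s n)" by (rule diff_zero)
    finally show "H.nrm (\<phi> (s n) - g) \<le> C + H.nrm g" using C[of "s n"] by linarith
   qed (rule H.nrm_nonneg[OF d])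
   finally show ?thesis by (simp add: fun_diff_def)
  qed
  show "AE z in W. (\<lambda>n. max (\<phi> (s n) z - g z) 0) \<longlonglongrightarrow> max (p z - g z) 0"
   using s(2) by eventually_elim (intro tendsto_intros)
 qed
qed

end

section \<open>The Heston weight\<close>

locale heston =
 fixes \<sigma> \<kappa> \<theta> \<gamma> :: real and U :: "(real \<times> real) set"
 assumes \<sigma>: "\<sigma> \<noteq> 0" and \<kappa>: "0 < \<kappa>" and \<theta>: "0 < \<theta>" and \<gamma>: "0 < \<gamma>" and dom: "half_plane_domain U"
begin

definition \<beta> :: real where "\<beta> = 2 * \<kappa> * \<theta> / \<sigma>\<^sup>2"
definition \<mu> :: real where "\<mu> = 2 * \<kappa> / \<sigma>\<^sup>2"

abbreviation wt :: "real \<times> real => real" where "wt \<equiv> heston_weight \<sigma> \<kappa> \<theta> \<gamma>"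

lemma \<beta>_pos: "0 < \<beta>" and \<mu>_pos: "0 < \<mu>"
 using \<sigma> \<kappa> \<theta> by (auto simp: \<beta>_def \<mu>_def)

lemma wt_eq: "wt z = snd z powr (\<beta> - 1) * exp (- \<gamma> * \<bar>fst z\<bar> - \<mu> * snd z)"
 by (simp add: heston_weight_def Let_def \<beta>_def \<mu>_def)

lemma snd_wt: "0 < snd z ==> snd z * wt z = snd z powr \<beta> * exp (- \<gamma> * \<bar>fst z\<bar> - \<mu> * snd z)"
 using powr_add[of "snd z" 1 "\<beta> - 1"] by (simp add: wt_eq)

end

sublocale heston \<subseteq> degenerate_domain U wt "exp (\<gamma> + \<mu>)"
proof
 show "open U" "U \<subseteq> half_plane" using dom by (auto simp: half_plane_domain_def)
 show "continuous_on half_plane wt"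
  unfolding wt_eq[abs_def] by (intro continuous_intros) (auto simp: half_plane_def)
 show "0 < wt z" if "z \<in> half_plane" for z using that by (simp add: wt_eq half_plane_def)
 fix z z' :: "real \<times> real" assume z: "0 < snd z" "snd z \<le> snd z'" "norm (z' - z) \<le> 1"
 have "\<bar>fst (z' - z)\<bar> \<le> norm (z' - z)" "\<bar>snd (z' - z)\<bar> \<le> norm (z' - z)"
  by (metis norm_fst_le real_norm_def prod.collapse, metis norm_snd_le real_norm_def prod.collapse)
 then have d: "\<bar>fst z'\<bar> \<le> \<bar>fst z\<bar> + 1" "snd z' \<le> snd z + 1" using z(3) by auto
 have "\<gamma> * \<bar>fst z'\<bar> \<le> \<gamma> * (\<bar>fst z\<bar> + 1)" "\<mu> * snd z' \<le> \<mu> * (snd z + 1)"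
  using d \<gamma> \<mu>_pos by (auto intro!: mult_left_mono)
 then have e: "- \<gamma> * \<bar>fst z\<bar> - \<mu> * snd z \<le> (\<gamma> + \<mu>) + (- \<gamma> * \<bar>fst z'\<bar> - \<mu> * snd z')"
  by (simp add: distrib_left)
 have "snd z * wt z = snd z powr \<beta> * exp (- \<gamma> * \<bar>fst z\<bar> - \<mu> * snd z)" by (rule snd_wt[OF z(1)])
 also have "\<dots> \<le> snd z' powr \<beta> * exp ((\<gamma> + \<mu>) + (- \<gamma> * \<bar>fst z'\<bar> - \<mu> * snd z'))"
  using z e \<beta>_pos by (intro mult_mono powr_mono2) auto
 also have "\<dots> = exp (\<gamma> + \<mu>) * (snd z' powr \<beta> * exp (- \<gamma> * \<bar>fst z'\<bar> - \<mu> * snd z'))"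
  by (simp only: exp_add) (simp add: ac_simps)
 also have "snd z' powr \<beta> * exp (- \<gamma> * \<bar>fst z'\<bar> - \<mu> * snd z') = snd z' * wt z'"
  using z by (intro snd_wt[symmetric]) simp
 finally show "snd z * wt z \<le> exp (\<gamma> + \<mu>) * (snd z' * wt z')" .
qed

context heston
begin

lemma W_eq: "heston_measure \<sigma> \<kappa> \<theta> \<gamma> U = W"
 by (simp add: heston_measure_def W_def)

subsection \<open>Integration by parts against the weight\<close>

text \<open>The weight is regularized by cutting it off near the degenerate boundary, where the cutoff
 \<open>((y - \<delta>)\<^sup>+ / y)\<^sup>2\<close> has \<open>y\<close> times its derivative bounded, and by smoothing the kink of
 \<open>\<bar>x\<bar>\<close>.\<close>

definition cut :: "real => real => real" where
 "cut \<delta> y = max (y - \<delta>) 0 / y"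

definition Py :: "real => real => real" where
 "Py \<delta> y = (max (y - \<delta>) 0)\<^sup>2 * (y powr (\<beta> - 2) * exp (- \<mu> * y))"

definition Py' :: "real => real => real" where
 "Py' \<delta> y = 2 * max (y - \<delta>) 0 * (y powr (\<beta> - 2) * exp (- \<mu> * y)) +
   (max (y - \<delta>) 0)\<^sup>2 * ((\<beta> - 2) * y powr (\<beta> - 3) * exp (- \<mu> * y) - \<mu> * (y powr (\<beta> - 2) * exp (- \<mu> * y)))"

definition Ex :: "real => real => real" where
 "Ex \<delta> x = exp (- \<gamma> * sqrt (x\<^sup>2 + \<delta>\<^sup>2))"

definition Ex' :: "real => real => real" where
 "Ex' \<delta> x = - \<gamma> * (x / sqrt (x\<^sup>2 + \<delta>\<^sup>2)) * Ex \<delta> x"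

lemma Py_has_derivative: "0 < y ==> (Py d has_real_derivative Py' d y) (at y)"
proof -
 assume y: "0 < y"
 have "((\<lambda>y. y - d) has_real_derivative 1) (at y)" by (auto intro!: derivative_eq_intros)
 from DERIV_chain2[OF pos_square_has_derivative this]
 have 1: "((\<lambda>y. (max (y - d) 0)\<^sup>2) has_real_derivative 2 * max (y - d) 0) (at y)" by simp
 have e: "((\<lambda>y. exp (- \<mu> * y)) has_real_derivative - \<mu> * exp (- \<mu> * y)) (at y)"
  by (auto intro!: derivative_eq_intros)
 have p: "((\<lambda>y. y powr (\<beta> - 2)) has_real_derivative (\<beta> - 2) * y powr (\<beta> - 2 - 1)) (at y)"
  using y by (rule has_real_derivative_powr)
 show ?thesis
  unfolding Py_def[abs_def] Py'_def using DERIV_mult[OF 1 DERIV_mult[OF p e]]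
  by (rule DERIV_cong) (simp add: algebra_simps)
qed

lemma Ex_has_derivative: "0 < d ==> (Ex d has_real_derivative Ex' d x) (at x)"
proof -
 assume d: "0 < d"
 then have p: "0 < x\<^sup>2 + d\<^sup>2" by (simp add: add_nonneg_pos)
 have "((\<lambda>x. x\<^sup>2 + d\<^sup>2) has_real_derivative 2 * x) (at x)" by (auto intro!: derivative_eq_intros)
 from DERIV_chain2[OF DERIV_real_sqrt[OF p] this]
 have "((\<lambda>x. sqrt (x\<^sup>2 + d\<^sup>2)) has_real_derivative x / sqrt (x\<^sup>2 + d\<^sup>2)) (at x)"
 proof (rule DERIV_cong)
  show "inverse (sqrt (x\<^sup>2 + d\<^sup>2)) / 2 * (2 * x) = x / sqrt (x\<^sup>2 + d\<^sup>2)"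
   by (simp add: inverse_eq_divide)
 qed
 from DERIV_chain2[OF DERIV_exp DERIV_cmult[OF this, of "- \<gamma>"]]
 show ?thesis unfolding Ex_def[abs_def] Ex'_def by (rule DERIV_cong) (simp add: Ex_def)
qed

definition regw :: "real => real \<times> real => real" where
 "regw \<delta> z = Py \<delta> (snd z) * Ex \<delta> (fst z)"

lemma regw_has_derivative:
 assumes "0 < d" "0 < snd z"
 shows "(regw d has_derivative
  (\<lambda>h. Py' d (snd z) * snd h * Ex d (fst z) + Py d (snd z) * (Ex' d (fst z) * fst h))) (at z)"
proof -
 have "((\<lambda>z. Py d (snd z)) has_derivative (\<lambda>h. snd h * Py' d (snd z))) (at z)"
  by (rule DERIV_compose_FDERIV[where f="Py d" and g=snd, OF Py_has_derivative[OF assms(2)]])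
   (rule bounded_linear_imp_has_derivative[OF bounded_linear_snd])
 moreover have "((\<lambda>z. Ex d (fst z)) has_derivative (\<lambda>h. fst h * Ex' d (fst z))) (at z)"
  by (rule DERIV_compose_FDERIV[where f="Ex d" and g=fst, OF Ex_has_derivative[OF assms(1)]])
   (rule bounded_linear_imp_has_derivative[OF bounded_linear_fst])
 ultimately show ?thesis
  unfolding regw_def[abs_def] using has_derivative_mult by (fastforce simp: ac_simps)
qed

text \<open>The smoothed factor in \<open>x\<close> over the given one. It is at most 1 and tends to 1 as \<open>\<delta>\<close> tends to 0, so that
 dominated convergence removes the regularization.\<close>

definition ratio :: "real => real => real" where
 "ratio \<delta> x = exp (\<gamma> * \<bar>x\<bar> - \<gamma> * sqrt (x\<^sup>2 + \<delta>\<^sup>2))"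

lemma ratio_bounds: "0 \<le> ratio d x" "ratio d x \<le> 1"
proof -
 have "\<bar>x\<bar> \<le> sqrt (x\<^sup>2 + d\<^sup>2)" by (metis real_sqrt_abs real_sqrt_le_mono le_add_same_cancel1 zero_le_power2)
 then have "\<gamma> * \<bar>x\<bar> \<le> \<gamma> * sqrt (x\<^sup>2 + d\<^sup>2)" using \<gamma> by (intro mult_left_mono) auto
 then show "ratio d x \<le> 1" by (simp add: ratio_def)
qed (simp add: ratio_def)

lemma cut_bounds: "0 < d ==> 0 < y ==> 0 \<le> cut d y" "0 < d ==> 0 < y ==> cut d y \<le> 1"
 by (auto simp: cut_def divide_le_eq)

lemma Ex_ratio: "Ex d x = exp (- \<gamma> * \<bar>x\<bar>) * ratio d x"
 by (simp add: Ex_def ratio_def exp_add[symmetric])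

lemma wt_split: "wt z = snd z powr (\<beta> - 1) * exp (- \<mu> * snd z) * exp (- \<gamma> * \<bar>fst z\<bar>)"
 unfolding wt_eq using exp_add[of "- \<mu> * snd z" "- \<gamma> * \<bar>fst z\<bar>"] by (simp add: ac_simps)

lemma powr_shift:
 assumes "0 < (y :: real)"
 shows "y powr (\<beta> - 2) = y powr (\<beta> - 1) / y" "y powr (\<beta> - 3) = y powr (\<beta> - 1) / y\<^sup>2"
proof -
 show "y powr (\<beta> - 2) = y powr (\<beta> - 1) / y"
  using assms powr_diff[of y "\<beta> - 1" 1] by simp
 show "y powr (\<beta> - 3) = y powr (\<beta> - 1) / y\<^sup>2"
  using assms powr_diff[of y "\<beta> - 1" 2] by simp
qed

lemma Py_cut: "0 < y ==> Py d y = y powr (\<beta> - 1) * exp (- \<mu> * y) * ((cut d y)\<^sup>2 * y)"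
 unfolding Py_def cut_def by (simp add: powr_shift power_divide) (simp add: power2_eq_square)

lemma Py'_cut: "0 < y ==> Py' d y = y powr (\<beta> - 1) * exp (- \<mu> * y) *
  (2 * cut d y + (\<beta> - 2) * (cut d y)\<^sup>2 - \<mu> * (cut d y)\<^sup>2 * y)"
 unfolding Py'_def cut_def by (simp add: powr_shift power_divide) (simp add: power2_eq_square field_simps)

definition slope :: "real => real \<times> real => real \<times> real => real" where
 "slope \<delta> e z = snd e * (2 * cut \<delta> (snd z) + (\<beta> - 2) * (cut \<delta> (snd z))\<^sup>2 - \<mu> * (cut \<delta> (snd z))\<^sup>2 * snd z)
   - fst e * \<gamma> * (fst z / sqrt ((fst z)\<^sup>2 + \<delta>\<^sup>2)) * ((cut \<delta> (snd z))\<^sup>2 * snd z)"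

lemma regw_eq: "0 < snd z ==> regw d z = wt z * (ratio d (fst z) * ((cut d (snd z))\<^sup>2 * snd z))"
 by (simp add: regw_def Py_cut Ex_ratio wt_split)

lemma regw_frechet:
 assumes "0 < d" "0 < snd z"
 shows "pd (regw d) e z = wt z * (ratio d (fst z) * slope d e z)"
 unfolding frechet_derivative_at[OF regw_has_derivative[OF assms], symmetric]
 using assms(2) by (simp add: Py_cut Py'_cut Ex'_def Ex_ratio wt_split slope_def algebra_simps)

lemma regw_frechet_continuous:
 assumes d: "0 < d"
 shows "continuous_on half_plane (pd (regw d) e)"
proof -
 have "continuous_on half_plane (\<lambda>z. Py' d (snd z) * snd e * Ex d (fst z) + Py d (snd z) * (Ex' d (fst z) * fst e))"
  unfolding Py'_def Py_def Ex'_def Ex_def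
  by (intro continuous_intros) (use d in \<open>auto simp: half_plane_def add_nonneg_eq_0_iff\<close>)
 moreover have "pd (regw d) e z = Py' d (snd z) * snd e * Ex d (fst z) + Py d (snd z) * (Ex' d (fst z) * fst e)"
  if "z \<in> half_plane" for z
  using frechet_derivative_at[OF regw_has_derivative[OF d, of z], symmetric] that by (simp add: half_plane_def)
 ultimately show ?thesis by (simp cong: continuous_on_cong)
qed

lemma cut_tendsto:
 assumes "0 < y" shows "(\<lambda>n. cut (1 / real (Suc n)) y) \<longlonglongrightarrow> 1"
proof -
 have "(\<lambda>n. max (y - 1 / real (Suc n)) 0 / y) \<longlonglongrightarrow> max (y - 0) 0 / y"
  using assms by (intro tendsto_intros) (real_asymp, auto)
 then show ?thesis using assms by (simp add: cut_def)
qed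

lemma sqrt_tendsto: "(\<lambda>n. sqrt (x\<^sup>2 + (1 / real (Suc n))\<^sup>2)) \<longlonglongrightarrow> \<bar>x\<bar>"
proof -
 have "(\<lambda>n. 1 / real (Suc n)) \<longlonglongrightarrow> 0" by real_asymp
 then have "(\<lambda>n. sqrt (x\<^sup>2 + (1 / real (Suc n))\<^sup>2)) \<longlonglongrightarrow> sqrt (x\<^sup>2 + 0\<^sup>2)" by (intro tendsto_intros)
 then show ?thesis by simp
qed

lemma ratio_tendsto: "(\<lambda>n. ratio (1 / real (Suc n)) x) \<longlonglongrightarrow> 1"
proof -
 have "(\<lambda>n. ratio (1 / real (Suc n)) x) \<longlonglongrightarrow> exp (\<gamma> * \<bar>x\<bar> - \<gamma> * \<bar>x\<bar>)"
  unfolding ratio_def by (intro tendsto_intros sqrt_tendsto)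
 then show ?thesis by simp
qed

lemma sgn_tendsto: "(\<lambda>n. x / sqrt (x\<^sup>2 + (1 / real (Suc n))\<^sup>2)) \<longlonglongrightarrow> sgn x"
proof (cases "x = 0")
 case False
 have "(\<lambda>n. x / sqrt (x\<^sup>2 + (1 / real (Suc n))\<^sup>2)) \<longlonglongrightarrow> x / \<bar>x\<bar>"
  using False by (intro tendsto_intros sqrt_tendsto) auto
 then show ?thesis by (simp add: real_sgn_eq)
qed simp

lemma slope_tendsto:
 assumes "0 < snd z"
 shows "(\<lambda>n. slope (1 / real (Suc n)) e z) \<longlonglongrightarrow>
  snd e * (\<beta> - \<mu> * snd z) - fst e * \<gamma> * sgn (fst z) * snd z"
proof -
 have "(\<lambda>n. slope (1 / real (Suc n)) e z) \<longlonglongrightarrow>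
  snd e * (2 * 1 + (\<beta> - 2) * 1\<^sup>2 - \<mu> * 1\<^sup>2 * snd z) - fst e * \<gamma> * sgn (fst z) * (1\<^sup>2 * snd z)"
  unfolding slope_def by (intro tendsto_intros cut_tendsto sgn_tendsto assms)
 then show ?thesis by simp
qed

lemma slope_bound:
 assumes d: "0 < d" and y: "0 < snd z" and e: "\<bar>fst e\<bar> \<le> 1" "\<bar>snd e\<bar> \<le> 1"
 shows "\<bar>slope d e z\<bar> \<le> (2 + \<bar>\<beta> - 2\<bar> + \<mu> + \<gamma>) * (1 + snd z)"
proof -
 let ?c = "cut d (snd z)" and ?q = "fst z / sqrt ((fst z)\<^sup>2 + d\<^sup>2)"
 have c: "0 \<le> ?c" "?c \<le> 1" using cut_bounds[OF d y] by auto
 have c2: "0 \<le> ?c\<^sup>2" "?c\<^sup>2 \<le> 1" using c by (auto simp: power_le_one)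
 have "\<bar>fst z\<bar> \<le> sqrt ((fst z)\<^sup>2 + d\<^sup>2)" by (metis real_sqrt_abs real_sqrt_le_mono le_add_same_cancel1 zero_le_power2)
 moreover have "0 < sqrt ((fst z)\<^sup>2 + d\<^sup>2)" using d by (simp add: add_nonneg_pos)
 ultimately have q: "\<bar>?q\<bar> \<le> 1" unfolding abs_divide by (simp only: abs_of_pos divide_le_eq_1_pos)
 have 1: "\<bar>2 * ?c + (\<beta> - 2) * ?c\<^sup>2 - \<mu> * ?c\<^sup>2 * snd z\<bar> \<le> 2 + \<bar>\<beta> - 2\<bar> + \<mu> * snd z"
 proof -
  have "\<bar>2 * ?c + (\<beta> - 2) * ?c\<^sup>2 - \<mu> * ?c\<^sup>2 * snd z\<bar> \<le> \<bar>2 * ?c\<bar> + \<bar>(\<beta> - 2) * ?c\<^sup>2\<bar> + \<bar>\<mu> * ?c\<^sup>2 * snd z\<bar>"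
   by linarith
  also have "\<dots> \<le> 2 + \<bar>\<beta> - 2\<bar> * 1 + \<mu> * 1 * snd z"
   unfolding abs_mult using c c2 y \<mu>_pos by (intro add_mono mult_mono) auto
  finally show ?thesis by simp
 qed
 have 2: "\<bar>\<gamma> * ?q * (?c\<^sup>2 * snd z)\<bar> \<le> \<gamma> * 1 * (1 * snd z)"
  unfolding abs_mult using c2 y \<gamma> q by (intro mult_mono) auto
 have "\<bar>slope d e z\<bar> \<le> \<bar>snd e\<bar> * \<bar>2 * ?c + (\<beta> - 2) * ?c\<^sup>2 - \<mu> * ?c\<^sup>2 * snd z\<bar> + \<bar>fst e\<bar> * \<bar>\<gamma> * ?q * (?c\<^sup>2 * snd z)\<bar>"
 proof -
  have "slope d e z = snd e * (2 * ?c + (\<beta> - 2) * ?c\<^sup>2 - \<mu> * ?c\<^sup>2 * snd z) - fst e * (\<gamma> * ?q * (?c\<^sup>2 * snd z))"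
   unfolding slope_def by (simp only: mult.assoc)
  then show ?thesis unfolding abs_mult[symmetric] by (simp only: abs_triangle_ineq4)
 qed
 also have "\<dots> \<le> 1 * (2 + \<bar>\<beta> - 2\<bar> + \<mu> * snd z) + 1 * (\<gamma> * 1 * (1 * snd z))"
  using 1 2 e y \<mu>_pos \<gamma> by (intro add_mono mult_mono) auto
 also have "\<dots> \<le> (2 + \<bar>\<beta> - 2\<bar> + \<mu> + \<gamma>) * (1 + snd z)"
 proof -
  have "0 \<le> (2 + \<bar>\<beta> - 2\<bar>) * snd z" "0 \<le> \<mu>" "0 \<le> \<gamma>" using y \<mu>_pos \<gamma> by auto
  then show ?thesis by (simp add: algebra_simps)
 qed
 finally show ?thesis .
qed

text \<open>The derivatives of \<open>y * wt\<close> are \<open>(\<beta> - \<mu> y) wt\<close> in the direction \<open>y\<close> and \<open>- \<gamma> sgn(x) y wt\<close> in the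
 direction \<open>x\<close>. No boundary term arises on the degenerate boundary, as \<open>y * wt\<close> vanishes there.\<close>

lemma weighted_integration_by_parts:
 assumes \<eta>: "\<eta> \<in> C0_infinity U (U \<union> Gamma0 U)" and e: "e \<in> Basis" and ge: "has_weak_deriv e U g ge"
  and i1: "integrable W (\<lambda>z. snd z * (g z * pd \<eta> e z))"
  and i2: "integrable W (\<lambda>z. snd z * (ge z * \<eta> z))"
  and i3: "integrable W (\<lambda>z. (1 + snd z) * (g z * \<eta> z))"
 shows "(LINT z|W. snd z * (g z * pd \<eta> e z)) +
   (LINT z|W. g z * \<eta> z * (snd e * (\<beta> - \<mu> * snd z) - fst e * \<gamma> * sgn (fst z) * snd z)) =
   - (LINT z|W. snd z * (ge z * \<eta> z))"
proof -
 note C1 = test_function_C1[OF \<eta>]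
 let ?d = "\<lambda>z. pd \<eta> e z"
 have e1: "\<bar>fst e\<bar> \<le> 1" "\<bar>snd e\<bar> \<le> 1" using Basis_real2_cases[OF e] by auto
 have [measurable]: "\<eta> \<in> borel_measurable W" "?d \<in> borel_measurable W"
  using continuous_borel_W C1(2)[OF e] C1(3) by auto
 have [measurable]: "g \<in> borel_measurable W" "ge \<in> borel_measurable W"
  using ge loc_integrable_borel_W by (auto simp: has_weak_deriv_def)
 define \<delta> where "\<delta> n = 1 / real (Suc n)" for n
 have \<delta>: "0 < \<delta> n" for n by (simp add: \<delta>_def)
 define K where "K = closure {z \<in> U \<union> Gamma0 U. \<eta> z \<noteq> 0}"
 have K: "compact K" "K \<subseteq> U \<union> Gamma0 U" using \<eta> by (auto simp: C0_infinity_def K_def)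
 have "{z \<in> U \<union> Gamma0 U. \<eta> z \<noteq> 0} \<subseteq> K" unfolding K_def by (rule closure_subset)
 then have K0: "\<eta> z = 0" if "z \<in> U" "z \<notin> K" for z using that by auto
 define \<zeta> where "\<zeta> n z = (if z \<in> U then \<eta> z * regw (\<delta> n) z else 0)" for n z
 have \<zeta>d: "(\<zeta> n has_derivative (\<lambda>h. \<eta> z * pd (regw (\<delta> n)) h z + pd \<eta> h z * regw (\<delta> n) z)) (at z)"
  if z: "z \<in> U" for z n
 proof (rule has_derivative_transform_within_open[OF _ open_U z])
  have "(\<eta> has_derivative frechet_derivative \<eta> (at z)) (at z)"
   using C1(1)[OF z] by (rule frechet_derivative_works[THEN iffD1])
  moreover have "(regw (\<delta> n) has_derivative frechet_derivative (regw (\<delta> n)) (at z)) (at z)"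
   using regw_has_derivative[OF \<delta> snd_pos[OF z]]
   by (intro frechet_derivative_works[THEN iffD1]) (auto simp: differentiable_def)
  ultimately show "((\<lambda>z. \<eta> z * regw (\<delta> n) z) has_derivative (\<lambda>h. \<eta> z * pd (regw (\<delta> n)) h z +
    pd \<eta> h z * regw (\<delta> n) z)) (at z)"
   by (rule has_derivative_mult)
 qed (simp add: \<zeta>_def)
 have \<zeta>fr: "pd (\<zeta> n) h z = \<eta> z * pd (regw (\<delta> n)) h z + pd \<eta> h z * regw (\<delta> n) z"
  if "z \<in> U" for z h n
  using frechet_derivative_at[OF \<zeta>d[OF that], symmetric] by metis
 have \<zeta>T: "C1_test U (\<zeta> n)" for n
 proof -
  define K' where "K' = K \<inter> {z. \<delta> n \<le> snd z}"
  have "closed {z :: real \<times> real. \<delta> n \<le> snd z}" by (intro closed_Collect_le continuous_intros)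
  then have K': "compact K'" unfolding K'_def by (intro compact_Int_closed K)
  have K'U: "K' \<subseteq> U"
  proof
   fix z assume z: "z \<in> K'"
   have "z \<notin> Gamma0 U"
   proof
    assume "z \<in> Gamma0 U"
    from subsetD[OF Gamma0_subset this] z \<delta>[of n] show False by (auto simp: K'_def)
   qed
   with z K(2) show "z \<in> U" by (auto simp: K'_def)
  qed
  show ?thesis
  proof (rule C1_testI[OF open_U K' K'U])
   show "\<zeta> n z = 0" if "z \<notin> K'" for z
   proof (cases "z \<in> K")
    case True
    then have "snd z < \<delta> n" using that by (simp add: K'_def)
    then show ?thesis by (simp add: \<zeta>_def regw_def Py_def)
   qed (simp add: \<zeta>_def K0)
   show "\<zeta> n differentiable (at z)" if "z \<in> U" for z using \<zeta>d[OF that] unfolding differentiable_def by blast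
   fix e' :: "real \<times> real" assume e': "e' \<in> Basis"
   have rc: "continuous_on U (regw (\<delta> n))"
    using regw_has_derivative[OF \<delta> snd_pos] has_derivative_continuous
    by (intro continuous_at_imp_continuous_on) blast
   have "continuous_on U (\<lambda>z. \<eta> z * pd (regw (\<delta> n)) e' z + pd \<eta> e' z * regw (\<delta> n) z)"
    by (intro continuous_intros C1(2)[OF e'] C1(3) rc continuous_on_subset[OF regw_frechet_continuous[OF \<delta>] U_half])
   then show "continuous_on U (pd (\<zeta> n) e')" using \<zeta>fr by (simp cong: continuous_on_cong)
  qed
 qed
 have ind_eq: "(LINT z:U|lebesgue. F z) = (LINT z:U|lebesgue. wt z * F' z)"
  if "\<And>z. z \<in> U ==> F z = wt z * F' z" for F F' :: "real \<times> real => real"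
  by (rule set_lebesgue_integral_cong) (use that in auto)
 define A where "A n z = ratio (\<delta> n) (fst z) * (cut (\<delta> n) (snd z))\<^sup>2 * (snd z * (g z * ?d z))" for n z
 define B where "B n z = ratio (\<delta> n) (fst z) * (g z * \<eta> z * slope (\<delta> n) e z)" for n z
 define C where "C n z = ratio (\<delta> n) (fst z) * (cut (\<delta> n) (snd z))\<^sup>2 * (snd z * (ge z * \<eta> z))" for n z
 have [measurable]: "(\<lambda>z. ratio (\<delta> n) (fst z)) \<in> borel_measurable W" "(\<lambda>z. cut (\<delta> n) (snd z)) \<in> borel_measurable W"
  "slope (\<delta> n) e \<in> borel_measurable W" for n
  unfolding ratio_def cut_def slope_def[abs_def] by measurable
 have [measurable]: "A n \<in> borel_measurable W" "B n \<in> borel_measurable W" "C n \<in> borel_measurable W" for n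
  unfolding A_def[abs_def] B_def[abs_def] C_def[abs_def] by measurable
 have rc: "\<bar>ratio (\<delta> n) (fst z) * (cut (\<delta> n) (snd z))\<^sup>2\<bar> \<le> 1" if "z \<in> U" for n z
 proof -
  have "\<bar>ratio (\<delta> n) (fst z)\<bar> * \<bar>(cut (\<delta> n) (snd z))\<^sup>2\<bar> \<le> 1 * 1"
   using ratio_bounds cut_bounds[OF \<delta> snd_pos[OF that]] by (intro mult_mono) (auto simp: power_le_one)
  then show ?thesis by (simp add: abs_mult)
 qed
 have A_le: "\<bar>A n z\<bar> \<le> \<bar>snd z * (g z * ?d z)\<bar>" if "z \<in> U" for n z
  unfolding A_def abs_mult[of "_ * _" "snd z * _"]
  using mult_right_mono[OF rc[OF that, of n], of "\<bar>snd z * (g z * ?d z)\<bar>"] by simp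
 have C_le: "\<bar>C n z\<bar> \<le> \<bar>snd z * (ge z * \<eta> z)\<bar>" if "z \<in> U" for n z
  unfolding C_def abs_mult[of "_ * _" "snd z * _"]
  using mult_right_mono[OF rc[OF that, of n], of "\<bar>snd z * (ge z * \<eta> z)\<bar>"] by simp
 let ?M = "2 + \<bar>\<beta> - 2\<bar> + \<mu> + \<gamma>"
 have B_le: "\<bar>B n z\<bar> \<le> ?M * \<bar>(1 + snd z) * (g z * \<eta> z)\<bar>" if z: "z \<in> U" for n z
 proof -
  have "\<bar>B n z\<bar> = \<bar>ratio (\<delta> n) (fst z)\<bar> * (\<bar>g z * \<eta> z\<bar> * \<bar>slope (\<delta> n) e z\<bar>)" by (simp add: B_def abs_mult)
  also have "\<dots> \<le> 1 * (\<bar>g z * \<eta> z\<bar> * (?M * (1 + snd z)))"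
   using ratio_bounds slope_bound[OF \<delta> snd_pos[OF z] e1, of n] by (intro mult_mono) auto
  also have "\<dots> = ?M * \<bar>(1 + snd z) * (g z * \<eta> z)\<bar>" using snd_nonneg[OF z] by (simp add: abs_mult)
  finally show ?thesis .
 qed
 have Ai: "integrable W (A n)" for n
  by (rule integrable_W_mono[OF integrable_abs[OF i1]]) (use A_le in auto)
 have Ci: "integrable W (C n)" for n
  by (rule integrable_W_mono[OF integrable_abs[OF i2]]) (use C_le in auto)
 have Bi: "integrable W (B n)" for n
  by (rule integrable_W_mono[OF integrable_mult_right[OF integrable_abs[OF i3], of ?M]]) (use B_le in auto)
 have parts: "(LINT z|W. A n z) + (LINT z|W. B n z) = - (LINT z|W. C n z)" for n
 proof -
  have "(LINT z|W. A n z) + (LINT z|W. B n z) = (LINT z|W. A n z + B n z)" using Ai Bi by simp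
  also have "\<dots> = (LINT z:U|lebesgue. wt z * (A n z + B n z))" by (rule integral_W) measurable
  also have "\<dots> = (LINT z:U|lebesgue. g z * pd (\<zeta> n) e z)"
   by (rule ind_eq[symmetric])
    (simp add: \<zeta>fr regw_eq snd_pos regw_frechet[OF \<delta>] A_def B_def algebra_simps)
  also have "\<dots> = - (LINT z:U|lebesgue. ge z * \<zeta> n z)"
   by (rule has_weak_deriv_C1_test[OF open_U e ge \<zeta>T])
  also have "(LINT z:U|lebesgue. ge z * \<zeta> n z) = (LINT z:U|lebesgue. wt z * C n z)"
   by (rule ind_eq) (simp add: \<zeta>_def regw_eq snd_pos C_def ac_simps)
  also have "\<dots> = (LINT z|W. C n z)" by (rule integral_W[symmetric]) measurable
  finally show ?thesis .
 qed
 have rcl: "(\<lambda>n. ratio (\<delta> n) (fst z) * (cut (\<delta> n) (snd z))\<^sup>2) \<longlonglongrightarrow> 1" if "z \<in> U" for z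
  using tendsto_mult[OF ratio_tendsto tendsto_power[OF cut_tendsto[OF snd_pos[OF that]], of 2]]
  by (simp add: \<delta>_def)
 have Al: "(\<lambda>n. LINT z|W. A n z) \<longlonglongrightarrow> (LINT z|W. snd z * (g z * ?d z))"
 proof (rule integral_dominated_convergence[OF _ _ integrable_abs[OF i1]])
  show "AE z in W. (\<lambda>n. A n z) \<longlonglongrightarrow> snd z * (g z * ?d z)"
  proof (rule AE_I2)
   fix z assume "z \<in> space W"
   then show "(\<lambda>n. A n z) \<longlonglongrightarrow> snd z * (g z * ?d z)"
    unfolding A_def using tendsto_mult[OF rcl tendsto_const, of z "snd z * (g z * ?d z)"] by simp
  qed
  show "AE z in W. norm (A n z) \<le> \<bar>snd z * (g z * ?d z)\<bar>" for n using A_le by (intro AE_I2) simp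
 qed measurable
 have Cl: "(\<lambda>n. LINT z|W. C n z) \<longlonglongrightarrow> (LINT z|W. snd z * (ge z * \<eta> z))"
 proof (rule integral_dominated_convergence[OF _ _ integrable_abs[OF i2]])
  show "AE z in W. (\<lambda>n. C n z) \<longlonglongrightarrow> snd z * (ge z * \<eta> z)"
  proof (rule AE_I2)
   fix z assume "z \<in> space W"
   then show "(\<lambda>n. C n z) \<longlonglongrightarrow> snd z * (ge z * \<eta> z)"
    unfolding C_def using tendsto_mult[OF rcl tendsto_const, of z "snd z * (ge z * \<eta> z)"] by simp
  qed
  show "AE z in W. norm (C n z) \<le> \<bar>snd z * (ge z * \<eta> z)\<bar>" for n using C_le by (intro AE_I2) simp
 qed measurable
 have Bl: "(\<lambda>n. LINT z|W. B n z) \<longlonglongrightarrow>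
   (LINT z|W. g z * \<eta> z * (snd e * (\<beta> - \<mu> * snd z) - fst e * \<gamma> * sgn (fst z) * snd z))"
 proof (rule integral_dominated_convergence[OF _ _ integrable_mult_right[OF integrable_abs[OF i3], of ?M]])
  show "(\<lambda>z. g z * \<eta> z * (snd e * (\<beta> - \<mu> * snd z) - fst e * \<gamma> * sgn (fst z) * snd z)) \<in> borel_measurable W"
   by measurable
  show "AE z in W. (\<lambda>n. B n z) \<longlonglongrightarrow> g z * \<eta> z * (snd e * (\<beta> - \<mu> * snd z) - fst e * \<gamma> * sgn (fst z) * snd z)"
  proof (rule AE_I2)
   fix z assume "z \<in> space W"
   then have y: "0 < snd z" using snd_pos by simp
   have "(\<lambda>n. B n z) \<longlonglongrightarrow> 1 * (g z * \<eta> z * (snd e * (\<beta> - \<mu> * snd z) - fst e * \<gamma> * sgn (fst z) * snd z))"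
    unfolding B_def \<delta>_def by (intro tendsto_intros ratio_tendsto slope_tendsto y)
   then show "(\<lambda>n. B n z) \<longlonglongrightarrow> g z * \<eta> z * (snd e * (\<beta> - \<mu> * snd z) - fst e * \<gamma> * sgn (fst z) * snd z)" by simp
  qed
  show "AE z in W. norm (B n z) \<le> ?M * \<bar>(1 + snd z) * (g z * \<eta> z)\<bar>" for n using B_le by (intro AE_I2) simp
 qed measurable
 from tendsto_add[OF Al Bl] have lim: "(\<lambda>n. - (LINT z|W. C n z)) \<longlonglongrightarrow> (LINT z|W. snd z * (g z * ?d z)) +
   (LINT z|W. g z * \<eta> z * (snd e * (\<beta> - \<mu> * snd z) - fst e * \<gamma> * sgn (fst z) * snd z))"
  by (simp add: parts)
 show ?thesis by (rule LIMSEQ_unique[OF lim tendsto_minus[OF Cl]])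
qed

end

subsection \<open>Second derivatives commute\<close>

lemma radial_has_derivative:
 fixes c :: "'a::euclidean_space"
 shows "((\<lambda>z. exp_inverse P (R - (norm (z - c))\<^sup>2)) has_derivative
  (\<lambda>h. exp_inverse ([:0, 0, 1:] * (P - pderiv P)) (R - (norm (z - c))\<^sup>2) * (- 2 * (h \<bullet> (z - c))))) (at z)"
proof -
 have "((\<lambda>z. R - (z - c) \<bullet> (z - c)) has_derivative (\<lambda>h. - 2 * (h \<bullet> (z - c)))) (at z)"
  by (auto intro!: derivative_eq_intros simp: inner_commute)
 from DERIV_compose_FDERIV[OF exp_inverse_has_derivative this]
 show ?thesis by (simp only: power2_norm_eq_inner mult.commute)
qed

lemma bump_second_derivative_symmetric:
 "pd (pd (bump c r) b) a z =
  pd (pd (bump c r) a) b z"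
proof -
 define Z where "Z = (LINT z|lborel. exp_inverse 1 (r\<^sup>2 - (norm (z - c))\<^sup>2))"
 define P where "P = [:0, 0, 1:] * (1 - pderiv 1 :: real poly)"
 define Q where "Q = [:0, 0, 1:] * (P - pderiv P)"
 have d1: "(bump c r has_derivative (\<lambda>h. exp_inverse P (r\<^sup>2 - (norm (z - c))\<^sup>2) * (- 2 * (h \<bullet> (z - c))) / Z)) (at z)" for z
  unfolding bump_def[abs_def] Z_def[symmetric] P_def
  using bounded_linear.has_derivative[OF bounded_linear_divide[of Z] radial_has_derivative[of 1 "r\<^sup>2" c z]] .
 have f1: "pd (bump c r) x z = exp_inverse P (r\<^sup>2 - (norm (z - c))\<^sup>2) * (- 2 * (x \<bullet> (z - c)) / Z)" for z x
  using frechet_derivative_at[OF d1, of z, symmetric] by simp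
 have d2: "((\<lambda>z. exp_inverse P (r\<^sup>2 - (norm (z - c))\<^sup>2) * (- 2 * (x \<bullet> (z - c)) / Z)) has_derivative
   (\<lambda>h. exp_inverse P (r\<^sup>2 - (norm (z - c))\<^sup>2) * (- 2 * (x \<bullet> h) / Z) +
    exp_inverse Q (r\<^sup>2 - (norm (z - c))\<^sup>2) * (- 2 * (h \<bullet> (z - c))) * (- 2 * (x \<bullet> (z - c)) / Z))) (at z)" for z x
 proof (rule has_derivative_mult)
  show "((\<lambda>z. exp_inverse P (r\<^sup>2 - (norm (z - c))\<^sup>2)) has_derivative
    (\<lambda>h. exp_inverse Q (r\<^sup>2 - (norm (z - c))\<^sup>2) * (- 2 * (h \<bullet> (z - c))))) (at z)"
   unfolding Q_def by (rule radial_has_derivative)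
  show "((\<lambda>z. - 2 * (x \<bullet> (z - c)) / Z) has_derivative (\<lambda>h. - 2 * (x \<bullet> h) / Z)) (at z)"
   unfolding divide_inverse by (auto intro!: derivative_eq_intros)
 qed
 have f2: "pd (pd (bump c r) x) y z =
   exp_inverse P (r\<^sup>2 - (norm (z - c))\<^sup>2) * (- 2 * (x \<bullet> y) / Z) +
    exp_inverse Q (r\<^sup>2 - (norm (z - c))\<^sup>2) * (- 2 * (y \<bullet> (z - c))) * (- 2 * (x \<bullet> (z - c)) / Z)" for x y
  unfolding f1 using frechet_derivative_at[OF d2, of z x, symmetric] by simp
 show ?thesis unfolding f2 by (simp add: inner_commute)
qed

text \<open>Bumps suffice to identify a locally integrable function, and their second derivatives are symmetric
 by the explicit formula.\<close>

lemma weak_derivs_commute: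
 fixes u :: "'a::euclidean_space => real"
 assumes U: "open U" and a: "a \<in> Basis" and b: "b \<in> Basis"
  and ua: "has_weak_deriv a U u ga" and uab: "has_weak_deriv b U ga gab"
  and ub: "has_weak_deriv b U u gb" and uba: "has_weak_deriv a U gb gba"
 shows "AE z in lebesgue_on U. gab z = gba z"
proof -
 have loc: "loc_integrable U (\<lambda>z. gab z + (-1) * gba z)"
  using uab uba by (intro loc_integrable_add loc_integrable_cmult) (auto simp: has_weak_deriv_def)
 have "AE z in lebesgue_on U. gab z + (-1) * gba z = 0"
 proof (rule loc_integrable_eq_0_AE[OF U loc])
  fix c :: 'a and r :: real assume r: "0 < r" "cball c r \<subseteq> U"
  note B = bump_C0_infinity_subset[OF r]
  have *: "set_integrable lebesgue U (\<lambda>z. w z * bump c r z)" if "loc_integrable U w" for w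
   by (rule loc_integrable_test_integrable[OF that bump_continuous compact_cball r(2)])
    (use r bump_eq_0[of r _ c] in auto)
  have second: "(LINT z:U|lebesgue. h z * bump c r z) =
    (LINT z:U|lebesgue. u z * pd (pd (bump c r) y) x z)"
   if x: "x \<in> Basis" and y: "y \<in> Basis" and g: "has_weak_deriv x U u g" and h: "has_weak_deriv y U g h" for x y g h
  proof -
   have "(LINT z:U|lebesgue. h z * bump c r z) = - (LINT z:U|lebesgue. g z * pd (bump c r) y z)"
    using h B by (simp add: has_weak_deriv_def)
   also have "\<dots> = (LINT z:U|lebesgue. u z * pd (pd (bump c r) y) x z)"
    using g C0_infinity_frechet[OF U B y] by (simp add: has_weak_deriv_def)
   finally show ?thesis .
  qed
  have "(LINT z:U|lebesgue. (gab z + (-1) * gba z) * bump c r z) =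
    (LINT z:U|lebesgue. gab z * bump c r z - gba z * bump c r z)"
   by (simp add: left_diff_distrib)
  also have "\<dots> = (LINT z:U|lebesgue. gab z * bump c r z) - (LINT z:U|lebesgue. gba z * bump c r z)"
   using * uab uba by (intro set_integral_diff) (auto simp: has_weak_deriv_def)
  also have "\<dots> = 0"
   unfolding second[OF a b ua uab] second[OF b a ub uba] bump_second_derivative_symmetric[of c r b _ a] by simp
  finally show "(LINT z:U|lebesgue. (gab z + (-1) * gba z) * bump c r z) = 0" .
 qed
 then show ?thesis by simp
qed

section \<open>The Heston form\<close>

locale heston_problem = heston +
 fixes \<rho> r q :: real
 assumes \<rho>: "-1 < \<rho>" "\<rho> < 1" and b1: "r - q - \<kappa> * \<theta> * \<rho> / \<sigma> = 0"
begin

definition a\<^sub>1 :: real where "a\<^sub>1 = \<kappa> * \<rho> / \<sigma> - 1 / 2"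

abbreviation a :: "(real \<times> real => real) => (real \<times> real => real) => real" where
 "a \<equiv> heston_form \<sigma> \<rho> \<kappa> \<theta> r \<gamma> U"

text \<open>The integrand of the form with the weak derivatives as arguments, arranged so that each summand is a
 product of two functions that are square integrable for the same weight.\<close>

definition q\<^sub>a :: "(real \<times> real => real) => (real \<times> real => real) => (real \<times> real => real) =>
  (real \<times> real => real) => (real \<times> real => real) => (real \<times> real => real) => real \<times> real => real" where
 "q\<^sub>a u ux uy v vx vy z =
   1 / 2 * (snd z * (ux z * vx z) + \<rho> * \<sigma> * (snd z * (uy z * vx z)) + \<rho> * \<sigma> * (snd z * (ux z * vy z)) +
    \<sigma>\<^sup>2 * (snd z * (uy z * vy z)))
   - \<gamma> / 2 * (sgn (fst z) * (snd z * (ux z * v z)) + \<rho> * \<sigma> * (sgn (fst z) * (snd z * (uy z * v z))))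
   - a\<^sub>1 * (snd z * (ux z * v z)) + r * (u z * v z)"

lemma snd_L2:
 assumes "u \<in> borel_measurable W" "integrable W (\<lambda>z. (1 + snd z) * (u z)\<^sup>2)"
 shows "integrable W (\<lambda>z. snd z * (u z)\<^sup>2)" "integrable W (\<lambda>z. (u z)\<^sup>2)"
proof -
 note [measurable] = assms(1)
 have "\<bar>snd z * (u z)\<^sup>2\<bar> \<le> (1 + snd z) * (u z)\<^sup>2 \<and> \<bar>(u z)\<^sup>2\<bar> \<le> (1 + snd z) * (u z)\<^sup>2" if "z \<in> U" for z
  using snd_nonneg[OF that] by (simp add: abs_mult distrib_right)
 then show "integrable W (\<lambda>z. snd z * (u z)\<^sup>2)" "integrable W (\<lambda>z. (u z)\<^sup>2)"
  by (intro integrable_W_mono[OF assms(2)]; (measurable; fail)?; simp)+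
qed

lemma H1_wd_D:
 assumes "wd u ux uy" "u \<in> H1 U W"
 shows "u \<in> borel_measurable W" "ux \<in> borel_measurable W" "uy \<in> borel_measurable W"
  "integrable W (\<lambda>z. snd z * (ux z)\<^sup>2)" "integrable W (\<lambda>z. snd z * (uy z)\<^sup>2)"
  "integrable W (\<lambda>z. (1 + snd z) * (u z)\<^sup>2)" "integrable W (\<lambda>z. snd z * (u z)\<^sup>2)" "integrable W (\<lambda>z. (u z)\<^sup>2)"
proof -
 show m: "u \<in> borel_measurable W" "ux \<in> borel_measurable W" "uy \<in> borel_measurable W" by (rule wd_borel[OF assms(1)])+
 show "integrable W (\<lambda>z. snd z * (ux z)\<^sup>2)" "integrable W (\<lambda>z. snd z * (uy z)\<^sup>2)"
  and i: "integrable W (\<lambda>z. (1 + snd z) * (u z)\<^sup>2)"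
  using H1_iff[OF assms(1)] assms(2) dens_integrable[OF m] by auto
 show "integrable W (\<lambda>z. snd z * (u z)\<^sup>2)" "integrable W (\<lambda>z. (u z)\<^sup>2)" by (rule snd_L2[OF m(1) i])+
qed

lemma L2_product_1:
 fixes p s :: "real \<times> real => real"
 assumes "p \<in> borel_measurable W" "s \<in> borel_measurable W" "integrable W (\<lambda>z. (p z)\<^sup>2)" "integrable W (\<lambda>z. (s z)\<^sup>2)"
 shows "integrable W (\<lambda>z. p z * s z)"
 using L2_product[of p s "\<lambda>z. 1"] assms by simp

lemma sgn_integrable:
 assumes "integrable W f" shows "integrable W (\<lambda>z. sgn (fst z) * f z)"
proof (rule integrable_W_mono[OF integrable_abs[OF assms]])
 show "(\<lambda>z. sgn (fst z) * f z) \<in> borel_measurable W" using borel_measurable_integrable[OF assms] by measurable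
qed (simp add: abs_mult abs_sgn_eq)

lemma form_products:
 assumes u: "wd u ux uy" "u \<in> H1 U W" and v: "wd v vx vy" "v \<in> H1 U W"
 shows "integrable W (\<lambda>z. snd z * (ux z * vx z))" "integrable W (\<lambda>z. snd z * (uy z * vx z))"
  "integrable W (\<lambda>z. snd z * (ux z * vy z))" "integrable W (\<lambda>z. snd z * (uy z * vy z))"
  "integrable W (\<lambda>z. snd z * (ux z * v z))" "integrable W (\<lambda>z. snd z * (uy z * v z))"
  "integrable W (\<lambda>z. u z * v z)"
proof -
 note U = H1_wd_D[OF u] and V = H1_wd_D[OF v]
 show "integrable W (\<lambda>z. snd z * (ux z * vx z))" by (rule L2_product[OF U(2) V(2) snd_W(1) snd_nonneg' U(4) V(4)])
 show "integrable W (\<lambda>z. snd z * (uy z * vx z))" by (rule L2_product[OF U(3) V(2) snd_W(1) snd_nonneg' U(5) V(4)])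
 show "integrable W (\<lambda>z. snd z * (ux z * vy z))" by (rule L2_product[OF U(2) V(3) snd_W(1) snd_nonneg' U(4) V(5)])
 show "integrable W (\<lambda>z. snd z * (uy z * vy z))" by (rule L2_product[OF U(3) V(3) snd_W(1) snd_nonneg' U(5) V(5)])
 show "integrable W (\<lambda>z. snd z * (ux z * v z))" by (rule L2_product[OF U(2) V(1) snd_W(1) snd_nonneg' U(4) V(7)])
 show "integrable W (\<lambda>z. snd z * (uy z * v z))" by (rule L2_product[OF U(3) V(1) snd_W(1) snd_nonneg' U(5) V(7)])
 show "integrable W (\<lambda>z. u z * v z)" by (rule L2_product_1[OF U(1) V(1) U(8) V(8)])
qed

lemma q_integrable:
 assumes u: "wd u ux uy" "u \<in> H1 U W" and v: "wd v vx vy" "v \<in> H1 U W"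
 shows "integrable W (q\<^sub>a u ux uy v vx vy)"
 unfolding q\<^sub>a_def[abs_def]
 by (intro Bochner_Integration.integrable_add Bochner_Integration.integrable_diff integrable_mult_right
   sgn_integrable form_products[OF u v])

lemma form_split:
 assumes u: "wd u ux uy" "u \<in> H1 U W" and v: "wd v vx vy" "v \<in> H1 U W"
 shows "(LINT z|W. q\<^sub>a u ux uy v vx vy z) =
  1 / 2 * ((LINT z|W. snd z * (ux z * vx z)) + \<rho> * \<sigma> * (LINT z|W. snd z * (uy z * vx z)) +
   \<rho> * \<sigma> * (LINT z|W. snd z * (ux z * vy z)) + \<sigma>\<^sup>2 * (LINT z|W. snd z * (uy z * vy z)))
  - \<gamma> / 2 * ((LINT z|W. sgn (fst z) * (snd z * (ux z * v z))) + \<rho> * \<sigma> * (LINT z|W. sgn (fst z) * (snd z * (uy z * v z))))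
  - a\<^sub>1 * (LINT z|W. snd z * (ux z * v z)) + r * (LINT z|W. u z * v z)"
 unfolding q\<^sub>a_def
 using form_products[OF u v] sgn_integrable[OF form_products(5)[OF u v]] sgn_integrable[OF form_products(6)[OF u v]]
 by simp

lemma form_eq:
 assumes u: "wd u ux uy" "u \<in> H1 U W" and v: "wd v vx vy" "v \<in> H1 U W"
 shows "a u v = (LINT z|W. q\<^sub>a u ux uy v vx vy z)"
proof -
 note U = H1D(1)[OF u(2)] and V = H1D(1)[OF v(2)]
 have "a u v = (LINT z|W. q\<^sub>a u (Dx U u) (Dy U u) v (Dx U v) (Dy U v) z)"
 proof -
  have 1: "(LINT z|W. (Dx U u z * Dx U v z + \<rho> * \<sigma> * Dy U u z * Dx U v z + \<rho> * \<sigma> * Dx U u z * Dy U v z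
     + \<sigma>\<^sup>2 * Dy U u z * Dy U v z) * snd z) =
    (LINT z|W. snd z * (Dx U u z * Dx U v z) + \<rho> * \<sigma> * (snd z * (Dy U u z * Dx U v z)) +
     \<rho> * \<sigma> * (snd z * (Dx U u z * Dy U v z)) + \<sigma>\<^sup>2 * (snd z * (Dy U u z * Dy U v z)))"
   by (intro Bochner_Integration.integral_cong) (auto simp: algebra_simps)
  have 2: "(LINT z|W. (Dx U u z + \<rho> * \<sigma> * Dy U u z) * v z * sgn (fst z) * snd z) =
    (LINT z|W. sgn (fst z) * (snd z * (Dx U u z * v z)) + \<rho> * \<sigma> * (sgn (fst z) * (snd z * (Dy U u z * v z))))"
   by (intro Bochner_Integration.integral_cong) (auto simp: algebra_simps)
  have 3: "(LINT z|W. a\<^sub>1 * snd z * Dx U u z * v z) = (LINT z|W. a\<^sub>1 * (snd z * (Dx U u z * v z)))"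
   "(LINT z|W. r * u z * v z) = (LINT z|W. r * (u z * v z))"
   by (simp_all add: mult.assoc)
  note P = form_products[OF U u(2) V v(2)]
  show ?thesis
   unfolding form_split[OF U u(2) V v(2)] heston_form_def Let_def W_eq a\<^sub>1_def[symmetric] 1 2 3
   using P sgn_integrable[OF P(5)] sgn_integrable[OF P(6)] by simp
 qed
 also have "\<dots> = (LINT z|W. q\<^sub>a u ux uy v vx vy z)"
 proof (rule integral_cong_AE)
  show "q\<^sub>a u (Dx U u) (Dy U u) v (Dx U v) (Dy U v) \<in> borel_measurable W" "q\<^sub>a u ux uy v vx vy \<in> borel_measurable W"
   using q_integrable[OF U u(2) V v(2)] q_integrable[OF u v] by auto
  show "AE z in W. q\<^sub>a u (Dx U u) (Dy U u) v (Dx U v) (Dy U v) z = q\<^sub>a u ux uy v vx vy z"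
   using wd_AE[OF u(1)] wd_AE[OF v(1)] by eventually_elim (simp add: q\<^sub>a_def)
 qed
 finally show ?thesis .
qed

lemma form_lincomb_left:
 assumes u: "u \<in> H1 U W" and u': "u' \<in> H1 U W" and v: "v \<in> H1 U W"
 shows "a (\<lambda>z. s * u z + t * u' z) v = s * a u v + t * a u' v"
proof -
 note U = H1D(1)[OF u] and U' = H1D(1)[OF u'] and V = H1D(1)[OF v]
 note C = wd_lincomb[where a=s and b=t, OF U U'] H1_lincomb[where a=s and b=t, OF u u']
 have eq: "q\<^sub>a (\<lambda>z. s * u z + t * u' z) (\<lambda>z. s * Dx U u z + t * Dx U u' z) (\<lambda>z. s * Dy U u z + t * Dy U u' z) v (Dx U v) (Dy U v) =
   (\<lambda>z. s * q\<^sub>a u (Dx U u) (Dy U u) v (Dx U v) (Dy U v) z + t * q\<^sub>a u' (Dx U u') (Dy U u') v (Dx U v) (Dy U v) z)"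
  by (rule ext) (unfold q\<^sub>a_def, algebra)
 show ?thesis
  unfolding form_eq[OF C V v] form_eq[OF U u V v] form_eq[OF U' u' V v] eq
  using q_integrable[OF U u V v] q_integrable[OF U' u' V v] by simp
qed

lemma form_lincomb_right:
 assumes u: "u \<in> H1 U W" and v: "v \<in> H1 U W" and v': "v' \<in> H1 U W"
 shows "a u (\<lambda>z. s * v z + t * v' z) = s * a u v + t * a u v'"
proof -
 note U = H1D(1)[OF u] and V' = H1D(1)[OF v'] and V = H1D(1)[OF v]
 note C = wd_lincomb[where a=s and b=t, OF V V'] H1_lincomb[where a=s and b=t, OF v v']
 have eq: "q\<^sub>a u (Dx U u) (Dy U u) (\<lambda>z. s * v z + t * v' z) (\<lambda>z. s * Dx U v z + t * Dx U v' z) (\<lambda>z. s * Dy U v z + t * Dy U v' z) =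
   (\<lambda>z. s * q\<^sub>a u (Dx U u) (Dy U u) v (Dx U v) (Dy U v) z + t * q\<^sub>a u (Dx U u) (Dy U u) v' (Dx U v') (Dy U v') z)"
  by (rule ext) (unfold q\<^sub>a_def, algebra)
 show ?thesis
  unfolding form_eq[OF U u C] form_eq[OF U u V v] form_eq[OF U u V' v'] eq
  using q_integrable[OF U u V v] q_integrable[OF U u V' v'] by simp
qed

definition C\<^sub>a :: real where
 "C\<^sub>a = 1 / 2 * (1 + \<bar>\<rho> * \<sigma>\<bar> + \<bar>\<rho> * \<sigma>\<bar> + \<sigma>\<^sup>2) + \<gamma> / 2 * (1 + \<bar>\<rho> * \<sigma>\<bar>) + \<bar>a\<^sub>1\<bar> + \<bar>r\<bar>"

lemma form_bound:
 assumes u: "u \<in> H1 U W" and v: "v \<in> H1 U W"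
 shows "\<bar>a u v\<bar> \<le> C\<^sub>a * (ip u u + ip v v)"
proof -
 note U = H1D(1)[OF u] and V = H1D(1)[OF v]
 let ?U = "dens u (Dx U u) (Dy U u)" and ?V = "dens v (Dx U v) (Dy U v)"
 have Ui: "integrable W ?U" "integrable W ?V" using H1_iff[OF U] H1_iff[OF V] u v by auto
 have pt: "\<bar>q\<^sub>a u (Dx U u) (Dy U u) v (Dx U v) (Dy U v) z\<bar> \<le> C\<^sub>a * (?U z + ?V z)" if z: "z \<in> U" for z
 proof -
  let ?D = "?U z + ?V z"
  have y: "0 \<le> snd z" by (rule snd_nonneg[OF z])
  have sq: "\<bar>k * (p * s)\<bar> \<le> k * p\<^sup>2 + k * s\<^sup>2" if "0 \<le> k" for k p s :: real
  proof -
   have "2 * \<bar>p * s\<bar> \<le> p\<^sup>2 + s\<^sup>2"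
    using sum_squares_bound[of "\<bar>p\<bar>" "\<bar>s\<bar>"] by (simp add: abs_mult mult.assoc)
   then have "\<bar>p * s\<bar> \<le> p\<^sup>2 + s\<^sup>2" using abs_ge_zero[of "p * s"] by linarith
   from mult_left_mono[OF this that] show ?thesis using that by (simp add: abs_mult distrib_left)
  qed
  have n: "0 \<le> snd z * p\<^sup>2" for p :: real using y by simp
  have dU: "snd z * (Dx U u z)\<^sup>2 \<le> ?U z" "snd z * (Dy U u z)\<^sup>2 \<le> ?U z" "snd z * (u z)\<^sup>2 \<le> ?U z" "(u z)\<^sup>2 \<le> ?U z"
   using n[of "Dx U u z"] n[of "Dy U u z"] n[of "u z"] unfolding dens_def by (simp_all add: distrib_left distrib_right)
  have dV: "snd z * (Dx U v z)\<^sup>2 \<le> ?V z" "snd z * (Dy U v z)\<^sup>2 \<le> ?V z" "snd z * (v z)\<^sup>2 \<le> ?V z" "(v z)\<^sup>2 \<le> ?V z"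
   using n[of "Dx U v z"] n[of "Dy U v z"] n[of "v z"] unfolding dens_def by (simp_all add: distrib_left distrib_right)
  have xx: "\<bar>snd z * (Dx U u z * Dx U v z)\<bar> \<le> ?D" using sq[OF y, of "Dx U u z" "Dx U v z"] dU dV by linarith
  have yx: "\<bar>snd z * (Dy U u z * Dx U v z)\<bar> \<le> ?D" using sq[OF y, of "Dy U u z" "Dx U v z"] dU dV by linarith
  have xy: "\<bar>snd z * (Dx U u z * Dy U v z)\<bar> \<le> ?D" using sq[OF y, of "Dx U u z" "Dy U v z"] dU dV by linarith
  have yy: "\<bar>snd z * (Dy U u z * Dy U v z)\<bar> \<le> ?D" using sq[OF y, of "Dy U u z" "Dy U v z"] dU dV by linarith
  have x0: "\<bar>snd z * (Dx U u z * v z)\<bar> \<le> ?D" using sq[OF y, of "Dx U u z" "v z"] dU dV by linarith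
  have y0: "\<bar>snd z * (Dy U u z * v z)\<bar> \<le> ?D" using sq[OF y, of "Dy U u z" "v z"] dU dV by linarith
  have 00: "\<bar>u z * v z\<bar> \<le> ?D" using sq[of 1 "u z" "v z"] dU dV by simp
  have sg: "\<bar>sgn (fst z) * t\<bar> \<le> ?D" if "\<bar>t\<bar> \<le> ?D" for t
   using that abs_ge_zero[of t] by (auto simp: abs_mult abs_sgn_eq)
  have cm: "\<bar>c * t\<bar> \<le> \<bar>c\<bar> * ?D" if "\<bar>t\<bar> \<le> ?D" for c t :: real
   unfolding abs_mult using that by (intro mult_left_mono) auto
  have "\<bar>q\<^sub>a u (Dx U u) (Dy U u) v (Dx U v) (Dy U v) z\<bar> \<le>
   1 / 2 * (?D + \<bar>\<rho> * \<sigma>\<bar> * ?D + \<bar>\<rho> * \<sigma>\<bar> * ?D + \<sigma>\<^sup>2 * ?D) + \<gamma> / 2 * (?D + \<bar>\<rho> * \<sigma>\<bar> * ?D) + \<bar>a\<^sub>1\<bar> * ?D + \<bar>r\<bar> * ?D"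
  proof -
   define t1 t2 where "t1 = snd z * (Dx U u z * Dx U v z) + \<rho> * \<sigma> * (snd z * (Dy U u z * Dx U v z)) +
     \<rho> * \<sigma> * (snd z * (Dx U u z * Dy U v z)) + \<sigma>\<^sup>2 * (snd z * (Dy U u z * Dy U v z))"
    and "t2 = sgn (fst z) * (snd z * (Dx U u z * v z)) + \<rho> * \<sigma> * (sgn (fst z) * (snd z * (Dy U u z * v z)))"
   have "\<bar>t1\<bar> \<le> ?D + \<bar>\<rho> * \<sigma>\<bar> * ?D + \<bar>\<rho> * \<sigma>\<bar> * ?D + \<bar>\<sigma>\<^sup>2\<bar> * ?D"
    unfolding t1_def using xx cm[OF yx, of "\<rho> * \<sigma>"] cm[OF xy, of "\<rho> * \<sigma>"] cm[OF yy, of "\<sigma>\<^sup>2"] by linarith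
   moreover have t2: "\<bar>t2\<bar> \<le> ?D + \<bar>\<rho> * \<sigma>\<bar> * ?D"
    unfolding t2_def using sg[OF x0] cm[OF sg[OF y0], of "\<rho> * \<sigma>"] by linarith
   moreover have "\<bar>\<gamma> / 2 * t2\<bar> \<le> \<gamma> / 2 * (?D + \<bar>\<rho> * \<sigma>\<bar> * ?D)"
    using mult_left_mono[OF t2, of "\<gamma> / 2"] \<gamma> by (simp only: abs_mult) simp
   moreover have "\<bar>1 / 2 * s1 - s2 - s3 + s4\<bar> \<le> 1 / 2 * b1 + b2 + b3 + b4"
    if "\<bar>s1\<bar> \<le> b1" "\<bar>s2\<bar> \<le> b2" "\<bar>s3\<bar> \<le> b3" "\<bar>s4\<bar> \<le> b4" for s1 s2 s3 s4 b1 b2 b3 b4 :: real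
    using that by linarith
   ultimately show ?thesis
    unfolding q\<^sub>a_def t1_def[symmetric] t2_def[symmetric]
    using cm[OF x0, of a\<^sub>1] cm[OF 00, of r] by (simp only: abs_power2)
  qed
  also have "\<dots> = C\<^sub>a * ?D" unfolding C\<^sub>a_def by algebra
  finally show ?thesis .
 qed
 have "\<bar>a u v\<bar> \<le> (LINT z|W. \<bar>q\<^sub>a u (Dx U u) (Dy U u) v (Dx U v) (Dy U v) z\<bar>)"
  unfolding form_eq[OF U u V v] by (rule integral_abs_bound)
 also have "\<dots> \<le> (LINT z|W. C\<^sub>a * (?U z + ?V z))"
  using q_integrable[OF U u V v] Ui pt by (intro integral_mono) auto
 also have "\<dots> = C\<^sub>a * (ip u u + ip v v)" unfolding ip_eq_wd[OF U u] ip_eq_wd[OF V v] using Ui by simp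
 finally show ?thesis .
qed

lemma form_add_left: "u \<in> H1 U W ==> u' \<in> H1 U W ==> v \<in> H1 U W ==> a (u + u') v = a u v + a u' v"
 using form_lincomb_left[of u u' v 1 1] by (simp add: plus_fun_def)

lemma form_diff_left: "u \<in> H1 U W ==> u' \<in> H1 U W ==> v \<in> H1 U W ==> a (u - u') v = a u v - a u' v"
 using form_lincomb_left[of u u' v 1 "-1"] by (simp add: fun_diff_def)

lemma form_scale_left: "u \<in> H1 U W ==> v \<in> H1 U W ==> a (c *\<^sub>R u) v = c * a u v"
 using form_lincomb_left[of u u v c 0] by (simp add: scaleR_fun_def)

lemma form_add_right: "u \<in> H1 U W ==> v \<in> H1 U W ==> v' \<in> H1 U W ==> a u (v + v') = a u v + a u v'"
 using form_lincomb_right[of u v v' 1 1] by (simp add: plus_fun_def)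

lemma form_diff_right: "u \<in> H1 U W ==> v \<in> H1 U W ==> v' \<in> H1 U W ==> a u (v - v') = a u v - a u v'"
 using form_lincomb_right[of u v v' 1 "-1"] by (simp add: fun_diff_def)

lemma form_scale_right: "u \<in> H1 U W ==> v \<in> H1 U W ==> a u (c *\<^sub>R v) = c * a u v"
 using form_lincomb_right[of u v v c 0] by (simp add: scaleR_fun_def)

lemma form_continuous:
 assumes "u \<in> H1 U W" "v \<in> H1 U W"
 shows "\<bar>a u v\<bar> \<le> 2 * C\<^sub>a * H.nrm u * H.nrm v"
 by (rule H.bounded_form_product[OF form_scale_left form_scale_right form_bound assms])

end

context semi_hilbert
begin

text \<open>Bounds of the form \<open>C + B x x\<close> are the ones that Young's inequality provides; homogeneity turns them
 into bounds by the norm.\<close>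

lemma functional_bound:
 assumes sc: "\<And>c x. x \<in> V ==> l (c *\<^sub>R x) = c * (l x :: real)" and bd: "\<And>x. x \<in> V ==> \<bar>l x\<bar> \<le> C + B x x" and x: "x \<in> V"
 shows "\<bar>l x\<bar> \<le> (C + 1) * nrm x"
proof (cases "nrm x = 0")
 case True
 then have B0: "B x x = 0" using nrm_sq[OF x] by simp
 show ?thesis
 proof (rule ccontr)
  assume "\<not> ?thesis"
  then have l: "l x \<noteq> 0" using True by auto
  have "\<bar>l (((C + 1) / \<bar>l x\<bar>) *\<^sub>R x)\<bar> \<le> C"
   using bd[OF V_scale[OF x], of "(C + 1) / \<bar>l x\<bar>"] x B0 by (simp add: bilin V_scale)
  then show False using l x by (simp add: sc abs_mult)
 qed
next
 case False
 then have n: "0 < nrm x" using nrm_nonneg[OF x] by simp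
 have "B ((1 / nrm x) *\<^sub>R x) ((1 / nrm x) *\<^sub>R x) = 1"
  using x n by (simp add: bilin V_scale flip: nrm_sq[OF x]) (simp add: power2_eq_square)
 then have "\<bar>l ((1 / nrm x) *\<^sub>R x)\<bar> \<le> C + 1" using bd[OF V_scale[OF x], of "1 / nrm x"] by simp
 then show ?thesis using n x by (simp add: sc abs_mult field_simps)
qed

end

context weighted_domain
begin

lemma L2_iff: "p \<in> Lspace 2 W \<longleftrightarrow> p \<in> borel_measurable W \<and> integrable W (\<lambda>z. (p z)\<^sup>2)"
proof -
 have "\<bar>p z\<bar> powr 2 = (p z)\<^sup>2" for z by (simp add: powr_numeral)
 then show ?thesis by (simp add: Lspace_def)
qed

lemma L2_mult_integrable:
 assumes "p \<in> Lspace 2 W" "s \<in> Lspace 2 W" shows "integrable W (\<lambda>z. p z * s z)"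
 using L2_product[of p s "\<lambda>z. 1"] assms by (simp add: L2_iff)

lemma L2_lincomb:
 assumes "p \<in> Lspace 2 W" "s \<in> Lspace 2 W" shows "(\<lambda>z. b * p z + c * s z) \<in> Lspace 2 W"
 using integrable_lincomb_square[of p s "\<lambda>z. 1" b c] assms by (auto simp: L2_iff)

lemma L2_mono:
 assumes p: "p \<in> Lspace 2 W" and s: "s \<in> borel_measurable W" and le: "\<And>z. z \<in> U ==> \<bar>s z\<bar> \<le> c * \<bar>p z\<bar>"
 shows "s \<in> Lspace 2 W"
 unfolding L2_iff
proof
 note [measurable] = s
 show "integrable W (\<lambda>z. (s z)\<^sup>2)"
 proof (rule integrable_W_mono)
  show "integrable W (\<lambda>z. c\<^sup>2 * (p z)\<^sup>2)" using p by (simp add: L2_iff)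
  show "(\<lambda>z. (s z)\<^sup>2) \<in> borel_measurable W" by measurable
  show "\<bar>(s z)\<^sup>2\<bar> \<le> c\<^sup>2 * (p z)\<^sup>2" if "z \<in> U" for z
   using power_mono[OF le[OF that], of 2] by (simp add: power_mult_distrib)
 qed
qed (rule s)

lemma H1_L2: "u \<in> H1 U W ==> u \<in> Lspace 2 W"
proof -
 assume u: "u \<in> H1 U W"
 note [measurable] = H1D(5)[OF u]
 show ?thesis
  unfolding L2_iff
 proof
  show "integrable W (\<lambda>z. (u z)\<^sup>2)"
  proof (rule integrable_W_mono[OF H1D(4)[OF u]])
   show "\<bar>(u z)\<^sup>2\<bar> \<le> (1 + snd z) * (u z)\<^sup>2" if "z \<in> U" for z
    using snd_nonneg[OF that] by (simp add: distrib_right)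
  qed measurable
 qed (rule H1D(5)[OF u])
qed

lemma L2_functional_bound:
 assumes f: "f \<in> Lspace 2 W" and v: "v \<in> H1 U W"
 shows "\<bar>LINT z|W. f z * v z\<bar> \<le> ((LINT z|W. (f z)\<^sup>2) + 1) * H.nrm v"
proof (rule H.functional_bound[OF _ _ v, of "\<lambda>v. LINT z|W. f z * v z"])
 show "(LINT z|W. f z * (c *\<^sub>R u) z) = c * (LINT z|W. f z * u z)" for c u
  by (simp add: scaleR_fun_def mult.left_commute)
 fix u assume u: "u \<in> H1 U W"
 note i = L2_mult_integrable[OF f H1_L2[OF u]]
 have "\<bar>LINT z|W. f z * u z\<bar> \<le> (LINT z|W. \<bar>f z * u z\<bar>)" by (rule integral_abs_bound)
 also have "\<dots> \<le> (LINT z|W. (f z)\<^sup>2 + (1 + snd z) * (u z)\<^sup>2)"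
 proof (rule integral_mono)
  show "integrable W (\<lambda>z. \<bar>f z * u z\<bar>)" using i by simp
  show "integrable W (\<lambda>z. (f z)\<^sup>2 + (1 + snd z) * (u z)\<^sup>2)" using f H1D(4)[OF u] by (simp add: L2_iff)
  fix z assume "z \<in> space W"
  then have "0 \<le> snd z * (u z)\<^sup>2" using snd_nonneg by simp
  moreover have "2 * \<bar>f z * u z\<bar> \<le> (f z)\<^sup>2 + (u z)\<^sup>2"
   using sum_squares_bound[of "\<bar>f z\<bar>" "\<bar>u z\<bar>"] by (simp add: abs_mult mult.assoc)
  ultimately show "\<bar>f z * u z\<bar> \<le> (f z)\<^sup>2 + (1 + snd z) * (u z)\<^sup>2"
   using abs_ge_zero[of "f z * u z"] unfolding distrib_right by linarith
 qed
 also have "\<dots> = (LINT z|W. (f z)\<^sup>2) + (LINT z|W. (1 + snd z) * (u z)\<^sup>2)"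
  using f H1D(4)[OF u] by (simp add: L2_iff)
 also have "\<dots> \<le> (LINT z|W. (f z)\<^sup>2) + ip u u" using L2_le_ip[OF u] by simp
 finally show "\<bar>LINT z|W. f z * u z\<bar> \<le> (LINT z|W. (f z)\<^sup>2) + ip u u" .
qed

lemma functional_eq_0_H1_0:
 assumes diff: "\<And>u v. u \<in> H1 U W ==> v \<in> H1 U W ==> d (u - v) = d u - (d v :: real)"
  and bd: "\<And>u. u \<in> H1 U W ==> \<bar>d u\<bar> \<le> C * H.nrm u"
  and test: "\<And>\<phi>. \<phi> \<in> C0_infinity U (U \<union> Gamma0 U) ==> \<phi> \<in> H1 U W ==> d \<phi> = 0"
  and v: "v \<in> H1_0 U W"
 shows "d v = 0"
proof -
 obtain \<phi> where \<phi>: "\<And>n::nat. \<phi> n \<in> C0_infinity U (U \<union> Gamma0 U)" "\<And>n. \<phi> n \<in> H1 U W"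
  "(\<lambda>n. H.nrm (\<phi> n - v)) \<longlonglongrightarrow> 0" using H1_0_approx[OF v] by metis
 note v1 = H1_0_H1[OF v]
 have "\<bar>d v\<bar> \<le> C * H.nrm (\<phi> n - v)" for n
  using bd[OF H.V_diff[OF \<phi>(2) v1], of n] diff[OF \<phi>(2) v1, of n] test[OF \<phi>(1,2), of n] by simp
 then have "\<bar>d v\<bar> \<le> C * 0"
  by (intro LIMSEQ_le_const[OF tendsto_mult_left[OF \<phi>(3)]]) auto
 then show ?thesis by simp
qed

end

section \<open>Coercivity\<close>

text \<open>Lower bound of the second-order and zeroth-order parts, bound of the first moment by the other parts of
 the norm, and bound of the terms of order \<open>\<gamma>\<close>. The maximum in \<open>moment_const\<close> is that of
 \<open>2 \<beta> / \<mu>\<close> and \<open>4 / \<mu>\<^sup>2\<close>.\<close>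

definition ellipticity :: "real => real => real => real" where
 "ellipticity \<sigma> \<rho> r = min ((1 - \<bar>\<rho>\<bar>) * min 1 (\<sigma>\<^sup>2) / 2) r"

definition moment_const :: "real => real => real => real" where
 "moment_const \<sigma> \<kappa> \<theta> = max (2 * \<theta>) (\<sigma> ^ 4 / \<kappa>\<^sup>2)"

definition drift_const :: "real => real => real => real" where
 "drift_const \<sigma> \<rho> \<kappa> = (1 + \<bar>\<rho> * \<sigma>\<bar> + \<bar>\<kappa> * \<rho> / \<sigma> - 1 / 2\<bar>) / 2"

definition coercivity_threshold :: "real => real => real => real => real => real" where
 "coercivity_threshold \<sigma> \<rho> \<kappa> \<theta> r = ellipticity \<sigma> \<rho> r / (2 * drift_const \<sigma> \<rho> \<kappa> * (1 + moment_const \<sigma> \<kappa> \<theta>))"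

lemma ellipticity_pos: "\<sigma> \<noteq> 0 ==> -1 < \<rho> ==> \<rho> < 1 ==> 0 < r ==> 0 < ellipticity \<sigma> \<rho> r"
 by (simp add: ellipticity_def)

lemma drift_const_pos: "0 < drift_const \<sigma> \<rho> \<kappa>"
 unfolding drift_const_def by (intro divide_pos_pos add_pos_nonneg) simp_all

lemma moment_const_nonneg: "0 < \<theta> ==> 0 \<le> moment_const \<sigma> \<kappa> \<theta>"
 by (simp add: moment_const_def max_def)

lemma coercivity_threshold_pos:
 "\<sigma> \<noteq> 0 ==> -1 < \<rho> ==> \<rho> < 1 ==> 0 < r ==> 0 < \<theta> ==> 0 < coercivity_threshold \<sigma> \<rho> \<kappa> \<theta> r"
 unfolding coercivity_threshold_def
 by (intro divide_pos_pos mult_pos_pos ellipticity_pos drift_const_pos) (use moment_const_nonneg in \<open>auto intro: add_pos_nonneg\<close>)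

context heston_problem
begin

abbreviation c\<^sub>a :: real where "c\<^sub>a \<equiv> ellipticity \<sigma> \<rho> r / (2 * (1 + moment_const \<sigma> \<kappa> \<theta>))"

lemma test_function_wd:
 assumes "\<eta> \<in> C0_infinity U (U \<union> Gamma0 U)"
 shows "wd \<eta> (pd \<eta> (1, 0)) (pd \<eta> (0, 1))"
 unfolding wd_def
 by (intro conjI C1_has_weak_deriv[OF open_U] test_function_C1[OF assms]) (auto simp: Basis_real2)

lemma integration_by_parts_x:
 assumes "\<eta> \<in> C0_infinity U (U \<union> Gamma0 U)" "has_weak_deriv (1, 0) U g ge"
  and "integrable W (\<lambda>z. snd z * (g z * pd \<eta> (1, 0) z))" "integrable W (\<lambda>z. snd z * (ge z * \<eta> z))"
  and "integrable W (\<lambda>z. (1 + snd z) * (g z * \<eta> z))"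
 shows "(LINT z|W. snd z * (g z * pd \<eta> (1, 0) z)) =
  \<gamma> * (LINT z|W. sgn (fst z) * (snd z * (g z * \<eta> z))) - (LINT z|W. snd z * (ge z * \<eta> z))"
proof -
 have "(LINT z|W. g z * \<eta> z * (snd (1::real, 0::real) * (\<beta> - \<mu> * snd z) - fst (1::real, 0::real) * \<gamma> * sgn (fst z) * snd z)) =
   (LINT z|W. - \<gamma> * (sgn (fst z) * (snd z * (g z * \<eta> z))))"
  by (intro Bochner_Integration.integral_cong) simp_all
 also have "\<dots> = - \<gamma> * (LINT z|W. sgn (fst z) * (snd z * (g z * \<eta> z)))" by simp
 finally show ?thesis
  using weighted_integration_by_parts[OF assms(1) _ assms(2-5)] by (simp add: Basis_real2)
qed

lemma integration_by_parts_y: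
 assumes "\<eta> \<in> C0_infinity U (U \<union> Gamma0 U)" "has_weak_deriv (0, 1) U g ge"
  and "integrable W (\<lambda>z. snd z * (g z * pd \<eta> (0, 1) z))" "integrable W (\<lambda>z. snd z * (ge z * \<eta> z))"
  and "integrable W (\<lambda>z. (1 + snd z) * (g z * \<eta> z))"
  and i: "integrable W (\<lambda>z. snd z * (g z * \<eta> z))" "integrable W (\<lambda>z. g z * \<eta> z)"
 shows "(LINT z|W. snd z * (g z * pd \<eta> (0, 1) z)) =
  \<mu> * (LINT z|W. snd z * (g z * \<eta> z)) - \<beta> * (LINT z|W. g z * \<eta> z) - (LINT z|W. snd z * (ge z * \<eta> z))"
proof -
 have "(LINT z|W. g z * \<eta> z * (snd (0::real, 1::real) * (\<beta> - \<mu> * snd z) - fst (0::real, 1::real) * \<gamma> * sgn (fst z) * snd z)) =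
   (LINT z|W. \<beta> * (g z * \<eta> z) - \<mu> * (snd z * (g z * \<eta> z)))"
  by (intro Bochner_Integration.integral_cong) (simp_all add: algebra_simps)
 also have "\<dots> = \<beta> * (LINT z|W. g z * \<eta> z) - \<mu> * (LINT z|W. snd z * (g z * \<eta> z))" using i by simp
 finally show ?thesis
  using weighted_integration_by_parts[OF assms(1) _ assms(2-5)] by (simp add: Basis_real2)
qed

lemma quadratic_form_lower_bound:
 "ellipticity \<sigma> \<rho> r * (p\<^sup>2 + s\<^sup>2) \<le> 1 / 2 * (p\<^sup>2 + 2 * (\<rho> * \<sigma>) * (p * s) + \<sigma>\<^sup>2 * s\<^sup>2)"
proof -
 have "2 * \<bar>p * (\<sigma> * s)\<bar> \<le> p\<^sup>2 + (\<sigma> * s)\<^sup>2"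
  using sum_squares_bound[of "\<bar>p\<bar>" "\<bar>\<sigma> * s\<bar>"] by (simp add: abs_mult mult.assoc power_mult_distrib)
 then have "\<bar>\<rho>\<bar> * (2 * \<bar>p * (\<sigma> * s)\<bar>) \<le> \<bar>\<rho>\<bar> * (p\<^sup>2 + (\<sigma> * s)\<^sup>2)" by (intro mult_left_mono) auto
 moreover have "- (2 * (\<rho> * \<sigma>) * (p * s)) \<le> \<bar>\<rho>\<bar> * (2 * \<bar>p * (\<sigma> * s)\<bar>)"
  using abs_ge_minus_self[of "2 * (\<rho> * \<sigma>) * (p * s)"] by (simp add: abs_mult ac_simps)
 ultimately have 1: "(1 - \<bar>\<rho>\<bar>) * (p\<^sup>2 + (\<sigma> * s)\<^sup>2) \<le> p\<^sup>2 + 2 * (\<rho> * \<sigma>) * (p * s) + \<sigma>\<^sup>2 * s\<^sup>2"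
  by (simp add: left_diff_distrib power_mult_distrib)
 have "min 1 (\<sigma>\<^sup>2) * p\<^sup>2 \<le> 1 * p\<^sup>2" "min 1 (\<sigma>\<^sup>2) * s\<^sup>2 \<le> \<sigma>\<^sup>2 * s\<^sup>2" by (intro mult_right_mono; simp)+
 then have "min 1 (\<sigma>\<^sup>2) * (p\<^sup>2 + s\<^sup>2) \<le> p\<^sup>2 + (\<sigma> * s)\<^sup>2" by (simp add: distrib_left power_mult_distrib)
 then have "(1 - \<bar>\<rho>\<bar>) * (min 1 (\<sigma>\<^sup>2) * (p\<^sup>2 + s\<^sup>2)) \<le> (1 - \<bar>\<rho>\<bar>) * (p\<^sup>2 + (\<sigma> * s)\<^sup>2)"
  using \<rho> by (intro mult_left_mono) auto
 moreover have "ellipticity \<sigma> \<rho> r * (p\<^sup>2 + s\<^sup>2) \<le> ((1 - \<bar>\<rho>\<bar>) * min 1 (\<sigma>\<^sup>2) / 2) * (p\<^sup>2 + s\<^sup>2)"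
  unfolding ellipticity_def by (intro mult_right_mono) auto
 ultimately show ?thesis using 1 by (simp add: mult.assoc)
qed

text \<open>Integration by parts in the direction \<open>x\<close> replaces the drift \<open>X\<close> by \<open>\<gamma>\<close> times a first moment, and in the
 direction \<open>y\<close> it bounds the first moment \<open>N1\<close> by \<open>N0\<close> and the gradient. All indefinite terms are then at
 most \<open>\<gamma>\<close> times a constant times \<open>Gx + Gy + N0\<close>, and the threshold leaves half of the ellipticity.\<close>

lemma form_coercive_test:
 assumes \<gamma>0: "\<gamma> < coercivity_threshold \<sigma> \<rho> \<kappa> \<theta> r" and r: "0 < r"
  and \<eta>: "\<eta> \<in> C0_infinity U (U \<union> Gamma0 U)" "\<eta> \<in> H1 U W"
 shows "c\<^sub>a * ip \<eta> \<eta> \<le> a \<eta> \<eta>"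
proof -
 define fx fy where "fx = (pd \<eta> (1, 0))" and "fy = (pd \<eta> (0, 1))"
 have wd: "wd \<eta> fx fy" using test_function_wd[OF \<eta>(1)] by (simp add: fx_def fy_def)
 have fxy: "pd \<eta> (1, 0) z = fx z" "pd \<eta> (0, 1) z = fy z" for z
  by (simp_all add: fx_def fy_def)
 note D = H1_wd_D[OF wd \<eta>(2)] and F = form_products[OF wd \<eta>(2) wd \<eta>(2)]
 define N0 N1 Gx Gy X Y Sx Sy where "N0 = (LINT z|W. (\<eta> z)\<^sup>2)" and "N1 = (LINT z|W. snd z * (\<eta> z)\<^sup>2)"
  and "Gx = (LINT z|W. snd z * (fx z)\<^sup>2)" and "Gy = (LINT z|W. snd z * (fy z)\<^sup>2)"
  and "X = (LINT z|W. snd z * (fx z * \<eta> z))" and "Y = (LINT z|W. snd z * (fy z * \<eta> z))"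
  and "Sx = (LINT z|W. sgn (fst z) * (snd z * (fx z * \<eta> z)))" and "Sy = (LINT z|W. sgn (fst z) * (snd z * (fy z * \<eta> z)))"
 have i3: "integrable W (\<lambda>z. (1 + snd z) * (\<eta> z * \<eta> z))" using D(6) by (simp only: power2_eq_square)
 have si: "integrable W (\<lambda>z. sgn (fst z) * (snd z * (\<eta> z)\<^sup>2))" by (rule sgn_integrable[OF D(7)])
 have X2: "2 * X = \<gamma> * (LINT z|W. sgn (fst z) * (snd z * (\<eta> z)\<^sup>2))"
  using integration_by_parts_x[OF \<eta>(1) wd[unfolded wd_def, THEN conjunct1] _ F(5) i3] F(5)
  by (simp add: X_def fxy power2_eq_square mult.commute[of "\<eta> _" "fx _"])
 have "\<bar>LINT z|W. sgn (fst z) * (snd z * (\<eta> z)\<^sup>2)\<bar> \<le> (LINT z|W. \<bar>sgn (fst z) * (snd z * (\<eta> z)\<^sup>2)\<bar>)"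
  by (rule integral_abs_bound)
 also have "\<dots> \<le> N1" unfolding N1_def
 proof (intro integral_mono integrable_abs si D(7))
  fix z assume "z \<in> space W"
  then have "0 \<le> snd z" using snd_nonneg by simp
  then show "\<bar>sgn (fst z) * (snd z * (\<eta> z)\<^sup>2)\<bar> \<le> snd z * (\<eta> z)\<^sup>2" by (simp add: abs_mult abs_sgn_eq)
 qed
 finally have "\<gamma> * \<bar>LINT z|W. sgn (fst z) * (snd z * (\<eta> z)\<^sup>2)\<bar> \<le> \<gamma> * N1" using \<gamma> by (intro mult_left_mono) auto
 then have "\<bar>2 * X\<bar> \<le> \<gamma> * N1" unfolding X2 using \<gamma> by (simp add: abs_mult)
 then have X: "\<bar>X\<bar> \<le> \<gamma> * N1 / 2" by simp
 have Y2: "\<mu> * N1 = \<beta> * N0 + 2 * Y"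
  using integration_by_parts_y[OF \<eta>(1) wd[unfolded wd_def, THEN conjunct2] _ F(6) i3] F(6,7) D(7)
  by (simp add: Y_def N0_def N1_def fxy power2_eq_square mult.commute[of "\<eta> _" "fy _"])
 \<comment> \<open>Young's inequality with a free constant.\<close>
 have am: "2 * \<bar>k * (p * s)\<bar> \<le> c * (k * p\<^sup>2) + 1 / c * (k * s\<^sup>2)" if "0 \<le> k" "0 < c" for k p s c :: real
 proof -
  have "0 \<le> (sqrt c * \<bar>p\<bar> - \<bar>s\<bar> / sqrt c)\<^sup>2" by simp
  also have "\<dots> = c * p\<^sup>2 + 1 / c * s\<^sup>2 - 2 * \<bar>p * s\<bar>"
   using that by (simp add: power2_diff power_mult_distrib power_divide abs_mult)
  finally have "k * (2 * \<bar>p * s\<bar>) \<le> k * (c * p\<^sup>2 + 1 / c * s\<^sup>2)" using that by (intro mult_left_mono) auto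
  then show ?thesis using that by (simp add: abs_mult algebra_simps)
 qed
 have amI: "2 * \<bar>LINT z|W. g z * (snd z * (p z * \<eta> z))\<bar> \<le> c * (LINT z|W. snd z * (p z)\<^sup>2) + 1 / c * N1"
  if c: "0 < c" and p: "integrable W (\<lambda>z. snd z * (p z)\<^sup>2)" "integrable W (\<lambda>z. snd z * (p z * \<eta> z))"
   and g: "\<And>z. \<bar>g z\<bar> \<le> (1::real)" "integrable W (\<lambda>z. g z * (snd z * (p z * \<eta> z)))" for g p c
 proof -
  have "2 * \<bar>LINT z|W. g z * (snd z * (p z * \<eta> z))\<bar> \<le> 2 * (LINT z|W. \<bar>g z * (snd z * (p z * \<eta> z))\<bar>)"
   using integral_abs_bound by simp
  also have "\<dots> = (LINT z|W. 2 * \<bar>g z * (snd z * (p z * \<eta> z))\<bar>)" by simp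
  also have "\<dots> \<le> (LINT z|W. c * (snd z * (p z)\<^sup>2) + 1 / c * (snd z * (\<eta> z)\<^sup>2))"
  proof (intro integral_mono)
   fix z assume "z \<in> space W"
   then have y: "0 \<le> snd z" using snd_nonneg by simp
   have "\<bar>g z * (snd z * (p z * \<eta> z))\<bar> \<le> 1 * \<bar>snd z * (p z * \<eta> z)\<bar>"
    unfolding abs_mult[of "g z"] using g(1) by (intro mult_right_mono) auto
   then show "2 * \<bar>g z * (snd z * (p z * \<eta> z))\<bar> \<le> c * (snd z * (p z)\<^sup>2) + 1 / c * (snd z * (\<eta> z)\<^sup>2)"
    using am[OF y c, of "p z" "\<eta> z"] by linarith
  qed (use g(2) p(1) D(7) in auto)
  also have "\<dots> = c * (LINT z|W. snd z * (p z)\<^sup>2) + 1 / c * N1" using p(1) D(7) by (simp add: N1_def)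
  finally show ?thesis .
 qed
 \<comment> \<open>This constant lets half of \<open>\<mu> * N1\<close> be absorbed in \<open>Y2\<close>.\<close>
 have Y: "2 * \<bar>Y\<bar> \<le> 2 / \<mu> * Gy + \<mu> / 2 * N1"
  using amI[of "2 / \<mu>" fy "\<lambda>_. 1"] \<mu>_pos D(5) F(6) by (simp add: Y_def Gy_def)
 have Sx: "2 * \<bar>Sx\<bar> \<le> Gx + N1"
  using amI[of 1 fx "\<lambda>z. sgn (fst z)"] D(4) F(5) sgn_integrable[OF F(5)] by (simp add: Sx_def Gx_def abs_sgn_eq)
 have Sy: "2 * \<bar>Sy\<bar> \<le> Gy + N1"
  using amI[of 1 fy "\<lambda>z. sgn (fst z)"] D(5) F(6) sgn_integrable[OF F(6)] by (simp add: Sy_def Gy_def abs_sgn_eq)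
 have nn: "0 \<le> N0" "0 \<le> N1" "0 \<le> Gx" "0 \<le> Gy"
  unfolding N0_def N1_def Gx_def Gy_def using snd_nonneg by (auto intro!: Bochner_Integration.integral_nonneg)
 define E where "E = ellipticity \<sigma> \<rho> r"
 define C where "C = moment_const \<sigma> \<kappa> \<theta>"
 define K where "K = drift_const \<sigma> \<rho> \<kappa>"
 have pos: "0 < E" "0 \<le> C" "0 < K"
  unfolding E_def C_def K_def using ellipticity_pos[OF \<sigma> \<rho> r] moment_const_nonneg[OF \<theta>] drift_const_pos by auto
 have "\<mu> / 2 * N1 \<le> \<beta> * N0 + 2 / \<mu> * Gy" using Y Y2 abs_ge_self[of Y] by linarith
 then have "(2 / \<mu>) * (\<mu> / 2 * N1) \<le> (2 / \<mu>) * (\<beta> * N0 + 2 / \<mu> * Gy)" using \<mu>_pos by (intro mult_left_mono) auto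
 then have "N1 \<le> 2 * \<beta> / \<mu> * N0 + 4 / \<mu>\<^sup>2 * Gy" using \<mu>_pos by (simp add: distrib_left power2_eq_square)
 also have "2 * \<beta> / \<mu> = 2 * \<theta>" using \<kappa> \<sigma> by (simp add: \<beta>_def \<mu>_def)
 also have "4 / \<mu>\<^sup>2 = \<sigma> ^ 4 / \<kappa>\<^sup>2" using \<kappa> \<sigma> by (simp add: \<mu>_def power_divide power_mult_distrib flip: power_mult)
 also have "2 * \<theta> * N0 + \<sigma> ^ 4 / \<kappa>\<^sup>2 * Gy \<le> C * N0 + C * Gy"
  unfolding C_def moment_const_def using nn by (intro add_mono mult_right_mono) auto
 finally have "N1 \<le> C * N0 + C * Gy" .
 moreover have "0 \<le> C * Gx" using nn pos by simp
 ultimately have N1: "N1 \<le> C * (N0 + Gx + Gy)" unfolding distrib_left by linarith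
 have ip: "ip \<eta> \<eta> = Gx + Gy + N0 + N1"
  unfolding ip_eq_wd[OF wd \<eta>(2)] dens_def Gx_def Gy_def N0_def N1_def
  using D(4,5,7,8) by (simp add: distrib_left distrib_right)
 have quad: "E * (Gx + Gy) \<le> 1 / 2 * (Gx + \<rho> * \<sigma> * (LINT z|W. snd z * (fy z * fx z)) +
   \<rho> * \<sigma> * (LINT z|W. snd z * (fx z * fy z)) + \<sigma>\<^sup>2 * Gy)"
 proof -
  have "E * (Gx + Gy) = (LINT z|W. E * (snd z * (fx z)\<^sup>2 + snd z * (fy z)\<^sup>2))"
   unfolding Gx_def Gy_def using D(4,5) by simp
  also have "\<dots> \<le> (LINT z|W. 1 / 2 * (snd z * (fx z)\<^sup>2 + \<rho> * \<sigma> * (snd z * (fy z * fx z)) +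
    \<rho> * \<sigma> * (snd z * (fx z * fy z)) + \<sigma>\<^sup>2 * (snd z * (fy z)\<^sup>2)))"
  proof (intro integral_mono)
   fix z assume "z \<in> space W"
   then have "0 \<le> snd z" using snd_nonneg by simp
   from mult_left_mono[OF quadratic_form_lower_bound[of "fx z" "fy z"] this]
   show "E * (snd z * (fx z)\<^sup>2 + snd z * (fy z)\<^sup>2) \<le> 1 / 2 * (snd z * (fx z)\<^sup>2 + \<rho> * \<sigma> * (snd z * (fy z * fx z)) +
    \<rho> * \<sigma> * (snd z * (fx z * fy z)) + \<sigma>\<^sup>2 * (snd z * (fy z)\<^sup>2))"
    unfolding E_def by (simp add: algebra_simps)
  qed (use D(4,5) F(2,3) in auto)
  also have "\<dots> = 1 / 2 * (Gx + \<rho> * \<sigma> * (LINT z|W. snd z * (fy z * fx z)) +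
   \<rho> * \<sigma> * (LINT z|W. snd z * (fx z * fy z)) + \<sigma>\<^sup>2 * Gy)"
   unfolding Gx_def Gy_def using D(4,5) F(2,3) by (simp add: mult.commute[of "fx _" "fy _"])
  finally show ?thesis .
 qed
 have form: "a \<eta> \<eta> = 1 / 2 * (Gx + \<rho> * \<sigma> * (LINT z|W. snd z * (fy z * fx z)) +
   \<rho> * \<sigma> * (LINT z|W. snd z * (fx z * fy z)) + \<sigma>\<^sup>2 * Gy) - \<gamma> / 2 * (Sx + \<rho> * \<sigma> * Sy) - a\<^sub>1 * X + r * N0"
  unfolding form_eq[OF wd \<eta>(2) wd \<eta>(2)] form_split[OF wd \<eta>(2) wd \<eta>(2)] Gx_def Gy_def Sx_def Sy_def X_def N0_def
  by (simp only: power2_eq_square)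
 define G where "G = Gx + Gy"
 have "\<bar>\<rho> * \<sigma> * Sy\<bar> \<le> \<bar>\<rho> * \<sigma>\<bar> * ((G + N1) / 2)"
  unfolding abs_mult[of _ Sy] using Sy nn by (intro mult_left_mono) (auto simp: G_def)
 moreover have "\<bar>Sx\<bar> \<le> (G + N1) / 2" using Sx nn by (simp add: G_def)
 ultimately have "Sx + \<rho> * \<sigma> * Sy \<le> (1 + \<bar>\<rho> * \<sigma>\<bar>) * ((G + N1) / 2)" unfolding distrib_right by linarith
 then have "\<gamma> / 2 * (Sx + \<rho> * \<sigma> * Sy) \<le> \<gamma> / 2 * ((1 + \<bar>\<rho> * \<sigma>\<bar>) * ((G + N1) / 2))"
  using \<gamma> by (intro mult_left_mono) auto
 also have "\<dots> \<le> \<gamma> / 2 * ((1 + \<bar>\<rho> * \<sigma>\<bar>) * (G + N1))"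
  using \<gamma> nn by (intro mult_left_mono) (auto simp: G_def)
 finally have 1: "\<gamma> / 2 * (Sx + \<rho> * \<sigma> * Sy) \<le> \<gamma> / 2 * ((1 + \<bar>\<rho> * \<sigma>\<bar>) * (G + N1))" .
 have "0 \<le> \<gamma> * G" using nn \<gamma> by (simp add: G_def)
 then have X': "\<bar>X\<bar> \<le> \<gamma> / 2 * (G + N1)" using X by (simp add: distrib_left)
 have "a\<^sub>1 * X \<le> \<bar>a\<^sub>1\<bar> * \<bar>X\<bar>" by (metis abs_ge_self abs_mult)
 also have "\<dots> \<le> \<bar>a\<^sub>1\<bar> * (\<gamma> / 2 * (G + N1))"
  using X' by (intro mult_left_mono) auto
 finally have 2: "a\<^sub>1 * X \<le> \<bar>a\<^sub>1\<bar> * (\<gamma> / 2 * (G + N1))" .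
 have "E * N0 \<le> r * N0" unfolding E_def ellipticity_def using nn by (intro mult_right_mono) auto
 then have "E * (G + N0) - (\<gamma> / 2 * ((1 + \<bar>\<rho> * \<sigma>\<bar>) * (G + N1)) + \<bar>a\<^sub>1\<bar> * (\<gamma> / 2 * (G + N1))) \<le> a \<eta> \<eta>"
  using quad 1 2 unfolding form G_def[symmetric] distrib_left[of E] by linarith
 moreover have "\<gamma> / 2 * ((1 + \<bar>\<rho> * \<sigma>\<bar>) * (G + N1)) + \<bar>a\<^sub>1\<bar> * (\<gamma> / 2 * (G + N1)) = \<gamma> * K * (G + N1)"
  unfolding K_def drift_const_def a\<^sub>1_def[symmetric] by (simp add: field_simps)
 ultimately have low: "E * (G + N0) - \<gamma> * K * (G + N1) \<le> a \<eta> \<eta>" by simp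
 have G1: "G + N1 \<le> (1 + C) * (G + N0)" and I1: "G + N0 + N1 \<le> (1 + C) * (G + N0)"
  using N1 nn unfolding G_def by (simp_all add: algebra_simps)
 have "\<gamma> * K * (G + N1) \<le> \<gamma> * K * ((1 + C) * (G + N0))" using G1 \<gamma> pos by (intro mult_left_mono) auto
 also have "\<dots> = (\<gamma> * (2 * K * (1 + C))) * ((G + N0) / 2)" by simp
 also have "\<dots> \<le> E * ((G + N0) / 2)"
 proof (rule mult_right_mono)
  have "0 < 2 * K * (1 + C)" using pos by simp
  then show "\<gamma> * (2 * K * (1 + C)) \<le> E"
   using \<gamma>0 unfolding coercivity_threshold_def E_def[symmetric] C_def[symmetric] K_def[symmetric]
   by (simp add: pos_less_divide_eq less_imp_le)
 qed (use nn in \<open>simp add: G_def\<close>)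
 finally have "E * ((G + N0) / 2) \<le> a \<eta> \<eta>" using low by (simp add: field_simps)
 moreover have "c\<^sub>a * ip \<eta> \<eta> \<le> c\<^sub>a * ((1 + C) * (G + N0))"
  using I1 pos unfolding E_def[symmetric] C_def[symmetric] ip G_def by (intro mult_left_mono) auto
 moreover have "c\<^sub>a * ((1 + C) * (G + N0)) = E * ((G + N0) / 2)"
  using pos unfolding E_def[symmetric] C_def[symmetric] by (simp add: field_simps)
 ultimately show ?thesis by linarith
qed

lemma form_coercive:
 assumes \<gamma>0: "\<gamma> < coercivity_threshold \<sigma> \<rho> \<kappa> \<theta> r" and r: "0 < r" and v: "v \<in> H1_0 U W"
 shows "c\<^sub>a * ip v v \<le> a v v"
proof -
 obtain \<phi> where \<phi>: "\<And>n::nat. \<phi> n \<in> C0_infinity U (U \<union> Gamma0 U)" "\<And>n. \<phi> n \<in> H1 U W"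
  "(\<lambda>n. H.nrm (\<phi> n - v)) \<longlonglongrightarrow> 0" using H1_0_approx[OF v] by metis
 note v1 = H1_0_H1[OF v]
 have n: "(\<lambda>n. H.nrm (\<phi> n)) \<longlonglongrightarrow> H.nrm v" by (rule H.tendsto_nrm[OF \<phi>(2) v1 \<phi>(3)])
 have le: "\<bar>a (\<phi> n) (\<phi> n) - a v v\<bar> \<le> 2 * C\<^sub>a * H.nrm (\<phi> n - v) * H.nrm (\<phi> n) + 2 * C\<^sub>a * H.nrm v * H.nrm (\<phi> n - v)" for n
 proof -
  note d = H.V_diff[OF \<phi>(2) v1, of n]
  have "a (\<phi> n) (\<phi> n) - a v v = a (\<phi> n - v) (\<phi> n) + a v (\<phi> n - v)"
   using form_diff_left[OF \<phi>(2) v1 \<phi>(2), of n n] form_diff_right[OF v1 \<phi>(2) v1, of n] by simp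
  then show ?thesis using form_continuous[OF d \<phi>(2), of n] form_continuous[OF v1 d] by linarith
 qed
 have "(\<lambda>n. 2 * C\<^sub>a * H.nrm (\<phi> n - v) * H.nrm (\<phi> n) + 2 * C\<^sub>a * H.nrm v * H.nrm (\<phi> n - v)) \<longlonglongrightarrow>
   2 * C\<^sub>a * 0 * H.nrm v + 2 * C\<^sub>a * H.nrm v * 0"
  by (intro tendsto_intros n \<phi>(3))
 then have z: "(\<lambda>n. 2 * C\<^sub>a * H.nrm (\<phi> n - v) * H.nrm (\<phi> n) + 2 * C\<^sub>a * H.nrm v * H.nrm (\<phi> n - v)) \<longlonglongrightarrow> 0" by simp
 have "(\<lambda>n. a (\<phi> n) (\<phi> n)) \<longlonglongrightarrow> a v v"
  by (rule LIM_zero_cancel, rule tendsto_rabs_zero_cancel, rule tendsto_sandwich[OF _ _ tendsto_const z]) (use le in auto)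
 moreover have "(\<lambda>n. c\<^sub>a * (H.nrm (\<phi> n))\<^sup>2) \<longlonglongrightarrow> c\<^sub>a * (H.nrm v)\<^sup>2" by (intro tendsto_intros n)
 moreover have "c\<^sub>a * (H.nrm (\<phi> n))\<^sup>2 \<le> a (\<phi> n) (\<phi> n)" for n
  unfolding H.nrm_sq[OF \<phi>(2)] by (rule form_coercive_test[OF \<gamma>0 r \<phi>(1,2)])
 ultimately have "c\<^sub>a * (H.nrm v)\<^sup>2 \<le> a v v" by (intro LIMSEQ_le[of _ _ "\<lambda>n. a (\<phi> n) (\<phi> n)"]) auto
 then show ?thesis unfolding H.nrm_sq[OF v1] .
qed

end

context heston_problem
begin

section \<open>The Heston operator as a functional\<close>

lemma H2D:
 assumes M: "M \<in> H2 U W"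
 shows "wd M (Dx U M) (Dy U M)" "wd (Dx U M) (Dx U (Dx U M)) (Dy U (Dx U M))" "wd (Dy U M) (Dx U (Dy U M)) (Dy U (Dy U M))"
  and "(\<lambda>z. snd z * Dx U (Dx U M) z) \<in> Lspace 2 W" "(\<lambda>z. snd z * Dy U (Dx U M) z) \<in> Lspace 2 W"
  "(\<lambda>z. snd z * Dx U (Dy U M) z) \<in> Lspace 2 W" "(\<lambda>z. snd z * Dy U (Dy U M) z) \<in> Lspace 2 W"
  "(\<lambda>z. (1 + snd z) * Dx U M z) \<in> Lspace 2 W" "(\<lambda>z. (1 + snd z) * Dy U M z) \<in> Lspace 2 W"
  and "M \<in> H1 U W"
proof -
 have w: "weakly_differentiable U M" "weakly_differentiable U (Dx U M)" "weakly_differentiable U (Dy U M)"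
  and i: "integrable W (H2_density U M)" using M by (auto simp: H2_def)
 show wd: "wd M (Dx U M) (Dy U M)" "wd (Dx U M) (Dx U (Dx U M)) (Dy U (Dx U M))" "wd (Dy U M) (Dx U (Dy U M)) (Dy U (Dy U M))"
  by (rule wd_Dxy; rule w)+
 note [measurable] = wd_borel[OF wd(1)] wd_borel[OF wd(2)] wd_borel[OF wd(3)]
 have le: "(snd z)\<^sup>2 * (Dx U (Dx U M) z)\<^sup>2 \<le> H2_density U M z \<and> (snd z)\<^sup>2 * (Dy U (Dx U M) z)\<^sup>2 \<le> H2_density U M z \<and>
   (snd z)\<^sup>2 * (Dx U (Dy U M) z)\<^sup>2 \<le> H2_density U M z \<and> (snd z)\<^sup>2 * (Dy U (Dy U M) z)\<^sup>2 \<le> H2_density U M z \<and>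
   (1 + snd z)\<^sup>2 * (Dx U M z)\<^sup>2 \<le> H2_density U M z \<and> (1 + snd z)\<^sup>2 * (Dy U M z)\<^sup>2 \<le> H2_density U M z \<and>
   (1 + snd z) * (M z)\<^sup>2 \<le> H2_density U M z" if "z \<in> U" for z
  using snd_nonneg[OF that] unfolding H2_density_def distrib_left[of "_\<^sup>2"]
  by (intro conjI) (auto intro!: add_increasing add_increasing2)
 have L: "s \<in> Lspace 2 W" if "s \<in> borel_measurable W" "\<And>z. z \<in> U ==> (s z)\<^sup>2 \<le> H2_density U M z" for s
  unfolding L2_iff using that by (intro conjI integrable_W_mono[OF i]) auto
 show "(\<lambda>z. snd z * Dx U (Dx U M) z) \<in> Lspace 2 W" "(\<lambda>z. snd z * Dy U (Dx U M) z) \<in> Lspace 2 W"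
  "(\<lambda>z. snd z * Dx U (Dy U M) z) \<in> Lspace 2 W" "(\<lambda>z. snd z * Dy U (Dy U M) z) \<in> Lspace 2 W"
  and L1: "(\<lambda>z. (1 + snd z) * Dx U M z) \<in> Lspace 2 W" "(\<lambda>z. (1 + snd z) * Dy U M z) \<in> Lspace 2 W"
  by (rule L, measurable, unfold power_mult_distrib, use le in blast)+
 show "M \<in> H1 U W"
 proof (rule H1I[OF wd(1)])
  have y: "snd z * p\<^sup>2 \<le> ((1 + snd z) * p)\<^sup>2" if "z \<in> U" for z p
   unfolding power_mult_distrib
   by (rule mult_right_mono) (use snd_nonneg[OF that] in \<open>simp_all add: power2_eq_square distrib_left distrib_right\<close>)
  show "integrable W (\<lambda>z. snd z * (Dx U M z)\<^sup>2)"
   by (rule integrable_W_mono[OF L1(1)[unfolded L2_iff, THEN conjunct2]], measurable) (use y snd_nonneg in auto)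
  show "integrable W (\<lambda>z. snd z * (Dy U M z)\<^sup>2)"
   by (rule integrable_W_mono[OF L1(2)[unfolded L2_iff, THEN conjunct2]], measurable) (use y snd_nonneg in auto)
  show "integrable W (\<lambda>z. (1 + snd z) * (M z)\<^sup>2)"
   by (rule integrable_W_mono[OF i], measurable) (use le snd_nonneg in \<open>auto simp: abs_mult\<close>)
 qed
qed

abbreviation A :: "(real \<times> real => real) => real \<times> real => real" where
 "A \<equiv> heston_op \<sigma> \<rho> \<kappa> \<theta> r q U"

lemma heston_op_L2:
 assumes M: "M \<in> H2 U W"
 shows "A M \<in> Lspace 2 W"
proof -
 note D = H2D[OF M]
 have [measurable]: "Dx U M \<in> borel_measurable W" "Dy U M \<in> borel_measurable W" by (rule wd_borel[OF D(1)])+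
 have x: "(\<lambda>z. (r - q - snd z / 2) * Dx U M z) \<in> Lspace 2 W"
 proof (rule L2_mono[OF D(8)])
  show "\<bar>(r - q - snd z / 2) * Dx U M z\<bar> \<le> (\<bar>r - q\<bar> + 1) * \<bar>(1 + snd z) * Dx U M z\<bar>" if "z \<in> U" for z
  proof -
   have "0 \<le> \<bar>r - q\<bar> * snd z" using snd_nonneg[OF that] by simp
   moreover have "(\<bar>r - q\<bar> + 1) * \<bar>1 + snd z\<bar> = \<bar>r - q\<bar> * snd z + \<bar>r - q\<bar> + 1 + snd z"
    using snd_nonneg[OF that] by (simp add: distrib_left distrib_right)
   ultimately have "\<bar>r - q - snd z / 2\<bar> \<le> (\<bar>r - q\<bar> + 1) * \<bar>1 + snd z\<bar>"
    using snd_nonneg[OF that] by linarith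
   then show ?thesis unfolding abs_mult mult.assoc[symmetric] by (rule mult_right_mono) simp
  qed
 qed measurable
 have y: "(\<lambda>z. \<kappa> * (\<theta> - snd z) * Dy U M z) \<in> Lspace 2 W"
 proof (rule L2_mono[OF D(9)])
  show "\<bar>\<kappa> * (\<theta> - snd z) * Dy U M z\<bar> \<le> (\<kappa> * (\<theta> + 1)) * \<bar>(1 + snd z) * Dy U M z\<bar>" if "z \<in> U" for z
  proof -
   have "0 \<le> \<theta> * snd z" using snd_nonneg[OF that] \<theta> by simp
   moreover have "(\<theta> + 1) * \<bar>1 + snd z\<bar> = \<theta> * snd z + \<theta> + 1 + snd z"
    using snd_nonneg[OF that] by (simp add: distrib_left distrib_right)
   ultimately have "\<bar>\<theta> - snd z\<bar> \<le> (\<theta> + 1) * \<bar>1 + snd z\<bar>"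
    using snd_nonneg[OF that] \<theta> by linarith
   then have "\<kappa> * \<bar>\<theta> - snd z\<bar> * \<bar>Dy U M z\<bar> \<le> \<kappa> * ((\<theta> + 1) * \<bar>1 + snd z\<bar>) * \<bar>Dy U M z\<bar>"
    using \<kappa> by (intro mult_right_mono mult_left_mono) auto
   then show ?thesis using \<kappa> by (simp only: abs_mult abs_of_pos mult.assoc)
  qed
 qed measurable
 have "(\<lambda>z. 1 * (1 * (1 * (1 * (- (1 / 2) * (snd z * Dx U (Dx U M) z) + - (\<rho> * \<sigma>) * (snd z * Dy U (Dx U M) z)) +
   - (\<sigma>\<^sup>2 / 2) * (snd z * Dy U (Dy U M) z)) + (-1) * ((r - q - snd z / 2) * Dx U M z)) +
   (-1) * (\<kappa> * (\<theta> - snd z) * Dy U M z)) + r * M z) \<in> Lspace 2 W"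
  by (intro L2_lincomb D(4,5,7) x y H1_L2 D(10))
 also have "(\<lambda>z. 1 * (1 * (1 * (1 * (- (1 / 2) * (snd z * Dx U (Dx U M) z) + - (\<rho> * \<sigma>) * (snd z * Dy U (Dx U M) z)) +
   - (\<sigma>\<^sup>2 / 2) * (snd z * Dy U (Dy U M) z)) + (-1) * ((r - q - snd z / 2) * Dx U M z)) +
   (-1) * (\<kappa> * (\<theta> - snd z) * Dy U M z)) + r * M z) = A M"
  by (rule ext) (simp add: heston_op_def field_simps)
 finally show ?thesis .
qed

text \<open>Integration by parts in \<open>x\<close> and \<open>y\<close> with each of the two first derivatives of \<open>M\<close>. The terms with \<open>\<gamma>\<close>
 cancel, \<open>\<sigma>\<^sup>2 * \<beta> = 2 * \<kappa> * \<theta>\<close> and \<open>\<sigma>\<^sup>2 * \<mu> = 2 * \<kappa>\<close> give the drift in \<open>y\<close>, and the normalization gives the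
 drift in \<open>x\<close>. The mixed derivatives meet in different orders, hence the need for their symmetry.\<close>

lemma form_eq_heston_op_test:
 assumes M: "M \<in> H2 U W" and \<eta>: "\<eta> \<in> C0_infinity U (U \<union> Gamma0 U)" "\<eta> \<in> H1 U W"
 shows "a M \<eta> = (LINT z|W. A M z * \<eta> z)"
proof -
 note D = H2D[OF M] and eL = H1_L2[OF \<eta>(2)]
 define fx fy where "fx = (pd \<eta> (1, 0))" and "fy = (pd \<eta> (0, 1))"
 have fxy: "pd \<eta> (1, 0) z = fx z" "pd \<eta> (0, 1) z = fy z" for z
  by (simp_all add: fx_def fy_def)
 have wd: "wd \<eta> fx fy" using test_function_wd[OF \<eta>(1)] by (simp add: fx_def fy_def)
 define N Px Py Qx Qy Kxx Kxy Kyx Kyy where "N = (LINT z|W. M z * \<eta> z)"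
  and "Px = (LINT z|W. Dx U M z * \<eta> z)" and "Py = (LINT z|W. Dy U M z * \<eta> z)"
  and "Qx = (LINT z|W. snd z * (Dx U M z * \<eta> z))" and "Qy = (LINT z|W. snd z * (Dy U M z * \<eta> z))"
  and "Kxx = (LINT z|W. snd z * (Dx U (Dx U M) z * \<eta> z))" and "Kxy = (LINT z|W. snd z * (Dy U (Dx U M) z * \<eta> z))"
  and "Kyx = (LINT z|W. snd z * (Dx U (Dy U M) z * \<eta> z))" and "Kyy = (LINT z|W. snd z * (Dy U (Dy U M) z * \<eta> z))"
 note F = form_products[OF D(1,10) wd \<eta>(2)]
 have K: "integrable W (\<lambda>z. snd z * (Dx U (Dx U M) z * \<eta> z))" "integrable W (\<lambda>z. snd z * (Dy U (Dx U M) z * \<eta> z))"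
  "integrable W (\<lambda>z. snd z * (Dx U (Dy U M) z * \<eta> z))" "integrable W (\<lambda>z. snd z * (Dy U (Dy U M) z * \<eta> z))"
  and i3: "integrable W (\<lambda>z. (1 + snd z) * (Dx U M z * \<eta> z))" "integrable W (\<lambda>z. (1 + snd z) * (Dy U M z * \<eta> z))"
  using L2_mult_integrable[OF _ eL] D(4-9) by (simp_all only: mult.assoc[symmetric])
 have P: "integrable W (\<lambda>z. Dx U M z * \<eta> z)" "integrable W (\<lambda>z. Dy U M z * \<eta> z)"
  using Bochner_Integration.integrable_diff[OF i3(1) F(5)] Bochner_Integration.integrable_diff[OF i3(2) F(6)]
  by (simp_all add: distrib_right)
 note ex = integration_by_parts_x[OF \<eta>(1), unfolded fxy] and ey = integration_by_parts_y[OF \<eta>(1), unfolded fxy]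
 have W: "has_weak_deriv (1, 0) U (Dx U M) (Dx U (Dx U M))" "has_weak_deriv (0, 1) U (Dx U M) (Dy U (Dx U M))"
  "has_weak_deriv (1, 0) U (Dy U M) (Dx U (Dy U M))" "has_weak_deriv (0, 1) U (Dy U M) (Dy U (Dy U M))"
  "has_weak_deriv (1, 0) U M (Dx U M)" "has_weak_deriv (0, 1) U M (Dy U M)"
  using D(1-3) by (auto simp: wd_def)
 have "AE z in W. Dy U (Dx U M) z = Dx U (Dy U M) z"
  unfolding AE_W by (rule weak_derivs_commute[OF open_U _ _ W(5,2,6,3)]) (auto simp: Basis_real2)
 then have Kyx: "Kyx = Kxy"
  unfolding Kyx_def Kxy_def using K(2,3) by (intro integral_cong_AE) auto
 have "(LINT z|W. A M z * \<eta> z) = (LINT z|W. - (1 / 2) * (snd z * (Dx U (Dx U M) z * \<eta> z)) - \<rho> * \<sigma> * (snd z * (Dy U (Dx U M) z * \<eta> z))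
   - \<sigma>\<^sup>2 / 2 * (snd z * (Dy U (Dy U M) z * \<eta> z)) - (r - q) * (Dx U M z * \<eta> z) + 1 / 2 * (snd z * (Dx U M z * \<eta> z))
   - \<kappa> * \<theta> * (Dy U M z * \<eta> z) + \<kappa> * (snd z * (Dy U M z * \<eta> z)) + r * (M z * \<eta> z))"
  by (intro Bochner_Integration.integral_cong) (simp_all add: heston_op_def field_simps)
 also have "\<dots> = - (1 / 2) * Kxx - \<rho> * \<sigma> * Kxy - \<sigma>\<^sup>2 / 2 * Kyy - (r - q) * Px + 1 / 2 * Qx - \<kappa> * \<theta> * Py + \<kappa> * Qy + r * N"
  unfolding Kxx_def Kxy_def Kyy_def Px_def Py_def Qx_def Qy_def N_def using K P F(5-7) by simp
 finally have AM: "(LINT z|W. A M z * \<eta> z) =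
   - (1 / 2) * Kxx - \<rho> * \<sigma> * Kxy - \<sigma>\<^sup>2 / 2 * Kyy - (r - q) * Px + 1 / 2 * Qx - \<kappa> * \<theta> * Py + \<kappa> * Qy + r * N" .
 have c: "\<sigma>\<^sup>2 * \<beta> = 2 * (\<kappa> * \<theta>)" "\<sigma>\<^sup>2 * \<mu> = 2 * \<kappa>" "\<rho> * \<sigma> * \<beta> = 2 * (r - q)" "\<rho> * \<sigma> * \<mu> = 2 * a\<^sub>1 + 1"
  using \<sigma> b1 by (simp_all add: \<beta>_def \<mu>_def a\<^sub>1_def field_simps power2_eq_square)
 have form: "a M \<eta> = 1 / 2 * ((\<gamma> * (LINT z|W. sgn (fst z) * (snd z * (Dx U M z * \<eta> z))) - Kxx) +
   \<rho> * \<sigma> * (\<gamma> * (LINT z|W. sgn (fst z) * (snd z * (Dy U M z * \<eta> z))) - Kxy) +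
   \<rho> * \<sigma> * (\<mu> * Qx - \<beta> * Px - Kxy) + \<sigma>\<^sup>2 * (\<mu> * Qy - \<beta> * Py - Kyy))
  - \<gamma> / 2 * ((LINT z|W. sgn (fst z) * (snd z * (Dx U M z * \<eta> z))) + \<rho> * \<sigma> * (LINT z|W. sgn (fst z) * (snd z * (Dy U M z * \<eta> z))))
  - a\<^sub>1 * Qx + r * N"
  unfolding form_eq[OF D(1,10) wd \<eta>(2)] form_split[OF D(1,10) wd \<eta>(2)]
   ex[OF W(1) F(1) K(1) i3(1)] ex[OF W(3) F(2) K(3) i3(2)] ey[OF W(2) F(3) K(2) i3(1) F(5) P(1)] ey[OF W(4) F(4) K(4) i3(2) F(6) P(2)]
   Kyx[symmetric] unfolding Kyx_def[symmetric] Kyx unfolding Kxx_def Kxy_def Kyy_def Px_def Py_def Qx_def Qy_def N_def ..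
 show ?thesis unfolding form AM using c by algebra
qed

lemma form_eq_heston_op:
 assumes M: "M \<in> H2 U W" and v: "v \<in> H1_0 U W"
 shows "a M v = (LINT z|W. A M z * v z)"
proof -
 note L = heston_op_L2[OF M] and M1 = H2D(10)[OF M]
 have "a M v - (LINT z|W. A M z * v z) = 0"
 proof (rule functional_eq_0_H1_0[OF _ _ _ v, of "\<lambda>v. a M v - (LINT z|W. A M z * v z)"])
  show "a M (u - v) - (LINT z|W. A M z * (u - v) z) = a M u - (LINT z|W. A M z * u z) - (a M v - (LINT z|W. A M z * v z))"
   if "u \<in> H1 U W" "v \<in> H1 U W" for u v
   using L2_mult_integrable[OF L H1_L2[OF that(1)]] L2_mult_integrable[OF L H1_L2[OF that(2)]]
   by (simp add: form_diff_right[OF M1 that] right_diff_distrib)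
  show "\<bar>a M u - (LINT z|W. A M z * u z)\<bar> \<le> (2 * C\<^sub>a * H.nrm M + ((LINT z|W. (A M z)\<^sup>2) + 1)) * H.nrm u" if "u \<in> H1 U W" for u
   using form_continuous[OF M1 that] L2_functional_bound[OF L that] unfolding distrib_right[of "2 * C\<^sub>a * H.nrm M"] by linarith
 qed (simp add: form_eq_heston_op_test[OF M])
 then show ?thesis by simp
qed

section \<open>Comparison\<close>

lemma H1_minus: "u \<in> H1 U W ==> (\<lambda>z. - u z) \<in> H1 U W"
 using H1_lincomb[where a="-1" and b=0, of u u] by simp

text \<open>\<open>u - M = (u + M\<^sup>-) - M\<^sup>+\<close>, where \<open>u + M\<^sup>-\<close> vanishes on the non-degenerate boundary and \<open>M\<^sup>+ \<ge> 0\<close>.\<close>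

lemma positive_part_above:
 assumes u: "u \<in> H1_0 U W" and M: "M \<in> H1 U W" "Gamma1_ge0 U W M"
 shows "(\<lambda>z. max (u z - M z) 0) \<in> H1_0 U W"
proof -
 have "(\<lambda>z. 1 * u z + 1 * (- min (M z) 0)) \<in> H1_0 U W"
  by (rule H1_0_lincomb[OF u]) (use M(2) in \<open>simp add: Gamma1_ge0_def\<close>)
 from H1_0_minus_nonneg[OF this H1_max_0(1)[OF M(1)]]
 have "(\<lambda>z. max (1 * u z + 1 * (- min (M z) 0) - max (M z) 0) 0) \<in> H1_0 U W" by simp
 moreover have eq: "1 * u z + 1 * (- min (M z) 0) - max (M z) 0 = u z - M z" for z by (simp add: min_def max_def)
 ultimately show ?thesis unfolding eq by blast
qed

lemma positive_part_below:
 assumes u: "u \<in> H1_0 U W" and m: "m \<in> H1 U W" "Gamma1_le0 U W m"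
 shows "(\<lambda>z. max (m z - u z) 0) \<in> H1_0 U W"
proof -
 have "(\<lambda>z. 1 * max (m z) 0 + (-1) * u z) \<in> H1_0 U W"
  by (rule H1_0_lincomb[OF _ u]) (use m(2) in \<open>simp add: Gamma1_le0_def\<close>)
 from H1_0_minus_nonneg[OF this H1_max_0(1)[OF H1_minus[OF m(1)]]]
 have "(\<lambda>z. max (1 * max (m z) 0 + (-1) * u z - max (- m z) 0) 0) \<in> H1_0 U W" by simp
 moreover have eq: "1 * max (m z) 0 + (-1) * u z - max (- m z) 0 = m z - u z" for z by (simp add: max_def)
 ultimately show ?thesis unfolding eq by blast
qed

text \<open>The form is local: both integrands vanish where \<open>g \<le> 0\<close>.\<close>

lemma form_positive_part:
 assumes g: "g \<in> H1 U W"
 shows "a g (\<lambda>z. max (g z) 0) = a (\<lambda>z. max (g z) 0) (\<lambda>z. max (g z) 0)"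
proof -
 note G = H1D(1)[OF g] and P = wd_max_0[OF H1D(1)[OF g]] and p = H1_max_0(1)[OF g]
 show ?thesis
  unfolding form_eq[OF G g P p] form_eq[OF P p P p]
  by (intro Bochner_Integration.integral_cong) (auto simp: q\<^sub>a_def max_def)
qed

lemma ip_eq_0_AE:
 assumes u: "u \<in> H1 U W" and 0: "ip u u \<le> 0"
 shows "AE z in W. u z = 0"
proof -
 have nn: "0 \<le> (1 + snd z) * (u z)\<^sup>2" if "z \<in> U" for z using snd_nonneg[OF that] by simp
 have nn': "AE z in W. 0 \<le> (1 + snd z) * (u z)\<^sup>2" using nn by (intro AE_I2) simp
 have "(LINT z|W. (1 + snd z) * (u z)\<^sup>2) = 0"
  using integral_nonneg_AE[OF nn'] L2_le_ip[OF u] 0 by simp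
 then have "AE z in W. (1 + snd z) * (u z)\<^sup>2 = 0"
  using integral_nonneg_eq_0_iff_AE[OF H1D(4)[OF u] nn'] by simp
 moreover have "AE z in W. 0 \<le> snd z" by (intro AE_I2) (simp add: snd_nonneg)
 ultimately show ?thesis by eventually_elim auto
qed

lemma obstacle_solution_iff:
 "obstacle_solution \<sigma> \<rho> \<kappa> \<theta> r \<gamma> U f \<psi> u \<longleftrightarrow> u \<in> H1_0 U W \<and> (AE z in W. \<psi> z \<le> u z) \<and>
  (\<forall>v \<in> H1_0 U W. (AE z in W. \<psi> z \<le> v z) \<longrightarrow> (LINT z|W. f z * (v - u) z) \<le> a u (v - u))"
 unfolding obstacle_solution_def Let_def W_eq AE_W fun_diff_def by simp

end

locale coercive_heston_problem = heston_problem +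
 assumes \<gamma>\<^sub>0: "\<gamma> < coercivity_threshold \<sigma> \<rho> \<kappa> \<theta> r" and r: "0 < r"
begin

lemma c\<^sub>a_pos: "0 < c\<^sub>a"
 using ellipticity_pos[OF \<sigma> \<rho> r] moment_const_nonneg[OF \<theta>, of \<sigma> \<kappa>] by (intro divide_pos_pos) auto

lemma form_nonpos_AE_0:
 assumes u: "u \<in> H1_0 U W" and 0: "a u u \<le> 0"
 shows "AE z in W. u z = 0"
proof (rule ip_eq_0_AE[OF H1_0_H1[OF u]])
 have "c\<^sub>a * ip u u \<le> 0" using form_coercive[OF \<gamma>\<^sub>0 r u] 0 by linarith
 then show "ip u u \<le> 0" using c\<^sub>a_pos mult_le_0_iff[of c\<^sub>a "ip u u"] by linarith
qed

text \<open>By locality the hypothesis says that the form is nonpositive on the diagonal at \<open>(p - s)\<^sup>+\<close>, which must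
 then vanish by coercivity.\<close>

lemma comparison:
 assumes p: "p \<in> H1 U W" and s: "s \<in> H1 U W" and w: "(\<lambda>z. max (p z - s z) 0) \<in> H1_0 U W"
  and le: "a p (\<lambda>z. max (p z - s z) 0) \<le> a s (\<lambda>z. max (p z - s z) 0)"
 shows "AE z in W. p z \<le> s z"
proof -
 have "a (p - s) (\<lambda>z. max ((p - s) z) 0) \<le> 0"
  using form_diff_left[OF p s H1_0_H1[OF w]] le by simp
 then have "AE z in W. max (p z - s z) 0 = 0"
  using form_nonpos_AE_0[OF w] form_positive_part[OF H.V_diff[OF p s]] by simp
 then show ?thesis by eventually_elim (simp add: max_def split: if_splits)
qed

lemma obstacle_solution_exists:
 assumes f: "f \<in> Lspace 2 W" and \<psi>: "Gamma1_le0 U W \<psi>"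
 obtains u where "obstacle_solution \<sigma> \<rho> \<kappa> \<theta> r \<gamma> U f \<psi> u"
proof -
 let ?K = "{v \<in> H1_0 U W. AE z in W. \<psi> z \<le> v z}"
 have 1: "?K \<subseteq> H1_0 U W" by auto
 have "(\<lambda>z. max (\<psi> z) 0) \<in> ?K" using \<psi> by (simp add: Gamma1_le0_def)
 then have 2: "?K \<noteq> {}" by blast
 have 3: "convex ?K"
 proof (rule convexI)
  fix u v and s t :: real assume u: "u \<in> ?K" and v: "v \<in> ?K" and st: "0 \<le> s" "0 \<le> t" "s + t = 1"
  have "AE z in W. \<psi> z \<le> u z" "AE z in W. \<psi> z \<le> v z" using u v by auto
  then have "AE z in W. \<psi> z \<le> (s *\<^sub>R u + t *\<^sub>R v) z"
  proof eventually_elim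
   case (elim z)
   then have "s * \<psi> z + t * \<psi> z \<le> s * u z + t * v z" using st by (intro add_mono mult_left_mono) auto
   then show ?case using st by (simp add: scaleR_fun_def flip: distrib_right)
  qed
  moreover have "s *\<^sub>R u + t *\<^sub>R v \<in> H1_0 U W" using u v by (intro H0.V_add H0.V_scale) auto
  ultimately show "s *\<^sub>R u + t *\<^sub>R v \<in> ?K" by simp
 qed
 have 4: "H0.nclosed ?K"
  unfolding H0.nclosed_def
 proof (intro allI impI)
  fix X :: "nat => _" and x assume X: "\<forall>n. X n \<in> ?K" and x: "x \<in> H1_0 U W" and lim: "(\<lambda>n. H0.nrm (X n - x)) \<longlonglongrightarrow> 0"
  have X1: "X n \<in> H1 U W" for n using X H1_0_H1 by auto
  obtain s where s: "strict_mono s" "AE z in W. (\<lambda>n. X (s n) z) \<longlonglongrightarrow> x z"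
   by (rule H1_limit_AE_subseq[OF X1 H1_0_H1[OF x] lim])
  have "AE z in W. \<forall>n. \<psi> z \<le> X n z" using X by (simp add: AE_all_countable)
  then have "AE z in W. \<psi> z \<le> x z"
   using s(2) by eventually_elim (rule LIMSEQ_le_const, auto)
  then show "x \<in> ?K" using x by simp
 qed
 obtain u where u: "u \<in> ?K" "\<And>v. v \<in> ?K ==> (LINT z|W. f z * (v - u) z) \<le> a u (v - u)"
 proof (rule H0.Lions_Stampacchia[OF 1 2 3 4, of "\<lambda>v. LINT z|W. f z * v z" _ a "2 * C\<^sub>a" c\<^sub>a])
  show "(LINT z|W. f z * (x + y) z) = (LINT z|W. f z * x z) + (LINT z|W. f z * y z)"
   if "x \<in> H1_0 U W" "y \<in> H1_0 U W" for x y
   using L2_mult_integrable[OF f H1_L2[OF H1_0_H1[OF that(1)]]] L2_mult_integrable[OF f H1_L2[OF H1_0_H1[OF that(2)]]]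
   by (simp add: distrib_left)
  show "(LINT z|W. f z * (c *\<^sub>R x) z) = c * (LINT z|W. f z * x z)" for c x
   by (simp add: scaleR_fun_def mult.left_commute)
  show "\<bar>LINT z|W. f z * x z\<bar> \<le> ((LINT z|W. (f z)\<^sup>2) + 1) * H0.nrm x" if "x \<in> H1_0 U W" for x
   by (rule L2_functional_bound[OF f H1_0_H1[OF that]])
  show "c\<^sub>a * ip x x \<le> a x x" if "x \<in> H1_0 U W" for x by (rule form_coercive[OF \<gamma>\<^sub>0 r that])
 qed (use H1_0_H1 c\<^sub>a_pos in \<open>auto intro: form_add_left form_add_right form_scale_right form_continuous\<close>)
 show ?thesis by (rule that[of u]) (use u in \<open>auto simp: obstacle_solution_iff\<close>)
qed

lemma obstacle_solution_unique:
 assumes f: "f \<in> Lspace 2 W" and u: "obstacle_solution \<sigma> \<rho> \<kappa> \<theta> r \<gamma> U f \<psi> u" and v: "obstacle_solution \<sigma> \<rho> \<kappa> \<theta> r \<gamma> U f \<psi> v"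
 shows "AE z in W. u z = v z"
proof -
 have U: "u \<in> H1_0 U W" "v \<in> H1_0 U W" using u v by (auto simp: obstacle_solution_iff)
 note U1 = H1_0_H1[OF U(1)] H1_0_H1[OF U(2)]
 have "(LINT z|W. f z * (v - u) z) \<le> a u (v - u)" "(LINT z|W. f z * (u - v) z) \<le> a v (u - v)"
  using u v by (auto simp: obstacle_solution_iff)
 moreover have "(LINT z|W. f z * (u - v) z) = - (LINT z|W. f z * (v - u) z)"
  using L2_mult_integrable[OF f H1_L2[OF U1(1)]] L2_mult_integrable[OF f H1_L2[OF U1(2)]] by (simp add: right_diff_distrib)
 moreover have "a (u - v) (u - v) = - a u (v - u) - a v (u - v)"
  using U1 by (simp add: form_diff_left form_diff_right H.V_diff)
 ultimately have "a (u - v) (u - v) \<le> 0" by linarith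
 from form_nonpos_AE_0[OF H0.V_diff[OF U] this] have "AE z in W. (u - v) z = 0" .
 then show ?thesis by eventually_elim simp
qed

text \<open>The competitor \<open>u - (u - M)\<^sup>+ = min u M\<close> stays above the obstacle.\<close>

lemma obstacle_solution_le_supersolution:
 assumes f: "f \<in> Lspace 2 W" and u: "obstacle_solution \<sigma> \<rho> \<kappa> \<theta> r \<gamma> U f \<psi> u"
  and M: "M \<in> H2 U W" "Gamma1_ge0 U W M" and \<psi>M: "AE z in W. \<psi> z \<le> M z" and fM: "AE z in W. f z \<le> A M z"
 shows "AE z in W. u z \<le> M z"
proof -
 let ?w = "\<lambda>z. max (u z - M z) 0"
 have u0: "u \<in> H1_0 U W" and \<psi>u: "AE z in W. \<psi> z \<le> u z" using u by (auto simp: obstacle_solution_iff)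
 note M1 = H2D(10)[OF M(1)] and u1 = H1_0_H1[OF u0]
 have w: "?w \<in> H1_0 U W" by (rule positive_part_above[OF u0 M1 M(2)])
 note w1 = H1_0_H1[OF w]
 have i: "integrable W (\<lambda>z. f z * ?w z)" "integrable W (\<lambda>z. A M z * ?w z)"
  by (rule L2_mult_integrable[OF _ H1_L2[OF w1]]; rule f heston_op_L2[OF M(1)])+
 have "AE z in W. \<psi> z \<le> (u - ?w) z" using \<psi>u \<psi>M by eventually_elim (simp add: max_def)
 moreover have "u - ?w \<in> H1_0 U W" by (rule H0.V_diff[OF u0 w])
 ultimately have "(LINT z|W. f z * (u - ?w - u) z) \<le> a u (u - ?w - u)" using u by (auto simp: obstacle_solution_iff)
 moreover have "a u (u - ?w - u) = - a u ?w"
  using form_diff_right[OF u1 H.V_diff[OF u1 w1] u1] form_diff_right[OF u1 u1 w1] by simp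
 moreover have "(LINT z|W. f z * (u - ?w - u) z) = - (LINT z|W. f z * ?w z)" by simp
 ultimately have "a u ?w \<le> (LINT z|W. f z * ?w z)" by linarith
 also have "\<dots> \<le> (LINT z|W. A M z * ?w z)"
  by (rule integral_mono_AE[OF i]) (use fM in \<open>eventually_elim, auto intro: mult_right_mono\<close>)
 also have "\<dots> = a M ?w" by (rule form_eq_heston_op[OF M(1) w, symmetric])
 finally show ?thesis by (rule comparison[OF u1 M1 w])
qed

lemma obstacle_solution_ge_subsolution:
 assumes f: "f \<in> Lspace 2 W" and u: "obstacle_solution \<sigma> \<rho> \<kappa> \<theta> r \<gamma> U f \<psi> u"
  and m: "m \<in> H2 U W" "Gamma1_le0 U W m" and fm: "AE z in W. A m z \<le> f z"
 shows "AE z in W. m z \<le> u z"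
proof -
 let ?w = "\<lambda>z. max (m z - u z) 0"
 have u0: "u \<in> H1_0 U W" and \<psi>u: "AE z in W. \<psi> z \<le> u z" using u by (auto simp: obstacle_solution_iff)
 note m1 = H2D(10)[OF m(1)] and u1 = H1_0_H1[OF u0]
 have w: "?w \<in> H1_0 U W" by (rule positive_part_below[OF u0 m1 m(2)])
 note w1 = H1_0_H1[OF w]
 have i: "integrable W (\<lambda>z. A m z * ?w z)" "integrable W (\<lambda>z. f z * ?w z)"
  by (rule L2_mult_integrable[OF _ H1_L2[OF w1]]; rule f heston_op_L2[OF m(1)])+
 have "AE z in W. \<psi> z \<le> (u + ?w) z" using \<psi>u by eventually_elim (simp add: add_increasing2)
 moreover have "u + ?w \<in> H1_0 U W" by (rule H0.V_add[OF u0 w])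
 ultimately have "(LINT z|W. f z * (u + ?w - u) z) \<le> a u (u + ?w - u)" using u by (auto simp: obstacle_solution_iff)
 then have fu: "(LINT z|W. f z * ?w z) \<le> a u ?w" by simp
 have "a m ?w = (LINT z|W. A m z * ?w z)" by (rule form_eq_heston_op[OF m(1) w])
 also have "\<dots> \<le> (LINT z|W. f z * ?w z)"
  by (rule integral_mono_AE[OF i]) (use fm in \<open>eventually_elim, auto intro: mult_right_mono\<close>)
 also note fu
 finally show ?thesis by (rule comparison[OF m1 u1 w])
qed

end

theorem theorem4p36:
  fixes \<sigma> \<rho> \<kappa> \<theta> r q :: real
  assumes "\<sigma> \<noteq> 0" and "-1 < \<rho>" and "\<rho> < 1" and "\<kappa> > 0" and "\<theta> > 0" and "r \<ge> 0" and "q \<ge> 0"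
    and "r - q - \<kappa> * \<theta> * \<rho> / \<sigma> = 0"
  shows "\<exists>\<gamma>\<^sub>0>0. \<forall>\<gamma> U W A \<psi> M m f.
    0 < \<gamma> \<and> \<gamma> < \<gamma>\<^sub>0 \<and>
    half_plane_domain U \<and> Gamma0 U \<noteq> {} \<and>
    W = heston_measure \<sigma> \<kappa> \<theta> \<gamma> U \<and> A = heston_op \<sigma> \<rho> \<kappa> \<theta> r q U \<and>
    r > 0 \<and>
    \<psi> \<in> H1 U W \<and> Gamma1_le0 U W \<psi> \<and>
    M \<in> H2 U W \<and> m \<in> H2 U W \<and>
    Gamma1_le0 U W m \<and> Gamma1_ge0 U W M \<and>
    (AE z in lebesgue_on U. m z \<le> M z) \<and>
    (AE z in lebesgue_on U. A m z \<le> A M z) \<and>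
    (AE z in lebesgue_on U. \<psi> z \<le> M z) \<and>
    (\<exists>s>2. (\<lambda>z. (1 + snd z) powr (1/2) * M z) \<in> Lspace s W \<and>
           (\<lambda>z. (1 + snd z) powr (1/2) * m z) \<in> Lspace s W) \<and>
    (\<lambda>z. (1 + snd z) * M z) \<in> Lspace 2 W \<and> (\<lambda>z. (1 + snd z) * m z) \<in> Lspace 2 W \<and>
    f \<in> Lspace 2 W \<and>
    (AE z in lebesgue_on U. A m z \<le> f z \<and> f z \<le> A M z)
    \<longrightarrow>
    (\<exists>u. obstacle_solution \<sigma> \<rho> \<kappa> \<theta> r \<gamma> U f \<psi> u \<and>
         (AE z in lebesgue_on U. max (m z) (\<psi> z) \<le> u z \<and> u z \<le> M z)) \<and>
    ((\<exists>\<phi> \<in> H2 U W.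
        (AE z in lebesgue_on U. A \<phi> z \<ge> 0) \<and>
        (AE z in lebesgue_on U. A (\<lambda>z. m z + \<phi> z) z > 0) \<and>
        (AE z in lebesgue_on U. \<phi> z \<ge> 0) \<and>
        (\<lambda>z. (1 + snd z) * \<phi> z) \<in> Lspace 2 W \<and>
        (\<lambda>z. (1 + snd z) powr (1/2) * A \<phi> z) \<in> Lspace 2 W \<and>
        esssup (lebesgue_on U)
          (\<lambda>z. ereal ((1 + snd z) * (M z + \<phi> z) / A (\<lambda>z. m z + \<phi> z) z)) < \<infinity> \<and>
        (\<exists>s>2. (\<lambda>z. (1 + snd z) powr (1/2) * \<phi> z) \<in> Lspace s W))
     \<longrightarrow>
     (\<forall>u\<^sub>1 u\<^sub>2. obstacle_solution \<sigma> \<rho> \<kappa> \<theta> r \<gamma> U f \<psi> u\<^sub>1 \<and> obstacle_solution \<sigma> \<rho> \<kappa> \<theta> r \<gamma> U f \<psi> u\<^sub>2 \<longrightarrow>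
        (AE z in lebesgue_on U. u\<^sub>1 z = u\<^sub>2 z)))"
proof (cases "0 < r")
  case True
  show ?thesis
  proof (intro exI[of _ "coercivity_threshold \<sigma> \<rho> \<kappa> \<theta> r"] conjI allI impI; (elim conjE)?)
    show "0 < coercivity_threshold \<sigma> \<rho> \<kappa> \<theta> r" by (rule coercivity_threshold_pos) (use assms True in auto)
  next
    fix \<gamma> U W A \<psi> M m f
    assume g: "0 < \<gamma>" "\<gamma> < coercivity_threshold \<sigma> \<rho> \<kappa> \<theta> r" and U: "half_plane_domain U"
      and W: "W = heston_measure \<sigma> \<kappa> \<theta> \<gamma> U" and A: "A = heston_op \<sigma> \<rho> \<kappa> \<theta> r q U"
      and \<psi>: "Gamma1_le0 U W \<psi>" and M: "M \<in> H2 U W" "Gamma1_ge0 U W M" and m: "m \<in> H2 U W" "Gamma1_le0 U W m"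
      and \<psi>M: "AE z in lebesgue_on U. \<psi> z \<le> M z"
      and f: "f \<in> Lspace 2 W" "AE z in lebesgue_on U. A m z \<le> f z \<and> f z \<le> A M z"
    interpret P: coercive_heston_problem \<sigma> \<kappa> \<theta> \<gamma> U \<rho> r q
      by unfold_locales (use assms g U True in auto)
    note H = W[unfolded P.W_eq]
    note \<psi>' = \<psi>[unfolded H] and M' = M[unfolded H] and m' = m[unfolded H] and f' = f(1)[unfolded H]
    obtain u where u: "obstacle_solution \<sigma> \<rho> \<kappa> \<theta> r \<gamma> U f \<psi> u"
      by (rule P.obstacle_solution_exists[OF f' \<psi>'])
    have "AE z in P.W. u z \<le> M z"
      by (rule P.obstacle_solution_le_supersolution[OF f' u M']) (use \<psi>M f(2) A in \<open>auto simp: P.AE_W\<close>)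
    moreover have "AE z in P.W. m z \<le> u z"
      by (rule P.obstacle_solution_ge_subsolution[OF f' u m']) (use f(2) A in \<open>auto simp: P.AE_W\<close>)
    moreover have "AE z in P.W. \<psi> z \<le> u z" using u by (simp add: P.obstacle_solution_iff)
    ultimately have "AE z in P.W. max (m z) (\<psi> z) \<le> u z \<and> u z \<le> M z" by eventually_elim simp
    then show "\<exists>u. obstacle_solution \<sigma> \<rho> \<kappa> \<theta> r \<gamma> U f \<psi> u \<and> (AE z in lebesgue_on U. max (m z) (\<psi> z) \<le> u z \<and> u z \<le> M z)"
      using u unfolding P.AE_W by blast
    show "AE z in lebesgue_on U. u\<^sub>1 z = u\<^sub>2 z"
      if "obstacle_solution \<sigma> \<rho> \<kappa> \<theta> r \<gamma> U f \<psi> u\<^sub>1" "obstacle_solution \<sigma> \<rho> \<kappa> \<theta> r \<gamma> U f \<psi> u\<^sub>2" for u\<^sub>1 u\<^sub>2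
      using P.obstacle_solution_unique[OF f' that] by (simp add: P.AE_W)
  qed
next
  case False
  then show ?thesis by (intro exI[of _ 1]) auto
qed

end
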